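(* Let $\alpha>-1$, $m\ge0$, $\nu>0$, and let $\Phi$, $D_p(\Phi)$ and $P^*_{t_0}$ be as defined in the context. Let $1<p<\infty$ and $t_0>0$ be fixed. Then, for a weight $w(x)>0$ on $\mathbb{R}_+$, the condition $w\in D_p(\Phi)$ is equivalent to the existence of some other weight $v(x)>0$ such that $$P^*_{t_0}:L^p(w)\to L^p(v)\quad\text{boundedly}.$$ Moreover, if $w\in D_p(\Phi)$, then for every $\varepsilon>0$ one can choose a weight $v\in D_{p+\varepsilon}(\Phi)$ with this boundedness property.
   Context: $\mathbb{R}_+=(0,\infty)$. A weight is a measurable, a.e. positive and finite function on $\mathbb{R}_+$; $L^p(w)$ is the space of measurable $f$ with $\|f\|_{L^p(w)}^p=\int_0^\infty|f|^pw\,dx<\infty$; $p'=p/(p-1)$. Let $\mathbb{L}=-y\,\partial_{yy}-(\alpha+1-y)\,\partial_y+m$ and let $L_n^\alpha$ be the normalized Laguerre polynomials ($L_n^\alpha$ has degree $n$ and $\{L_n^\alpha\}_{n\ge0}$ is orthonormal in $L^2(\mathbb{R}_+,y^\alpha e^{-y}dy)$), so that $\mathbb{L}L_n^\alpha=(n+m)L_n^\alpha$. The heat semigroup is $$[e^{-u\mathbb{L}}f](x)=\int_0^\infty \Big(\sum_{n=0}^\infty e^{-(n+m)u}L_n^\alpha(x)L_n^\alpha(y)\Big)f(y)\,y^\alpha e^{-y}\,dy,\quad u>0,$$ and $$P_tf(x)=\frac{t^{2\nu}}{4^\nu\Gamma(\nu)}\int_0^\infty e^{-\frac{t^2}{4u}}\,[e^{-u\mathbb{L}}f](x)\,\frac{du}{u^{1+\nu}},\quad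 t>0,\qquad P^*_{t_0}f(x)=\sup_{0<t\le t_0}|P_tf(x)| .$$ Boundedness of $P^*_{t_0}:L^p(w)\to L^p(v)$ means that for all $f\in L^p(w)$ the integrals defining $P_tf$ converge absolutely (so $P^*_{t_0}f$ is well defined) and $\|P^*_{t_0}f\|_{L^p(v)}\le C\|f\|_{L^p(w)}$ with $C$ independent of $f$. The function $\Phi$ is $$\Phi(y)=\frac{y^\alpha e^{-y}}{(1+y)^m[\ln(e+y)]^{1+\nu}}\ \text{ if }m>0,\qquad \Phi(y)=\frac{y^\alpha e^{-y}}{[\ln(e+y)]^{\nu}}\ \text{ if }m=0,$$ and for $1<p<\infty$ $$D_p(\Phi)=\Big\{w>0\text{ weight}:\ \big\|w^{-1/p}\,\Phi\big\|_{L^{p'}(\mathbb{R}_+,dy)}<\infty\Big\}.$$ *)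

theory Defs
  imports "HOL-Analysis.Analysis" "HOL-Computational_Algebra.Polynomial"
begin

abbreviation half_line :: "real measure" where
  "half_line \<equiv> lebesgue_on {0<..}"

definition weight :: "(real \<Rightarrow> real) \<Rightarrow> bool" where
  "weight w \<longleftrightarrow> w \<in> borel_measurable half_line \<and> (AE x in half_line. 0 < w x)"

text \<open>The maximal function may take the value \<open>\<infinity>\<close>, so norms are taken of functions with values
  in \<open>[0,\<infinity>]\<close>; for the exponents \<open>p > 0\<close> used below, \<open>\<infinity>\<close> to the power \<open>p\<close> is \<open>\<infinity>\<close>.\<close>

definition ennreal_powr :: "ennreal \<Rightarrow> real \<Rightarrow> ennreal" where
  "ennreal_powr a p = (if a = \<infinity> then \<infinity> else ennreal (enn2real a powr p))"

definition Lp_norm :: "real \<Rightarrow> (real \<Rightarrow> real) \<Rightarrow> (real \<Rightarrow> ennreal) \<Rightarrow> ennreal" where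
  "Lp_norm p w g =
     ennreal_powr (\<integral>\<^sup>+x. ennreal_powr (g x) p * ennreal (w x) \<partial>half_line) (1 / p)"

definition Lp :: "real \<Rightarrow> (real \<Rightarrow> real) \<Rightarrow> (real \<Rightarrow> real) set" where
  "Lp p w = {f \<in> borel_measurable half_line. Lp_norm p w (\<lambda>x. ennreal \<bar>f x\<bar>) < \<infinity>}"

text \<open>Orthonormality and the degree condition determine each polynomial up to its sign, and the
  sign cancels in the heat kernel.\<close>

definition normalized_laguerre :: "real \<Rightarrow> (nat \<Rightarrow> real poly) \<Rightarrow> bool" where
  "normalized_laguerre \<alpha> L \<longleftrightarrow>
     (\<forall>n. degree (L n) = n) \<and>
     (\<forall>i j. has_bochner_integral half_line (\<lambda>y. poly (L i) y * poly (L j) y * (y powr \<alpha> * exp (- y)))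
              (if i = j then 1 else 0))"

definition heat_kernel :: "(nat \<Rightarrow> real poly) \<Rightarrow> real \<Rightarrow> real \<Rightarrow> real \<Rightarrow> real \<Rightarrow> real" where
  "heat_kernel L m u x y = (\<Sum>n. exp (- ((real n + m) * u)) * poly (L n) x * poly (L n) y)"

definition heat_integrand ::
    "real \<Rightarrow> (nat \<Rightarrow> real poly) \<Rightarrow> real \<Rightarrow> (real \<Rightarrow> real) \<Rightarrow> real \<Rightarrow> real \<Rightarrow> real \<Rightarrow> real" where
  "heat_integrand \<alpha> L m f u x y = heat_kernel L m u x y * f y * (y powr \<alpha> * exp (- y))"

definition heat ::
    "real \<Rightarrow> (nat \<Rightarrow> real poly) \<Rightarrow> real \<Rightarrow> (real \<Rightarrow> real) \<Rightarrow> real \<Rightarrow> real \<Rightarrow> real" where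
  "heat \<alpha> L m f u x = (\<integral>y. heat_integrand \<alpha> L m f u x y \<partial>half_line)"

definition poisson_integrand ::
    "real \<Rightarrow> (nat \<Rightarrow> real poly) \<Rightarrow> real \<Rightarrow> real \<Rightarrow> (real \<Rightarrow> real) \<Rightarrow> real \<Rightarrow> real \<Rightarrow> real \<Rightarrow> real" where
  "poisson_integrand \<alpha> L m \<nu> f t x u =
     exp (- (t\<^sup>2 / (4 * u))) * heat \<alpha> L m f u x / u powr (1 + \<nu>)"

definition poisson ::
    "real \<Rightarrow> (nat \<Rightarrow> real poly) \<Rightarrow> real \<Rightarrow> real \<Rightarrow> (real \<Rightarrow> real) \<Rightarrow> real \<Rightarrow> real \<Rightarrow> real" where
  "poisson \<alpha> L m \<nu> f t x =
     t powr (2 * \<nu>) / (4 powr \<nu> * Gamma \<nu>) *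
       (\<integral>u. poisson_integrand \<alpha> L m \<nu> f t x u \<partial>half_line)"

text \<open>Integrability over \<open>half_line\<close> is absolute convergence; both iterated integrals are required
  to converge at every point where they are used.\<close>

definition poisson_converges ::
    "real \<Rightarrow> (nat \<Rightarrow> real poly) \<Rightarrow> real \<Rightarrow> real \<Rightarrow> (real \<Rightarrow> real) \<Rightarrow> real \<Rightarrow> real \<Rightarrow> bool" where
  "poisson_converges \<alpha> L m \<nu> f t x \<longleftrightarrow>
     (\<forall>u>0. integrable half_line (heat_integrand \<alpha> L m f u x)) \<and>
     integrable half_line (poisson_integrand \<alpha> L m \<nu> f t x)"

definition poisson_maximal ::
    "real \<Rightarrow> (nat \<Rightarrow> real poly) \<Rightarrow> real \<Rightarrow> real \<Rightarrow> real \<Rightarrow> (real \<Rightarrow> real) \<Rightarrow> real \<Rightarrow> ennreal" where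
  "poisson_maximal \<alpha> L m \<nu> t0 f x = (SUP t\<in>{0<..t0}. ennreal \<bar>poisson \<alpha> L m \<nu> f t x\<bar>)"

definition poisson_maximal_bounded ::
    "real \<Rightarrow> (nat \<Rightarrow> real poly) \<Rightarrow> real \<Rightarrow> real \<Rightarrow> real \<Rightarrow> real \<Rightarrow>
       (real \<Rightarrow> real) \<Rightarrow> (real \<Rightarrow> real) \<Rightarrow> bool" where
  "poisson_maximal_bounded \<alpha> L m \<nu> t0 p w v \<longleftrightarrow>
     (\<forall>f\<in>Lp p w. (\<forall>t\<in>{0<..t0}. \<forall>x>0. poisson_converges \<alpha> L m \<nu> f t x) \<and>
        poisson_maximal \<alpha> L m \<nu> t0 f \<in> borel_measurable half_line) \<and>
     (\<exists>C\<ge>0. \<forall>f\<in>Lp p w. Lp_norm p v (poisson_maximal \<alpha> L m \<nu> t0 f) \<le>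
        ennreal C * Lp_norm p w (\<lambda>x. ennreal \<bar>f x\<bar>))"

definition laguerre_Phi :: "real \<Rightarrow> real \<Rightarrow> real \<Rightarrow> real \<Rightarrow> real" where
  "laguerre_Phi \<alpha> m \<nu> y =
     (if m > 0 then y powr \<alpha> * exp (- y) / ((1 + y) powr m * ln (exp 1 + y) powr (1 + \<nu>))
      else y powr \<alpha> * exp (- y) / ln (exp 1 + y) powr \<nu>)"

definition D_class :: "real \<Rightarrow> (real \<Rightarrow> real) \<Rightarrow> (real \<Rightarrow> real) set" where
  "D_class p \<Phi> = {w. weight w \<and>
     Lp_norm (p / (p - 1)) (\<lambda>_. 1) (\<lambda>y. ennreal \<bar>w y powr (- 1 / p) * \<Phi> y\<bar>) < \<infinity>}"

end

theory Submission
  imports Defs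
begin

text \<open>
  The Hille-Hardy formula shows that the heat kernel is positive, and makes the semigroup a symmetric
  Markov semigroup for \<open>y\<^sup>\<alpha> e\<^sup>-\<^sup>y dy\<close>. Hence the maximal function of its time averages is of weak type (1,1)
  by Hopf's maximal theorem, and this maximal function dominates the subordinated operators \<open>P\<^sub>t\<close>. For
  large times or far-away \<open>y\<close> the kernel of \<open>P\<^sub>t\<close> is of size \<open>e\<^sup>x \<Phi>(y)\<close> up to factors \<open>e\<^sup>\<kappa>\<^sup>x\<close>. Together,
  \<open>P\<^sup>*f\<close> is dominated by a positive operator \<open>N\<close> of weak type with respect to \<open>\<Phi>(y) dy\<close>.

  If \<open>w \<in> D\<^sub>p(\<Phi>)\<close>, put \<open>\<tau> = (\<Phi>/w) powr (1/(p - 1))\<close>, which is integrable against \<open>\<Phi>\<close>, and \<open>G = 1 + N\<tau>\<close>. The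
  operator \<open>g \<mapsto> N(g\<tau>)/G\<close> is bounded on \<open>L\<^sup>\<infinity>\<close> and of weak type (1,1) into the measure with density
  \<open>G powr (1 - \<delta>)\<close>, so by interpolation \<open>v = G powr (1 - \<delta> - p)\<close> times an explicit factor is admissible, and
  Kolmogorov's inequality for \<open>G\<close> puts \<open>v\<close> into \<open>D\<^sub>q(\<Phi>)\<close> as soon as \<open>\<delta> < q - p\<close>.

  Conversely, convergence of \<open>P\<^sub>tf(1)\<close> for all \<open>f\<close> in \<open>L\<^sup>p(w)\<close> forces \<open>\<integral>|f|\<Phi> < \<infinity>\<close> because the kernel at
  \<open>x = 1\<close> is bounded below by a multiple of \<open>\<Phi>\<close>, and duality gives \<open>w \<in> D\<^sub>p(\<Phi>)\<close>.
\<close>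

section \<open>Laguerre polynomials and the Hille-Hardy formula\<close>

text \<open>The weight \<open>w\<close> is arbitrary and the Laguerre measure is not doubling, so
  neither weight conditions nor covering arguments are at hand. Hopf's theorem does without them: it
  uses only positivity, symmetry and mass at most 1. The mass is 1 once
  \<open>exp (- (m * u))\<close> is left out of the semigroup; this factor is at most 1 at small
  times and matters only at large ones, where times from about \<open>ln (exp 1 + y)\<close> on
  produce the logarithms in \<Phi>. The function \<tau> is the extremal case of Hoelder's inequality
  between the space of \<open>w\<close> and \<Phi>: for |f| = g \<tau> the norm of f becomes that of
  g for the finite measure \<tau> \<Phi> dy. Two small losses shape the rest. With \<delta> = 0 all
  dyadic level sets of G would contribute equally and their sum would diverge. Inserting the factor
  \<open>phi\<close> under the averages, and the kernel at large times, cost exponentials of small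
  rate \<kappa>, which are put into the weight. The room \<epsilon> pays for both: \<delta> <
  \<epsilon> is fixed first, then \<kappa> is chosen small in terms of it.\<close>

lemma infsum_nat_eq_suminf:
  fixes f :: "nat \<Rightarrow> real"
  assumes "f summable_on UNIV"
  shows "infsum f UNIV = suminf f"
  using assms by (metis has_sum_imp_sums has_sum_infsum sums_unique)

text \<open>Absolutely convergent rows with summable row sums mean summability over
  \<open>UNIV \<times> UNIV\<close>, where the order is free. The second conclusion gives each
  column sum, written with \<open>suminf\<close>, its meaning; the third is absolute convergence of
  the resulting series.\<close>

lemma sums_swap_real:
  fixes a :: "nat \<Rightarrow> nat \<Rightarrow> real"
  assumes A: "\<And>k. (\<lambda>n. \<bar>a k n\<bar>) sums A k" and "summable A"
  shows "(\<lambda>n. \<Sum>k. a k n) sums (\<Sum>k. \<Sum>n. a k n)"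
    and "\<And>n. summable (\<lambda>k. \<bar>a k n\<bar>)"
    and "summable (\<lambda>n. \<bar>\<Sum>k. a k n\<bar>)"
proof -
  have A0: "0 \<le> A k" for k
    using A[of k] by (metis abs_ge_zero sums_iff suminf_nonneg)
  have nn: "(\<lambda>(k,n). \<bar>a k n\<bar>) summable_on (UNIV \<times> UNIV)"
    using A A0 assms(2)
    by (intro summable_on_SigmaI[where g = A] sums_nonneg_imp_has_sum)
       (auto simp: summable_nonneg_imp_summable_on)
  then have nn': "(\<lambda>x. norm ((\<lambda>(k,n). a k n) x)) summable_on (UNIV \<times> UNIV)"
    by (simp add: case_prod_unfold)
  have s: "(\<lambda>(k,n). a k n) summable_on (UNIV \<times> UNIV)"
    using abs_summable_summable[OF nn'] .
  have s2: "(\<lambda>(n,k). a k n) summable_on (UNIV \<times> UNIV)"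
    using s summable_on_swap[of "\<lambda>(k,n). a k n" UNIV UNIV] by simp
  have nn2: "(\<lambda>(n,k). \<bar>a k n\<bar>) summable_on (UNIV \<times> UNIV)"
    using nn summable_on_swap[of "\<lambda>(k,n). \<bar>a k n\<bar>" UNIV UNIV] by simp
  have col: "(\<lambda>k. \<bar>a k n\<bar>) summable_on UNIV" for n
    using summable_on_SigmaD1[OF nn2, of n] by simp
  then show 1: "\<And>n. summable (\<lambda>k. \<bar>a k n\<bar>)"
    by (simp add: summable_on_UNIV_nonneg_real_iff)
  have colS: "(\<Sum>\<^sub>\<infinity>k. a k n) = (\<Sum>k. a k n)" for n
    using summable_on_SigmaD1[OF s2, of n] 1[of n]
    by (simp add: infsum_nat_eq_suminf)
  have rowS: "(\<Sum>\<^sub>\<infinity>n. a k n) = (\<Sum>n. a k n)" for k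
    using summable_on_SigmaD1[OF s, of k] by (simp add: infsum_nat_eq_suminf)
  have "(\<lambda>n. \<Sum>\<^sub>\<infinity>k. a k n) summable_on UNIV"
    using s2 by (intro summable_on_Sigma_banach) auto
  then have n1: "(\<lambda>n. \<Sum>k. a k n) summable_on UNIV" by (simp add: colS)
  have "(\<lambda>k. \<Sum>\<^sub>\<infinity>n. a k n) summable_on UNIV"
    using s by (intro summable_on_Sigma_banach) auto
  then have n2: "(\<lambda>k. \<Sum>n. a k n) summable_on UNIV" by (simp add: rowS)
  have "(\<Sum>\<^sub>\<infinity>k. \<Sum>\<^sub>\<infinity>n. a k n) = (\<Sum>\<^sub>\<infinity>n. \<Sum>\<^sub>\<infinity>k. a k n)"
    using s by (rule infsum_swap_banach)
  then have "(\<Sum>k. \<Sum>n. a k n) = (\<Sum>\<^sub>\<infinity>n. \<Sum>k. a k n)"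
    using n2 by (simp add: rowS colS infsum_nat_eq_suminf)
  then show "(\<lambda>n. \<Sum>k. a k n) sums (\<Sum>k. \<Sum>n. a k n)"
    using n1 by (metis has_sum_imp_sums has_sum_infsum)
  show "summable (\<lambda>n. \<bar>\<Sum>k. a k n\<bar>)"
  proof -
    have "(\<lambda>n. norm (\<Sum>k. a k n)) summable_on UNIV"
      using n1 by (subst (asm) summable_on_iff_abs_summable_on_real)
    then show ?thesis by (simp add: summable_on_UNIV_nonneg_real_iff)
  qed
qed

text \<open>Throughout, \<open>b = \<alpha> + 1 > 0\<close>, and \<open>lag b n\<close> is the classical (not normalized) Laguerre
  polynomial of parameter \<open>\<alpha>\<close>, so its squared norm is \<open>Gamma (b + n) / n!\<close>.\<close>

definition lcoef :: "real \<Rightarrow> nat \<Rightarrow> nat \<Rightarrow> real" where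
  "lcoef b n k = Gamma (b + real n) / (Gamma (b + real k) * fact (n - k) * fact k)"

definition lag :: "real \<Rightarrow> nat \<Rightarrow> real \<Rightarrow> real" where
  "lag b n x = (\<Sum>k\<le>n. lcoef b n k * (- x) ^ k)"

lemma lcoef_pos: "b > 0 \<Longrightarrow> 0 < lcoef b n k"
  unfolding lcoef_def by (auto intro!: divide_pos_pos mult_pos_pos Gamma_real_pos)

lemma neg_binomial_sums:
  fixes b r :: real
  assumes "b > 0" "\<bar>r\<bar> < 1"
  shows "(\<lambda>j. Gamma (b + real j) / (Gamma b * fact j) * r ^ j) sums (1 - r) powr (- b)"
proof -
  have "b \<notin> \<int>\<^sub>\<le>\<^sub>0" using assms(1) by (auto elim!: nonpos_Ints_cases)
  moreover have "(- 1) ^ j * (- r) ^ j = r ^ j" for j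
    by (simp flip: power_mult_distrib)
  ultimately have "((- b) gchoose j) * (- r) ^ j = Gamma (b + real j) / (Gamma b * fact j) * r ^ j" for j
    by (simp add: gbinomial_pochhammer pochhammer_Gamma mult.assoc mult.left_commute mult.commute)
  then show ?thesis using gen_binomial_real[of "- r" "- b"] assms(2) by simp
qed

text \<open>After \<open>n = k + j\<close> the numerator \<open>Gamma (b + real n)\<close> is the
  one of the negative binomial series with parameter \<open>b + real k\<close>, whose denominator is
  already present in \<open>lcoef\<close>.\<close>

lemma laguerre_generating_column:
  fixes b r x :: real
  assumes b: "b > 0" and r: "\<bar>r\<bar> < 1"
  defines "a \<equiv> \<lambda>k n. if k \<le> n then lcoef b n k * (- x) ^ k * r ^ n else 0"
  shows "a k sums ((- x * r) ^ k / fact k * (1 - r) powr (- (b + real k)))"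
proof -
  have "(\<lambda>i. a k (i + k)) sums ((- x * r) ^ k / fact k * (1 - r) powr (- (b + real k)))"
  proof -
    have "(\<lambda>j. (- x * r) ^ k / fact k * (Gamma (b + real k + real j) / (Gamma (b + real k) * fact j) * r ^ j)) sums
        ((- x * r) ^ k / fact k * (1 - r) powr (- (b + real k)))"
      by (intro sums_mult neg_binomial_sums) (use b r in auto)
    also have "(\<lambda>j. (- x * r) ^ k / fact k * (Gamma (b + real k + real j) / (Gamma (b + real k) * fact j) * r ^ j))
       = (\<lambda>i. a k (i + k))"
      unfolding power_mult_distrib
      by (auto simp: a_def lcoef_def power_add ac_simps fun_eq_iff)
    finally show ?thesis .
  qed
  then show ?thesis
    by (subst (asm) sums_zero_iff_shift) (auto simp: a_def)
qed

lemma laguerre_generating: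
  fixes b r x :: real
  assumes b: "b > 0" and r: "\<bar>r\<bar> < 1"
  shows "(\<lambda>n. lag b n x * r ^ n) sums ((1 - r) powr (- b) * exp (- x * r / (1 - r)))"
    and "summable (\<lambda>n. \<bar>lag b n x * r ^ n\<bar>)"
proof -
  define a where "a = (\<lambda>k n. if k \<le> n then lcoef b n k * (- x) ^ k * r ^ n else 0)"
  \<comment> \<open>Since \<open>lcoef\<close> is positive, taking absolute values amounts to
    passing to the arguments \<open>- \<bar>x\<bar>\<close> and \<open>\<bar>r\<bar>\<close>, so the
    same closed form evaluates the majorant.\<close>
  have ab: "(\<lambda>n. \<bar>a k n\<bar>) sums ((\<bar>x\<bar> * \<bar>r\<bar>) ^ k / fact k * (1 - \<bar>r\<bar>) powr (- (b + real k)))" for k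
    using laguerre_generating_column[of b "\<bar>r\<bar>" k "- \<bar>x\<bar>"] b r lcoef_pos[OF b]
    by (simp add: a_def abs_mult power_abs if_distrib less_imp_le cong: if_cong)
  have sm: "(\<lambda>k. (- x * r) ^ k / fact k * (1 - r) powr (- (b + real k))) sums
     ((1 - r) powr (- b) * exp (- x * r / (1 - r)))" if r: "\<bar>r\<bar> < 1" for r x :: real
  proof -
    have "(\<lambda>k. (1 - r) powr (- b) * ((- x * r / (1 - r)) ^ k /\<^sub>R fact k)) sums
       ((1 - r) powr (- b) * exp (- x * r / (1 - r)))"
      by (intro sums_mult exp_converges)
    also have "(\<lambda>k. (1 - r) powr (- b) * ((- x * r / (1 - r)) ^ k /\<^sub>R fact k)) =
       (\<lambda>k. (- x * r) ^ k / fact k * (1 - r) powr (- (b + real k)))"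
    proof
      fix k
      have "- (b + real k) = - b - real k" by simp
      then have "(1 - r) powr (- (b + real k)) = (1 - r) powr (- b) / (1 - r) ^ k"
        using r by (simp only: powr_diff) (simp add: powr_realpow)
      then show "(1 - r) powr (- b) * ((- x * r / (1 - r)) ^ k /\<^sub>R fact k) =
        (- x * r) ^ k / fact k * (1 - r) powr (- (b + real k))"
        by (simp only: power_divide real_scaleR_def) (simp add: divide_inverse)
    qed
    finally show ?thesis .
  qed
  have smA: "summable (\<lambda>k. (\<bar>x\<bar> * \<bar>r\<bar>) ^ k / fact k * (1 - \<bar>r\<bar>) powr (- (b + real k)))"
    using sm[of "\<bar>r\<bar>" "- \<bar>x\<bar>"] r by (simp add: sums_iff)
  have row: "(\<Sum>n. a k n) = (- x * r) ^ k / fact k * (1 - r) powr (- (b + real k))" for k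
    using laguerre_generating_column[OF b r] by (simp add: a_def sums_iff)
  have col: "(\<Sum>k. a k n) = lag b n x * r ^ n" for n
    by (subst suminf_finite[of "{..n}"]) (auto simp: a_def lag_def sum_distrib_right)
  show "(\<lambda>n. lag b n x * r ^ n) sums ((1 - r) powr (- b) * exp (- x * r / (1 - r)))"
    using sums_swap_real(1)[of a, OF ab smA] sm[OF r, of x] unfolding row col by (simp add: sums_iff)
  show "summable (\<lambda>n. \<bar>lag b n x * r ^ n\<bar>)"
    using sums_swap_real(3)[of a, OF ab smA] unfolding col .
qed

text \<open>\<open>bessel_series b (z\<^sup>2) = z powr (1 - b) * I\<^bsub>b - 1\<^esub>(2z)\<close> with the modified Bessel function \<open>I\<close>.\<close>

definition bessel_series :: "real \<Rightarrow> real \<Rightarrow> real" where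
  "bessel_series b z = (\<Sum>k. z ^ k / (fact k * Gamma (b + real k)))"

text \<open>For \<open>b < 1\<close> the quotient of \<open>Gamma (b + real k)\<close> by
  \<open>fact k\<close> tends to 0, hence the shift to \<open>Suc k\<close>; it costs one power in
  the later estimates.\<close>

lemma Gamma_ge_fact:
  assumes "b > 0"
  obtains c where "c > 0" "\<And>k. c * fact k \<le> Gamma (b + real (Suc k))"
proof
  show "Gamma (b + 1) * min 1 b > 0" using assms by (auto intro!: mult_pos_pos Gamma_real_pos)
  show "Gamma (b + 1) * min 1 b * fact k \<le> Gamma (b + real (Suc k))" for k
  proof (induction k)
    case 0
    have "Gamma (b + 1) * min 1 b \<le> Gamma (b + 1) * 1"
      using assms by (intro mult_left_mono) (auto intro!: less_imp_le Gamma_real_pos)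
    then show ?case by simp
  next
    case (Suc k)
    have "Gamma (b + 1) * min 1 b * fact (Suc k) = real (Suc k) * (Gamma (b + 1) * min 1 b * fact k)" by simp
    also have "\<dots> \<le> (b + real (Suc k)) * Gamma (b + real (Suc k))"
      using assms Suc by (intro mult_mono) (auto intro!: less_imp_le mult_pos_pos Gamma_real_pos)
    also have "\<dots> = Gamma (b + real (Suc k) + 1)"
      using assms by (subst Gamma_plus1) (auto elim!: nonpos_Ints_cases)
    finally show ?case by (simp add: add_ac)
  qed
qed

lemma bessel_series_summable:
  assumes "b > 0" 
  shows "summable (\<lambda>k. \<bar>z ^ k / (fact k * Gamma (b + real k))\<bar>)"
proof -
  obtain c where c: "c > 0" "\<And>k. c * fact k \<le> Gamma (b + real (Suc k))" using Gamma_ge_fact[OF assms] by blast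
  have "summable (\<lambda>k. (\<bar>z\<bar> / c) * (\<bar>z\<bar> ^ k / fact k))"
    using summable_exp[of "\<bar>z\<bar>"] by (intro summable_mult) (simp add: field_simps)
  then have "summable (\<lambda>k. \<bar>z ^ (Suc k) / (fact (Suc k) * Gamma (b + real (Suc k)))\<bar>)"
  proof (rule summable_comparison_test_ev[rotated], intro always_eventually allI)
    fix k
    have "c * fact k \<le> fact (Suc k) * Gamma (b + real (Suc k))"
    proof -
      have "1 * Gamma (b + real (Suc k)) \<le> fact (Suc k) * Gamma (b + real (Suc k))"
        using assms fact_ge_1[of "Suc k", where ?'a = real] by (intro mult_right_mono) (auto intro!: less_imp_le Gamma_real_pos simp del: fact_Suc)
      then show ?thesis using c(2)[of k] by linarith
    qed
    then have "\<bar>z ^ (Suc k)\<bar> / (fact (Suc k) * Gamma (b + real (Suc k))) \<le> \<bar>z ^ (Suc k)\<bar> / (c * fact k)"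
      using c(1) by (intro divide_left_mono mult_pos_pos Gamma_real_pos) (use assms in \<open>auto simp del: fact_Suc\<close>)
    moreover have "Gamma (b + real (Suc k)) > 0" using assms by (intro Gamma_real_pos) auto
    ultimately show "norm \<bar>z ^ (Suc k) / (fact (Suc k) * Gamma (b + real (Suc k)))\<bar> \<le> (\<bar>z\<bar> / c) * (\<bar>z\<bar> ^ k / fact k)"
      by (simp add: abs_mult power_abs)
  qed
  then show ?thesis by (subst (asm) summable_Suc_iff)
qed

text \<open>Dividing by \<open>Gamma (b + real k)\<close> cancels the numerator of
  \<open>lcoef\<close>, and what remains is the Cauchy product of the exponential and the Bessel
  series. This evaluates the outer sum in the Hille-Hardy formula.\<close>

lemma laguerre_bessel:
  assumes b: "b > 0"
  shows "(\<lambda>k. t ^ k / Gamma (b + real k) * lag b k Y) sums (exp t * bessel_series b (- (t * Y)))"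
proof -
  define u where "u = (\<lambda>j. (- (t * Y)) ^ j / (fact j * Gamma (b + real j)))"
  define v where "v = (\<lambda>j. t ^ j /\<^sub>R fact j)"
  have su: "summable (\<lambda>k. norm (u k))" using bessel_series_summable[OF b, of "- (t * Y)"] by (simp add: u_def)
  have sv: "summable (\<lambda>k. norm (v k))" unfolding v_def by (rule summable_norm_exp)
  have "(\<lambda>k. \<Sum>i\<le>k. u i * v (k - i)) sums ((\<Sum>k. u k) * (\<Sum>k. v k))"
    by (rule Cauchy_product_sums[OF su sv])
  also have "(\<lambda>k. \<Sum>i\<le>k. u i * v (k - i)) = (\<lambda>k. t ^ k / Gamma (b + real k) * lag b k Y)"
  proof
    fix k
    have "u i * v (k - i) = t ^ k / Gamma (b + real k) * (lcoef b k i * (- Y) ^ i)" if "i \<le> k" for i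
    proof -
      have "t ^ k = t ^ i * t ^ (k - i)" using that by (simp flip: power_add)
      moreover have "Gamma (b + real k) > 0" using b by (intro Gamma_real_pos) auto
      moreover have "(- (t * Y)) ^ i = t ^ i * (- Y) ^ i" by (simp flip: power_mult_distrib)
      ultimately show ?thesis by (simp add: u_def v_def lcoef_def field_simps)
    qed
    then show "(\<Sum>i\<le>k. u i * v (k - i)) = t ^ k / Gamma (b + real k) * lag b k Y"
      by (simp add: lag_def sum_distrib_left)
  qed
  also have "(\<Sum>k. v k) = exp t" unfolding v_def exp_def ..
  also have "(\<Sum>k. u k) = bessel_series b (- (t * Y))" unfolding u_def bessel_series_def ..
  finally show ?thesis by (simp add: mult.commute)
qed

section \<open>Comparison of power series and re-expansion of the generating function\<close>

lemma real_powser_zero: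
  fixes c :: "nat \<Rightarrow> real"
  assumes e: "e > 0" and c: "\<And>h. \<bar>h\<bar> < e \<Longrightarrow> (\<lambda>k. c k * h ^ k) sums 0"
  shows "c k = 0"
proof (induction k rule: less_induct)
  case (less k)
  have "(\<lambda>j. c (j + k) * h ^ j) sums 0" if "h \<noteq> 0" "norm h < e" for h
  proof -
    have "(\<lambda>j. c (j + k) * h ^ (j + k)) sums 0"
      using c[of h] that less by (subst sums_zero_iff_shift) auto
    then have "(\<lambda>j. h ^ k * (c (j + k) * h ^ j)) sums (h ^ k * 0)"
      by (simp add: power_add mult_ac)
    then show ?thesis using that by (subst (asm) sums_mult_iff) auto
  qed
  from powser_limit_0_strong[OF e this] have "((\<lambda>_::real. 0::real) \<longlongrightarrow> c (0 + k)) (at 0)" by simp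
  then show ?case by (simp add: tendsto_const_iff)
qed

lemma real_powser_unique:
  fixes c d :: "nat \<Rightarrow> real"
  assumes e: "e > 0" and cd: "\<And>h. \<bar>h\<bar> < e \<Longrightarrow> \<exists>s. (\<lambda>k. c k * h ^ k) sums s \<and> (\<lambda>k. d k * h ^ k) sums s"
  shows "c k = d k"
proof -
  have "(\<lambda>k. (c k - d k) * h ^ k) sums 0" if h: "\<bar>h\<bar> < e" for h
    using cd[OF h] sums_diff by (fastforce simp: left_diff_distrib)
  from real_powser_zero[OF e this, of k] show ?thesis by simp
qed

text \<open>Expand the generating function at \<open>r + h\<close> in powers of \<open>h = (1 - r) q\<close>: since
  \<open>1 - r - h = (1 - r) (1 - q)\<close>, it factors into its value at \<open>r\<close> and the generating function of the
  argument \<open>y / (1 - r)\<close> at \<open>q\<close>.\<close>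

lemma laguerre_reexpansion:
  fixes b r y :: real
  assumes b: "b > 0" and r: "0 \<le> r" "r < 1"
  shows "(\<Sum>n. real (n choose k) * r ^ (n - k) * lag b n y) =
    (1 - r) powr (- b) * exp (- y * r / (1 - r)) * lag b k (y / (1 - r)) / (1 - r) ^ k"
proof (rule real_powser_unique[where e = "1 - r"])
  show "0 < 1 - r" using r by simp
  fix h :: real assume h: "\<bar>h\<bar> < 1 - r"
  define a where "a = (\<lambda>n k. real (n choose k) * r ^ (n - k) * lag b n y * h ^ k)"
  have bin: "(\<lambda>k. real (n choose k) * r ^ (n - k) * g ^ k) sums (r + g) ^ n" for n g
  proof -
    have "(\<lambda>k. real (n choose k) * r ^ (n - k) * g ^ k) sums (\<Sum>k\<le>n. real (n choose k) * r ^ (n - k) * g ^ k)"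
      by (rule sums_finite) auto
    also have "(\<Sum>k\<le>n. real (n choose k) * r ^ (n - k) * g ^ k) = (r + g) ^ n"
      by (simp add: binomial_ring[of g r] mult_ac add.commute)
    finally show ?thesis .
  qed
  have 1: "(\<lambda>k. \<bar>a n k\<bar>) sums (\<bar>lag b n y\<bar> * (r + \<bar>h\<bar>) ^ n)" for n
    using sums_mult[OF bin[of n "\<bar>h\<bar>"], of "\<bar>lag b n y\<bar>"] r
    by (simp add: a_def abs_mult mult_ac power_abs)
  have 2: "summable (\<lambda>n. \<bar>lag b n y\<bar> * (r + \<bar>h\<bar>) ^ n)"
    using laguerre_generating(2)[OF b, of "r + \<bar>h\<bar>" y] h r by (simp add: abs_mult)
  \<comment> \<open>The factor \<open>h ^ k\<close> may leave the sum only if the remaining series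
    converges, and convergence is obtained by dividing the absolutely summable column by
    \<open>h ^ k\<close>. If this power is 0, both sides vanish.\<close>
  have col: "(\<Sum>n. a n k) = (\<Sum>n. real (n choose k) * r ^ (n - k) * lag b n y) * h ^ k" for k
  proof (cases "h = 0 \<and> k > 0")
    case False
    have "summable (\<lambda>n. h ^ k * (real (n choose k) * r ^ (n - k) * lag b n y))"
      using summable_rabs_cancel[OF sums_swap_real(2)[of a, OF 1 2], of k] by (simp add: a_def mult_ac)
    moreover have "h ^ k \<noteq> 0" using False by auto
    ultimately have "summable (\<lambda>n. real (n choose k) * r ^ (n - k) * lag b n y)"
      by (rule summable_mult_D)
    then show ?thesis unfolding a_def by (rule suminf_mult2[symmetric])
  qed (simp add: a_def zero_power)
  have row: "(\<Sum>k. a n k) = lag b n y * (r + h) ^ n" for n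
  proof -
    have "a n = (\<lambda>k. lag b n y * (real (n choose k) * r ^ (n - k) * h ^ k))"
      by (simp add: a_def fun_eq_iff)
    then show ?thesis using sums_mult[OF bin[of n h], of "lag b n y"] by (simp only: sums_iff)
  qed
  have G: "(\<lambda>n. lag b n y * (r + h) ^ n) sums ((1 - (r + h)) powr (- b) * exp (- y * (r + h) / (1 - (r + h))))"
    by (rule laguerre_generating) (use b h r in auto)
  define q where "q = h / (1 - r)"
  have q: "\<bar>q\<bar> < 1" "h = q * (1 - r)" using h r by (auto simp: q_def)
  have G2: "(\<lambda>k. lag b k (y / (1 - r)) * q ^ k) sums ((1 - q) powr (- b) * exp (- (y / (1 - r)) * q / (1 - q)))"
    by (rule laguerre_generating) (use b q in auto)
  have 3: "(1 - (r + h)) = (1 - r) * (1 - q)" using q(2) by (simp add: algebra_simps)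
  have E: "- y * (r + h) / (1 - (r + h)) = - y * r / (1 - r) + - (y / (1 - r)) * q / (1 - q)"
    using q r unfolding 3 by (simp add: divide_simps) (simp add: algebra_simps)
  have eq: "(1 - (r + h)) powr (- b) * exp (- y * (r + h) / (1 - (r + h))) =
      ((1 - r) powr (- b) * exp (- y * r / (1 - r))) * ((1 - q) powr (- b) * exp (- (y / (1 - r)) * q / (1 - q)))"
    unfolding E exp_add unfolding 3 using q r by (simp add: powr_mult)
  have "(\<lambda>k. (\<Sum>n. real (n choose k) * r ^ (n - k) * lag b n y) * h ^ k) sums (\<Sum>n. lag b n y * (r + h) ^ n)"
    using sums_swap_real(1)[of a, OF 1 2] unfolding col row .
  then have "(\<lambda>k. (\<Sum>n. real (n choose k) * r ^ (n - k) * lag b n y) * h ^ k) sums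
       ((1 - (r + h)) powr (- b) * exp (- y * (r + h) / (1 - (r + h))))" using G by (simp add: sums_iff)
  moreover have "(\<lambda>k. (1 - r) powr (- b) * exp (- y * r / (1 - r)) * lag b k (y / (1 - r)) / (1 - r) ^ k * h ^ k)
     sums ((1 - (r + h)) powr (- b) * exp (- y * (r + h) / (1 - (r + h))))"
    using sums_mult[OF G2, of "(1 - r) powr (- b) * exp (- y * r / (1 - r))"] unfolding eq
    by (simp add: q_def power_divide mult_ac)
  ultimately show "\<exists>s. (\<lambda>k. (\<Sum>n. real (n choose k) * r ^ (n - k) * lag b n y) * h ^ k) sums s \<and> 
    (\<lambda>k. (1 - r) powr (- b) * exp (- y * r / (1 - r)) * lag b k (y / (1 - r)) / (1 - r) ^ k * h ^ k) sums s" by blast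
qed

section \<open>Orthogonality of the Laguerre polynomials and uniqueness of the normalized
  family\<close>

lemma has_bochner_integral_half_line:
  fixes f :: "real \<Rightarrow> real"
  assumes "\<And>y. y > 0 \<Longrightarrow> 0 \<le> f y" "(f has_integral I) {0<..}"
  shows "has_bochner_integral half_line f I"
proof -
  have "f absolutely_integrable_on {0<..}"
    using assms by (intro nonnegative_absolutely_integrable_1) auto
  then have "integrable half_line f" by (intro absolutely_integrable_imp_integrable) auto
  then show ?thesis
    using lebesgue_integral_eq_integral[of "{0<..}" f] assms(2)
    by (simp add: has_bochner_integral_iff integral_unique)
qed

lemma Gamma_has_bochner_integral:
  assumes "b > 0"
  shows "has_bochner_integral half_line (\<lambda>y. y powr (b - 1) * exp (- y)) (Gamma b)"
proof (rule has_bochner_integral_half_line)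
  have "((\<lambda>t. t powr (b - 1) / exp t) has_integral Gamma b) {0..}"
    using assms by (rule Gamma_integral_real)
  then have "((\<lambda>t. t powr (b - 1) * exp (- t)) has_integral Gamma b) {0..}"
    by (simp add: exp_minus divide_inverse)
  then show "((\<lambda>t. t powr (b - 1) * exp (- t)) has_integral Gamma b) {0<..}"
    by (subst (asm) has_integral_spike_set_eq[where T = "{0<..}"]) (auto intro: negligible_subset[of "{0}"])
qed simp

lemma moment_has_bochner_integral:
  assumes "b > 0"
  shows "has_bochner_integral half_line (\<lambda>y. y ^ k * (y powr (b - 1) * exp (- y))) (Gamma (b + real k))"
proof -
  have "has_bochner_integral half_line (\<lambda>y. y powr (b + real k - 1) * exp (- y)) (Gamma (b + real k))"
    using assms by (intro Gamma_has_bochner_integral) auto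
  moreover have "has_bochner_integral half_line (\<lambda>y. y powr (b + real k - 1) * exp (- y)) (Gamma (b + real k)) \<longleftrightarrow> ?thesis"
    by (intro has_bochner_integral_cong refl)
       (auto simp: powr_add powr_diff powr_realpow)
  ultimately show ?thesis by blast
qed

definition laguerre_int :: "real \<Rightarrow> real poly \<Rightarrow> real" where
  "laguerre_int b p = (\<integral>y. poly p y * (y powr (b - 1) * exp (- y)) \<partial>half_line)"

lemma poly_integrable:
  assumes "b > 0"
  shows "integrable half_line (\<lambda>y. poly p y * (y powr (b - 1) * exp (- y)))"
proof -
  have "integrable half_line (\<lambda>y. \<Sum>i\<le>degree p. coeff p i * (y ^ i * (y powr (b - 1) * exp (- y))))"
    using moment_has_bochner_integral[OF assms]
    by (intro Bochner_Integration.integrable_sum integrable_mult_right) (auto simp: has_bochner_integral_iff)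
  then show ?thesis by (simp add: poly_altdef sum_distrib_right mult.assoc)
qed

lemma laguerre_int_add: "b > 0 \<Longrightarrow> laguerre_int b (p + q) = laguerre_int b p + laguerre_int b q"
  unfolding laguerre_int_def using poly_integrable[of b p] poly_integrable[of b q]
  by (simp add: distrib_right)

lemma laguerre_int_smult: "laguerre_int b (smult c p) = c * laguerre_int b p"
  unfolding laguerre_int_def by (simp add: mult.assoc)

lemma laguerre_int_0 [simp]: "laguerre_int b 0 = 0"
  by (simp add: laguerre_int_def)

lemma laguerre_int_sum: "b > 0 \<Longrightarrow> laguerre_int b (sum f A) = (\<Sum>i\<in>A. laguerre_int b (f i))"
  by (induction A rule: infinite_finite_induct) (auto simp: laguerre_int_add)

lemma laguerre_int_diff: "b > 0 \<Longrightarrow> laguerre_int b (p - q) = laguerre_int b p - laguerre_int b q"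
  using laguerre_int_add[of b p "smult (- 1) q"] laguerre_int_smult[of b "- 1" q] by simp

lemma laguerre_int_monom: "b > 0 \<Longrightarrow> laguerre_int b (monom c k) = c * Gamma (b + real k)"
  unfolding laguerre_int_def using moment_has_bochner_integral[of b k]
  by (simp add: poly_monom mult.assoc has_bochner_integral_iff)

lemma laguerre_int_square_zero:
  assumes b: "b > 0" and z: "laguerre_int b (p * p) = 0"
  shows "p = 0"
proof (rule ccontr)
  assume "p \<noteq> 0"
  have "AE y in half_line. poly (p * p) y * (y powr (b - 1) * exp (- y)) = 0"
    using z poly_integrable[OF b, of "p * p"] unfolding laguerre_int_def
    by (subst (asm) integral_nonneg_eq_0_iff_AE) auto
  then have "AE y in lebesgue. y \<in> {0<..} \<longrightarrow> poly (p * p) y * (y powr (b - 1) * exp (- y)) = 0"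
    by (subst (asm) AE_restrict_space_iff) auto
  then have *: "AE y in lebesgue. y \<in> {0<..} \<longrightarrow> poly p y = 0" by eventually_elim auto
  have "finite {y. poly p y = 0}" using \<open>p \<noteq> 0\<close> by (rule poly_roots_finite)
  then have "AE y in lebesgue. y \<notin> {y. poly p y = 0}"
    by (intro AE_not_in) (metis negligible_finite negligible_iff_null_sets)
  with * have "AE y in lebesgue. y \<notin> {0<..<(1::real)}" by eventually_elim auto
  then have "{0<..<(1::real)} \<in> null_sets lebesgue" by (subst AE_iff_null_sets) auto
  then show False by (auto simp: null_sets_def)
qed

text \<open>Up to sign this is the \<open>n\<close>-th finite difference of
  \<open>pochhammer b j\<close>, a polynomial in \<open>b\<close> of degree \<open>j\<close>: it
  annihilates degrees below \<open>n\<close> and leaves the factorial in degree \<open>n\<close>. A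
  single difference lowers \<open>j\<close> by one and shifts \<open>b\<close>, which drives the
  induction.\<close>

lemma pochhammer_alternating_sum:
  fixes b :: real
  shows "j \<le> n \<Longrightarrow> (\<Sum>k\<le>n. (- 1) ^ k * real (n choose k) * pochhammer (b + real k) j) =
           (if j = n then (- 1) ^ n * fact n else 0)"
proof (induction n arbitrary: j b)
  case (Suc n)
  define D where "D = (\<lambda>n j b. (\<Sum>k\<le>n. (- 1) ^ k * real (n choose k) * pochhammer (b + real k) j))"
  have pascal: "D (Suc n) j b = D n j b - D n j (b + 1)"
  proof -
    have "D (Suc n) j b = pochhammer b j + (\<Sum>k\<le>n. (- 1) ^ Suc k * real (Suc n choose Suc k) * pochhammer (b + real (Suc k)) j)"
      unfolding D_def by (subst sum.atMost_Suc_shift) simp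
    also have "(\<Sum>k\<le>n. (- 1) ^ Suc k * real (Suc n choose Suc k) * pochhammer (b + real (Suc k)) j) =
        (\<Sum>k\<le>n. (- 1) ^ Suc k * real (n choose Suc k) * pochhammer (b + real (Suc k)) j) - D n j (b + 1)"
      unfolding D_def sum_subtractf[symmetric]
      by (intro sum.cong) (auto simp: algebra_simps)
    also have "pochhammer b j + ((\<Sum>k\<le>n. (- 1) ^ Suc k * real (n choose Suc k) * pochhammer (b + real (Suc k)) j) - D n j (b + 1))
       = (\<Sum>k\<le>Suc n. (- 1) ^ k * real (n choose k) * pochhammer (b + real k) j) - D n j (b + 1)"
      by (simp add: sum.atMost_Suc_shift del: sum.atMost_Suc)
    also have "(\<Sum>k\<le>Suc n. (- 1) ^ k * real (n choose k) * pochhammer (b + real k) j) = D n j b"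
      unfolding D_def by simp
    finally show ?thesis .
  qed
  have "D (Suc n) j b = (if j = Suc n then (- 1) ^ Suc n * fact (Suc n) else 0)"
  proof (cases j)
    case 0
    then show ?thesis unfolding pascal by (simp add: D_def)
  next
    case (Suc i)
    have "pochhammer (b + real k) (Suc i) - pochhammer (b + 1 + real k) (Suc i) =
       - real (Suc i) * pochhammer (b + 1 + real k) i" for k
      by (subst (1) pochhammer_rec, subst pochhammer_rec') (simp add: algebra_simps)
    then have "D (Suc n) j b = - real (Suc i) * D n i (b + 1)"
      unfolding pascal unfolding D_def Suc sum_subtractf[symmetric] right_diff_distrib[symmetric] sum_distrib_left
      by (intro sum.cong) auto
    also have "D n i (b + 1) = (if i = n then (- 1) ^ n * fact n else 0)"
      using Suc.IH[of i "b + 1"] Suc.prems Suc by (simp add: D_def)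
    finally show ?thesis using Suc by (auto simp: algebra_simps)
  qed
  then show ?case unfolding D_def .
qed auto

definition lagp :: "real \<Rightarrow> nat \<Rightarrow> real poly" where
  "lagp b n = (\<Sum>k\<le>n. monom (lcoef b n k * (- 1) ^ k) k)"

lemma poly_lagp: "poly (lagp b n) x = lag b n x"
proof -
  have "(- x) ^ k = (- 1) ^ k * x ^ k" for k by (rule power_minus)
  then show ?thesis unfolding lagp_def lag_def by (simp add: poly_sum poly_monom mult.assoc)
qed

lemma coeff_lagp: "coeff (lagp b n) i = (if i \<le> n then lcoef b n i * (- 1) ^ i else 0)"
  unfolding lagp_def by (simp add: coeff_sum)

lemma degree_lagp: "b > 0 \<Longrightarrow> degree (lagp b n) = n"
  using lcoef_pos[of b n n] by (intro antisym degree_le le_degree) (auto simp: coeff_lagp)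

lemma lagp_moment:
  assumes b: "b > 0" and j: "j \<le> n"
  shows "laguerre_int b (lagp b n * monom 1 j) = (if j = n then (- 1) ^ n * Gamma (b + real n) else 0)"
proof -
  have "lagp b n * monom 1 j = (\<Sum>k\<le>n. monom (lcoef b n k * (- 1) ^ k) (k + j))"
    unfolding lagp_def sum_distrib_right by (simp add: mult_monom)
  then have "laguerre_int b (lagp b n * monom 1 j) = (\<Sum>k\<le>n. lcoef b n k * (- 1) ^ k * Gamma (b + real (k + j)))"
    using b by (simp add: laguerre_int_sum laguerre_int_monom)
  also have "\<dots> = (\<Sum>k\<le>n. Gamma (b + real n) / fact n * ((- 1) ^ k * real (n choose k) * pochhammer (b + real k) j))"
  proof (intro sum.cong refl)
    fix k assume k: "k \<in> {..n}"
    have "b + real k \<notin> \<int>\<^sub>\<le>\<^sub>0" using b by (auto elim!: nonpos_Ints_cases)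
    then have "pochhammer (b + real k) j = Gamma (b + real (k + j)) / Gamma (b + real k)"
      by (simp add: pochhammer_Gamma add_ac)
    moreover have "real (n choose k) = fact n / (fact k * fact (n - k))"
      using k by (simp add: binomial_fact)
    ultimately show "lcoef b n k * (- 1) ^ k * Gamma (b + real (k + j)) =
      Gamma (b + real n) / fact n * ((- 1) ^ k * real (n choose k) * pochhammer (b + real k) j)"
      unfolding lcoef_def by (simp add: ac_simps)
  qed
  also have "\<dots> = Gamma (b + real n) / fact n * (if j = n then (- 1) ^ n * fact n else 0)"
    unfolding sum_distrib_left[symmetric] pochhammer_alternating_sum[OF j] ..
  finally show ?thesis by auto
qed

lemma lagp_orthogonal:
  assumes b: "b > 0" and q: "degree q < n \<or> q = 0"
  shows "laguerre_int b (lagp b n * q) = 0"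
proof -
  have "lagp b n * q = (\<Sum>i\<le>degree q. smult (coeff q i) (lagp b n * monom 1 i))"
    by (subst (1) poly_as_sum_of_monoms[of q, symmetric], subst sum_distrib_left)
       (auto simp: mult_smult_right[symmetric] smult_monom)
  moreover have "laguerre_int b (lagp b n * monom 1 i) = 0" if "i \<le> degree q" "q \<noteq> 0" for i
    using lagp_moment[OF b, of i n] q that by auto
  ultimately show ?thesis using b by (cases "q = 0") (auto simp: laguerre_int_sum laguerre_int_smult)
qed

text \<open>Orthogonality removes everything but the leading term of the second factor, whose moment
  is known.\<close>

lemma lagp_norm:
  assumes b: "b > 0"
  shows "laguerre_int b (lagp b n * lagp b n) = Gamma (b + real n) / fact n"
proof -
  define c where "c = lcoef b n n * (- 1) ^ n"
  define q where "q = lagp b n - smult c (monom 1 n)"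
  have "degree q < n \<or> q = 0"
  proof (cases "n = 0")
    case True
    then have "q = 0" by (auto simp: q_def c_def lagp_def smult_monom monom_0)
    then show ?thesis ..
  next
    case False
    have "coeff q i = 0" if "i \<ge> n" for i
      using that by (cases "i = n") (auto simp: q_def c_def coeff_lagp)
    then have "degree q \<le> n - 1" using False by (intro degree_le) auto
    then show ?thesis using False by auto
  qed
  then have 0: "laguerre_int b (lagp b n * q) = 0" by (rule lagp_orthogonal[OF b])
  have "lagp b n * lagp b n = lagp b n * q + smult c (lagp b n * monom 1 n)"
    by (simp add: q_def algebra_simps)
  then have "laguerre_int b (lagp b n * lagp b n) = c * ((- 1) ^ n * Gamma (b + real n))"
    using 0 b lagp_moment[OF b, of n n] by (simp add: laguerre_int_add laguerre_int_smult)
  also have "\<dots> = Gamma (b + real n) / fact n"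
    using b Gamma_real_pos[of "b + real n"] by (auto simp: c_def lcoef_def simp flip: power_mult_distrib)
  finally show ?thesis .
qed

text \<open>Subtracting the right multiple \<open>c\<close> of the classical polynomial leaves
  \<open>d\<close> of lower degree, orthogonal to both polynomials, hence 0. The norm fixes only
  \<open>c * c\<close>, but this is all that the product of the values at \<open>x\<close> and
  \<open>y\<close> contains, so the free sign disappears.\<close>

lemma normalized_laguerre_product:
  assumes \<alpha>: "\<alpha> > -1" and L: "normalized_laguerre \<alpha> L"
  shows "poly (L n) x * poly (L n) y =
    fact n / Gamma (\<alpha> + 1 + real n) * (lag (\<alpha> + 1) n x * lag (\<alpha> + 1) n y)"
proof -
  define b where "b = \<alpha> + 1"
  have b: "b > 0" using \<alpha> by (simp add: b_def)
  have deg: "degree (L n) = n" for n using L by (simp add: normalized_laguerre_def)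
  have orth: "laguerre_int b (L i * L j) = (if i = j then 1 else 0)" for i j
    using L by (simp add: normalized_laguerre_def laguerre_int_def b_def has_bochner_integral_iff)
  have Lnz: "L n \<noteq> 0" for n using orth[of n n] by (auto simp: laguerre_int_def)
  \<comment> \<open>Orthogonality is given only within the family. The degree condition makes its
    first \<open>n\<close> members span the polynomials of degree below \<open>n\<close>; the
    induction realizes this by removing leading terms.\<close>
  have lower: "laguerre_int b (L n * q) = 0" if "degree q < n \<or> q = 0" for q n
    using that
  proof (induction "degree q" arbitrary: q rule: less_induct)
    case less
    show ?case
    proof (cases "q = 0")
      case False
      define m where "m = degree q"
      define c where "c = lead_coeff q / lead_coeff (L m)"
      define q' where "q' = q - smult c (L m)"
      have "m < n" using less.prems False by (simp add: m_def)
      have z: "coeff q' i = 0" if "i \<ge> m" for i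
        using that deg[of m] Lnz[of m] leading_coeff_0_iff[of "L m"]
        by (cases "i = m") (auto simp: q'_def c_def m_def coeff_eq_0)
      have "degree q' < m \<or> q' = 0"
        using z[of "degree q'"] by (metis leI leading_coeff_0_iff)
      then have "laguerre_int b (L n * q') = 0"
        using less.hyps[of q'] \<open>m < n\<close> by (auto simp: m_def laguerre_int_def)
      moreover have "L n * q = L n * q' + smult c (L n * L m)" by (simp add: q'_def algebra_simps)
      ultimately show ?thesis using b orth[of n m] \<open>m < n\<close> by (simp add: laguerre_int_add laguerre_int_smult)
    qed (simp add: laguerre_int_def)
  qed
  define l where "l = lagp b n"
  have dl: "degree l = n" and lnz: "l \<noteq> 0"
    using degree_lagp[OF b, of n] lcoef_pos[OF b, of n n] coeff_lagp[of b n n]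
    by (auto simp: l_def)
  define c where "c = lead_coeff (L n) / lead_coeff l"
  define d where "d = L n - smult c l"
  have z: "coeff d i = 0" if "i \<ge> n" for i
    using that deg[of n] dl lnz by (cases "i = n") (auto simp: d_def c_def coeff_eq_0)
  have "degree d < n \<or> d = 0"
    using z[of "degree d"] by (metis leI leading_coeff_0_iff)
  then have "laguerre_int b (L n * d) = 0" "laguerre_int b (l * d) = 0"
    using lower lagp_orthogonal[OF b] by (auto simp: l_def)
  moreover have "d * d = L n * d - smult c (l * d)" by (subst (1) d_def) (simp add: left_diff_distrib)
  ultimately have "laguerre_int b (d * d) = 0" using b by (simp add: laguerre_int_diff laguerre_int_smult)
  then have "d = 0" by (rule laguerre_int_square_zero[OF b])
  then have "L n = smult c l" by (simp add: d_def)
  moreover have "c * c * laguerre_int b (l * l) = 1"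
    using orth[of n n] unfolding \<open>L n = smult c l\<close> by (simp add: laguerre_int_smult)
  moreover have "Gamma (b + real n) > 0" using b by (intro Gamma_real_pos) auto
  ultimately have cc: "c * c = fact n / Gamma (b + real n)" and Lc: "L n = smult c l"
    unfolding l_def lagp_norm[OF b] by (auto simp: field_simps)
  have "poly (L n) x * poly (L n) y = (c * c) * (lag b n x * lag b n y)"
    unfolding Lc by (simp add: l_def poly_lagp)
  then show ?thesis unfolding cc b_def .
qed


section \<open>The bilinear series and the Hille-Hardy formula\<close>

lemma fact_div_Gamma_le:
  assumes b: "b > 0"
  obtains C where "C > 0" "\<And>n. fact n / Gamma (b + real n) \<le> C * (real n + 1)"
proof -
  obtain c where c: "c > 0" "\<And>k. c * fact k \<le> Gamma (b + real (Suc k))"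
    using Gamma_ge_fact[OF b] by blast
  have G: "Gamma (b + real n) > 0" for n using b by (intro Gamma_real_pos) auto
  show ?thesis
  proof
    show "1 / c + 1 / Gamma b > 0" using c(1) G[of 0] by (simp add: add_pos_pos)
    fix n
    show "fact n / Gamma (b + real n) \<le> (1 / c + 1 / Gamma b) * (real n + 1)"
    proof (cases n)
      case 0
      then show ?thesis using c(1) by simp
    next
      case (Suc k)
      have "fact n / Gamma (b + real n) \<le> fact n / (c * fact k)"
        using c G[of n] by (intro divide_left_mono) (auto simp: Suc simp del: fact_Suc)
      also have "\<dots> = (1 / c) * real n" by (simp add: Suc)
      also have "\<dots> \<le> (1 / c + 1 / Gamma b) * (real n + 1)"
        using c(1) G[of 0] by (intro mult_mono) auto
      finally show ?thesis .
    qed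
  qed
qed

lemma summable_linear_geometric:
  fixes r :: real
  assumes "0 \<le> r" "r < 1"
  shows "summable (\<lambda>n. (real n + 1) * r ^ n)"
proof -
  have "(\<lambda>n. real (Suc n) * r ^ n) sums (1 / (1 - r)\<^sup>2)"
    using assms by (intro geometric_deriv_sums) auto
  then show ?thesis by (simp add: sums_iff add.commute)
qed

lemma lag_power_bounded:
  assumes "b > 0" "0 \<le> r" "r < 1"
  obtains M where "M > 0" "\<And>n. \<bar>lag b n x\<bar> * r ^ n \<le> M"
proof -
  have "summable (\<lambda>n. lag b n x * r ^ n)"
    by (rule summable_rabs_cancel, rule laguerre_generating(2)) (use assms in auto)
  then have "Bseq (\<lambda>n. lag b n x * r ^ n)"
    by (intro convergent_imp_Bseq summable_LIMSEQ_zero[THEN convergentI])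
  then obtain M where "M > 0" "\<And>n. norm (lag b n x * r ^ n) \<le> M" unfolding Bseq_def by blast
  then show ?thesis using that[of M] assms by (simp add: abs_mult)
qed

text \<open>The cube root splits the geometric factor into three: two of them control the Laguerre
  factors, and the third sums the at most linear growth of
  \<open>fact n / Gamma (b + real n)\<close>.\<close>

lemma laguerre_product_summable:
  assumes b: "b > 0" and r: "0 \<le> r" "r < 1"
  shows "summable (\<lambda>n. fact n / Gamma (b + real n) * \<bar>lag b n x\<bar> * \<bar>lag b n y\<bar> * r ^ n)"
proof -
  define \<rho> where "\<rho> = root 3 r"
  have \<rho>: "0 \<le> \<rho>" "\<rho> < 1" "\<rho> ^ 3 = r"
    using r by (auto simp: \<rho>_def real_root_lt_1_iff)
  obtain C where C: "C > 0" "\<And>n. fact n / Gamma (b + real n) \<le> C * (real n + 1)"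
    using fact_div_Gamma_le[OF b] by blast
  obtain M where M: "M > 0" "\<And>n. \<bar>lag b n x\<bar> * \<rho> ^ n \<le> M"
    using lag_power_bounded[OF b \<rho>(1,2)] by blast
  obtain N where N: "N > 0" "\<And>n. \<bar>lag b n y\<bar> * \<rho> ^ n \<le> N"
    using lag_power_bounded[OF b \<rho>(1,2)] by blast
  have "summable (\<lambda>n. (C * M * N) * ((real n + 1) * \<rho> ^ n))"
    using \<rho> by (intro summable_mult summable_linear_geometric)
  then show ?thesis
  proof (rule summable_comparison_test_ev[rotated], intro always_eventually allI)
    fix n
    have G: "Gamma (b + real n) > 0" using b by (intro Gamma_real_pos) auto
    have "r ^ n = \<rho> ^ n * \<rho> ^ n * \<rho> ^ n"
      unfolding \<rho>(3)[symmetric] by (simp add: power3_eq_cube power_mult_distrib)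
    then have "fact n / Gamma (b + real n) * \<bar>lag b n x\<bar> * \<bar>lag b n y\<bar> * r ^ n =
      (fact n / Gamma (b + real n)) * (\<bar>lag b n x\<bar> * \<rho> ^ n) * (\<bar>lag b n y\<bar> * \<rho> ^ n) * \<rho> ^ n"
      by simp
    also have "\<dots> \<le> (C * (real n + 1)) * M * N * \<rho> ^ n"
      using C M N \<rho> G by (intro mult_mono mult_nonneg_nonneg) (auto intro: less_imp_le)
    finally show "norm (fact n / Gamma (b + real n) * \<bar>lag b n x\<bar> * \<bar>lag b n y\<bar> * r ^ n) \<le>
      (C * M * N) * ((real n + 1) * \<rho> ^ n)"
      using G r by (simp add: mult_ac)
  qed
qed

definition lag_kernel :: "real \<Rightarrow> real \<Rightarrow> real \<Rightarrow> real \<Rightarrow> real" where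
  "lag_kernel b r x y =
     (1 - r) powr (- b) * exp (- (r * (x + y) / (1 - r))) * bessel_series b (r * x * y / (1 - r)\<^sup>2)"

text \<open>One Laguerre polynomial is expanded in powers of \<open>x\<close> and the sums are
  exchanged. The sum over \<open>n\<close> is then \<open>laguerre_reexpansion\<close> in
  \<open>y\<close>, and the sum over \<open>k\<close> is \<open>laguerre_bessel\<close> at the
  dilated argument \<open>y / (1 - r)\<close>.\<close>

theorem hille_hardy:
  fixes b r x y :: real
  assumes b: "b > 0" and r: "0 \<le> r" "r < 1"
  shows "(\<lambda>n. r ^ n * (fact n / Gamma (b + real n) * (lag b n x * lag b n y))) sums lag_kernel b r x y"
proof -
  define a where "a = (\<lambda>n k. (- x) ^ k / Gamma (b + real k) * (real (n choose k) * r ^ n * lag b n y))"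
  have G: "Gamma (b + real n) > 0" for n using b by (intro Gamma_real_pos) auto
  have fin: "(\<lambda>k. real (n choose k) * z ^ k / Gamma (b + real k)) sums (fact n / Gamma (b + real n) * lag b n (- z))" for n z
  proof -
    have "(\<lambda>k. real (n choose k) * z ^ k / Gamma (b + real k)) sums (\<Sum>k\<le>n. real (n choose k) * z ^ k / Gamma (b + real k))"
      by (rule sums_finite) auto
    also have "(\<Sum>k\<le>n. real (n choose k) * z ^ k / Gamma (b + real k)) = fact n / Gamma (b + real n) * lag b n (- z)"
      unfolding lag_def lcoef_def sum_distrib_left
      by (intro sum.cong refl) (use G[of n] in \<open>auto simp: binomial_fact ac_simps\<close>)
    finally show ?thesis .
  qed
  have a_abs: "\<bar>a n k\<bar> = r ^ n * \<bar>lag b n y\<bar> * (real (n choose k) * \<bar>x\<bar> ^ k / Gamma (b + real k))" for n k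
    using r G[of k] by (simp add: a_def abs_mult power_abs)
  have 1: "(\<lambda>k. \<bar>a n k\<bar>) sums (r ^ n * \<bar>lag b n y\<bar> * (fact n / Gamma (b + real n) * lag b n (- \<bar>x\<bar>)))" for n
    unfolding a_abs by (intro sums_mult fin)
  \<comment> \<open>The absolute values of the terms of \<open>lag b n x\<close> add up to
    \<open>lag b n (- \<bar>x\<bar>)\<close>, so the bilinear series at this argument is the
    majorant.\<close>
  have lpos: "\<bar>lag b n (- \<bar>x\<bar>)\<bar> = lag b n (- \<bar>x\<bar>)" for n
    using lcoef_pos[OF b] by (intro abs_of_nonneg) (auto simp: lag_def intro!: sum_nonneg mult_nonneg_nonneg intro: less_imp_le)
  have 2: "summable (\<lambda>n. r ^ n * \<bar>lag b n y\<bar> * (fact n / Gamma (b + real n) * lag b n (- \<bar>x\<bar>)))"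
    using laguerre_product_summable[OF b r, of "- \<bar>x\<bar>" y] unfolding lpos by (simp add: mult_ac)
  have row: "(\<Sum>k. a n k) = r ^ n * (fact n / Gamma (b + real n) * (lag b n x * lag b n y))" for n
  proof -
    have "a n = (\<lambda>k. r ^ n * lag b n y * (real (n choose k) * (- x) ^ k / Gamma (b + real k)))"
      by (simp add: a_def fun_eq_iff)
    then show ?thesis using sums_mult[OF fin[of n "- x"], of "r ^ n * lag b n y"]
      by (simp add: sums_iff)
  qed
  define K where "K = (1 - r) powr (- b) * exp (- y * r / (1 - r))"
  define t where "t = - x * r / (1 - r)"
  have col: "(\<Sum>n. a n k) = K * (t ^ k / Gamma (b + real k) * lag b k (y / (1 - r)))" for k
  proof -
    have eq: "a n k = ((- x) ^ k / Gamma (b + real k) * r ^ k) * (real (n choose k) * r ^ (n - k) * lag b n y)" for n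
    proof (cases "k \<le> n")
      case True
      then have "r ^ n = r ^ k * r ^ (n - k)" by (simp flip: power_add)
      then show ?thesis by (simp add: a_def)
    qed (simp add: a_def)
    \<comment> \<open>Pulling out the constant needs convergence of the remaining series, which
      comes from the column by division; hence the separate treatment of the cases in which a factor
      of the constant may vanish.\<close>
    have "(\<Sum>n. a n k) = ((- x) ^ k / Gamma (b + real k) * r ^ k) * (\<Sum>n. real (n choose k) * r ^ (n - k) * lag b n y)"
    proof (cases "r = 0")
      case True
      show ?thesis
      proof (cases "k = 0")
        case True
        have "a n k = ((- x) ^ k / Gamma (b + real k) * r ^ k) * (real (n choose k) * r ^ (n - k) * lag b n y)" for n
          by (rule eq)
        moreover have "summable (\<lambda>n. real (n choose k) * r ^ (n - k) * lag b n y)"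
          using laguerre_generating(2)[OF b, of r y] r True
          by (simp add: mult.commute) (rule summable_rabs_cancel)
        ultimately show ?thesis by (simp only: suminf_mult)
      next
        case False
        then have "r ^ k = 0" using \<open>r = 0\<close> by simp
        then have "(- x) ^ k / Gamma (b + real k) * r ^ k = 0" by (rule ssubst) simp
        then show ?thesis unfolding eq by (simp only: mult_zero_left suminf_zero)
      qed
    next
      case False
      show ?thesis
      proof (cases "(- x) ^ k = 0")
        case True
        then have "(- x) ^ k / Gamma (b + real k) * r ^ k = 0" by (rule ssubst) simp
        then show ?thesis unfolding eq by (simp only: mult_zero_left suminf_zero)
      next
        case nz: False
        have "summable (\<lambda>n. a n k)"
        proof (rule summable_rabs_cancel, rule sums_swap_real(2)[of "\<lambda>n k. a n k", OF 1 2])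
        qed
        then have "summable (\<lambda>n. real (n choose k) * r ^ (n - k) * lag b n y)"
          unfolding eq by (rule summable_mult_D) (use nz False G[of k] in auto)
        then show ?thesis unfolding eq by (rule suminf_mult)
      qed
    qed
    also have "\<dots> = K * (t ^ k / Gamma (b + real k) * lag b k (y / (1 - r)))"
      unfolding laguerre_reexpansion[OF b r] K_def t_def power_divide power_mult_distrib
      by (simp add: ac_simps)
    finally show ?thesis .
  qed
  define R where "R = (\<lambda>n. r ^ n * (fact n / Gamma (b + real n) * (lag b n x * lag b n y)))"
  have "(\<lambda>k. K * (t ^ k / Gamma (b + real k) * lag b k (y / (1 - r)))) sums (\<Sum>n. R n)"
    using sums_swap_real(1)[of a, OF 1 2] unfolding row col R_def .
  moreover have "(\<lambda>k. K * (t ^ k / Gamma (b + real k) * lag b k (y / (1 - r)))) sums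
      (K * (exp t * bessel_series b (- (t * (y / (1 - r))))))"
    by (intro sums_mult laguerre_bessel b)
  ultimately have "(\<Sum>n. R n) = K * (exp t * bessel_series b (- (t * (y / (1 - r)))))"
    by (rule sums_unique2)
  also have "\<dots> = lag_kernel b r x y"
  proof -
    have "- (t * (y / (1 - r))) = r * x * y / (1 - r)\<^sup>2"
      by (simp add: t_def power2_eq_square)
    moreover have "- (r * (x + y) / (1 - r)) = - y * r / (1 - r) + t"
      by (simp add: t_def algebra_simps add_divide_distrib diff_divide_distrib)
    ultimately show ?thesis unfolding K_def lag_kernel_def by (simp only: exp_add mult.assoc)
  qed
  finally have "(\<Sum>n. R n) = lag_kernel b r x y" .
  moreover have "summable R"
  proof (rule summable_rabs_cancel)
    show "summable (\<lambda>n. \<bar>R n\<bar>)"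
      using laguerre_product_summable[OF b r, of x y] r G
      by (simp add: R_def abs_mult mult_ac power_abs abs_of_pos)
  qed
  ultimately show ?thesis unfolding R_def by (simp add: sums_iff)
qed

lemma heat_kernel_sums:
  assumes \<alpha>: "\<alpha> > -1" and L: "normalized_laguerre \<alpha> L" and u: "u > 0"
  shows "(\<lambda>n. exp (- ((real n + m) * u)) * poly (L n) x * poly (L n) y) sums
    (exp (- (m * u)) * lag_kernel (\<alpha> + 1) (exp (- u)) x y)"
proof -
  have "(\<lambda>n. exp (- (m * u)) * (exp (- u) ^ n * (fact n / Gamma (\<alpha> + 1 + real n) * (lag (\<alpha> + 1) n x * lag (\<alpha> + 1) n y)))) sums
    (exp (- (m * u)) * lag_kernel (\<alpha> + 1) (exp (- u)) x y)"
    using \<alpha> u by (intro sums_mult hille_hardy) auto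
  also have "(\<lambda>n. exp (- (m * u)) * (exp (- u) ^ n * (fact n / Gamma (\<alpha> + 1 + real n) * (lag (\<alpha> + 1) n x * lag (\<alpha> + 1) n y))))
    = (\<lambda>n. exp (- ((real n + m) * u)) * poly (L n) x * poly (L n) y)"
  proof
    fix n
    have "exp (- ((real n + m) * u)) = exp (- (m * u)) * exp (- u) ^ n"
      by (simp add: exp_of_nat_mult[symmetric] exp_add[symmetric] algebra_simps)
    then show "exp (- (m * u)) * (exp (- u) ^ n * (fact n / Gamma (\<alpha> + 1 + real n) * (lag (\<alpha> + 1) n x * lag (\<alpha> + 1) n y)))
      = exp (- ((real n + m) * u)) * poly (L n) x * poly (L n) y"
      using normalized_laguerre_product[OF \<alpha> L, of n x y] by (simp add: mult.assoc)
  qed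
  finally show ?thesis .
qed

lemma heat_kernel_eq:
  assumes "\<alpha> > -1" "normalized_laguerre \<alpha> L" "u > 0"
  shows "heat_kernel L m u x y = exp (- (m * u)) * lag_kernel (\<alpha> + 1) (exp (- u)) x y"
  unfolding heat_kernel_def using heat_kernel_sums[OF assms] by (rule sums_unique[symmetric])

text \<open>On the diagonal \<open>x = y\<close> the bilinear series controls the squares, and
  \<open>\<bar>z\<bar> \<le> 1 + z * z\<close> passes from squares to absolute values at the price
  of a geometric series.\<close>

lemma normalized_laguerre_summable:
  assumes \<alpha>: "\<alpha> > -1" and L: "normalized_laguerre \<alpha> L" and u: "u > 0"
  shows "summable (\<lambda>n. exp (- (real n * u)) * \<bar>poly (L n) x\<bar>)"
proof -
  define b where "b = \<alpha> + 1"
  have b: "b > 0" using \<alpha> by (simp add: b_def)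
  have r: "0 \<le> exp (- u)" "exp (- u) < 1" using u by auto
  have "summable (\<lambda>n. exp (- u) ^ n * (1 + fact n / Gamma (b + real n) * \<bar>lag b n x\<bar> * \<bar>lag b n x\<bar>))"
    using laguerre_product_summable[OF b r, of x x] r
    by (simp add: distrib_left summable_add summable_geometric mult_ac)
  then show ?thesis
  proof (rule summable_comparison_test_ev[rotated], intro always_eventually allI)
    fix n
    have "\<bar>z\<bar> \<le> 1 + z * z" for z :: real
      by (metis (no_types, opaque_lifting) abs_mult_self_eq abs_ge_zero add_increasing2 linorder_le_cases mult_left_mono mult.right_neutral order_trans zero_le_one add_increasing zero_le_square)
    from this[of "poly (L n) x"]
    have "\<bar>poly (L n) x\<bar> \<le> 1 + fact n / Gamma (b + real n) * \<bar>lag b n x\<bar> * \<bar>lag b n x\<bar>"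
      using normalized_laguerre_product[OF \<alpha> L, of n x x] by (simp add: b_def mult.assoc)
    moreover have "exp (- (real n * u)) = exp (- u) ^ n" by (simp add: exp_of_nat_mult[symmetric])
    ultimately show "norm (exp (- (real n * u)) * \<bar>poly (L n) x\<bar>) \<le>
       exp (- u) ^ n * (1 + fact n / Gamma (b + real n) * \<bar>lag b n x\<bar> * \<bar>lag b n x\<bar>)"
      by (simp add: abs_mult mult_left_mono)
  qed
qed

section \<open>Bounds for the heat kernel\<close>

lemma powr_times_exp_bounded:
  fixes N \<eta> :: real
  assumes "\<eta> > 0"
  obtains C where "C > 0" "\<And>t. t \<ge> 0 \<Longrightarrow> (1 + t) powr N * exp (- \<eta> * t) \<le> C"
proof (cases "N > 0")
  case True
  \<comment> \<open>At this scale the tangent bound for \<open>ln\<close>, multiplied by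
    \<open>N\<close>, grows at the rate \<eta> exactly.\<close>
  define \<delta> where "\<delta> = \<eta> / N"
  have \<delta>: "\<delta> > 0" "N * \<delta> = \<eta>" using assms True by (auto simp: \<delta>_def)
  have "(1 + t) powr N * exp (- \<eta> * t) \<le> exp (\<eta> - N - N * ln \<delta>)" if "t \<ge> 0" for t
  proof -
    have "ln (\<delta> * (1 + t)) \<le> \<delta> * (1 + t) - 1" using that \<delta> by (intro ln_le_minus_one) auto
    moreover have "ln (\<delta> * (1 + t)) = ln \<delta> + ln (1 + t)" using that \<delta> by (intro ln_mult_pos) auto
    ultimately have "ln (1 + t) \<le> \<delta> * (1 + t) - 1 - ln \<delta>" by simp
    then have "N * ln (1 + t) \<le> N * (\<delta> * (1 + t) - 1 - ln \<delta>)" using True by simp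
    also have "\<dots> = (N * \<delta>) * (1 + t) - N - N * ln \<delta>" by (simp add: algebra_simps)
    finally have "N * ln (1 + t) - \<eta> * t \<le> \<eta> - N - N * ln \<delta>"
      unfolding \<delta>(2) by (simp add: algebra_simps)
    then show ?thesis using that by (simp add: powr_def flip: exp_add)
  qed
  then show ?thesis using that[of "exp (\<eta> - N - N * ln \<delta>)"] by simp
next
  case False
  have "(1 + t) powr N * exp (- \<eta> * t) \<le> 1" if "t \<ge> 0" for t
  proof -
    have "(1 + t) powr N \<le> (1 + t) powr 0" using that False by (intro powr_mono) auto
    then have "(1 + t) powr N * exp (- \<eta> * t) \<le> 1 * 1" 
      using that assms by (intro mult_mono) auto
    then show ?thesis by simp
  qed
  then show ?thesis using that[of 1] by simp
qed

lemma power_div_fact_le_exp: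
  fixes s :: real
  assumes "s \<ge> 0"
  shows "s ^ n / fact n \<le> exp s"
proof -
  have "(\<Sum>k\<in>{n}. s ^ k /\<^sub>R fact k) \<le> (\<Sum>k. s ^ k /\<^sub>R fact k)"
    using assms summable_exp_generic[of s] by (intro sum_le_suminf) auto
  then show ?thesis by (simp add: exp_def divide_inverse mult.commute)
qed

lemma bessel_series_lower:
  assumes b: "b > 0" and z: "z \<ge> 0"
  shows "1 / Gamma b \<le> bessel_series b z"
proof -
  have G: "Gamma (b + real k) > 0" for k using b by (intro Gamma_real_pos) auto
  have "(\<Sum>k\<in>{0}. z ^ k / (fact k * Gamma (b + real k))) \<le> bessel_series b z"
    unfolding bessel_series_def using summable_rabs_cancel[OF bessel_series_summable[OF b, of z]] z G
    by (intro sum_le_suminf) (auto intro!: divide_nonneg_nonneg mult_nonneg_nonneg intro: less_imp_le)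
  then show ?thesis by simp
qed

text \<open>Of the two factors \<open>s ^ k\<close>, one over \<open>fact k\<close> is left to form
  the exponential series and the other, over the Gamma value, is bounded termwise by
  \<open>exp s\<close>. The power in front is not sharp, but the exponential rate
  \<open>2 * s\<close> is, and it is what the kernel bounds depend on.\<close>

lemma bessel_series_upper:
  assumes b: "b > 0"
  obtains C where "C > 0" "\<And>s. s \<ge> 0 \<Longrightarrow> bessel_series b (s\<^sup>2) \<le> C * (1 + s) * exp (2 * s)"
proof -
  obtain c where c: "c > 0" "\<And>k. c * fact k \<le> Gamma (b + real (Suc k))"
    using Gamma_ge_fact[OF b] by blast
  have G: "Gamma (b + real k) > 0" for k using b by (intro Gamma_real_pos) auto
  have G0: "Gamma b > 0" using b by (intro Gamma_real_pos) auto
  define C where "C = 1 / Gamma b + 1 / c"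
  have C: "C > 0" "1 / Gamma b \<le> C" "1 / c \<le> C" using c(1) G0 by (auto simp: C_def add_pos_pos)
  have "bessel_series b (s\<^sup>2) \<le> C * (1 + s) * exp (2 * s)" if s: "s \<ge> 0" for s
  proof -
    have "(s\<^sup>2) ^ k / (fact k * Gamma (b + real k)) \<le> C * (1 + s) * exp s * (s ^ k / fact k)" for k
    proof (cases k)
      case 0
      have "1 / Gamma b * (1 * 1) \<le> C * ((1 + s) * exp s)"
        using C s G0 by (intro mult_mono) auto
      then show ?thesis by (simp add: 0 mult.assoc)
    next
      case (Suc j)
      have "(s\<^sup>2) ^ k / (fact k * Gamma (b + real k)) = (s ^ k / fact k) * (s * s ^ j / Gamma (b + real (Suc j)))"
        unfolding Suc by (simp add: power_mult_distrib power2_eq_square)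
      also have "\<dots> \<le> (s ^ k / fact k) * (s * s ^ j / (c * fact j))"
        using c s by (intro mult_left_mono divide_left_mono mult_pos_pos G) auto
      also have "s * s ^ j / (c * fact j) = (1 / c) * s * (s ^ j / fact j)" by simp
      also have "(s ^ k / fact k) * \<dots> \<le> (s ^ k / fact k) * (C * (1 + s) * exp s)"
        using s C c(1) by (intro mult_left_mono mult_mono power_div_fact_le_exp) auto
      finally show ?thesis by (simp add: mult_ac)
    qed
    note terms = this
    have sms: "(\<lambda>k. C * (1 + s) * exp s * (s ^ k / fact k)) sums (C * (1 + s) * exp s * exp s)"
      using exp_converges[of s] by (intro sums_mult) (simp add: divide_inverse mult.commute)
    have "bessel_series b (s\<^sup>2) \<le> (\<Sum>k. C * (1 + s) * exp s * (s ^ k / fact k))"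
      unfolding bessel_series_def
      by (rule suminf_le[OF terms summable_rabs_cancel[OF bessel_series_summable[OF b]] sums_summable[OF sms]])
    also have "\<dots> = C * (1 + s) * exp s * exp s" using sms by (rule sums_unique[symmetric])
    also have "\<dots> = C * (1 + s) * exp (2 * s)" by (simp add: mult.assoc flip: exp_add)
    finally show ?thesis .
  qed
  then show ?thesis using that C(1) by blast
qed

lemma lag_kernel_pos:
  assumes "b > 0" "0 \<le> r" "r < 1" "x \<ge> 0" "y \<ge> 0"
  shows "lag_kernel b r x y > 0"
proof -
  have "1 / Gamma b > 0" using assms by (auto intro: Gamma_real_pos)
  then have "bessel_series b (r * x * y / (1 - r)\<^sup>2) > 0"
    using bessel_series_lower[of b "r * x * y / (1 - r)\<^sup>2"] assms by (smt (verit) divide_nonneg_nonneg mult_nonneg_nonneg zero_le_power2)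
  then show ?thesis unfolding lag_kernel_def using assms by simp
qed

lemma lag_kernel_sym: "lag_kernel b r x y = lag_kernel b r y x"
  unfolding lag_kernel_def by (simp add: ac_simps)

lemma lag_kernel_upper:
  assumes b: "b > 0"
  obtains C where "C > 0" "\<And>r x y. \<lbrakk>0 < r; r < 1; 0 \<le> x; 0 \<le> y\<rbrakk> \<Longrightarrow>
    lag_kernel b r x y \<le> C * (1 - r) powr (- b) * (1 + sqrt (r * x * y) / (1 - r)) *
       exp ((2 * sqrt (r * x * y) - r * (x + y)) / (1 - r))"
proof -
  obtain C where C: "C > 0" "\<And>s. s \<ge> 0 \<Longrightarrow> bessel_series b (s\<^sup>2) \<le> C * (1 + s) * exp (2 * s)"
    using bessel_series_upper[OF b] by blast
  show ?thesis
  proof (rule that[OF C(1)])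
    fix r x y :: real
    assume a: "0 < r" "r < 1" "0 \<le> x" "0 \<le> y"
    define s where "s = sqrt (r * x * y) / (1 - r)"
    have s: "s \<ge> 0" "s\<^sup>2 = r * x * y / (1 - r)\<^sup>2" using a by (auto simp: s_def power_divide)
    have "lag_kernel b r x y \<le> (1 - r) powr (- b) * exp (- (r * (x + y) / (1 - r))) * (C * (1 + s) * exp (2 * s))"
      unfolding lag_kernel_def s(2)[symmetric] using C(2)[OF s(1)] by (intro mult_left_mono) auto
    also have "\<dots> = C * (1 - r) powr (- b) * (1 + s) * exp (2 * s + - (r * (x + y) / (1 - r)))"
      unfolding exp_add by (simp add: ac_simps)
    also have "2 * s + - (r * (x + y) / (1 - r)) = (2 * sqrt (r * x * y) - r * (x + y)) / (1 - r)"
      by (simp add: s_def diff_divide_distrib)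
    finally show "lag_kernel b r x y \<le> C * (1 - r) powr (- b) * (1 + sqrt (r * x * y) / (1 - r)) *
       exp ((2 * sqrt (r * x * y) - r * (x + y)) / (1 - r))" unfolding s_def .
  qed
qed

text \<open>Weighted AM-GM for the exponent in \<open>lag_kernel_upper\<close>; the choice of
  \<open>c\<close> decides how much decay in \<open>y\<close> survives.\<close>

lemma sqrt_mult_le_weighted:
  fixes c p q :: real
  assumes "c > 0" "p \<ge> 0" "q \<ge> 0"
  shows "2 * sqrt (p * q) \<le> c * p + q / c"
proof -
  have "0 \<le> (sqrt (c * p) - sqrt (q / c))\<^sup>2" by simp
  also have "\<dots> = c * p + q / c - 2 * (sqrt (c * p) * sqrt (q / c))"
    using assms by (simp add: power2_diff)
  also have "sqrt (c * p) * sqrt (q / c) = sqrt (p * q)"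
    using assms by (simp flip: real_sqrt_mult)
  finally show ?thesis by simp
qed

text \<open>With equal weights the exponent is at most \<open>x\<close>, uniformly in
  \<open>r\<close>. No decay in \<open>y\<close> is left, so the bound serves where \<open>y\<close>
  is at most a multiple of \<open>1 + x\<close>.\<close>

lemma lag_kernel_upper_general:
  assumes b: "b > 0"
  obtains C where "C > 0" "\<And>r x y. \<lbrakk>0 < r; r < 1; 0 \<le> x; 0 \<le> y\<rbrakk> \<Longrightarrow>
    lag_kernel b r x y \<le> C * (1 - r) powr (- (b + 1)) * (1 + sqrt (x * y)) * exp x"
proof -
  obtain C where C: "C > 0" "\<And>r x y. \<lbrakk>0 < r; r < 1; 0 \<le> x; 0 \<le> y\<rbrakk> \<Longrightarrow>
    lag_kernel b r x y \<le> C * (1 - r) powr (- b) * (1 + sqrt (r * x * y) / (1 - r)) *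
       exp ((2 * sqrt (r * x * y) - r * (x + y)) / (1 - r))"
    using lag_kernel_upper[OF b] by blast
  show ?thesis
  proof (rule that[OF C(1)])
    fix r x y :: real
    assume a: "0 < r" "r < 1" "0 \<le> x" "0 \<le> y"
    have "2 * sqrt ((r * y) * x) \<le> 1 * (r * y) + x / 1" using a by (intro sqrt_mult_le_weighted) auto
    then have "(2 * sqrt (r * x * y) - r * (x + y)) / (1 - r) \<le> (x * (1 - r)) / (1 - r)"
      using a by (intro divide_right_mono) (auto simp: algebra_simps)
    then have E: "(2 * sqrt (r * x * y) - r * (x + y)) / (1 - r) \<le> x" using a by simp
    have "sqrt (r * x * y) \<le> sqrt (x * y)" 
      using a mult_left_le_one_le[of "x * y" r] by (simp add: mult.assoc)
    then have "sqrt (r * x * y) / (1 - r) \<le> sqrt (x * y) / (1 - r)" using a by (intro divide_right_mono) auto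
    moreover have "1 \<le> 1 / (1 - r)" using a by simp
    ultimately have S: "1 + sqrt (r * x * y) / (1 - r) \<le> (1 + sqrt (x * y)) / (1 - r)"
      by (simp add: add_divide_distrib)
    have "lag_kernel b r x y \<le> C * (1 - r) powr (- b) * ((1 + sqrt (x * y)) / (1 - r)) * exp x"
      using C(1) a S E by (intro order.trans[OF C(2)[OF a]] mult_mono) auto
    also have "\<dots> = C * ((1 - r) powr (- b) / (1 - r)) * (1 + sqrt (x * y)) * exp x" by simp
    also have "(1 - r) powr (- b) / (1 - r) = (1 - r) powr (- (b + 1))"
      using a powr_diff[of "1 - r" "- b" 1] by simp
    finally show "lag_kernel b r x y \<le> C * (1 - r) powr (- (b + 1)) * (1 + sqrt (x * y)) * exp x" .
  qed
qed

text \<open>For \<open>r \<ge> 1 / 2\<close> and \<open>y\<close> much larger than \<open>x\<close>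
  the term \<open>- r * y\<close> dominates the square root. The constant 72 is twice 36, which
  gives \<open>S \<le> r * y / 6\<close>, and eight times 9, so that half of the decay
  \<open>y / (4 * q)\<close> leaves \<open>exp (- 9 / q)\<close> to absorb the singularity
  \<open>q powr (- b)\<close>.\<close>

lemma lag_kernel_upper_far:
  assumes b: "b > 0"
  obtains C where "C > 0" "\<And>r x y. \<lbrakk>1 / 2 \<le> r; r < 1; 0 \<le> x; 72 * (1 + x) \<le> y\<rbrakk> \<Longrightarrow>
    lag_kernel b r x y \<le> C * exp (- y / 4)"
proof -
  obtain C where C: "C > 0" "\<And>r x y. \<lbrakk>0 < r; r < 1; 0 \<le> x; 0 \<le> y\<rbrakk> \<Longrightarrow>
    lag_kernel b r x y \<le> C * (1 - r) powr (- b) * (1 + sqrt (r * x * y) / (1 - r)) *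
       exp ((2 * sqrt (r * x * y) - r * (x + y)) / (1 - r))"
    using lag_kernel_upper[OF b] by blast
  obtain B where B: "B > 0" "\<And>t. t \<ge> 0 \<Longrightarrow> (1 + t) powr b * exp (- 9 * t) \<le> B"
    using powr_times_exp_bounded[of 9 b] by auto
  show ?thesis
  proof (rule that[of "C * B"])
    show "C * B > 0" using C B by simp
    fix r x y :: real
    assume a: "1 / 2 \<le> r" "r < 1" "0 \<le> x" "72 * (1 + x) \<le> y"
    define q where "q = 1 - r"
    have q: "0 < q" "q \<le> 1 / 2" using a by (auto simp: q_def)
    define S where "S = sqrt (r * x * y)"
    have y: "y \<ge> 72" "y \<ge> 0" using a by auto
    have "36 * x \<le> r * y" using a mult_mono[of "1/2" r "72 * (1 + x)" y] by simp
    then have "36 * x * (r * y) \<le> (r * y) * (r * y)" using a y by (intro mult_right_mono) auto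
    then have "S \<le> r * y / 6" unfolding S_def using a y
      by (intro real_le_lsqrt) (auto simp: power2_eq_square algebra_simps)
    moreover have "r * y \<ge> y / 2" using a y mult_right_mono[of "1/2" r y] by simp
    moreover have "r * x \<ge> 0" using a by simp
    \<comment> \<open>The additional \<open>S\<close> pays for the factor \<open>1 + S / q\<close>,
      bounded by \<open>exp (S / q)\<close>.\<close>
    ultimately have "S + (2 * S - r * (x + y)) \<le> - y / 4" by (simp add: algebra_simps)
    then have "(S + (2 * S - r * (x + y))) / q \<le> (- y / 4) / q" using q by (intro divide_right_mono) auto
    also have "(- y / 4) / q = (- y / 8) / q + (- y / 8) / q" by (simp flip: add_divide_distrib)
    also have "\<dots> \<le> (- y / 8) / (1 / 2) + - 9 / q"
      using q y by (intro add_mono divide_right_mono) (auto simp: field_simps)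
    finally have E: "S / q + (2 * S - r * (x + y)) / q \<le> - y / 4 + - 9 / q"
      by (simp add: add_divide_distrib[symmetric])
    have "lag_kernel b r x y \<le> C * q powr (- b) * (1 + S / q) * exp ((2 * S - r * (x + y)) / q)"
      using C(2)[of r x y] a y by (simp add: q_def S_def)
    also have "\<dots> \<le> C * q powr (- b) * exp (S / q) * exp ((2 * S - r * (x + y)) / q)"
      using C(1) by (intro mult_mono exp_ge_add_one_self) (use a y q in \<open>auto simp: S_def intro!: add_nonneg_nonneg divide_nonneg_nonneg\<close>)
    also have "\<dots> = C * q powr (- b) * exp (S / q + (2 * S - r * (x + y)) / q)" by (simp add: exp_add)
    also have "\<dots> \<le> C * q powr (- b) * exp (- y / 4 + - 9 / q)" using C(1) E by (intro mult_left_mono) auto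
    also have "\<dots> = C * (q powr (- b) * exp (- 9 / q)) * exp (- y / 4)" unfolding exp_add by simp
    also have "q powr (- b) * exp (- 9 / q) \<le> B"
    proof -
      have "q powr (- b) = (1 / q) powr b" using q by (simp add: powr_minus_divide powr_divide)
      also have "\<dots> \<le> (1 + 1 / q) powr b" using q b by (intro powr_mono2) auto
      finally have "q powr (- b) * exp (- 9 / q) \<le> (1 + 1 / q) powr b * exp (- 9 / q)" 
        by (intro mult_right_mono) auto
      also have "\<dots> \<le> B" using B(2)[of "1 / q"] q by simp
      finally show ?thesis .
    qed
    then have "C * (q powr (- b) * exp (- 9 / q)) * exp (- y / 4) \<le> C * B * exp (- y / 4)"
      using C(1) by (intro mult_right_mono mult_left_mono) auto
    finally show "lag_kernel b r x y \<le> C * B * exp (- y / 4)" .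
  qed
qed

text \<open>The exponent is at most \<open>x\<close> in general. Allowing the slightly larger rate
  \<open>1 + \<kappa>\<close> buys decay in \<open>r * y\<close>, from which the integral over large
  times obtains the decay of \<open>laguerre_phi\<close>.\<close>

lemma lag_kernel_upper_late:
  assumes b: "b > 0" and \<kappa>: "\<kappa> > 0"
  obtains C \<eta> where "C > 0" "\<eta> > 0" "\<And>r x y. \<lbrakk>0 < r; r \<le> 1 / 2; 0 \<le> x; 0 \<le> y\<rbrakk> \<Longrightarrow>
    lag_kernel b r x y \<le> C * exp ((1 + \<kappa>) * x) * exp (- \<eta> * (r * y))"
proof -
  obtain C where C: "C > 0" "\<And>r x y. \<lbrakk>0 < r; r < 1; 0 \<le> x; 0 \<le> y\<rbrakk> \<Longrightarrow>
    lag_kernel b r x y \<le> C * (1 - r) powr (- b) * (1 + sqrt (r * x * y) / (1 - r)) *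
       exp ((2 * sqrt (r * x * y) - r * (x + y)) / (1 - r))"
    using lag_kernel_upper[OF b] by blast
  \<comment> \<open>\<open>A\<close> below is the coefficient of \<open>x\<close> after AM-GM with
    weight \<open>1 / (1 - \<eta>)\<close>, the summand \<open>\<eta> / 2\<close> reserving
    \<open>\<eta> * S\<close> for the factor \<open>1 + S / q\<close>. Since \<open>A - 1\<close> is
    at most \<open>9 / 2 * \<eta>\<close> and division by \<open>q \<ge> 1 / 2\<close> at most
    doubles it, \<open>\<kappa> / 9\<close> suffices.\<close>
  define \<eta> where "\<eta> = min (1 / 2) (\<kappa> / 9)"
  have \<eta>: "0 < \<eta>" "\<eta> \<le> 1 / 2" "9 * \<eta> \<le> \<kappa>" using \<kappa> by (auto simp: \<eta>_def)
  define A where "A = (1 + \<eta> / 2)\<^sup>2 / (1 - \<eta>)"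
  have A1: "1 \<le> A" using \<eta> by (auto simp: A_def power2_eq_square field_simps)
  have A2: "2 * (A - 1) \<le> \<kappa>"
  proof -
    have "\<eta> * \<eta> \<le> \<eta> * (1 / 2)" using \<eta> by (intro mult_left_mono) auto
    then have "(1 + \<eta> / 2)\<^sup>2 \<le> (1 + 9 / 2 * \<eta>) * (1 - \<eta>)"
      using \<eta> by (simp add: power2_eq_square algebra_simps)
    then have "A \<le> 1 + 9 / 2 * \<eta>" unfolding A_def using \<eta> by (simp add: divide_le_eq)
    then show ?thesis using \<eta> by simp
  qed
  show ?thesis
  proof (rule that[of "C * 2 powr b * (1 / \<eta>)" \<eta>])
    show "C * 2 powr b * (1 / \<eta>) > 0" using C \<eta> by simp
    show "\<eta> > 0" by fact
    fix r x y :: real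
    assume a: "0 < r" "r \<le> 1 / 2" "0 \<le> x" "0 \<le> y"
    define S where "S = sqrt (r * x * y)"
    define q where "q = 1 - r"
    have q: "1 / 2 \<le> q" "q < 1" using a by (auto simp: q_def)
    have "S \<ge> 0" using a by (simp add: S_def)
    have "2 * sqrt (((1 + \<eta> / 2)\<^sup>2 * x) * (r * y)) \<le> (1 / (1 - \<eta>)) * ((1 + \<eta> / 2)\<^sup>2 * x) + (r * y) / (1 / (1 - \<eta>))"
      using a \<eta> by (intro sqrt_mult_le_weighted) auto
    also have "sqrt (((1 + \<eta> / 2)\<^sup>2 * x) * (r * y)) = (1 + \<eta> / 2) * S"
      using \<eta> by (simp add: S_def real_sqrt_mult ac_simps)
    also have "(1 / (1 - \<eta>)) * ((1 + \<eta> / 2)\<^sup>2 * x) = A * x" by (simp add: A_def)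
    also have "(r * y) / (1 / (1 - \<eta>)) = (1 - \<eta>) * (r * y)" by simp
    finally have "\<eta> * S + (2 * S - r * (x + y)) \<le> (A - r) * x - \<eta> * (r * y)" by (simp add: algebra_simps)
    then have "(\<eta> * S + (2 * S - r * (x + y))) / q \<le> ((A - r) * x - \<eta> * (r * y)) / q"
      using q by (intro divide_right_mono) auto
    also have "\<dots> = ((A - r) / q) * x - \<eta> * (r * y) / q"
      by (simp only: diff_divide_distrib[of "(A - r) * x"] times_divide_eq_left)
    also have "\<dots> \<le> (1 + \<kappa>) * x - \<eta> * (r * y)"
    proof -
      have "(A - r) / q = 1 + (A - 1) / q" using q by (simp add: q_def field_simps)
      also have "(A - 1) / q \<le> (A - 1) / (1 / 2)" using q A1 by (intro divide_left_mono) auto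
      also have "\<dots> = 2 * (A - 1)" by simp
      finally have "(A - r) / q \<le> 1 + \<kappa>" using A2 by linarith
      then have "((A - r) / q) * x \<le> (1 + \<kappa>) * x" using a by (intro mult_right_mono) auto
      moreover have "\<eta> * (r * y) \<le> \<eta> * (r * y) / q" using q a \<eta> by (simp add: le_divide_eq mult_left_le)
      ultimately show ?thesis by linarith
    qed
    finally have E: "\<eta> * S / q + (2 * S - r * (x + y)) / q \<le> (1 + \<kappa>) * x + - \<eta> * (r * y)"
      by (simp add: add_divide_distrib)
    have S1: "1 + S / q \<le> (1 / \<eta>) * exp (\<eta> * S / q)"
    proof -
      have "1 + S / q \<le> (1 / \<eta>) * (1 + \<eta> * S / q)" using \<eta> q \<open>S \<ge> 0\<close> by (simp add: field_simps)
      also have "\<dots> \<le> (1 / \<eta>) * exp (\<eta> * S / q)" using \<eta> by (intro mult_left_mono exp_ge_add_one_self) auto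
      finally show ?thesis .
    qed
    have q2: "q powr (- b) \<le> 2 powr b"
    proof -
      have "q powr (- b) \<le> (1 / 2) powr (- b)" using q b by (intro powr_mono2') auto
      also have "\<dots> = 2 powr b" by (simp add: powr_minus powr_divide)
      finally show ?thesis .
    qed
    have "lag_kernel b r x y \<le> C * q powr (- b) * (1 + S / q) * exp ((2 * S - r * (x + y)) / q)"
      using C(2)[of r x y] a by (simp add: q_def S_def)
    also have "\<dots> \<le> C * 2 powr b * ((1 / \<eta>) * exp (\<eta> * S / q)) * exp ((2 * S - r * (x + y)) / q)"
      using C(1) q2 S1 \<open>S \<ge> 0\<close> q \<eta> by (intro mult_mono mult_nonneg_nonneg add_nonneg_nonneg divide_nonneg_nonneg) auto
    also have "\<dots> = C * 2 powr b * (1 / \<eta>) * exp (\<eta> * S / q + (2 * S - r * (x + y)) / q)" by (simp add: exp_add)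
    also have "\<dots> \<le> C * 2 powr b * (1 / \<eta>) * exp ((1 + \<kappa>) * x + - \<eta> * (r * y))"
      using C(1) \<eta> E by (intro mult_left_mono) auto
    also have "\<dots> = C * 2 powr b * (1 / \<eta>) * exp ((1 + \<kappa>) * x) * exp (- \<eta> * (r * y))" unfolding exp_add by simp
    finally show "lag_kernel b r x y \<le> C * 2 powr b * (1 / \<eta>) * exp ((1 + \<kappa>) * x) * exp (- \<eta> * (r * y))" .
  qed
qed

text \<open>The function \<open>\<Phi>\<close> divided by the Laguerre weight \<open>y powr \<alpha> * exp (- y)\<close>.\<close>

definition laguerre_phi :: "real \<Rightarrow> real \<Rightarrow> real \<Rightarrow> real" where
  "laguerre_phi m \<nu> y = (if m > 0 then 1 / ((1 + y) powr m * ln (exp 1 + y) powr (1 + \<nu>))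
                 else 1 / ln (exp 1 + y) powr \<nu>)"

lemma laguerre_Phi_eq: "laguerre_Phi \<alpha> m \<nu> y = laguerre_phi m \<nu> y * (y powr \<alpha> * exp (- y))"
  by (simp add: laguerre_Phi_def laguerre_phi_def)

lemma ln_exp1_plus:
  fixes y :: real
  assumes "y \<ge> 0"
  shows "1 \<le> ln (exp 1 + y)" "ln (exp 1 + y) \<le> 1 + y"
proof -
  show "1 \<le> ln (exp 1 + y)" using assms ln_le_cancel_iff[of "exp 1" "exp 1 + y"]
    by (simp add: add_pos_nonneg)
  have "exp 1 + y \<le> exp 1 * (1 + y)"
    using assms mult_right_mono[of 1 "exp 1" y] by (simp add: algebra_simps)
  also have "\<dots> \<le> exp 1 * exp y" by (intro mult_left_mono exp_ge_add_one_self) auto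
  also have "\<dots> = exp (1 + y)" by (simp add: exp_add)
  finally have "ln (exp 1 + y) \<le> ln (exp (1 + y))"
    using assms by (subst ln_le_cancel_iff) (auto intro: add_pos_nonneg)
  then show "ln (exp 1 + y) \<le> 1 + y" by simp
qed

lemma laguerre_phi_pos: "y \<ge> 0 \<Longrightarrow> laguerre_phi m \<nu> y > 0"
  using ln_exp1_plus[of y] by (auto simp: laguerre_phi_def)

lemma laguerre_phi_ge:
  assumes "y \<ge> 0" "m \<ge> 0" "\<nu> > 0"
  shows "(1 + y) powr (- (m + 1 + \<nu>)) \<le> laguerre_phi m \<nu> y"
proof -
  note l = ln_exp1_plus[OF assms(1)]
  have "ln (exp 1 + y) powr (1 + \<nu>) \<le> (1 + y) powr (1 + \<nu>)"
    using l assms by (intro powr_mono2) auto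
  then have "(1 + y) powr m * ln (exp 1 + y) powr (1 + \<nu>) \<le> (1 + y) powr m * (1 + y) powr (1 + \<nu>)"
    by (intro mult_left_mono) auto
  also have "\<dots> = (1 + y) powr (m + 1 + \<nu>)" by (simp flip: powr_add add: add.assoc)
  finally have 1: "1 / (1 + y) powr (m + 1 + \<nu>) \<le> 1 / ((1 + y) powr m * ln (exp 1 + y) powr (1 + \<nu>))"
    using l assms by (intro divide_left_mono mult_pos_pos) auto
  have "ln (exp 1 + y) powr \<nu> \<le> (1 + y) powr \<nu>" using l assms by (intro powr_mono2) auto
  also have "\<dots> \<le> (1 + y) powr (m + 1 + \<nu>)" using assms by (intro powr_mono) auto
  finally have 2: "1 / (1 + y) powr (m + 1 + \<nu>) \<le> 1 / ln (exp 1 + y) powr \<nu>"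
    using l assms by (intro divide_left_mono mult_pos_pos) auto
  have "(1 + y) powr (- (m + 1 + \<nu>)) = 1 / (1 + y) powr (m + 1 + \<nu>)"
    by (rule powr_minus_divide)
  then show ?thesis using 1 2 unfolding laguerre_phi_def by presburger
qed

lemma laguerre_phi_le_1:
  assumes "y \<ge> 0" "m \<ge> 0" "\<nu> > 0"
  shows "laguerre_phi m \<nu> y \<le> 1"
proof -
  note l = ln_exp1_plus[OF assms(1)]
  have "1 \<le> ln (exp 1 + y) powr (1 + \<nu>)" "1 \<le> ln (exp 1 + y) powr \<nu>" "1 \<le> (1 + y) powr m"
    using l assms by (auto intro!: ge_one_powr_ge_zero)
  moreover from this have "1 * 1 \<le> (1 + y) powr m * ln (exp 1 + y) powr (1 + \<nu>)" by (intro mult_mono) auto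
  moreover have i: "1 / c \<le> 1" if "1 \<le> c" for c :: real using that by simp
  ultimately show ?thesis
    unfolding laguerre_phi_def by (cases "m > 0") (simp_all only: if_True if_False i mult_1_left)
qed

lemma laguerre_phi_antimono:
  assumes "0 \<le> x" "x \<le> y" "m \<ge> 0" "\<nu> > 0"
  shows "laguerre_phi m \<nu> y \<le> laguerre_phi m \<nu> x"
proof -
  note l = ln_exp1_plus[OF assms(1)]
  have "ln (exp 1 + x) \<le> ln (exp 1 + y)" using assms by (subst ln_le_cancel_iff) (auto intro: add_pos_nonneg)
  then have "ln (exp 1 + x) powr c \<le> ln (exp 1 + y) powr c" if "c \<ge> 0" for c
    using l that by (intro powr_mono2) auto
  moreover have "(1 + x) powr m \<le> (1 + y) powr m" using assms by (intro powr_mono2) auto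
  moreover have "0 < ln (exp 1 + x)" "0 < ln (exp 1 + y)" using l ln_exp1_plus[of y] assms by auto
  ultimately show ?thesis using assms unfolding laguerre_phi_def
    by (auto intro!: divide_left_mono mult_mono mult_pos_pos)
qed

lemma exp_le_laguerre_phi:
  assumes "\<eta> > 0" "m \<ge> 0" "\<nu> > 0"
  obtains C where "C > 0" "\<And>y. y \<ge> 0 \<Longrightarrow> exp (- \<eta> * y) \<le> C * laguerre_phi m \<nu> y"
proof -
  obtain C where C: "C > 0" "\<And>t. t \<ge> 0 \<Longrightarrow> (1 + t) powr (m + 1 + \<nu>) * exp (- \<eta> * t) \<le> C"
    using powr_times_exp_bounded[OF assms(1)] by blast
  have "exp (- \<eta> * y) \<le> C * laguerre_phi m \<nu> y" if y: "y \<ge> 0" for y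
  proof -
    have "(1 + y) powr (m + 1 + \<nu>) * (1 + y) powr (- (m + 1 + \<nu>)) = 1"
      using y by (subst powr_add[symmetric]) simp
    then have "exp (- \<eta> * y) = ((1 + y) powr (m + 1 + \<nu>) * (1 + y) powr (- (m + 1 + \<nu>))) * exp (- \<eta> * y)"
      by simp
    also have "\<dots> = ((1 + y) powr (m + 1 + \<nu>) * exp (- \<eta> * y)) * (1 + y) powr (- (m + 1 + \<nu>))"
      by (simp only: ac_simps)
    also have "\<dots> \<le> C * laguerre_phi m \<nu> y"
      using C y laguerre_phi_ge[OF y assms(2,3)] by (intro mult_mono) auto
    finally show ?thesis .
  qed
  then show ?thesis using that C(1) by blast
qed


section \<open>Integrals over the half line and over large times\<close>

lemma measurable_half_line_id [measurable]: "(\<lambda>x. x) \<in> borel_measurable half_line"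
  by (intro measurable_completion measurable_restrict_space1) auto

lemma nn_integral_half_line: "nn_integral half_line f = (\<integral>\<^sup>+x. f x * indicator {0<..} x \<partial>lborel)"
  by (simp add: nn_integral_restrict_space nn_integral_completion)

lemma nn_integral_half_line_le: "nn_integral half_line f \<le> nn_integral lborel f"
  unfolding nn_integral_half_line by (intro nn_integral_mono) (auto split: split_indicator)

lemma nn_integral_powr_tail_lborel:
  fixes c a \<nu> :: real
  assumes "c + a > 0" "\<nu> > 0"
  shows "(\<integral>\<^sup>+u. ennreal ((c + u) powr (- 1 - \<nu>)) * indicator {a..} u \<partial>lborel) = ennreal ((c + a) powr (- \<nu>) / \<nu>)"
proof -
  have "(\<integral>\<^sup>+u. ennreal ((c + u) powr (- 1 - \<nu>)) * indicator {a..} u \<partial>lborel) = ennreal (0 - (- ((c + a) powr (- \<nu>) / \<nu>)))"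
  proof (rule nn_integral_FTC_atLeast[where F = "\<lambda>u. - ((c + u) powr (- \<nu>) / \<nu>)"])
    show "((\<lambda>u. - ((c + u) powr - \<nu> / \<nu>)) has_real_derivative (c + x) powr (- 1 - \<nu>)) (at x)" if "a \<le> x" for x
    proof -
      have eq: "- 1 - \<nu> = - \<nu> - 1" by simp
      show ?thesis unfolding eq using that assms by (auto intro!: derivative_eq_intros)
    qed
    have "((\<lambda>u. (c + u) powr (- \<nu>)) \<longlongrightarrow> 0) at_top"
      by (rule tendsto_neg_powr) (use assms in \<open>auto intro: filterlim_tendsto_add_at_top[OF tendsto_const] filterlim_ident\<close>)
    then have "((\<lambda>u. - ((c + u) powr - \<nu> / \<nu>)) \<longlongrightarrow> - (0 / \<nu>)) at_top"
      using assms by (intro tendsto_minus tendsto_divide tendsto_const) auto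
    then show "((\<lambda>u. - ((c + u) powr - \<nu> / \<nu>)) \<longlongrightarrow> 0) at_top" by simp
  qed auto
  then show ?thesis by simp
qed

lemma nn_integral_powr_tail:
  fixes c a \<nu> :: real
  assumes "c + a > 0" "\<nu> > 0"
  shows "(\<integral>\<^sup>+u. ennreal ((c + u) powr (- 1 - \<nu>)) * indicator {a..} u \<partial>half_line) \<le> ennreal ((c + a) powr (- \<nu>) / \<nu>)"
  using nn_integral_half_line_le[of "\<lambda>u. ennreal ((c + u) powr (- 1 - \<nu>)) * indicator {a..} u"]
  unfolding nn_integral_powr_tail_lborel[OF assms] .

lemma nn_integral_exp_abs:
  fixes m a :: real
  assumes "m > 0"
  shows "(\<integral>\<^sup>+u. ennreal (exp (- (m * \<bar>u - a\<bar>))) \<partial>half_line) \<le> ennreal (2 / m)"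
proof -
  have tail: "(\<integral>\<^sup>+u. ennreal (exp (- (m * (u - c)))) * indicator {c..} u \<partial>lborel) = ennreal (1 / m)" for c
  proof -
    have "(\<integral>\<^sup>+u. ennreal (exp (- (m * (u - c)))) * indicator {c..} u \<partial>lborel) = ennreal (0 - (- (exp (- (m * (c - c))) / m)))"
    proof (rule nn_integral_FTC_atLeast[where F = "\<lambda>u. - (exp (- (m * (u - c))) / m)"])
      show "((\<lambda>u. - (exp (- (m * (u - c))) / m)) has_real_derivative exp (- (m * (x - c)))) (at x)" for x
        using assms by (auto intro!: derivative_eq_intros)
      have "filterlim (\<lambda>u. m * (- c + u)) at_top at_top"
        using assms by (intro filterlim_tendsto_pos_mult_at_top[OF tendsto_const] filterlim_tendsto_add_at_top[OF tendsto_const] filterlim_ident) auto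
      then have "((\<lambda>u. exp (- (m * (u - c)))) \<longlongrightarrow> 0) at_top"
        by (intro filterlim_compose[OF exp_at_bot]) (simp add: filterlim_uminus_at_bot)
      then have "((\<lambda>u. - (exp (- (m * (u - c))) / m)) \<longlongrightarrow> - (0 / m)) at_top"
        using assms by (intro tendsto_minus tendsto_divide tendsto_const) auto
      then show "((\<lambda>u. - (exp (- (m * (u - c))) / m)) \<longlongrightarrow> 0) at_top" by simp
    qed auto
    then show ?thesis by simp
  qed
  have "(\<integral>\<^sup>+u. ennreal (exp (- (m * \<bar>u - a\<bar>))) \<partial>half_line) \<le> (\<integral>\<^sup>+u. ennreal (exp (- (m * \<bar>u - a\<bar>))) \<partial>lborel)"
    by (rule nn_integral_half_line_le)
  also have "\<dots> \<le> (\<integral>\<^sup>+u. ennreal (exp (- (m * (u - a)))) * indicator {a..} u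
      + ennreal (exp (- (m * (- u - (- a))))) * indicator {- a..} (- u) \<partial>lborel)"
    by (intro nn_integral_mono) (auto split: split_indicator simp: abs_if algebra_simps)
  also have "\<dots> = ennreal (1 / m) + (\<integral>\<^sup>+u. ennreal (exp (- (m * (- u - (- a))))) * indicator {- a..} (- u) \<partial>lborel)"
    by (subst nn_integral_add) (auto simp: tail)
  also have "(\<integral>\<^sup>+u. ennreal (exp (- (m * (- u - (- a))))) * indicator {- a..} (- u) \<partial>lborel) =
      (\<integral>\<^sup>+u. ennreal (exp (- (m * (u - (- a))))) * indicator {- a..} u \<partial>lborel)"
    using nn_integral_real_affine[of "\<lambda>u. ennreal (exp (- (m * (u - (- a))))) * indicator {- a..} u" "- 1" 0]
    by simp
  also have "\<dots> = ennreal (1 / m)" by (rule tail)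
  also have "ennreal (1 / m) + ennreal (1 / m) = ennreal (2 / m)" using assms by (simp flip: ennreal_plus)
  finally show ?thesis .
qed

text \<open>This is where the shape of \<Phi> arises. Up to time \<open>ln (exp 1 + y) / 2\<close>
  the argument \<open>exp (- u) * y\<close> is still at least about \<open>sqrt y\<close>, and the
  last factor is smaller than any power. Afterwards \<open>u\<close> has at least logarithmic size:
  for \<open>m > 0\<close> the integral is carried by \<open>u\<close> near
  \<open>ln (1 + y)\<close>, for \<open>m = 0\<close> it is a power tail, and this explains the
  different powers of the logarithm.\<close>

lemma late_time_integral:
  fixes m \<nu> \<eta> :: real
  assumes m: "m \<ge> 0" and \<nu>: "\<nu> > 0" and \<eta>: "\<eta> > 0"
  obtains C where "C > 0" "\<And>y. y \<ge> 0 \<Longrightarrow>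
    (\<integral>\<^sup>+u. ennreal (exp (- (m * u)) * u powr (- 1 - \<nu>) * exp (- \<eta> * (exp (- u) * y))) * indicator {ln 2..} u \<partial>half_line)
      \<le> ennreal (C * laguerre_phi m \<nu> y)"
proof -
  define g where "g = (\<lambda>y u. exp (- (m * u)) * u powr (- 1 - \<nu>) * exp (- \<eta> * (exp (- u) * y)))"
  \<comment> \<open>One more than the exponent in \<open>laguerre_phi_ge\<close>, to cover the
    length of the time interval, which is at most \<open>1 + y\<close>. It is doubled in
    \<open>B\<close> because \<open>1 + y\<close> is at most the square of
    \<open>1 + sqrt (exp 1 + y)\<close>.\<close>
  define N where "N = m + 2 + \<nu>"
  obtain B where B: "B > 0" "\<And>t. t \<ge> 0 \<Longrightarrow> (1 + t) powr (2 * N) * exp (- \<eta> * t) \<le> B"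
    using powr_times_exp_bounded[OF \<eta>] by blast
  obtain D where D: "D > 0" "\<And>t. t \<ge> 0 \<Longrightarrow> (1 + t) powr (2 * m) * exp (- \<eta> * t) \<le> D"
    using powr_times_exp_bounded[OF \<eta>] by blast
  define C1 where "C1 = (ln 2) powr (- 1 - \<nu>) * exp (\<eta> * exp 1) * B"
  have C1: "C1 > 0" using B by (simp add: C1_def)
  define C2 where "C2 = (if m = 0 then 2 powr \<nu> / \<nu> else 2 powr (1 + \<nu>) * (max 1 (D * exp \<eta>)) * 2 / m)"
  have C2: "C2 > 0" using m \<nu> by (auto simp: C2_def max_def intro!: mult_pos_pos divide_pos_pos)
  have early: "(\<integral>\<^sup>+u. ennreal (g y u) * indicator {ln 2..ln (exp 1 + y) / 2} u \<partial>half_line) \<le> ennreal (C1 * laguerre_phi m \<nu> y)"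
    if y: "y \<ge> 0" for y
  proof -
    define l where "l = ln (exp 1 + y)"
    note l = ln_exp1_plus[OF y, folded l_def]
    define t where "t = sqrt (exp 1 + y)"
    have ey: "exp 1 + y \<ge> 1 + y" by simp
    have t: "t \<ge> 1" "t\<^sup>2 = exp 1 + y" using y by (auto simp: t_def intro: add_nonneg_nonneg order.trans[OF _ ey])
    have ln2: "0 < ln (2::real)" by simp
    define K where "K = (ln 2) powr (- 1 - \<nu>) * exp (\<eta> * exp 1) * exp (- \<eta> * t)"
    have gK: "g y u \<le> K" if u: "ln 2 \<le> u" "u \<le> l / 2" for u
    proof -
      have u0: "u > 0" using u ln_gt_zero[of "2::real"] by linarith
      have le1: "exp (- l / 2) \<le> exp (- u)" using u by simp
      have le2: "exp (- l / 2) = 1 / t"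
      proof -
        have z: "exp 1 + y > 0" using y by (intro add_pos_nonneg) auto
        then have "exp (l / 2) = exp (ln t)" unfolding t_def l_def by (simp only: ln_sqrt)
        then have "exp (l / 2) = t" using z by (simp add: t_def)
        then show ?thesis by (metis exp_minus inverse_eq_divide minus_divide_left)
      qed
      have "y / t \<le> exp (- u) * y"
        using mult_right_mono[OF le1 y] unfolding le2 by simp
      moreover have "t - exp 1 \<le> y / t"
      proof -
        have "exp 1 * 1 \<le> exp 1 * t" using t by (intro mult_left_mono) auto
        then have "t * t - exp 1 * t \<le> y" using t by (simp add: power2_eq_square)
        then show ?thesis using t by (simp add: le_divide_eq left_diff_distrib)
      qed
      ultimately have "\<eta> * (t - exp 1) \<le> \<eta> * (exp (- u) * y)" using \<eta> by (intro mult_left_mono) auto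
      then have 1: "exp (- \<eta> * (exp (- u) * y)) \<le> exp (\<eta> * exp 1) * exp (- \<eta> * t)"
        by (simp add: algebra_simps flip: exp_add)
      have 2: "exp (- (m * u)) \<le> 1" using m u0 by simp
      have 3: "u powr (- 1 - \<nu>) \<le> (ln 2) powr (- 1 - \<nu>)" using u \<nu> by (intro powr_mono2') auto
      have "g y u \<le> 1 * (ln 2) powr (- 1 - \<nu>) * (exp (\<eta> * exp 1) * exp (- \<eta> * t))"
        unfolding g_def by (intro mult_mono 1 2 3) auto
      then show ?thesis by (simp add: K_def)
    qed
    have "(\<integral>\<^sup>+u. ennreal (g y u) * indicator {ln 2..l / 2} u \<partial>half_line) \<le>
        (\<integral>\<^sup>+u. ennreal K * indicator {0..l / 2} u \<partial>lborel)"
      by (rule order.trans[OF nn_integral_half_line_le])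
         (use ln2 in \<open>intro nn_integral_mono, auto split: split_indicator simp: gK ennreal_leI simp del: ln_gt_zero_iff\<close>)
    also have "\<dots> = ennreal (K * (l / 2))"
      using l by (subst nn_integral_cmult_indicator) (auto simp: K_def ennreal_mult[symmetric])
    also have "\<dots> \<le> ennreal (C1 * laguerre_phi m \<nu> y)"
    proof (intro ennreal_leI)
      have lp: "(1 + y) powr (- (m + 1 + \<nu>)) \<le> laguerre_phi m \<nu> y" by (rule laguerre_phi_ge[OF y m \<nu>])
      have "exp (- \<eta> * t) * (l / 2) \<le> exp (- \<eta> * t) * (1 + y)"
        using l y by (intro mult_left_mono) auto
      also have "\<dots> = exp (- \<eta> * t) * ((1 + y) powr N * (1 + y) powr (- (m + 1 + \<nu>)))"
        using y by (subst powr_add[symmetric]) (simp add: N_def)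
      also have "\<dots> \<le> exp (- \<eta> * t) * ((1 + t) powr (2 * N) * (1 + y) powr (- (m + 1 + \<nu>)))"
      proof (intro mult_left_mono mult_right_mono)
        have "1 + y \<le> (1 + t) powr 2" using t ey by (simp add: power2_sum)
        then have "(1 + y) powr N \<le> ((1 + t) powr 2) powr N" using y m \<nu> by (intro powr_mono2) (auto simp: N_def)
        then show "(1 + y) powr N \<le> (1 + t) powr (2 * N)" by (simp add: powr_powr)
      qed auto
      also have "\<dots> = ((1 + t) powr (2 * N) * exp (- \<eta> * t)) * (1 + y) powr (- (m + 1 + \<nu>))" by (simp only: ac_simps)
      also have "\<dots> \<le> B * laguerre_phi m \<nu> y" using B t lp by (intro mult_mono) auto
      finally have "exp (- \<eta> * t) * (l / 2) \<le> B * laguerre_phi m \<nu> y" .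
      then have "((ln 2) powr (- 1 - \<nu>) * exp (\<eta> * exp 1)) * (exp (- \<eta> * t) * (l / 2)) \<le>
         ((ln 2) powr (- 1 - \<nu>) * exp (\<eta> * exp 1)) * (B * laguerre_phi m \<nu> y)" by (intro mult_left_mono) auto
      then show "K * (l / 2) \<le> C1 * laguerre_phi m \<nu> y" by (simp add: K_def C1_def mult.assoc)
    qed
    finally show ?thesis unfolding l_def .
  qed
  have late: "(\<integral>\<^sup>+u. ennreal (g y u) * indicator {ln (exp 1 + y) / 2..} u \<partial>half_line) \<le> ennreal (C2 * laguerre_phi m \<nu> y)"
    if y: "y \<ge> 0" for y
  proof -
    define l where "l = ln (exp 1 + y)"
    note l = ln_exp1_plus[OF y, folded l_def]
    show ?thesis
    proof (cases "m = 0")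
      case True
      have "(\<integral>\<^sup>+u. ennreal (g y u) * indicator {l / 2..} u \<partial>half_line) \<le>
          (\<integral>\<^sup>+u. ennreal ((0 + u) powr (- 1 - \<nu>)) * indicator {l / 2..} u \<partial>half_line)"
        using \<eta> y by (intro nn_integral_mono mult_right_mono ennreal_leI) (auto simp: g_def True intro!: mult_left_le)
      also have "\<dots> \<le> ennreal ((0 + l / 2) powr (- \<nu>) / \<nu>)"
        using l \<nu> by (intro nn_integral_powr_tail) auto
      also have "(0 + l / 2) powr (- \<nu>) / \<nu> = C2 * laguerre_phi m \<nu> y"
      proof -
        have "laguerre_phi m \<nu> y = 1 / l powr \<nu>" by (simp add: True laguerre_phi_def l_def)
        moreover have "(0 + l / 2) powr (- \<nu>) = 2 powr \<nu> / l powr \<nu>"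
          using powr_minus_divide[of "l / 2" \<nu>] l by (simp add: powr_divide)
        ultimately show ?thesis by (simp add: True C2_def)
      qed
      finally show ?thesis unfolding l_def .
    next
      case False
      then have m: "m > 0" using m by simp
      define A where "A = max 1 (D * exp \<eta>)"
      define a where "a = ln (1 + y)"
      have ea: "exp a = 1 + y" using y by (simp add: a_def)
      have pw: "(1 + y) powr (- m) = exp (- (m * a))" using y by (simp add: a_def powr_def)
      \<comment> \<open>The right side peaks at \<open>a = ln (1 + y)\<close>. To the left of it
        \<open>exp (- (m * u))\<close> exceeds this profile by \<open>t powr (2 * m)\<close>, one
        \<open>m\<close> for the height at \<open>a\<close> and one for the decay away from it;
        \<open>exp (- \<eta> * t)\<close> absorbs the excess.\<close>
      have pt: "exp (- (m * u)) * exp (- \<eta> * (exp (- u) * y)) \<le> A * (1 + y) powr (- m) * exp (- (m * \<bar>u - a\<bar>))"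
        if u: "u > 0" for u
      proof (cases "u \<ge> a")
        case True
        have "exp (- (m * u)) * exp (- \<eta> * (exp (- u) * y)) \<le> exp (- (m * u)) * 1"
          using \<eta> y by (intro mult_left_mono) auto
        also have "\<dots> \<le> A * exp (- (m * u))" by (simp add: A_def)
        also have "\<dots> = A * ((1 + y) powr (- m) * exp (- (m * \<bar>u - a\<bar>)))"
          using True unfolding pw by (simp add: algebra_simps flip: exp_add)
        finally show ?thesis by simp
      next
        case False
        define t where "t = exp (- u) * (1 + y)"
        have t0: "t \<ge> 0" using y by (simp add: t_def)
        have "exp (- u) \<le> 1" using u by simp
        then have "t - 1 \<le> exp (- u) * y" by (simp add: t_def algebra_simps)
        then have "\<eta> * (t - 1) \<le> \<eta> * (exp (- u) * y)" using \<eta> by (intro mult_left_mono) auto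
        then have 1: "exp (- \<eta> * (exp (- u) * y)) \<le> exp \<eta> * exp (- \<eta> * t)"
          by (simp add: algebra_simps flip: exp_add)
        have tp: "t = exp (a - u)" by (simp add: t_def ea[symmetric] flip: exp_add)
        then have "t > 0" by simp
        have 2: "exp (- (m * u)) = (1 + y) powr (- m) * exp (- (m * \<bar>u - a\<bar>)) * t powr (2 * m)"
          using False unfolding pw tp by (simp add: powr_def algebra_simps flip: exp_add)
        have "t powr (2 * m) \<le> (1 + t) powr (2 * m)" using m \<open>t > 0\<close> by (intro powr_mono2) auto
        then have "t powr (2 * m) * exp (- \<eta> * t) \<le> (1 + t) powr (2 * m) * exp (- \<eta> * t)" by (intro mult_right_mono) auto
        also have "\<dots> \<le> D" by (rule D(2)[OF t0])
        finally have 3: "t powr (2 * m) * exp (- \<eta> * t) \<le> D" .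
        have "exp (- (m * u)) * exp (- \<eta> * (exp (- u) * y)) \<le> exp (- (m * u)) * (exp \<eta> * exp (- \<eta> * t))"
          using 1 by (intro mult_left_mono) auto
        also have "\<dots> = ((1 + y) powr (- m) * exp (- (m * \<bar>u - a\<bar>)) * exp \<eta>) * (t powr (2 * m) * exp (- \<eta> * t))"
          unfolding 2 by (simp only: ac_simps)
        also have "\<dots> \<le> ((1 + y) powr (- m) * exp (- (m * \<bar>u - a\<bar>)) * exp \<eta>) * D"
          using 3 by (intro mult_left_mono) auto
        also have "\<dots> = (D * exp \<eta>) * ((1 + y) powr (- m) * exp (- (m * \<bar>u - a\<bar>)))" by simp
        also have "\<dots> \<le> A * ((1 + y) powr (- m) * exp (- (m * \<bar>u - a\<bar>)))"
          by (intro mult_right_mono) (auto simp: A_def)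
        finally show ?thesis by simp
      qed
      define K where "K = (l / 2) powr (- 1 - \<nu>) * (A * (1 + y) powr (- m))"
      have K: "K \<ge> 0" by (simp add: K_def A_def)
      have "(\<integral>\<^sup>+u. ennreal (g y u) * indicator {l / 2..} u \<partial>half_line) \<le>
          (\<integral>\<^sup>+u. ennreal K * ennreal (exp (- (m * \<bar>u - a\<bar>))) \<partial>half_line)"
      proof (intro nn_integral_mono)
        fix u
        show "ennreal (g y u) * indicator {l / 2..} u \<le> ennreal K * ennreal (exp (- (m * \<bar>u - a\<bar>)))"
        proof (cases "u \<ge> l / 2")
          case True
          then have u: "u > 0" using l by linarith
          have "u powr (- 1 - \<nu>) \<le> (l / 2) powr (- 1 - \<nu>)" using True l \<nu> by (intro powr_mono2') auto
          then have "u powr (- 1 - \<nu>) * (exp (- (m * u)) * exp (- \<eta> * (exp (- u) * y))) \<le>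
            (l / 2) powr (- 1 - \<nu>) * (A * (1 + y) powr (- m) * exp (- (m * \<bar>u - a\<bar>)))"
            by (intro mult_mono pt u) auto
          then have "g y u \<le> K * exp (- (m * \<bar>u - a\<bar>))" unfolding g_def K_def by (simp only: ac_simps)
          then show ?thesis using True K by (simp add: ennreal_mult[symmetric] ennreal_leI)
        qed simp
      qed
      also have "\<dots> = ennreal K * (\<integral>\<^sup>+u. ennreal (exp (- (m * \<bar>u - a\<bar>))) \<partial>half_line)"
        by (intro nn_integral_cmult measurable_completion measurable_restrict_space1) auto
      also have "\<dots> \<le> ennreal K * ennreal (2 / m)" by (intro mult_left_mono nn_integral_exp_abs m) auto
      also have "\<dots> = ennreal (K * (2 / m))" using K m by (simp add: ennreal_mult[symmetric])
      also have "K * (2 / m) = C2 * laguerre_phi m \<nu> y"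
      proof -
        have "(l / 2) powr (- 1 - \<nu>) = 2 powr (1 + \<nu>) / l powr (1 + \<nu>)"
          using l powr_minus_divide[of "l / 2" "1 + \<nu>"] by (simp add: powr_divide)
        moreover have "(1 + y) powr (- m) = 1 / (1 + y) powr m" by (rule powr_minus_divide)
        ultimately show ?thesis using m by (simp add: K_def C2_def A_def laguerre_phi_def l_def[symmetric])
      qed
      finally show ?thesis unfolding l_def .
    qed
  qed
  have gm: "g y \<in> borel_measurable half_line" for y
    unfolding g_def by measurable
  show ?thesis
  proof (rule that[of "C1 + C2"])
    show "C1 + C2 > 0" using C1 C2 by simp
    fix y :: real assume y: "y \<ge> 0"
    have "(\<integral>\<^sup>+u. ennreal (g y u) * indicator {ln 2..} u \<partial>half_line) \<le>
      (\<integral>\<^sup>+u. ennreal (g y u) * indicator {ln 2..ln (exp 1 + y) / 2} u +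
           ennreal (g y u) * indicator {ln (exp 1 + y) / 2..} u \<partial>half_line)"
      by (intro nn_integral_mono) (auto split: split_indicator)
    also have "\<dots> = (\<integral>\<^sup>+u. ennreal (g y u) * indicator {ln 2..ln (exp 1 + y) / 2} u \<partial>half_line) +
      (\<integral>\<^sup>+u. ennreal (g y u) * indicator {ln (exp 1 + y) / 2..} u \<partial>half_line)"
      using gm[of y] by (subst nn_integral_add) auto
    also have "\<dots> \<le> ennreal (C1 * laguerre_phi m \<nu> y) + ennreal (C2 * laguerre_phi m \<nu> y)"
      by (intro add_mono early late y)
    also have "\<dots> = ennreal ((C1 + C2) * laguerre_phi m \<nu> y)"
      using C1 C2 laguerre_phi_pos[OF y, of m \<nu>] by (simp add: distrib_right flip: ennreal_plus)
    finally show "(\<integral>\<^sup>+u. ennreal (exp (- (m * u)) * u powr (- 1 - \<nu>) * exp (- \<eta> * (exp (- u) * y))) * indicator {ln 2..} u \<partial>half_line)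
      \<le> ennreal ((C1 + C2) * laguerre_phi m \<nu> y)" unfolding g_def .
  qed
qed


lemma lag_kernel_laguerre_phi:
  assumes b: "b > 0" and r: "0 < r" "r < 1" and x: "x \<ge> 0" and m: "m \<ge> 0" and \<nu>: "\<nu> > 0"
  obtains C where "C > 0" "\<And>y. y \<ge> 0 \<Longrightarrow> lag_kernel b r x y \<le> C * laguerre_phi m \<nu> y"
proof -
  obtain C where C: "C > 0" "\<And>r x y. \<lbrakk>0 < r; r < 1; 0 \<le> x; 0 \<le> y\<rbrakk> \<Longrightarrow>
    lag_kernel b r x y \<le> C * (1 - r) powr (- b) * (1 + sqrt (r * x * y) / (1 - r)) *
       exp ((2 * sqrt (r * x * y) - r * (x + y)) / (1 - r))"
    using lag_kernel_upper[OF b] by blast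
  obtain D where D: "D > 0" "\<And>y. y \<ge> 0 \<Longrightarrow> exp (- (r / 2) * y) \<le> D * laguerre_phi m \<nu> y"
    using exp_le_laguerre_phi[of "r / 2" m \<nu>] r m \<nu> by auto
  define q where "q = 1 - r"
  have q: "0 < q" "q \<le> 1" using r by (auto simp: q_def)
  show ?thesis
  proof (rule that[of "C * q powr (- b) * exp (9 / 2 * x / q) * D"])
    show "C * q powr (- b) * exp (9 / 2 * x / q) * D > 0" using C D q by simp
    fix y :: real assume y: "y \<ge> 0"
    define S where "S = sqrt (r * x * y)"
    have S: "S \<ge> 0" using r x y by (simp add: S_def)
    \<comment> \<open>The left side is \<open>3 * S\<close>: two copies from the exponent and one
      from the factor \<open>1 + S / q\<close>. Weight 2 keeps half of the decay in
      \<open>r * y\<close>.\<close>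
    have "2 * sqrt ((9 / 4 * x) * (r * y)) \<le> 2 * (9 / 4 * x) + (r * y) / 2"
      using r x y by (intro sqrt_mult_le_weighted) auto
    moreover have "sqrt ((9 / 4 * x) * (r * y)) = 3 / 2 * S"
      by (simp add: S_def real_sqrt_mult real_sqrt_divide)
    moreover have "r * x \<ge> 0" using r x by simp
    ultimately have "S + (2 * S - r * (x + y)) \<le> 9 / 2 * x - r * y / 2" by (simp add: algebra_simps)
    then have "(S + (2 * S - r * (x + y))) / q \<le> (9 / 2 * x - r * y / 2) / q"
      using q by (intro divide_right_mono) auto
    also have "\<dots> = 9 / 2 * x / q - (r * y / 2) / q" by (simp add: diff_divide_distrib)
    also have "\<dots> \<le> 9 / 2 * x / q - r * y / 2"
      using q r y by (intro diff_left_mono) (simp add: le_divide_eq mult_left_le)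
    finally have E: "S / q + (2 * S - r * (x + y)) / q \<le> 9 / 2 * x / q + - (r / 2) * y"
      by (simp add: add_divide_distrib[symmetric])
    have "lag_kernel b r x y \<le> C * q powr (- b) * (1 + S / q) * exp ((2 * S - r * (x + y)) / q)"
      using C(2)[of r x y] r x y by (simp add: q_def S_def)
    also have "\<dots> \<le> C * q powr (- b) * exp (S / q) * exp ((2 * S - r * (x + y)) / q)"
      using C(1) S q by (intro mult_mono exp_ge_add_one_self) (auto intro!: add_nonneg_nonneg)
    also have "\<dots> = C * q powr (- b) * exp (S / q + (2 * S - r * (x + y)) / q)" by (simp add: exp_add)
    also have "\<dots> \<le> C * q powr (- b) * exp (9 / 2 * x / q + - (r / 2) * y)" using C(1) E by (intro mult_left_mono) auto
    also have "\<dots> = C * q powr (- b) * exp (9 / 2 * x / q) * exp (- (r / 2) * y)" unfolding exp_add by simp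
    also have "\<dots> \<le> C * q powr (- b) * exp (9 / 2 * x / q) * (D * laguerre_phi m \<nu> y)"
      using C(1) D(2)[OF y] by (intro mult_left_mono) auto
    finally show "lag_kernel b r x y \<le> C * q powr (- b) * exp (9 / 2 * x / q) * D * laguerre_phi m \<nu> y" by simp
  qed
qed

text \<open>The left side is not monotone in \<open>u\<close>. The majorant is decreasing, hence a
  superposition of averages over \<open>{0<..a}\<close>, and keeps the scale
  \<open>t\<^sup>2\<close> of the subordination.\<close>

lemma time_majorant:
  fixes \<nu> :: real
  assumes "\<nu> > 0"
  obtains C where "C > 0" "\<And>t u. \<lbrakk>t > 0; u > 0\<rbrakk> \<Longrightarrow>
    exp (- (t\<^sup>2 / (4 * u))) * u powr (- 1 - \<nu>) \<le> C * (t\<^sup>2 + u) powr (- 1 - \<nu>)"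
proof -
  obtain B where B: "B > 0" "\<And>t. t \<ge> 0 \<Longrightarrow> (1 + t) powr (1 + \<nu>) * exp (- (1 / 4) * t) \<le> B"
    using powr_times_exp_bounded[of "1 / 4"] by auto
  show ?thesis
  proof (rule that[OF B(1)])
    fix t u :: real assume tu: "t > 0" "u > 0"
    define s where "s = t\<^sup>2 / u"
    have s: "s \<ge> 0" "t\<^sup>2 + u = u * (1 + s)" using tu by (auto simp: s_def field_simps)
    have "(t\<^sup>2 + u) powr (- 1 - \<nu>) = u powr (- 1 - \<nu>) * (1 + s) powr (- 1 - \<nu>)"
      unfolding s(2) by (rule powr_mult)
    moreover have "(1 + s) powr (1 + \<nu>) * (1 + s) powr (- 1 - \<nu>) = 1"
      using s by (subst powr_add[symmetric]) simp
    ultimately have "(1 + s) powr (1 + \<nu>) * (t\<^sup>2 + u) powr (- 1 - \<nu>) = u powr (- 1 - \<nu>)"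
      by (simp add: mult.left_commute)
    then have "exp (- (t\<^sup>2 / (4 * u))) * u powr (- 1 - \<nu>) =
        ((1 + s) powr (1 + \<nu>) * exp (- (1 / 4) * s)) * (t\<^sup>2 + u) powr (- 1 - \<nu>)"
      by (simp add: s_def mult_ac)
    also have "\<dots> \<le> B * (t\<^sup>2 + u) powr (- 1 - \<nu>)" using B(2)[OF s(1)] by (intro mult_right_mono) auto
    finally show "exp (- (t\<^sup>2 / (4 * u))) * u powr (- 1 - \<nu>) \<le> B * (t\<^sup>2 + u) powr (- 1 - \<nu>)" .
  qed
qed

section \<open>Two-sided bounds for the subordinated kernel\<close>

definition poisson_ker :: "real \<Rightarrow> real \<Rightarrow> real \<Rightarrow> real \<Rightarrow> real \<Rightarrow> real \<Rightarrow> real \<Rightarrow> real" where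
  "poisson_ker b m \<nu> t x y u =
     exp (- (t\<^sup>2 / (4 * u))) * u powr (- 1 - \<nu>) * (exp (- (m * u)) * lag_kernel b (exp (- u)) x y)"

lemma borel_measurable_bessel_series [measurable]: "bessel_series b \<in> borel_measurable borel"
  unfolding bessel_series_def by measurable

lemma borel_measurable_lag_kernel [measurable (raw)]:
  assumes [measurable]: "f \<in> borel_measurable M" "g \<in> borel_measurable M" "h \<in> borel_measurable M"
  shows "(\<lambda>w. lag_kernel b (f w) (g w) (h w)) \<in> borel_measurable M"
  unfolding lag_kernel_def by measurable

lemma borel_measurable_poisson_ker [measurable (raw)]:
  assumes [measurable]: "f \<in> borel_measurable M" "g \<in> borel_measurable M"
    "h \<in> borel_measurable M" "k \<in> borel_measurable M"
  shows "(\<lambda>w. poisson_ker b m \<nu> (f w) (g w) (h w) (k w)) \<in> borel_measurable M"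
  unfolding poisson_ker_def by measurable

lemma one_minus_exp_ge:
  fixes u :: real
  assumes "0 \<le> u" "u \<le> 1"
  shows "u / 2 \<le> 1 - exp (- u)"
proof -
  have "exp (- u) \<le> 1 / (1 + u)"
    using exp_ge_add_one_self[of u] assms by (simp add: exp_minus divide_inverse le_imp_inverse_le)
  also have "1 / (1 + u) = 1 - u / (1 + u)" using assms by (simp add: field_simps)
  finally have "u / (1 + u) \<le> 1 - exp (- u)" by simp
  moreover have "u / 2 \<le> u / (1 + u)" using assms by (intro divide_left_mono) auto
  ultimately show ?thesis by linarith
qed

lemma ln2_le_1: "ln (2::real) \<le> 1"
  using ln_le_minus_one[of "2::real"] by simp

lemma exp_minus_ge_half: "u \<le> ln 2 \<Longrightarrow> 1 / 2 \<le> exp (- u)" for u :: real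
proof -
  assume "u \<le> ln 2"
  then have "exp (- ln 2) \<le> exp (- u)" by simp
  then show ?thesis by (simp add: exp_minus)
qed

lemma exp_minus_le_half: "ln 2 \<le> u \<Longrightarrow> exp (- u) \<le> 1 / 2" for u :: real
proof -
  assume "ln 2 \<le> u"
  then have "exp (- u) \<le> exp (- ln 2)" by simp
  then show ?thesis by (simp add: exp_minus)
qed

lemma poisson_ker_late:
  assumes b: "b > 0" and m: "m \<ge> 0" and \<nu>: "\<nu> > 0" and \<kappa>: "\<kappa> > 0"
  obtains C where "C > 0" "\<And>t x y. \<lbrakk>x \<ge> 0; y \<ge> 0\<rbrakk> \<Longrightarrow>
    (\<integral>\<^sup>+u. ennreal (poisson_ker b m \<nu> t x y u) * indicator {ln 2..} u \<partial>half_line)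
      \<le> ennreal (C * exp ((1 + \<kappa>) * x) * laguerre_phi m \<nu> y)"
proof -
  obtain A \<eta> where A: "A > 0" "\<eta> > 0" "\<And>r x y. \<lbrakk>0 < r; r \<le> 1 / 2; 0 \<le> x; 0 \<le> y\<rbrakk> \<Longrightarrow>
    lag_kernel b r x y \<le> A * exp ((1 + \<kappa>) * x) * exp (- \<eta> * (r * y))"
    using lag_kernel_upper_late[OF b \<kappa>] by blast
  obtain C where C: "C > 0" "\<And>y. y \<ge> 0 \<Longrightarrow>
    (\<integral>\<^sup>+u. ennreal (exp (- (m * u)) * u powr (- 1 - \<nu>) * exp (- \<eta> * (exp (- u) * y))) * indicator {ln 2..} u \<partial>half_line)
      \<le> ennreal (C * laguerre_phi m \<nu> y)"
    using late_time_integral[OF m \<nu> A(2)] by blast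
  show ?thesis
  proof (rule that[of "A * C"])
    show "A * C > 0" using A C by simp
    fix t x y :: real assume xy: "x \<ge> 0" "y \<ge> 0"
    define K where "K = A * exp ((1 + \<kappa>) * x)"
    have K: "K \<ge> 0" using A by (simp add: K_def)
    define g where "g = (\<lambda>u. exp (- (m * u)) * u powr (- 1 - \<nu>) * exp (- \<eta> * (exp (- u) * y)))"
    have "(\<integral>\<^sup>+u. ennreal (poisson_ker b m \<nu> t x y u) * indicator {ln 2..} u \<partial>half_line) \<le>
      (\<integral>\<^sup>+u. ennreal K * (ennreal (g u) * indicator {ln 2..} u) \<partial>half_line)"
    proof (intro nn_integral_mono)
      fix u
      show "ennreal (poisson_ker b m \<nu> t x y u) * indicator {ln 2..} u \<le> ennreal K * (ennreal (g u) * indicator {ln 2..} u)"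
      proof (cases "u \<ge> ln 2")
        case True
        have u: "u > 0" using True ln_gt_zero[of "2::real"] by linarith
        have lk: "lag_kernel b (exp (- u)) x y \<le> K * exp (- \<eta> * (exp (- u) * y))"
          unfolding K_def using xy exp_minus_le_half[OF True] by (intro A(3)) auto
        have lk0: "0 \<le> lag_kernel b (exp (- u)) x y"
          using xy u b by (intro lag_kernel_pos[THEN less_imp_le]) auto
        have "poisson_ker b m \<nu> t x y u \<le> 1 * u powr (- 1 - \<nu>) * (exp (- (m * u)) * (K * exp (- \<eta> * (exp (- u) * y))))"
          unfolding poisson_ker_def using u lk lk0 by (intro mult_mono) auto
        also have "\<dots> = K * g u" by (simp add: g_def)
        finally show ?thesis using True K by (simp add: ennreal_leI flip: ennreal_mult')
      qed simp
    qed
    also have "\<dots> = ennreal K * (\<integral>\<^sup>+u. (ennreal (g u) * indicator {ln 2..} u) \<partial>half_line)"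
      unfolding g_def by (intro nn_integral_cmult measurable_completion[THEN measurable_restrict_space1]) auto
    also have "\<dots> \<le> ennreal K * ennreal (C * laguerre_phi m \<nu> y)"
      unfolding g_def by (intro mult_left_mono C xy) auto
    also have "\<dots> = ennreal (K * (C * laguerre_phi m \<nu> y))" by (rule ennreal_mult'[symmetric, OF K])
    also have "K * (C * laguerre_phi m \<nu> y) = A * C * exp ((1 + \<kappa>) * x) * laguerre_phi m \<nu> y" by (simp add: K_def)
    finally show "(\<integral>\<^sup>+u. ennreal (poisson_ker b m \<nu> t x y u) * indicator {ln 2..} u \<partial>half_line)
      \<le> ennreal (A * C * exp ((1 + \<kappa>) * x) * laguerre_phi m \<nu> y)" .
  qed
qed

text \<open>Qualitative only, the constant depending on \<open>t\<close> and \<open>x\<close>: it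
  secures absolute convergence, while uniformity in \<open>t\<close> comes later from the maximal
  averages. For fixed \<open>t\<close> the exponential in \<open>t\<^sup>2 / u\<close> kills the
  singularity at small \<open>u\<close>.\<close>

lemma poisson_ker_integral_upper:
  assumes b: "b > 0" and m: "m \<ge> 0" and \<nu>: "\<nu> > 0" and x: "x \<ge> 0" and t: "t > 0"
  obtains C where "C > 0" "\<And>y. y \<ge> 0 \<Longrightarrow>
    (\<integral>\<^sup>+u. ennreal (poisson_ker b m \<nu> t x y u) \<partial>half_line) \<le> ennreal (C * laguerre_phi m \<nu> y)"
proof -
  obtain A where A: "A > 0" "\<And>t x y. \<lbrakk>x \<ge> 0; y \<ge> 0\<rbrakk> \<Longrightarrow>
    (\<integral>\<^sup>+u. ennreal (poisson_ker b m \<nu> t x y u) * indicator {ln 2..} u \<partial>half_line)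
      \<le> ennreal (A * exp ((1 + 1) * x) * laguerre_phi m \<nu> y)"
    using poisson_ker_late[OF b m \<nu>, of 1] by auto
  obtain F where F: "F > 0" "\<And>r x y. \<lbrakk>1 / 2 \<le> r; r < 1; 0 \<le> x; 72 * (1 + x) \<le> y\<rbrakk> \<Longrightarrow>
    lag_kernel b r x y \<le> F * exp (- y / 4)"
    using lag_kernel_upper_far[OF b] by blast
  obtain G where G: "G > 0" "\<And>r x y. \<lbrakk>0 < r; r < 1; 0 \<le> x; 0 \<le> y\<rbrakk> \<Longrightarrow>
    lag_kernel b r x y \<le> G * (1 - r) powr (- (b + 1)) * (1 + sqrt (x * y)) * exp x"
    using lag_kernel_upper_general[OF b] by blast
  obtain E where E: "E > 0" "\<And>y. y \<ge> 0 \<Longrightarrow> exp (- (1 / 4) * y) \<le> E * laguerre_phi m \<nu> y"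
    using exp_le_laguerre_phi[of "1 / 4" m \<nu>] m \<nu> by auto
  \<comment> \<open>The exponent adds \<open>1 + \<nu>\<close> from the subordination to
    \<open>b + 1\<close> from the kernel at small times.\<close>
  obtain T where T: "T > 0" "\<And>s. s \<ge> 0 \<Longrightarrow> (1 + s) powr (2 + \<nu> + b) * exp (- (t\<^sup>2 / 4) * s) \<le> T"
    using powr_times_exp_bounded[of "t\<^sup>2 / 4"] t by auto
  define R where "R = 72 * (1 + x)"
  have R: "R \<ge> 0" using x by (simp add: R_def)
  \<comment> \<open>The first term is for \<open>y \<ge> R\<close>, where the far bound applies.
    Below \<open>R\<close>, \<open>laguerre_phi m \<nu> y\<close> is at least its value at
    \<open>R\<close>, hence the division in the second.\<close>
  define H where "H = F * E + G * (1 + sqrt (x * R)) * exp x / laguerre_phi m \<nu> R"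
  have pR: "laguerre_phi m \<nu> R > 0" using R by (rule laguerre_phi_pos)
  have H: "H \<ge> F * E" "H \<ge> G * (1 + sqrt (x * R)) * exp x / laguerre_phi m \<nu> R" "H > 0"
    using F E G R x pR by (auto simp: H_def intro!: add_pos_nonneg divide_nonneg_nonneg mult_nonneg_nonneg add_nonneg_nonneg)
  have early: "lag_kernel b (exp (- u)) x y \<le> H * (1 - exp (- u)) powr (- (b + 1)) * laguerre_phi m \<nu> y"
    if u: "0 < u" "u \<le> ln 2" and y: "y \<ge> 0" for u y
  proof (cases "y \<ge> R")
    case True
    have one: "1 \<le> (1 - exp (- u)) powr (- (b + 1))"
      using u b powr_mono2'[of "- (b + 1)" "1 - exp (- u)" 1] by simp
    have "lag_kernel b (exp (- u)) x y \<le> F * exp (- y / 4)"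
      using u exp_minus_ge_half[of u] x True by (intro F) (auto simp: R_def)
    also have "\<dots> \<le> F * (E * laguerre_phi m \<nu> y)" using E(2)[OF y] F(1) by simp
    also have "\<dots> = (F * E) * 1 * laguerre_phi m \<nu> y" by simp
    also have "\<dots> \<le> H * (1 - exp (- u)) powr (- (b + 1)) * laguerre_phi m \<nu> y"
      using H one F(1) E(1) laguerre_phi_pos[OF y, of m \<nu>] by (intro mult_mono) auto
    finally show ?thesis .
  next
    case False
    have "lag_kernel b (exp (- u)) x y \<le> G * (1 - exp (- u)) powr (- (b + 1)) * (1 + sqrt (x * y)) * exp x"
      using u x y by (intro G) auto
    also have "\<dots> \<le> G * (1 - exp (- u)) powr (- (b + 1)) * (1 + sqrt (x * R)) * exp x"
      using False G(1) x y R by (intro mult_right_mono mult_left_mono add_left_mono real_sqrt_le_mono) auto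
    also have "\<dots> = (G * (1 + sqrt (x * R)) * exp x / laguerre_phi m \<nu> R) * (1 - exp (- u)) powr (- (b + 1)) * laguerre_phi m \<nu> R"
      using pR by simp
    also have "\<dots> \<le> H * (1 - exp (- u)) powr (- (b + 1)) * laguerre_phi m \<nu> y"
      using H False y m \<nu> pR by (intro mult_mono laguerre_phi_antimono) auto
    finally show ?thesis .
  qed
  define K where "K = T * H * 2 powr (b + 1)"
  have K: "K > 0" using T H by (simp add: K_def)
  have pk: "poisson_ker b m \<nu> t x y u \<le> K * laguerre_phi m \<nu> y" if u: "0 < u" "u \<le> ln 2" and y: "y \<ge> 0" for u y
  proof -
    have "u / 2 \<le> 1 - exp (- u)" using u ln2_le_1 by (intro one_minus_exp_ge) auto
    then have "(1 - exp (- u)) powr (- (b + 1)) \<le> (u / 2) powr (- (b + 1))"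
      using u b by (intro powr_mono2') auto
    also have "\<dots> = 2 powr (b + 1) * u powr (- (b + 1))"
      using u powr_divide[of u 2 "- (b + 1)"] powr_minus_divide[of 2 "b + 1"] by simp
    finally have "H * (1 - exp (- u)) powr (- (b + 1)) * laguerre_phi m \<nu> y \<le> H * (2 powr (b + 1) * u powr (- (b + 1))) * laguerre_phi m \<nu> y"
      using H laguerre_phi_pos[OF y, of m \<nu>] by (intro mult_right_mono mult_left_mono) auto
    then have lk: "lag_kernel b (exp (- u)) x y \<le> H * (2 powr (b + 1) * u powr (- (b + 1))) * laguerre_phi m \<nu> y"
      using early[OF u y] by linarith
    have lk0: "0 \<le> lag_kernel b (exp (- u)) x y" using x y u b by (intro lag_kernel_pos[THEN less_imp_le]) auto
    have "exp (- (t\<^sup>2 / (4 * u))) * (u powr (- 1 - \<nu>) * u powr (- (b + 1))) \<le> T"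
    proof -
      have "u powr (- 1 - \<nu>) * u powr (- (b + 1)) = u powr (- (2 + \<nu> + b))"
        by (subst powr_add[symmetric], rule arg_cong[of _ _ "(powr) u"]) simp
      also have "\<dots> = (1 / u) powr (2 + \<nu> + b)" using u by (subst powr_minus_divide) (simp add: powr_divide)
      also have "\<dots> \<le> (1 + 1 / u) powr (2 + \<nu> + b)" using u \<nu> b by (intro powr_mono2) auto
      finally have "exp (- (t\<^sup>2 / (4 * u))) * (u powr (- 1 - \<nu>) * u powr (- (b + 1))) \<le>
        exp (- (t\<^sup>2 / (4 * u))) * (1 + 1 / u) powr (2 + \<nu> + b)" by (intro mult_left_mono) auto
      also have "\<dots> \<le> T" using T(2)[of "1 / u"] u by (simp add: mult.commute)
      finally show ?thesis .
    qed
    then have main: "(exp (- (t\<^sup>2 / (4 * u))) * (u powr (- 1 - \<nu>) * u powr (- (b + 1)))) * (H * 2 powr (b + 1) * laguerre_phi m \<nu> y)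
        \<le> T * (H * 2 powr (b + 1) * laguerre_phi m \<nu> y)"
      using H laguerre_phi_pos[OF y, of m \<nu>] by (intro mult_right_mono) auto
    have "poisson_ker b m \<nu> t x y u \<le> exp (- (t\<^sup>2 / (4 * u))) * u powr (- 1 - \<nu>) * (1 * (H * (2 powr (b + 1) * u powr (- (b + 1))) * laguerre_phi m \<nu> y))"
      unfolding poisson_ker_def using lk lk0 m u by (intro mult_mono) auto
    also have "\<dots> = (exp (- (t\<^sup>2 / (4 * u))) * (u powr (- 1 - \<nu>) * u powr (- (b + 1)))) * (H * 2 powr (b + 1) * laguerre_phi m \<nu> y)"
      by (simp only: ac_simps mult_1_left)
    finally show ?thesis using main by (simp add: K_def mult_ac)
  qed
  show ?thesis
  proof (rule that[of "K * ln 2 + A * exp ((1 + 1) * x)"])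
    show "K * ln 2 + A * exp ((1 + 1) * x) > 0" using K A by (intro add_pos_pos) auto
    fix y :: real assume y: "y \<ge> 0"
    have "(\<integral>\<^sup>+u. ennreal (poisson_ker b m \<nu> t x y u) \<partial>half_line) \<le>
      (\<integral>\<^sup>+u. ennreal (K * laguerre_phi m \<nu> y) * indicator {0..ln 2} u + ennreal (poisson_ker b m \<nu> t x y u) * indicator {ln 2..} u \<partial>half_line)"
      by (intro nn_integral_mono) (auto split: split_indicator simp: pk y ennreal_leI)
    also have "\<dots> \<le> (\<integral>\<^sup>+u. ennreal (K * laguerre_phi m \<nu> y) * indicator {0..ln 2} u \<partial>half_line) +
        (\<integral>\<^sup>+u. ennreal (poisson_ker b m \<nu> t x y u) * indicator {ln 2..} u \<partial>half_line)"
      by (subst nn_integral_add) auto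
    also have "(\<integral>\<^sup>+u. ennreal (K * laguerre_phi m \<nu> y) * indicator {0..ln 2} u \<partial>half_line) \<le>
       (\<integral>\<^sup>+u. ennreal (K * laguerre_phi m \<nu> y) * indicator {0..ln (2::real)} u \<partial>lborel)"
      by (rule nn_integral_half_line_le)
    also have "\<dots> = ennreal (K * ln 2 * laguerre_phi m \<nu> y)"
      using K laguerre_phi_pos[OF y, of m \<nu>] by (subst nn_integral_cmult_indicator) (auto simp: ennreal_mult[symmetric] mult_ac)
    also have "(\<integral>\<^sup>+u. ennreal (poisson_ker b m \<nu> t x y u) * indicator {ln 2..} u \<partial>half_line) \<le>
        ennreal (A * exp ((1 + 1) * x) * laguerre_phi m \<nu> y)" by (rule A(2)[OF x y])
    finally show "(\<integral>\<^sup>+u. ennreal (poisson_ker b m \<nu> t x y u) \<partial>half_line) \<le> ennreal ((K * ln 2 + A * exp ((1 + 1) * x)) * laguerre_phi m \<nu> y)"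
      using K A laguerre_phi_pos[OF y, of m \<nu>] by (simp add: distrib_right flip: ennreal_plus)
  qed
qed

text \<open>From time \<open>ln (exp 1 + y)\<close> on, \<open>r = exp (- u)\<close> satisfies
  \<open>r * (1 + y) \<le> 1\<close>, so at \<open>x = 1\<close> the factors of the kernel are
  bounded below by constants. What remains is integrated over a window of length \<open>h\<close>: 1
  if \<open>m > 0\<close>, where the integrand decays exponentially, and
  \<open>ln (exp 1 + y)\<close> if \<open>m = 0\<close>, which gains the missing power of the
  logarithm.\<close>

lemma poisson_ker_integral_lower:
  assumes b: "b > 0" and m: "m \<ge> 0" and \<nu>: "\<nu> > 0" and t: "t > 0"
  obtains c where "c > 0" "\<And>y. y \<ge> 0 \<Longrightarrow>
    ennreal (c * laguerre_phi m \<nu> y) \<le> (\<integral>\<^sup>+u. ennreal (poisson_ker b m \<nu> t 1 y u) \<partial>half_line)"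
proof -
  define k where "k = exp (- (t\<^sup>2 / 4)) * (exp (- 2) / Gamma b)"
  have k: "k > 0" using b by (auto simp: k_def intro: Gamma_real_pos)
  have pk: "k * (exp (- (m * u)) * u powr (- 1 - \<nu>)) \<le> poisson_ker b m \<nu> t 1 y u"
    if y: "y \<ge> 0" and u: "ln (exp 1 + y) \<le> u" for y u
  proof -
    have u1: "u \<ge> 1" using ln_exp1_plus[OF y] u by linarith
    define r where "r = exp (- u)"
    have pos: "exp 1 + y > 0" using y by (intro add_pos_nonneg) auto
    have "exp (- u) \<le> exp (- ln (exp 1 + y))" using u by simp
    also have "\<dots> = 1 / (exp 1 + y)" using pos by (simp add: exp_minus divide_inverse)
    finally have r: "r \<le> 1 / (exp 1 + y)" unfolding r_def .
    have e2: "exp 1 \<ge> (2::real)" using exp_ge_add_one_self[of 1] by simp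
    have r0: "r > 0" by (simp add: r_def)
    have "r * (exp 1 + y) \<le> 1" using r pos by (simp add: le_divide_eq)
    moreover have "r * (1 + y) \<le> r * (exp 1 + y)" "r * (2 + 0) \<le> r * (exp 1 + y)"
      using e2 y r0 by (intro mult_left_mono; simp)+
    ultimately have r1: "r * (1 + y) \<le> 1" "r \<le> 1 / 2" by auto
    have "r * (1 + y) / (1 - r) \<le> 1 / (1 / 2)" using r1 r0 y by (intro frac_le) auto
    then have E: "exp (- 2) \<le> exp (- (r * (1 + y) / (1 - r)))" by simp
    have P: "1 \<le> (1 - r) powr (- b)" using powr_mono2'[of "- b" "1 - r" 1] r1 r0 b by simp
    have B: "1 / Gamma b \<le> bessel_series b (r * 1 * y / (1 - r)\<^sup>2)" using b r0 y by (intro bessel_series_lower) auto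
    have G: "Gamma b > 0" using b by (intro Gamma_real_pos) auto
    have "1 * exp (- 2) * (1 / Gamma b) \<le> lag_kernel b r 1 y"
      unfolding lag_kernel_def using P E B G by (intro mult_mono) auto
    moreover have "exp (- (t\<^sup>2 / 4)) \<le> exp (- (t\<^sup>2 / (4 * u)))"
      using u1 by (simp only: exp_le_cancel_iff neg_le_iff_le) (intro divide_left_mono, auto)
    ultimately have "exp (- (t\<^sup>2 / 4)) * u powr (- 1 - \<nu>) * (exp (- (m * u)) * (1 * exp (- 2) * (1 / Gamma b))) \<le> poisson_ker b m \<nu> t 1 y u"
      unfolding poisson_ker_def r_def using G by (intro mult_mono) auto
    then show ?thesis by (simp add: k_def mult_ac)
  qed
  define c0 where "c0 = (if m > 0 then exp (- m * 2) * 2 powr (- 1 - \<nu>) else 2 powr (- 1 - \<nu>))"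
  have c0: "c0 > 0" by (auto simp: c0_def)
  show ?thesis
  proof (rule that[of "k * c0"])
    show "k * c0 > 0" using k c0 by simp
    fix y :: real assume y: "y \<ge> 0"
    define l where "l = ln (exp 1 + y)"
    note l = ln_exp1_plus[OF y, folded l_def]
    have pos: "exp 1 + y > 0" using y by (intro add_pos_nonneg) auto
    define h where "h = (if m > 0 then 1 else l)"
    have h: "h > 0" "h \<le> l" using l by (auto simp: h_def)
    define g where "g = exp (- (m * (l + h))) * (l + h) powr (- 1 - \<nu>)"
    have "(\<integral>\<^sup>+u. ennreal (k * g) * indicator {l..l + h} u \<partial>half_line) \<le> (\<integral>\<^sup>+u. ennreal (poisson_ker b m \<nu> t 1 y u) \<partial>half_line)"
    proof (intro nn_integral_mono)
      fix u
      show "ennreal (k * g) * indicator {l..l + h} u \<le> ennreal (poisson_ker b m \<nu> t 1 y u)"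
      proof (cases "u \<in> {l..l + h}")
        case True
        have "g \<le> exp (- (m * u)) * u powr (- 1 - \<nu>)"
          unfolding g_def using True l m \<nu> by (intro mult_mono powr_mono2') (auto intro: mult_left_mono)
        then have "k * g \<le> k * (exp (- (m * u)) * u powr (- 1 - \<nu>))" using k by simp
        also have "\<dots> \<le> poisson_ker b m \<nu> t 1 y u" using True by (intro pk y) (auto simp: l_def)
        finally show ?thesis using True by (simp add: ennreal_leI)
      qed simp
    qed
    also have "(\<integral>\<^sup>+u. ennreal (k * g) * indicator {l..l + h} u \<partial>half_line) = (\<integral>\<^sup>+u. ennreal (k * g) * indicator {l..l + h} u \<partial>lborel)"
      unfolding nn_integral_half_line using l by (intro nn_integral_cong) (auto split: split_indicator)
    also have "\<dots> = ennreal (k * g * h)"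
      using k h by (subst nn_integral_cmult_indicator) (auto simp: ennreal_mult[symmetric] g_def)
    finally have "ennreal (k * g * h) \<le> (\<integral>\<^sup>+u. ennreal (poisson_ker b m \<nu> t 1 y u) \<partial>half_line)" .
    moreover have "c0 * laguerre_phi m \<nu> y \<le> g * h"
    proof (cases "m > 0")
      case True
      have "exp (- (m * (l + 1))) = exp (- m) * (exp 1 + y) powr (- m)"
        using pos by (simp add: l_def powr_def algebra_simps flip: exp_add)
      moreover have "exp (- m) * (1 + y) powr (- m) \<le> (exp 1 + y) powr (- m)"
      proof -
        have "exp 1 + y \<le> exp 1 * (1 + y)"
          using y mult_right_mono[of 1 "exp 1" y] by (simp add: algebra_simps)
        then have "(exp 1 * (1 + y)) powr (- m) \<le> (exp 1 + y) powr (- m)" using pos True by (intro powr_mono2') auto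
        then show ?thesis using y by (simp add: powr_mult exp_powr_real)
      qed
      ultimately have 1: "exp (- m * 2) * (1 + y) powr (- m) \<le> exp (- (m * (l + 1)))"
        using mult_left_mono[of "exp (- m) * (1 + y) powr (- m)" "(exp 1 + y) powr (- m)" "exp (- m)"]
        by (simp add: mult.assoc[symmetric] mult.commute[of m 2] flip: exp_add)
      have "(2 * l) powr (- 1 - \<nu>) \<le> (l + 1) powr (- 1 - \<nu>)" using l \<nu> by (intro powr_mono2') auto
      then have 2: "2 powr (- 1 - \<nu>) * l powr (- 1 - \<nu>) \<le> (l + 1) powr (- 1 - \<nu>)" using l by (simp add: powr_mult)
      have "c0 * laguerre_phi m \<nu> y = (exp (- m * 2) * (1 + y) powr (- m)) * (2 powr (- 1 - \<nu>) * l powr (- 1 - \<nu>))"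
        using True powr_minus_divide[of l "1 + \<nu>"] powr_minus_divide[of "1 + y" m]
        by (simp add: c0_def laguerre_phi_def l_def)
      also have "\<dots> \<le> exp (- (m * (l + 1))) * (l + 1) powr (- 1 - \<nu>)" by (intro mult_mono 1 2) auto
      finally show ?thesis using True by (simp add: g_def h_def)
    next
      case False
      then have "g * h = (2 * l) powr (- 1 - \<nu>) * l" using m by (simp add: g_def h_def)
      also have "\<dots> = 2 powr (- 1 - \<nu>) * (l powr (- 1 - \<nu>) * l powr 1)" using l by (simp add: powr_mult)
      also have "l powr (- 1 - \<nu>) * l powr 1 = l powr (- \<nu>)" by (subst powr_add[symmetric]) simp
      also have "\<dots> = 1 / l powr \<nu>" by (rule powr_minus_divide)
      finally show ?thesis using False by (simp add: c0_def laguerre_phi_def l_def)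
    qed
    then have "k * c0 * laguerre_phi m \<nu> y \<le> k * g * h" using k by (simp add: mult.assoc)
    ultimately show "ennreal (k * c0 * laguerre_phi m \<nu> y) \<le> (\<integral>\<^sup>+u. ennreal (poisson_ker b m \<nu> t 1 y u) \<partial>half_line)"
      by (meson ennreal_leI order.trans)
  qed
qed

section \<open>The heat semigroup and its maximal averages\<close>

lemma summable_mult_nonneg:
  fixes f g :: "nat \<Rightarrow> real"
  assumes "summable f" "summable g" "\<And>n. 0 \<le> f n" "\<And>n. 0 \<le> g n"
  shows "summable (\<lambda>n. f n * g n)"
proof -
  obtain M where M: "\<And>n. norm (f n) \<le> M"
  proof -
    have "Bseq f" by (rule convergent_imp_Bseq[OF convergentI[OF summable_LIMSEQ_zero[OF assms(1)]]])
    then show ?thesis using that unfolding Bseq_def by blast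
  qed
  show ?thesis
    by (rule summable_comparison_test_ev[OF _ summable_mult[OF assms(2), of M]])
       (use M assms in \<open>auto intro!: always_eventually mult_right_mono simp: abs_mult\<close>)
qed

lemma ennreal_truncated_le: "(a::ennreal) \<le> (a - s) + s"
  by (cases "s \<le> a") (auto simp: diff_add_cancel_ennreal add_increasing)

text \<open>With \<open>S\<close> the integral operator of \<open>k\<close>, the iteration \<open>m\<^sub>0 = 0\<close>, \<open>m\<^sub>n\<^sub>+\<^sub>1 = (g + S m\<^sub>n) - s\<close> with
  truncated subtraction keeps Garsia's proof inside \<open>[0,\<infinity>]\<close>: \<open>A N - N s \<le> m\<^sub>n\<close> for \<open>N \<le> n\<close>, and
  \<open>m\<^sub>n + s \<le> g + S m\<^sub>n\<close> where \<open>m\<^sub>n > 0\<close>; integrating the latter gives the bound.\<close>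

lemma hopf_maximal:
  fixes k :: "'a \<Rightarrow> 'a \<Rightarrow> ennreal" and A :: "nat \<Rightarrow> 'a \<Rightarrow> ennreal"
  assumes M: "sigma_finite_measure M"
    and k[measurable]: "case_prod k \<in> borel_measurable (M \<Otimes>\<^sub>M M)"
    and sym: "\<And>x y. k x y = k y x"
    and mass: "\<And>x. x \<in> space M \<Longrightarrow> (\<integral>\<^sup>+y. k x y \<partial>M) \<le> 1"
    and g[measurable]: "g \<in> borel_measurable M"
    and A[measurable]: "\<And>N. A N \<in> borel_measurable M"
    and A0: "\<And>x. x \<in> space M \<Longrightarrow> A 0 x = 0"
    and AS: "\<And>N x. x \<in> space M \<Longrightarrow> A (Suc N) x = g x + (\<integral>\<^sup>+y. k x y * A N y \<partial>M)"
  shows "ennreal s * emeasure M {x \<in> space M. \<exists>N. ennreal (real N * s) < A N x} \<le> (\<integral>\<^sup>+x. g x \<partial>M)"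
proof (cases "s > 0 \<and> (\<integral>\<^sup>+x. g x \<partial>M) < \<infinity>")
  case False
  then show ?thesis by (auto simp: ennreal_neg not_less top_unique)
next
  case True
  then have s: "s > 0" and gfin: "(\<integral>\<^sup>+x. g x \<partial>M) < \<infinity>" by auto
  interpret sigma_finite_measure M by (rule M)
  interpret P: pair_sigma_finite M M ..
  define S where "S = (\<lambda>F x. \<integral>\<^sup>+y. k x y * F y \<partial>M)"
  have Sm: "S F \<in> borel_measurable M" if [measurable]: "F \<in> borel_measurable M" for F
    unfolding S_def by measurable
  have Smono: "S F x \<le> S G x" if "\<And>y. y \<in> space M \<Longrightarrow> F y \<le> G y" for F G x
    unfolding S_def by (intro nn_integral_mono mult_left_mono that) auto
  have Sint: "(\<integral>\<^sup>+x. S F x \<partial>M) \<le> (\<integral>\<^sup>+x. F x \<partial>M)" if [measurable]: "F \<in> borel_measurable M" for F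
  proof -
    have "(\<integral>\<^sup>+x. S F x \<partial>M) = (\<integral>\<^sup>+y. \<integral>\<^sup>+x. k x y * F y \<partial>M \<partial>M)"
      unfolding S_def by (rule P.Fubini'[symmetric]) measurable
    also have "\<dots> = (\<integral>\<^sup>+y. (\<integral>\<^sup>+x. k y x \<partial>M) * F y \<partial>M)"
      by (intro nn_integral_cong) (subst sym, rule nn_integral_multc, measurable)
    also have "\<dots> \<le> (\<integral>\<^sup>+y. 1 * F y \<partial>M)"
      by (intro nn_integral_mono mult_right_mono mass) auto
    finally show ?thesis by simp
  qed
  define m where "m = rec_nat (\<lambda>_. 0) (\<lambda>_ F x. (g x + S F x) - ennreal s)"
  have m0: "m 0 = (\<lambda>_. 0)" and mS: "m (Suc n) = (\<lambda>x. (g x + S (m n) x) - ennreal s)" for n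
    by (simp_all add: m_def)
  have mm[measurable]: "m n \<in> borel_measurable M" for n
  proof (induction n)
    case (Suc n)
    have [measurable]: "S (m n) \<in> borel_measurable M" by (rule Sm[OF Suc])
    show ?case unfolding mS by measurable
  qed (simp add: m0)
  have minc: "m n x \<le> m (Suc n) x" for n x
  proof (induction n arbitrary: x)
    case (Suc n)
    have "m (Suc n) x = (g x + S (m n) x) - ennreal s" by (simp add: mS)
    also have "\<dots> \<le> (g x + S (m (Suc n)) x) - ennreal s"
      by (intro ennreal_minus_mono add_left_mono Smono Suc) auto
    also have "\<dots> = m (Suc (Suc n)) x" by (simp add: mS)
    finally show ?case .
  qed (simp add: m0)
  \<comment> \<open>Finiteness lets the integral of \<open>m (Suc n)\<close> be cancelled in the
    final comparison.\<close>
  have mint: "(\<integral>\<^sup>+x. m n x \<partial>M) < \<infinity>" for n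
  proof (induction n)
    case (Suc n)
    have "(\<integral>\<^sup>+x. m (Suc n) x \<partial>M) \<le> (\<integral>\<^sup>+x. g x + S (m n) x \<partial>M)"
      unfolding mS by (intro nn_integral_mono diff_le_self_ennreal)
    also have "\<dots> = (\<integral>\<^sup>+x. g x \<partial>M) + (\<integral>\<^sup>+x. S (m n) x \<partial>M)"
      using Sm by (intro nn_integral_add) auto
    also have "\<dots> \<le> (\<integral>\<^sup>+x. g x \<partial>M) + (\<integral>\<^sup>+x. m n x \<partial>M)" by (intro add_left_mono Sint) auto
    also have "\<dots> < \<infinity>" using gfin Suc by simp
    finally show ?case .
  qed (simp add: m0)
  \<comment> \<open>A constant does not grow under \<open>S\<close> because the mass is at most 1,
    so each step adds only the \<open>s\<close> removed by the truncation.\<close>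
  have Am: "A N x \<le> m n x + ennreal (real N * s)" if "N \<le> n" "x \<in> space M" for N n x
    using that
  proof (induction n arbitrary: N x)
    case 0
    then show ?case by (simp add: A0)
  next
    case (Suc n)
    show ?case
    proof (cases N)
      case 0
      then show ?thesis using Suc.prems by (simp add: A0)
    next
      case (Suc N')
      then have N': "N' \<le> n" using Suc.prems by simp
      have "S (A N') x \<le> S (\<lambda>y. m n y + ennreal (real N' * s)) x"
        using N' by (intro Smono Suc.IH) auto
      also have "\<dots> = S (m n) x + (\<integral>\<^sup>+y. k x y * ennreal (real N' * s) \<partial>M)"
        unfolding S_def using Suc.prems by (simp add: distrib_left nn_integral_add)
      also have "(\<integral>\<^sup>+y. k x y * ennreal (real N' * s) \<partial>M) = (\<integral>\<^sup>+y. k x y \<partial>M) * ennreal (real N' * s)"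
        using Suc.prems by (intro nn_integral_multc) auto
      also have "\<dots> \<le> 1 * ennreal (real N' * s)"
        using Suc.prems by (intro mult_right_mono mass) auto
      finally have "A N x \<le> g x + (S (m n) x + ennreal (real N' * s))"
        using Suc.prems unfolding Suc AS[OF Suc.prems(2)] S_def by (simp add: add_left_mono)
      also have "\<dots> = (g x + S (m n) x) + ennreal (real N' * s)" by (simp add: add.assoc)
      also have "\<dots> \<le> (m (Suc n) x + ennreal s) + ennreal (real N' * s)"
        unfolding mS by (intro add_right_mono ennreal_truncated_le)
      also have "\<dots> = m (Suc n) x + ennreal (real N * s)"
        using s by (simp add: Suc add.assoc distrib_right flip: ennreal_plus)
      finally show ?thesis .
    qed
  qed
  define E where "E = (\<lambda>n. {x \<in> space M. 0 < m (Suc n) x})"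
  have Em[measurable]: "E n \<in> sets M" for n unfolding E_def by measurable
  have E1: "ennreal s * emeasure M (E n) \<le> (\<integral>\<^sup>+x. g x \<partial>M)" for n
  proof -
    have "(\<integral>\<^sup>+x. m (Suc n) x \<partial>M) + ennreal s * emeasure M (E n) =
        (\<integral>\<^sup>+x. m (Suc n) x + ennreal s * indicator (E n) x \<partial>M)"
      by (subst nn_integral_add) (auto simp: nn_integral_cmult_indicator)
    also have "\<dots> \<le> (\<integral>\<^sup>+x. g x + S (m n) x \<partial>M)"
    proof (intro nn_integral_mono)
      fix x assume x: "x \<in> space M"
      show "m (Suc n) x + ennreal s * indicator (E n) x \<le> g x + S (m n) x"
      proof (cases "x \<in> E n")
        case True
        then have "(g x + S (m n) x) - ennreal s \<noteq> 0" by (auto simp: E_def mS)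
        have "ennreal s \<le> g x + S (m n) x"
        proof (rule ccontr)
          assume "\<not> ?thesis"
          then have "g x + S (m n) x < ennreal s" by (simp add: not_le)
          moreover from this have "g x + S (m n) x < top" by (rule order.strict_trans) simp
          ultimately have "(g x + S (m n) x) - ennreal s = 0"
            unfolding diff_eq_0_iff_ennreal by (auto intro: order.strict_implies_order)
          then show False using \<open>(g x + S (m n) x) - ennreal s \<noteq> 0\<close> by contradiction
        qed
        then show ?thesis using True by (simp add: mS diff_add_cancel_ennreal)
      next
        case False
        then have "m (Suc n) x = 0" using x by (auto simp: E_def)
        then show ?thesis using False by simp
      qed
    qed
    also have "\<dots> = (\<integral>\<^sup>+x. g x \<partial>M) + (\<integral>\<^sup>+x. S (m n) x \<partial>M)"
      using Sm by (intro nn_integral_add) auto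
    also have "\<dots> \<le> (\<integral>\<^sup>+x. g x \<partial>M) + (\<integral>\<^sup>+x. m (Suc n) x \<partial>M)"
      by (intro add_left_mono order.trans[OF Sint] nn_integral_mono minc) auto
    finally have "(\<integral>\<^sup>+x. m (Suc n) x \<partial>M) + ennreal s * emeasure M (E n) \<le>
       (\<integral>\<^sup>+x. m (Suc n) x \<partial>M) + (\<integral>\<^sup>+x. g x \<partial>M)" by (simp add: add.commute)
    then show ?thesis using mint[of "Suc n"] by (auto simp: ennreal_add_left_cancel_le)
  qed
  have sub: "{x \<in> space M. \<exists>N. ennreal (real N * s) < A N x} \<subseteq> (\<Union>n. E n)"
  proof
    fix x assume "x \<in> {x \<in> space M. \<exists>N. ennreal (real N * s) < A N x}"
    then obtain N where x: "x \<in> space M" and N: "ennreal (real N * s) < A N x" by auto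
    have "m (Suc N) x \<noteq> 0"
    proof
      assume "m (Suc N) x = 0"
      then have "A N x \<le> ennreal (real N * s)" using Am[of N "Suc N" x] x by simp
      then show False using N by simp
    qed
    then show "x \<in> (\<Union>n. E n)" using x by (auto simp: E_def zero_less_iff_neq_zero)
  qed
  have incE: "incseq E" unfolding E_def incseq_Suc_iff using minc by (auto intro: less_le_trans)
  have "ennreal s * emeasure M {x \<in> space M. \<exists>N. ennreal (real N * s) < A N x} \<le> ennreal s * emeasure M (\<Union>n. E n)"
    by (intro mult_left_mono emeasure_mono sub) auto
  also have "emeasure M (\<Union>n. E n) = (SUP n. emeasure M (E n))"
    using incE by (intro SUP_emeasure_incseq[symmetric]) auto
  also have "ennreal s * (SUP n. emeasure M (E n)) = (SUP n. ennreal s * emeasure M (E n))"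
    by (rule SUP_mult_left_ennreal)
  also have "\<dots> \<le> (\<integral>\<^sup>+x. g x \<partial>M)" by (intro SUP_least E1)
  finally show ?thesis .
qed

lemma sigma_finite_lebesgue: "sigma_finite_measure (lebesgue :: real measure)"
proof
  obtain A where A: "countable A" "A \<subseteq> sets lborel" "\<Union>A = space (lborel :: real measure)" "\<forall>a\<in>A. emeasure lborel a \<noteq> \<infinity>"
    using lborel.sigma_finite_countable by blast
  show "\<exists>A::real set set. countable A \<and> A \<subseteq> sets lebesgue \<and> \<Union> A = space lebesgue \<and> (\<forall>a\<in>A. emeasure lebesgue a \<noteq> \<infinity>)"
  proof (intro exI[of _ A] conjI ballI)
    show "A \<subseteq> sets lebesgue" using A(2) by auto
    show "emeasure lebesgue a \<noteq> \<infinity>" if "a \<in> A" for a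
      using A(2,4) that by (subst emeasure_completion) (auto simp: subset_eq)
  qed (use A in auto)
qed

interpretation half_line: sigma_finite_measure half_line
  by (rule sigma_finite_measure_restrict_space[OF sigma_finite_lebesgue]) auto

section \<open>The symmetric Markov semigroup\<close>

locale laguerre_semigroup =
  fixes \<alpha> :: real and L :: "nat \<Rightarrow> real poly"
  assumes \<alpha>: "\<alpha> > -1" and L: "normalized_laguerre \<alpha> L"
begin

definition mu :: "real measure" where
  "mu = density half_line (\<lambda>y. ennreal (y powr \<alpha> * exp (- y)))"

lemma space_mu [simp]: "space mu = {0<..}" and sets_mu [simp, measurable_cong]: "sets mu = sets half_line"
  by (simp_all add: mu_def)

lemma b_pos: "\<alpha> + 1 > 0" using \<alpha> by simp

lemma weight_measurable [measurable]: "(\<lambda>y. y powr \<alpha> * exp (- y)) \<in> borel_measurable half_line"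
  by measurable

lemma nn_integral_mu:
  "f \<in> borel_measurable half_line \<Longrightarrow> (\<integral>\<^sup>+y. f y \<partial>mu) = (\<integral>\<^sup>+y. f y * ennreal (y powr \<alpha> * exp (- y)) \<partial>half_line)"
  unfolding mu_def by (subst nn_integral_density) (auto simp: mult.commute)

lemma integrable_mu_iff:
  "f \<in> borel_measurable half_line \<Longrightarrow> integrable mu f \<longleftrightarrow> integrable half_line (\<lambda>y. f y * (y powr \<alpha> * exp (- y)))"
  unfolding mu_def by (subst integrable_density) (auto simp: mult.commute)

lemma integral_mu:
  "f \<in> borel_measurable half_line \<Longrightarrow> integral\<^sup>L mu f = (\<integral>y. f y * (y powr \<alpha> * exp (- y)) \<partial>half_line)"
  unfolding mu_def by (subst integral_density) (auto simp: mult.commute)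

sublocale mu: finite_measure mu
proof
  have "emeasure mu (space mu) = (\<integral>\<^sup>+y. 1 \<partial>mu)" by simp
  also have "\<dots> = (\<integral>\<^sup>+y. ennreal (y powr \<alpha> * exp (- y)) \<partial>half_line)" by (subst nn_integral_mu) auto
  also have "\<dots> = ennreal (Gamma (\<alpha> + 1))"
    using Gamma_has_bochner_integral[OF b_pos] by (subst nn_integral_eq_integral) (auto simp: has_bochner_integral_iff)
  finally show "emeasure mu (space mu) \<noteq> \<infinity>" by simp
qed

text \<open>The factor \<open>exp (- (m * u))\<close> is left out, which makes the total mass
  exactly 1 whatever \<open>m\<close> is.\<close>

definition heat_ker :: "real \<Rightarrow> real \<Rightarrow> real \<Rightarrow> real" where
  "heat_ker u x y = lag_kernel (\<alpha> + 1) (exp (- u)) x y"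

lemma borel_measurable_heat_ker [measurable (raw)]:
  assumes [measurable]: "f \<in> borel_measurable M" "g \<in> borel_measurable M" "h \<in> borel_measurable M"
  shows "(\<lambda>w. heat_ker (f w) (g w) (h w)) \<in> borel_measurable M"
  unfolding heat_ker_def by measurable

lemma heat_ker_pos: "u > 0 \<Longrightarrow> x \<ge> 0 \<Longrightarrow> y \<ge> 0 \<Longrightarrow> heat_ker u x y > 0"
  unfolding heat_ker_def by (intro lag_kernel_pos b_pos) auto

lemma heat_ker_sym: "heat_ker u x y = heat_ker u y x"
  unfolding heat_ker_def by (rule lag_kernel_sym)

lemma heat_kernel_heat_ker: "u > 0 \<Longrightarrow> heat_kernel L m u x y = exp (- (m * u)) * heat_ker u x y"
  unfolding heat_ker_def by (rule heat_kernel_eq[OF \<alpha> L])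

lemma heat_ker_sums: "u > 0 \<Longrightarrow> (\<lambda>n. exp (- (real n * u)) * poly (L n) x * poly (L n) y) sums heat_ker u x y"
  unfolding heat_ker_def using heat_kernel_sums[OF \<alpha> L, of u 0] by simp

lemma poly_measurable_mu [measurable]: "poly p \<in> borel_measurable mu"
proof -
  have "poly p \<in> borel_measurable borel" by (intro borel_measurable_continuous_onI continuous_intros)
  then show ?thesis by measurable
qed

lemma L_orthonormal:
  "has_bochner_integral mu (\<lambda>y. poly (L i) y * poly (L j) y) (if i = j then 1 else 0)"
proof -
  have "has_bochner_integral half_line (\<lambda>y. poly (L i) y * poly (L j) y * (y powr \<alpha> * exp (- y))) (if i = j then 1 else 0)"
    using L by (simp add: normalized_laguerre_def)
  moreover have "(\<lambda>y. poly (L i) y * poly (L j) y) \<in> borel_measurable half_line"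
    using poly_measurable_mu by measurable
  ultimately show ?thesis
    by (simp add: has_bochner_integral_iff integrable_mu_iff integral_mu)
qed

lemma L_abs_integral:
  "(\<integral>y. \<bar>poly (L i) y * poly (L j) y\<bar> \<partial>mu) \<le> 1"
proof -
  have "(\<integral>y. \<bar>poly (L i) y * poly (L j) y\<bar> \<partial>mu) \<le>
      (\<integral>y. (poly (L i) y * poly (L i) y + poly (L j) y * poly (L j) y) / 2 \<partial>mu)"
  proof (rule integral_mono)
    show "\<bar>poly (L i) y * poly (L j) y\<bar> \<le> (poly (L i) y * poly (L i) y + poly (L j) y * poly (L j) y) / 2" for y
      using sum_squares_bound[of "\<bar>poly (L i) y\<bar>" "\<bar>poly (L j) y\<bar>"] by (simp add: abs_mult power2_eq_square)
  qed (use L_orthonormal in \<open>auto simp: has_bochner_integral_iff\<close>)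
  also have "\<dots> = 1" using L_orthonormal[of i i] L_orthonormal[of j j] by (simp add: has_bochner_integral_iff)
  finally show ?thesis .
qed

text \<open>Termwise integration of the bilinear series. The third conclusion bounds the absolute
  integral independently of \<open>n\<close>; this is the domination used for the Chapman-Kolmogorov
  identity.\<close>

lemma L_integral_heat_ker:
  assumes u: "u > 0"
  shows "integrable mu (\<lambda>z. poly (L n) z * heat_ker u x z)"
    and "(\<integral>z. poly (L n) z * heat_ker u x z \<partial>mu) = exp (- (real n * u)) * poly (L n) x"
    and "(\<integral>z. \<bar>poly (L n) z * heat_ker u x z\<bar> \<partial>mu) \<le> (\<Sum>i. exp (- (real i * u)) * \<bar>poly (L i) x\<bar>)"
proof -
  define f where "f = (\<lambda>i z. (exp (- (real i * u)) * poly (L i) x) * (poly (L n) z * poly (L i) z))"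
  have I: "integrable mu (f i)" for i
    unfolding f_def using L_orthonormal[of n i] by (auto simp: has_bochner_integral_iff)
  have fs: "(\<lambda>i. f i z) sums (poly (L n) z * heat_ker u x z)" for z
    using sums_mult[OF heat_ker_sums[OF u, of x z], of "poly (L n) z"] by (simp add: f_def mult_ac)
  have fss: "(\<lambda>i. \<bar>f i z\<bar>) sums (\<Sum>i. \<bar>f i z\<bar>)" for z
  proof (rule summable_sums)
    \<comment> \<open>Half of the time is spent on each of the two Laguerre factors.\<close>
    have u2: "u / 2 > 0" using u by simp
    have "summable (\<lambda>i. exp (- (real i * (u / 2))) * \<bar>poly (L i) x\<bar>)" "summable (\<lambda>i. exp (- (real i * (u / 2))) * \<bar>poly (L i) z\<bar>)"
      using normalized_laguerre_summable[OF \<alpha> L u2] by auto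
    then have "summable (\<lambda>i. (exp (- (real i * (u / 2))) * \<bar>poly (L i) x\<bar>) * (exp (- (real i * (u / 2))) * \<bar>poly (L i) z\<bar>))"
      by (rule summable_mult_nonneg) auto
    then have "summable (\<lambda>i. \<bar>poly (L n) z\<bar> * ((exp (- (real i * (u / 2))) * \<bar>poly (L i) x\<bar>) * (exp (- (real i * (u / 2))) * \<bar>poly (L i) z\<bar>)))"
      by (rule summable_mult)
    moreover have "exp (- (real i * u)) = exp (- (real i * (u / 2))) * exp (- (real i * (u / 2)))" for i
      by (simp flip: exp_add)
    ultimately show "summable (\<lambda>i. \<bar>f i z\<bar>)" by (simp add: f_def abs_mult mult_ac)
  qed
  have nb: "(\<integral>z. norm (f i z) \<partial>mu) \<le> exp (- (real i * u)) * \<bar>poly (L i) x\<bar>" for i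
  proof -
    have "(\<integral>z. norm (f i z) \<partial>mu) = (exp (- (real i * u)) * \<bar>poly (L i) x\<bar>) * (\<integral>z. \<bar>poly (L n) z * poly (L i) z\<bar> \<partial>mu)"
      by (simp add: f_def abs_mult[of "exp (- (real i * u)) * poly (L i) x"] abs_mult[of "exp (- (real i * u))"])
    also have "\<dots> \<le> (exp (- (real i * u)) * \<bar>poly (L i) x\<bar>) * 1" by (intro mult_left_mono L_abs_integral) auto
    finally show ?thesis by simp
  qed
  have sn: "summable (\<lambda>i. \<integral>z. norm (f i z) \<partial>mu)"
    by (rule summable_comparison_test_ev[OF _ normalized_laguerre_summable[OF \<alpha> L u, of x]])
       (use nb in \<open>auto intro!: always_eventually\<close>)
  have AEs: "AE z in mu. summable (\<lambda>i. norm (f i z))" using fss by (auto simp: sums_iff)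
  have eq: "(\<Sum>i. f i z) = poly (L n) z * heat_ker u x z" for z using fs[of z] by (simp add: sums_iff)
  show int: "integrable mu (\<lambda>z. poly (L n) z * heat_ker u x z)"
    using integrable_suminf[OF I AEs sn] unfolding eq .
  have "(\<lambda>i. integral\<^sup>L mu (f i)) sums (\<integral>z. poly (L n) z * heat_ker u x z \<partial>mu)"
    using sums_integral[OF I AEs sn] unfolding eq .
  moreover have "integral\<^sup>L mu (f i) = (if i = n then exp (- (real n * u)) * poly (L n) x else 0)" for i
    unfolding f_def using L_orthonormal[of n i] by (auto simp: has_bochner_integral_iff)
  then have "(\<lambda>i. integral\<^sup>L mu (f i)) sums (exp (- (real n * u)) * poly (L n) x)"
    using sums_single[of n "\<lambda>_. exp (- (real n * u)) * poly (L n) x"] by simp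
  ultimately show "(\<integral>z. poly (L n) z * heat_ker u x z \<partial>mu) = exp (- (real n * u)) * poly (L n) x"
    by (rule sums_unique2)
  have "(\<integral>z. \<bar>poly (L n) z * heat_ker u x z\<bar> \<partial>mu) \<le> (\<integral>z. (\<Sum>i. norm (f i z)) \<partial>mu)"
  proof (rule integral_mono)
    show "integrable mu (\<lambda>z. \<Sum>i. norm (f i z))"
      using I AEs sn by (intro integrable_suminf) auto
    show "\<bar>poly (L n) z * heat_ker u x z\<bar> \<le> (\<Sum>i. norm (f i z))" for z
      unfolding eq[symmetric] using fss[of z] by (intro summable_norm[of "\<lambda>i. f i z", simplified real_norm_def, THEN order.trans]) (auto simp: sums_iff)
  qed (use int in auto)
  also have "\<dots> = (\<Sum>i. \<integral>z. norm (f i z) \<partial>mu)"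
    using I AEs sn by (intro integral_suminf) auto
  also have "\<dots> \<le> (\<Sum>i. exp (- (real i * u)) * \<bar>poly (L i) x\<bar>)"
    by (intro suminf_le nb sn normalized_laguerre_summable[OF \<alpha> L u])
  finally show "(\<integral>z. \<bar>poly (L n) z * heat_ker u x z\<bar> \<partial>mu) \<le> (\<Sum>i. exp (- (real i * u)) * \<bar>poly (L i) x\<bar>)" .
qed

text \<open>Only the first kernel is expanded; the second acts on \<open>L n\<close> as
  multiplication by an eigenvalue, and the two exponentials multiply to that of
  \<open>u + v\<close>.\<close>

lemma chapman_kolmogorov_real:
  assumes u: "u > 0" and v: "v > 0"
  shows "integrable mu (\<lambda>z. heat_ker u x z * heat_ker v y z)" "(\<integral>z. heat_ker u x z * heat_ker v y z \<partial>mu) = heat_ker (u + v) x y"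
proof -
  define f where "f = (\<lambda>n z. (exp (- (real n * u)) * poly (L n) x) * (poly (L n) z * heat_ker v y z))"
  define B where "B = (\<Sum>i. exp (- (real i * v)) * \<bar>poly (L i) y\<bar>)"
  have I: "integrable mu (f n)" for n
    unfolding f_def using L_integral_heat_ker(1)[OF v] by (intro integrable_mult_right) auto
  have fs: "(\<lambda>n. f n z) sums (heat_ker u x z * heat_ker v y z)" for z
    using sums_mult2[OF heat_ker_sums[OF u, of x z], of "heat_ker v y z"] by (simp add: f_def mult_ac)
  have eq: "(\<Sum>n. f n z) = heat_ker u x z * heat_ker v y z" for z using fs[of z] by (simp add: sums_iff)
  have AEs: "AE z in mu. summable (\<lambda>n. norm (f n z))"
  proof (intro AE_I2)
    fix z
    have u2: "u / 2 > 0" using u by simp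
    have "summable (\<lambda>i. (exp (- (real i * (u / 2))) * \<bar>poly (L i) x\<bar>) * (exp (- (real i * (u / 2))) * \<bar>poly (L i) z\<bar>))"
      by (rule summable_mult_nonneg[OF normalized_laguerre_summable[OF \<alpha> L u2] normalized_laguerre_summable[OF \<alpha> L u2]]) auto
    then have "summable (\<lambda>i. \<bar>heat_ker v y z\<bar> * ((exp (- (real i * (u / 2))) * \<bar>poly (L i) x\<bar>) * (exp (- (real i * (u / 2))) * \<bar>poly (L i) z\<bar>)))"
      by (rule summable_mult)
    moreover have "exp (- (real i * u)) = exp (- (real i * (u / 2))) * exp (- (real i * (u / 2)))" for i
      by (simp flip: exp_add)
    ultimately show "summable (\<lambda>n. norm (f n z))" by (simp add: f_def abs_mult mult_ac)
  qed
  have sn: "summable (\<lambda>n. \<integral>z. norm (f n z) \<partial>mu)"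
  proof (rule summable_comparison_test_ev)
    show "summable (\<lambda>n. (exp (- (real n * u)) * \<bar>poly (L n) x\<bar>) * B)"
      by (intro summable_mult2 normalized_laguerre_summable[OF \<alpha> L u])
    show "\<forall>\<^sub>F n in sequentially. norm (\<integral>z. norm (f n z) \<partial>mu) \<le> exp (- (real n * u)) * \<bar>poly (L n) x\<bar> * B"
    proof (intro always_eventually allI)
      fix n
      have "(\<integral>z. norm (f n z) \<partial>mu) = (exp (- (real n * u)) * \<bar>poly (L n) x\<bar>) * (\<integral>z. \<bar>poly (L n) z * heat_ker v y z\<bar> \<partial>mu)"
        by (simp add: f_def abs_mult[of "exp (- (real n * u)) * poly (L n) x"] abs_mult[of "exp (- (real n * u))"])
      also have "\<dots> \<le> (exp (- (real n * u)) * \<bar>poly (L n) x\<bar>) * B"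
        unfolding B_def by (intro mult_left_mono L_integral_heat_ker(3)[OF v]) auto
      finally show "norm (\<integral>z. norm (f n z) \<partial>mu) \<le> exp (- (real n * u)) * \<bar>poly (L n) x\<bar> * B" by simp
    qed
  qed
  show "integrable mu (\<lambda>z. heat_ker u x z * heat_ker v y z)"
    using integrable_suminf[OF I AEs sn] unfolding eq .
  have "(\<lambda>n. integral\<^sup>L mu (f n)) sums (\<integral>z. heat_ker u x z * heat_ker v y z \<partial>mu)"
    using sums_integral[OF I AEs sn] unfolding eq .
  moreover have "integral\<^sup>L mu (f n) = exp (- (real n * (u + v))) * poly (L n) x * poly (L n) y" for n
  proof -
    have "exp (- (real n * (u + v))) = exp (- (real n * u)) * exp (- (real n * v))"
      by (simp add: distrib_left flip: exp_add)
    then show ?thesis unfolding f_def using L_integral_heat_ker(2)[OF v, of n y] by simp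
  qed
  moreover have "(\<lambda>n. exp (- (real n * (u + v))) * poly (L n) x * poly (L n) y) sums heat_ker (u + v) x y"
    using u v by (intro heat_ker_sums) auto
  ultimately show "(\<integral>z. heat_ker u x z * heat_ker v y z \<partial>mu) = heat_ker (u + v) x y"
    by (auto dest: sums_unique2)
qed

text \<open>\<open>L 0\<close> is a nonzero constant, and the eigenvalue belonging to it is 1 at
  every time.\<close>

lemma heat_ker_mass:
  assumes u: "u > 0" and x: "x > 0"
  shows "(\<integral>\<^sup>+y. ennreal (heat_ker u x y) \<partial>mu) = 1"
proof -
  obtain c where c: "L 0 = [:c:]" using L by (metis normalized_laguerre_def degree_eq_zeroE)
  have "c \<noteq> 0" using L_orthonormal[of 0 0] by (auto simp: c has_bochner_integral_iff)
  moreover have "integrable mu (\<lambda>z. c * heat_ker u x z)" "(\<integral>z. c * heat_ker u x z \<partial>mu) = c"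
    using L_integral_heat_ker(1,2)[OF u, of 0 x] by (auto simp: c)
  ultimately have "integrable mu (\<lambda>z. heat_ker u x z)" "(\<integral>z. heat_ker u x z \<partial>mu) = 1" by auto
  then show ?thesis using heat_ker_pos[OF u] x
    by (subst nn_integral_eq_integral) (auto intro!: AE_I2 less_imp_le)
qed

lemma chapman_kolmogorov:
  assumes "u > 0" "v > 0" "x > 0" "y > 0"
  shows "(\<integral>\<^sup>+z. ennreal (heat_ker u x z) * ennreal (heat_ker v z y) \<partial>mu) = ennreal (heat_ker (u + v) x y)"
proof -
  have "(\<integral>\<^sup>+z. ennreal (heat_ker u x z) * ennreal (heat_ker v z y) \<partial>mu) = (\<integral>\<^sup>+z. ennreal (heat_ker u x z * heat_ker v y z) \<partial>mu)"
    using assms heat_ker_pos by (intro nn_integral_cong) (auto simp: ennreal_mult'[symmetric] less_imp_le heat_ker_sym[of v y])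
  also have "\<dots> = ennreal (heat_ker (u + v) x y)"
    using chapman_kolmogorov_real[of u v x y] assms heat_ker_pos
    by (subst nn_integral_eq_integral) (auto intro!: AE_I2 mult_nonneg_nonneg less_imp_le)
  finally show ?thesis .
qed

end

lemma borel_measurable_indicator_Ioc [measurable (raw)]:
  fixes f g :: "'a \<Rightarrow> real"
  assumes [measurable]: "f \<in> borel_measurable N" "g \<in> borel_measurable N"
  shows "(\<lambda>w. indicator {0<..f w} (g w) :: ennreal) \<in> borel_measurable N"
  unfolding indicator_def greaterThanAtMost_iff by measurable

context laguerre_semigroup
begin

section \<open>Time averages and their maximal function\<close>

definition heat_op :: "real \<Rightarrow> (real \<Rightarrow> ennreal) \<Rightarrow> real \<Rightarrow> ennreal" where
  "heat_op u F x = (\<integral>\<^sup>+y. ennreal (heat_ker u x y) * F y \<partial>mu)"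

lemma borel_measurable_heat_op [measurable (raw)]:
  assumes [measurable]: "F \<in> borel_measurable half_line" "f \<in> borel_measurable N" "g \<in> borel_measurable N"
  shows "(\<lambda>w. heat_op (f w) F (g w)) \<in> borel_measurable N"
  unfolding heat_op_def by measurable

lemma heat_op_semigroup:
  assumes [measurable]: "F \<in> borel_measurable half_line" and uv: "u > 0" "v > 0" "x > 0"
  shows "heat_op u (heat_op v F) x = heat_op (u + v) F x"
proof -
  interpret P: pair_sigma_finite mu mu ..
  have "heat_op u (heat_op v F) x = (\<integral>\<^sup>+z. \<integral>\<^sup>+y. ennreal (heat_ker u x z) * (ennreal (heat_ker v z y) * F y) \<partial>mu \<partial>mu)"
    unfolding heat_op_def by (intro nn_integral_cong nn_integral_cmult[symmetric]) measurable
  also have "\<dots> = (\<integral>\<^sup>+y. \<integral>\<^sup>+z. ennreal (heat_ker u x z) * (ennreal (heat_ker v z y) * F y) \<partial>mu \<partial>mu)"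
    by (rule P.Fubini'[symmetric]) measurable
  also have "\<dots> = (\<integral>\<^sup>+y. (\<integral>\<^sup>+z. ennreal (heat_ker u x z) * ennreal (heat_ker v z y) \<partial>mu) * F y \<partial>mu)"
    unfolding mult.assoc[symmetric] by (intro nn_integral_cong nn_integral_multc) measurable
  also have "\<dots> = heat_op (u + v) F x"
    unfolding heat_op_def using uv by (intro nn_integral_cong) (simp add: chapman_kolmogorov)
  finally show ?thesis .
qed

lemma heat_op_integral:
  assumes [measurable]: "F \<in> borel_measurable half_line" and u: "u > 0"
  shows "(\<integral>\<^sup>+x. heat_op u F x \<partial>mu) = (\<integral>\<^sup>+x. F x \<partial>mu)"
proof -
  interpret P: pair_sigma_finite mu mu ..
  have "(\<integral>\<^sup>+x. heat_op u F x \<partial>mu) = (\<integral>\<^sup>+y. \<integral>\<^sup>+x. ennreal (heat_ker u x y) * F y \<partial>mu \<partial>mu)"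
    unfolding heat_op_def by (rule P.Fubini'[symmetric]) measurable
  also have "\<dots> = (\<integral>\<^sup>+y. (\<integral>\<^sup>+x. ennreal (heat_ker u y x) \<partial>mu) * F y \<partial>mu)"
    by (intro nn_integral_cong) (subst heat_ker_sym, rule nn_integral_multc, measurable)
  also have "\<dots> = (\<integral>\<^sup>+y. F y \<partial>mu)" using u by (intro nn_integral_cong) (simp add: heat_ker_mass)
  finally show ?thesis .
qed

lemma heat_op_mono: "(\<And>y. y > 0 \<Longrightarrow> F y \<le> G y) \<Longrightarrow> heat_op u F x \<le> heat_op u G x"
  unfolding heat_op_def by (intro nn_integral_mono mult_left_mono) auto

lemma heat_op_add:
  assumes [measurable]: "F \<in> borel_measurable half_line" "G \<in> borel_measurable half_line"
  shows "heat_op u (\<lambda>y. F y + G y) x = heat_op u F x + heat_op u G x"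
  unfolding heat_op_def distrib_left by (intro nn_integral_add) measurable

lemma heat_op_cmult:
  assumes [measurable]: "F \<in> borel_measurable half_line"
  shows "heat_op u (\<lambda>y. c * F y) x = c * heat_op u F x"
  unfolding heat_op_def by (subst nn_integral_cmult[symmetric]) (auto intro!: nn_integral_cong simp: mult.left_commute)

definition time_int :: "real \<Rightarrow> (real \<Rightarrow> ennreal) \<Rightarrow> real \<Rightarrow> ennreal" where
  "time_int a F x = (\<integral>\<^sup>+u. heat_op u F x * indicator {0<..a} u \<partial>half_line)"

lemma borel_measurable_time_int [measurable (raw)]:
  assumes [measurable]: "F \<in> borel_measurable half_line" "g \<in> borel_measurable N"
  shows "(\<lambda>w. time_int a F (g w)) \<in> borel_measurable N"
  unfolding time_int_def by measurable

lemma time_int_mono_time: "a \<le> c \<Longrightarrow> time_int a F x \<le> time_int c F x"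
  unfolding time_int_def by (intro nn_integral_mono) (auto split: split_indicator)

lemma time_int_0: "time_int 0 F x = 0"
  unfolding time_int_def by simp

text \<open>The semigroup law moves the interval \<open>{h<..h + a}\<close> back to
  \<open>{0<..a}\<close>. For \<open>a = real N * h\<close> this is the recursion required of
  \<open>A\<close> in \<open>hopf_maximal\<close>, so integrals up to multiples of \<open>h\<close>
  are exactly discrete ergodic sums.\<close>

lemma time_int_shift:
  assumes [measurable]: "F \<in> borel_measurable half_line" and h: "h > 0" and a: "a \<ge> 0" and x: "x > 0"
  shows "time_int (h + a) F x = time_int h F x + (\<integral>\<^sup>+y. ennreal (heat_ker h x y) * time_int a F y \<partial>mu)"
proof -
  interpret P: pair_sigma_finite half_line mu ..
  have "(\<integral>\<^sup>+y. ennreal (heat_ker h x y) * time_int a F y \<partial>mu) =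
      (\<integral>\<^sup>+y. \<integral>\<^sup>+u. ennreal (heat_ker h x y) * (heat_op u F y * indicator {0<..a} u) \<partial>half_line \<partial>mu)"
    unfolding time_int_def by (intro nn_integral_cong nn_integral_cmult[symmetric]) measurable
  also have "\<dots> = (\<integral>\<^sup>+u. \<integral>\<^sup>+y. ennreal (heat_ker h x y) * (heat_op u F y * indicator {0<..a} u) \<partial>mu \<partial>half_line)"
    by (rule P.Fubini') measurable
  also have "\<dots> = (\<integral>\<^sup>+u. heat_op h (heat_op u F) x * indicator {0<..a} u \<partial>half_line)"
    unfolding mult.assoc[symmetric] heat_op_def[of h] by (intro nn_integral_cong nn_integral_multc) measurable
  also have "\<dots> = (\<integral>\<^sup>+u. heat_op (h + u) F x * indicator {0<..a} u \<partial>half_line)"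
    using h x by (intro nn_integral_cong) (simp add: heat_op_semigroup)
  also have "\<dots> = (\<integral>\<^sup>+u. heat_op (h + 1 * u) F x * indicator {h<..h + a} (h + 1 * u) \<partial>lborel)"
    unfolding nn_integral_half_line using h a by (intro nn_integral_cong) (auto split: split_indicator)
  also have "\<dots> = (\<integral>\<^sup>+u. heat_op u F x * indicator {h<..h + a} u \<partial>lborel)"
    using nn_integral_real_affine[of "\<lambda>u. heat_op u F x * indicator {h<..h + a} u" 1 h] by simp
  also have "\<dots> = (\<integral>\<^sup>+u. heat_op u F x * indicator {h<..h + a} u \<partial>half_line)"
    unfolding nn_integral_half_line using h a by (intro nn_integral_cong) (auto split: split_indicator)
  finally have "time_int h F x + (\<integral>\<^sup>+y. ennreal (heat_ker h x y) * time_int a F y \<partial>mu) =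
     (\<integral>\<^sup>+u. heat_op u F x * indicator {0<..h} u + heat_op u F x * indicator {h<..h + a} u \<partial>half_line)"
    unfolding time_int_def by (subst nn_integral_add) auto
  also have "\<dots> = time_int (h + a) F x"
    unfolding time_int_def using h a by (intro nn_integral_cong) (auto split: split_indicator)
  finally show ?thesis ..
qed

lemma time_int_integral:
  assumes [measurable]: "F \<in> borel_measurable half_line" and h: "h > 0"
  shows "(\<integral>\<^sup>+x. time_int h F x \<partial>mu) = ennreal h * (\<integral>\<^sup>+x. F x \<partial>mu)"
proof -
  interpret P: pair_sigma_finite half_line mu ..
  have "(\<integral>\<^sup>+x. time_int h F x \<partial>mu) = (\<integral>\<^sup>+u. \<integral>\<^sup>+x. heat_op u F x * indicator {0<..h} u \<partial>mu \<partial>half_line)"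
    unfolding time_int_def by (rule P.Fubini') measurable
  also have "\<dots> = (\<integral>\<^sup>+u. (\<integral>\<^sup>+x. heat_op u F x \<partial>mu) * indicator {0<..h} u \<partial>half_line)"
    by (intro nn_integral_cong nn_integral_multc) measurable
  also have "\<dots> = (\<integral>\<^sup>+u. (\<integral>\<^sup>+x. F x \<partial>mu) * indicator {0<..h} u \<partial>lborel)"
    unfolding nn_integral_half_line by (intro nn_integral_cong) (auto split: split_indicator simp: heat_op_integral)
  also have "\<dots> = ennreal h * (\<integral>\<^sup>+x. F x \<partial>mu)"
    using h by (subst nn_integral_cmult_indicator) (auto simp: mult.commute)
  finally show ?thesis .
qed

text \<open>The averages over dyadic rational times suffice up to a factor 2, and countably many of them keep
  the supremum measurable.\<close>

definition max_avg :: "(real \<Rightarrow> ennreal) \<Rightarrow> real \<Rightarrow> ennreal" where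
  "max_avg F x = (SUP j. SUP N. ennreal (2 ^ j / real (Suc N)) * time_int (real (Suc N) / 2 ^ j) F x)"

lemma borel_measurable_max_avg [measurable (raw)]:
  assumes [measurable]: "F \<in> borel_measurable half_line" "g \<in> borel_measurable N"
  shows "(\<lambda>w. max_avg F (g w)) \<in> borel_measurable N"
  unfolding max_avg_def by measurable

lemma time_int_le_max_avg:
  assumes a: "a > 0"
  shows "time_int a F x \<le> ennreal (2 * a) * max_avg F x"
proof -
  obtain j where j: "(1 / 2) ^ j < a" using real_arch_pow_inv[of a "1 / 2"] a by auto
  \<comment> \<open>\<open>Suc N\<close> is the ceiling of \<open>a * 2 ^ j\<close>; since this
    number is at least 1, rounding up at most doubles it.\<close>
  define N where "N = nat \<lceil>a * 2 ^ j\<rceil> - 1"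
  have pos: "a * 2 ^ j > 0" using a by simp
  have N: "real (Suc N) = of_int \<lceil>a * 2 ^ j\<rceil>" using pos by (simp add: N_def)
  have lo: "a * 2 ^ j \<le> real (Suc N)" unfolding N by (rule le_of_int_ceiling)
  have "real (Suc N) \<le> a * 2 ^ j + 1" unfolding N using of_int_ceiling_le_add_one .
  moreover have "1 \<le> a * 2 ^ j" using j by (simp add: power_one_over field_simps)
  ultimately have hi: "real (Suc N) \<le> 2 * a * 2 ^ j" by simp
  define c where "c = real (Suc N) / 2 ^ j"
  have c: "c > 0" "a \<le> c" "c \<le> 2 * a" using lo hi by (auto simp: c_def field_simps)
  have "time_int a F x \<le> time_int c F x" by (rule time_int_mono_time[OF c(2)])
  also have "\<dots> = ennreal c * (ennreal (1 / c) * time_int c F x)"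
    using c by (simp add: mult.assoc[symmetric] ennreal_mult'[symmetric])
  also have "ennreal (1 / c) * time_int c F x \<le> max_avg F x"
    unfolding max_avg_def by (rule SUP_upper2[of j], simp, rule SUP_upper2[of N]) (auto simp: c_def)
  also have "ennreal c \<le> ennreal (2 * a)" using c by (intro ennreal_leI)
  finally show ?thesis by (simp add: mult_left_mono mult_right_mono)
qed

lemma max_avg_mono:
  assumes "\<And>y. y > 0 \<Longrightarrow> F y \<le> G y"
  shows "max_avg F x \<le> max_avg G x"
  unfolding max_avg_def time_int_def
  by (intro SUP_mono' mult_left_mono nn_integral_mono mult_right_mono heat_op_mono assms) auto

lemma max_avg_add:
  assumes [measurable]: "F \<in> borel_measurable half_line" "G \<in> borel_measurable half_line"
  shows "max_avg (\<lambda>y. F y + G y) x \<le> max_avg F x + max_avg G x"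
proof -
  have time_int_add: "time_int a (\<lambda>y. F y + G y) x = time_int a F x + time_int a G x" for a
    unfolding time_int_def by (subst nn_integral_add[symmetric]) (auto simp: heat_op_add distrib_right)
  have "ennreal (2 ^ j / real (Suc N)) * time_int (real (Suc N) / 2 ^ j) F x \<le> max_avg F x" for F j N
    unfolding max_avg_def by (rule SUP_upper2[of j], simp, rule SUP_upper2[of N]) auto
  then show ?thesis unfolding max_avg_def[of "\<lambda>y. F y + G y"] time_int_add distrib_left
    by (intro SUP_least add_mono)
qed

lemma max_avg_cmult:
  assumes [measurable]: "F \<in> borel_measurable half_line"
  shows "max_avg (\<lambda>y. c * F y) x = c * max_avg F x"
proof -
  have "time_int a (\<lambda>y. c * F y) x = c * time_int a F x" for a
    unfolding time_int_def by (subst nn_integral_cmult[symmetric]) (auto simp: heat_op_cmult mult.assoc)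
  then show ?thesis unfolding max_avg_def SUP_mult_left_ennreal by (simp add: mult.left_commute)
qed

text \<open>Hopf's theorem is applied to \<open>time_int h F\<close> with step
  \<open>h = 1 / 2 ^ j\<close>; height and integral both carry the factor \<open>h\<close>, which
  cancels. Refining \<open>j\<close> replaces \<open>N\<close> by \<open>2 * N\<close>, so the sets
  increase and no constant is lost in the limit.\<close>

theorem max_avg_weak_type:
  assumes F[measurable]: "F \<in> borel_measurable half_line" and s: "s > 0"
  shows "ennreal s * emeasure mu {x \<in> space mu. ennreal s < max_avg F x} \<le> (\<integral>\<^sup>+x. F x \<partial>mu)"
proof -
  define E where "E = (\<lambda>j. {x \<in> space mu. \<exists>N. ennreal (real N * (s / 2 ^ j)) < time_int (real N / 2 ^ j) F x})"
  have Em[measurable]: "E j \<in> sets mu" for j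
  proof -
    have "E j = (\<Union>N. {x \<in> space mu. ennreal (real N * (s / 2 ^ j)) < time_int (real N / 2 ^ j) F x})" by (auto simp: E_def)
    moreover have "{x \<in> space mu. ennreal (real N * (s / 2 ^ j)) < time_int (real N / 2 ^ j) F x} \<in> sets mu" for N
      by measurable
    ultimately show ?thesis by auto
  qed
  have weak: "ennreal s * emeasure mu (E j) \<le> (\<integral>\<^sup>+x. F x \<partial>mu)" for j
  proof -
    define h :: real where "h = 1 / 2 ^ j"
    have h: "h > 0" by (simp add: h_def)
    have "ennreal (s * h) * emeasure mu {x \<in> space mu. \<exists>N. ennreal (real N * (s * h)) < time_int (real N * h) F x} \<le> (\<integral>\<^sup>+x. time_int h F x \<partial>mu)"
    proof (rule hopf_maximal[where k = "\<lambda>x y. ennreal (heat_ker h x y)"])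
      show "sigma_finite_measure mu" ..
      show "time_int (real (Suc N) * h) F x = time_int h F x + (\<integral>\<^sup>+y. ennreal (heat_ker h x y) * time_int (real N * h) F y \<partial>mu)"
        if "x \<in> space mu" for N x
        using time_int_shift[OF F h, of "real N * h" x] that h by (simp add: distrib_right)
    qed (use h in \<open>auto simp: heat_ker_sym heat_ker_mass time_int_0\<close>)
    also have "\<dots> = ennreal h * (\<integral>\<^sup>+x. F x \<partial>mu)" by (rule time_int_integral[OF F h])
    also have "{x \<in> space mu. \<exists>N. ennreal (real N * (s * h)) < time_int (real N * h) F x} = E j"
      by (simp add: E_def h_def)
    also have "ennreal (s * h) = ennreal h * ennreal s" using h s by (simp add: ennreal_mult mult.commute)
    finally have "ennreal h * (ennreal s * emeasure mu (E j)) \<le> ennreal h * (\<integral>\<^sup>+x. F x \<partial>mu)"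
      by (simp only: mult.assoc)
    then show ?thesis using h by (subst (asm) ennreal_mult_le_mult_iff) auto
  qed
  have inc: "incseq E"
  proof (rule incseq_SucI, rule subsetI)
    fix j x assume "x \<in> E j"
    then obtain N where x: "x \<in> space mu" and N: "ennreal (real N * (s / 2 ^ j)) < time_int (real N / 2 ^ j) F x"
      by (auto simp: E_def)
    have "real (2 * N) / 2 ^ Suc j = real N / 2 ^ j" "real (2 * N) * (s / 2 ^ Suc j) = real N * (s / 2 ^ j)" by auto
    then show "x \<in> E (Suc j)" using x N unfolding E_def by (auto intro!: exI[of _ "2 * N"])
  qed
  have "{x \<in> space mu. ennreal s < max_avg F x} \<subseteq> (\<Union>j. E j)"
  proof
    fix x assume "x \<in> {x \<in> space mu. ennreal s < max_avg F x}"
    then obtain j N where x: "x \<in> space mu" and jN: "ennreal s < ennreal (2 ^ j / real (Suc N)) * time_int (real (Suc N) / 2 ^ j) F x"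
      by (auto simp: max_avg_def less_SUP_iff)
    have "ennreal (real (Suc N) * (s / 2 ^ j)) < time_int (real (Suc N) / 2 ^ j) F x"
    proof (rule ccontr)
      assume "\<not> ?thesis"
      then have "ennreal (2 ^ j / real (Suc N)) * time_int (real (Suc N) / 2 ^ j) F x \<le>
          ennreal (2 ^ j / real (Suc N)) * ennreal (real (Suc N) * (s / 2 ^ j))"
        by (intro mult_left_mono) auto
      also have "\<dots> = ennreal s" using s by (subst ennreal_mult[symmetric]) auto
      finally show False using jN by simp
    qed
    then have "x \<in> E j" unfolding E_def using x by blast
    then show "x \<in> (\<Union>j. E j)" by blast
  qed
  then have "ennreal s * emeasure mu {x \<in> space mu. ennreal s < max_avg F x} \<le> ennreal s * emeasure mu (\<Union>j. E j)"
    using Em by (intro mult_left_mono emeasure_mono) auto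
  also have "emeasure mu (\<Union>j. E j) = (SUP j. emeasure mu (E j))"
    using inc Em by (intro SUP_emeasure_incseq[symmetric]) auto
  also have "ennreal s * (SUP j. emeasure mu (E j)) = (SUP j. ennreal s * emeasure mu (E j))"
    by (rule SUP_mult_left_ennreal)
  also have "\<dots> \<le> (\<integral>\<^sup>+x. F x \<partial>mu)" by (intro SUP_least weak)
  finally show ?thesis .
qed

text \<open>\<open>(c + u) powr (- 1 - \<nu>)\<close> is a superposition of indicators of \<open>{0<..a}\<close>, so the integral is a
  superposition of averages over \<open>{0<..a}\<close>.\<close>

lemma subordinated_le_max_avg:
  assumes F[measurable]: "F \<in> borel_measurable half_line" and \<nu>: "\<nu> > 0" and c: "c > 0"
  shows "(\<integral>\<^sup>+u. ennreal ((c + u) powr (- 1 - \<nu>)) * heat_op u F x \<partial>half_line) \<le> ennreal (2 * (1 + \<nu>) * (c powr (- \<nu>) / \<nu>)) * max_avg F x"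
proof -
  interpret P: pair_sigma_finite half_line half_line ..
  \<comment> \<open>Minus the derivative of \<open>(c + a) powr (- 1 - \<nu>)\<close> in
    \<open>a\<close>. Enlarging \<open>a\<close> to \<open>c + a\<close> in
    \<open>k a * (2 * a)\<close> turns the remaining integral into a power tail of size
    \<open>c powr (- \<nu>) / \<nu>\<close>.\<close>
  define k where "k = (\<lambda>a. (1 + \<nu>) * (c + a) powr (- 1 - (1 + \<nu>)))"
  have km[measurable]: "k \<in> borel_measurable borel" unfolding k_def by measurable
  have tail: "ennreal ((c + u) powr (- 1 - \<nu>)) = (\<integral>\<^sup>+a. ennreal (k a) * indicator {u..} a \<partial>half_line)" if u: "u > 0" for u
  proof -
    have "(\<integral>\<^sup>+a. ennreal (k a) * indicator {u..} a \<partial>half_line) =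
        (\<integral>\<^sup>+a. ennreal (1 + \<nu>) * (ennreal ((c + a) powr (- 1 - (1 + \<nu>))) * indicator {u..} a) \<partial>lborel)"
      unfolding nn_integral_half_line using u \<nu>
      by (intro nn_integral_cong) (auto simp: k_def ennreal_mult split: split_indicator)
    also have "\<dots> = ennreal (1 + \<nu>) * (\<integral>\<^sup>+a. ennreal ((c + a) powr (- 1 - (1 + \<nu>))) * indicator {u..} a \<partial>lborel)"
    proof (rule nn_integral_cmult)
      have "(\<lambda>a. ennreal ((c + a) powr (- 1 - (1 + \<nu>))) * indicator {u..} a) \<in> borel_measurable borel"
        by measurable
      then show "(\<lambda>a. ennreal ((c + a) powr (- 1 - (1 + \<nu>))) * indicator {u..} a) \<in> borel_measurable lborel"
        by simp
    qed
    also have "(\<integral>\<^sup>+a. ennreal ((c + a) powr (- 1 - (1 + \<nu>))) * indicator {u..} a \<partial>lborel) = ennreal ((c + u) powr (- (1 + \<nu>)) / (1 + \<nu>))"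
      using u c \<nu> by (intro nn_integral_powr_tail_lborel) auto
    also have "ennreal (1 + \<nu>) * \<dots> = ennreal ((c + u) powr (- 1 - \<nu>))"
      using \<nu> by (subst ennreal_mult[symmetric]) auto
    finally show ?thesis ..
  qed
  have "(\<integral>\<^sup>+u. ennreal ((c + u) powr (- 1 - \<nu>)) * heat_op u F x \<partial>half_line) =
      (\<integral>\<^sup>+u. \<integral>\<^sup>+a. ennreal (k a) * indicator {u..} a * heat_op u F x \<partial>half_line \<partial>half_line)"
    by (intro nn_integral_cong) (simp add: tail nn_integral_multc)
  also have "\<dots> = (\<integral>\<^sup>+u. \<integral>\<^sup>+a. ennreal (k a) * (heat_op u F x * indicator {0<..a} u) \<partial>half_line \<partial>half_line)"
    by (intro nn_integral_cong) (auto split: split_indicator)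
  also have "\<dots> = (\<integral>\<^sup>+a. \<integral>\<^sup>+u. ennreal (k a) * (heat_op u F x * indicator {0<..a} u) \<partial>half_line \<partial>half_line)"
    by (rule P.Fubini') measurable
  also have "\<dots> = (\<integral>\<^sup>+a. ennreal (k a) * time_int a F x \<partial>half_line)"
    unfolding time_int_def by (intro nn_integral_cong nn_integral_cmult) measurable
  also have "\<dots> \<le> (\<integral>\<^sup>+a. ennreal (2 * (1 + \<nu>)) * (ennreal ((c + a) powr (- 1 - \<nu>)) * indicator {0..} a) * max_avg F x \<partial>half_line)"
  proof (intro nn_integral_mono)
    fix a assume "a \<in> space half_line"
    then have a: "a > 0" by simp
    have "ennreal (k a) * time_int a F x \<le> ennreal (k a) * (ennreal (2 * a) * max_avg F x)"
      by (intro mult_left_mono time_int_le_max_avg a) auto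
    also have "\<dots> = ennreal (k a * (2 * a)) * max_avg F x"
    proof -
      have "0 \<le> k a" using \<nu> by (simp add: k_def)
      then show ?thesis by (simp only: ennreal_mult' mult.assoc)
    qed
    also have "k a * (2 * a) \<le> k a * (2 * (c + a))" using a c \<nu> by (intro mult_left_mono) (auto simp: k_def)
    also have "k a * (2 * (c + a)) = 2 * (1 + \<nu>) * ((c + a) powr (- 1 - (1 + \<nu>)) * (c + a) powr 1)"
      using a c by (simp add: k_def algebra_simps)
    also have "(c + a) powr (- 1 - (1 + \<nu>)) * (c + a) powr 1 = (c + a) powr (- 1 - \<nu>)"
      by (subst powr_add[symmetric]) simp
    finally have "ennreal (k a) * time_int a F x \<le> ennreal (2 * (1 + \<nu>) * (c + a) powr (- 1 - \<nu>)) * max_avg F x"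
      by (simp add: mult_right_mono ennreal_leI)
    also have "\<dots> = ennreal (2 * (1 + \<nu>)) * (ennreal ((c + a) powr (- 1 - \<nu>)) * indicator {0..} a) * max_avg F x"
      using a \<nu> by (simp add: ennreal_mult)
    finally show "ennreal (k a) * time_int a F x \<le> ennreal (2 * (1 + \<nu>)) * (ennreal ((c + a) powr (- 1 - \<nu>)) * indicator {0..} a) * max_avg F x" .
  qed
  also have "\<dots> = ennreal (2 * (1 + \<nu>)) * (\<integral>\<^sup>+a. ennreal ((c + a) powr (- 1 - \<nu>)) * indicator {0..} a \<partial>half_line) * max_avg F x"
    by (subst nn_integral_multc, measurable, subst nn_integral_cmult, measurable)
  also have "\<dots> \<le> ennreal (2 * (1 + \<nu>)) * ennreal ((c + 0) powr (- \<nu>) / \<nu>) * max_avg F x"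
    using c \<nu> by (intro mult_right_mono mult_left_mono nn_integral_powr_tail) auto
  also have "\<dots> = ennreal (2 * (1 + \<nu>) * (c powr (- \<nu>) / \<nu>)) * max_avg F x"
    using \<nu> by (subst ennreal_mult'[of "2 * (1 + \<nu>)"]) auto
  finally show ?thesis .
qed

end

section \<open>Poisson integrals\<close>

locale laguerre_poisson = laguerre_semigroup +
  fixes m \<nu> :: real
  assumes m: "m \<ge> 0" and \<nu>: "\<nu> > 0"
begin

abbreviation phi :: "real \<Rightarrow> real" where "phi \<equiv> laguerre_phi m \<nu>"

abbreviation pk :: "real \<Rightarrow> real \<Rightarrow> real \<Rightarrow> real \<Rightarrow> real" where "pk \<equiv> poisson_ker (\<alpha> + 1) m \<nu>"

lemma pk_eq: "pk t x y u = exp (- (t\<^sup>2 / (4 * u))) * u powr (- 1 - \<nu>) * (exp (- (m * u)) * heat_ker u x y)"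
  by (simp add: poisson_ker_def heat_ker_def)

lemma phi_measurable [measurable]: "phi \<in> borel_measurable borel"
  unfolding laguerre_phi_def by measurable

lemma phi_measurable_half_line [measurable]: "phi \<in> borel_measurable half_line"
  by (rule measurable_compose[OF measurable_half_line_id phi_measurable])

text \<open>The normalizing factor is omitted. With \<open>y\<close> outermost the kernel bounds can
  be inserted directly; Tonelli's theorem restores the order of \<open>poisson\<close>.\<close>

definition poisson_op :: "real \<Rightarrow> (real \<Rightarrow> ennreal) \<Rightarrow> real \<Rightarrow> ennreal" where
  "poisson_op t F x = (\<integral>\<^sup>+y. (\<integral>\<^sup>+u. ennreal (pk t x y u) \<partial>half_line) * F y \<partial>mu)"

definition Phi_int :: "(real \<Rightarrow> ennreal) \<Rightarrow> ennreal" where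
  "Phi_int F = (\<integral>\<^sup>+y. F y * ennreal (phi y) \<partial>mu)"

lemma poisson_op_swap:
  assumes [measurable]: "F \<in> borel_measurable half_line" and x: "x > 0"
  shows "poisson_op t F x = (\<integral>\<^sup>+u. ennreal (exp (- (t\<^sup>2 / (4 * u))) * u powr (- 1 - \<nu>)) * (ennreal (exp (- (m * u))) * heat_op u F x) \<partial>half_line)"
proof -
  interpret P: pair_sigma_finite half_line mu ..
  have "poisson_op t F x = (\<integral>\<^sup>+y. \<integral>\<^sup>+u. ennreal (pk t x y u) * F y \<partial>half_line \<partial>mu)"
    unfolding poisson_op_def by (intro nn_integral_cong nn_integral_multc[symmetric]) measurable
  also have "\<dots> = (\<integral>\<^sup>+u. \<integral>\<^sup>+y. ennreal (pk t x y u) * F y \<partial>mu \<partial>half_line)"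
    by (rule P.Fubini') measurable
  also have "\<dots> = (\<integral>\<^sup>+u. \<integral>\<^sup>+y. ennreal (exp (- (t\<^sup>2 / (4 * u))) * u powr (- 1 - \<nu>)) * (ennreal (exp (- (m * u))) * (ennreal (heat_ker u x y) * F y)) \<partial>mu \<partial>half_line)"
    unfolding pk_eq by (intro nn_integral_cong) (simp add: ennreal_mult' mult.assoc)
  also have "\<dots> = (\<integral>\<^sup>+u. ennreal (exp (- (t\<^sup>2 / (4 * u))) * u powr (- 1 - \<nu>)) * (ennreal (exp (- (m * u))) * heat_op u F x) \<partial>half_line)"
    unfolding heat_op_def by (intro nn_integral_cong, subst nn_integral_cmult, measurable, subst nn_integral_cmult, measurable)
  finally show ?thesis .
qed

lemma heat_integrand_eq: 
  "u > 0 \<Longrightarrow> heat_integrand \<alpha> L m f u x y = exp (- (m * u)) * heat_ker u x y * f y * (y powr \<alpha> * exp (- y))"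
  by (simp add: heat_integrand_def heat_kernel_heat_ker)

lemma heat_integrand_measurable [measurable]:
  assumes [measurable]: "f \<in> borel_measurable half_line" and u: "u > 0"
  shows "heat_integrand \<alpha> L m f u x \<in> borel_measurable half_line"
  unfolding heat_integrand_eq[OF u, abs_def] by measurable

lemma nn_integral_heat_integrand:
  assumes [measurable]: "f \<in> borel_measurable half_line" and u: "u > 0" "x > 0"
  shows "(\<integral>\<^sup>+y. ennreal \<bar>heat_integrand \<alpha> L m f u x y\<bar> \<partial>half_line) = ennreal (exp (- (m * u))) * heat_op u (\<lambda>y. ennreal \<bar>f y\<bar>) x"
proof -
  have "(\<integral>\<^sup>+y. ennreal \<bar>heat_integrand \<alpha> L m f u x y\<bar> \<partial>half_line) =
     (\<integral>\<^sup>+y. ennreal (exp (- (m * u))) * (ennreal (heat_ker u x y) * ennreal \<bar>f y\<bar>) * ennreal (y powr \<alpha> * exp (- y)) \<partial>half_line)"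
    using u heat_ker_pos[of u x] unfolding heat_integrand_eq[OF u(1)]
    by (intro nn_integral_cong) (simp add: abs_mult ennreal_mult'[symmetric] ennreal_mult''[symmetric] abs_of_pos mult.assoc)
  also have "\<dots> = (\<integral>\<^sup>+y. ennreal (exp (- (m * u))) * (ennreal (heat_ker u x y) * ennreal \<bar>f y\<bar>) \<partial>mu)"
    by (rule nn_integral_mu[symmetric]) measurable
  also have "\<dots> = ennreal (exp (- (m * u))) * heat_op u (\<lambda>y. ennreal \<bar>f y\<bar>) x"
    unfolding heat_op_def by (rule nn_integral_cmult) measurable
  finally show ?thesis .
qed

lemma heat_op_finite:
  assumes [measurable]: "f \<in> borel_measurable half_line" and u: "u > 0" "x > 0" and fin: "Phi_int (\<lambda>y. ennreal \<bar>f y\<bar>) < \<infinity>"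
  shows "heat_op u (\<lambda>y. ennreal \<bar>f y\<bar>) x < \<infinity>"
proof -
  obtain C where C: "C > 0" "\<And>y. y \<ge> 0 \<Longrightarrow> lag_kernel (\<alpha> + 1) (exp (- u)) x y \<le> C * phi y"
    using lag_kernel_laguerre_phi[OF b_pos, of "exp (- u)" x m \<nu>] u m \<nu> by auto
  have "heat_op u (\<lambda>y. ennreal \<bar>f y\<bar>) x \<le> (\<integral>\<^sup>+y. ennreal C * (ennreal \<bar>f y\<bar> * ennreal (phi y)) \<partial>mu)"
    unfolding heat_op_def
  proof (intro nn_integral_mono)
    fix y assume "y \<in> space mu"
    then have "ennreal (heat_ker u x y) \<le> ennreal (C * phi y)" using C(2)[of y] by (simp add: heat_ker_def ennreal_leI)
    then have "ennreal (heat_ker u x y) * ennreal \<bar>f y\<bar> \<le> ennreal (C * phi y) * ennreal \<bar>f y\<bar>" by (rule mult_right_mono) simp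
    then show "ennreal (heat_ker u x y) * ennreal \<bar>f y\<bar> \<le> ennreal C * (ennreal \<bar>f y\<bar> * ennreal (phi y))"
      using C(1) by (simp add: ennreal_mult' mult_ac)
  qed
  also have "\<dots> = ennreal C * Phi_int (\<lambda>y. ennreal \<bar>f y\<bar>)" unfolding Phi_int_def by (rule nn_integral_cmult) measurable
  also have "\<dots> < \<infinity>" using fin by (simp add: ennreal_mult_less_top)
  finally show ?thesis .
qed

lemma heat_integrable:
  assumes [measurable]: "f \<in> borel_measurable half_line" and u: "u > 0" "x > 0" and fin: "Phi_int (\<lambda>y. ennreal \<bar>f y\<bar>) < \<infinity>"
  shows "integrable half_line (heat_integrand \<alpha> L m f u x)"
proof (rule integrableI_bounded)
  show "(\<integral>\<^sup>+y. ennreal (norm (heat_integrand \<alpha> L m f u x y)) \<partial>half_line) < \<infinity>"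
    using nn_integral_heat_integrand[OF assms(1-3)] heat_op_finite[OF assms] by (simp add: ennreal_mult_less_top)
qed (use u in measurable)

lemma poisson_op_finite:
  assumes [measurable]: "f \<in> borel_measurable half_line" and t: "t > 0" "x > 0" and fin: "Phi_int (\<lambda>y. ennreal \<bar>f y\<bar>) < \<infinity>"
  shows "poisson_op t (\<lambda>y. ennreal \<bar>f y\<bar>) x < \<infinity>"
proof -
  obtain C where C: "C > 0" "\<And>y. y \<ge> 0 \<Longrightarrow> (\<integral>\<^sup>+u. ennreal (pk t x y u) \<partial>half_line) \<le> ennreal (C * phi y)"
    using poisson_ker_integral_upper[OF b_pos m \<nu>, of x t] t by auto
  have "poisson_op t (\<lambda>y. ennreal \<bar>f y\<bar>) x \<le> (\<integral>\<^sup>+y. ennreal C * (ennreal \<bar>f y\<bar> * ennreal (phi y)) \<partial>mu)"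
    unfolding poisson_op_def
  proof (intro nn_integral_mono)
    fix y assume "y \<in> space mu"
    then have "(\<integral>\<^sup>+u. ennreal (pk t x y u) \<partial>half_line) * ennreal \<bar>f y\<bar> \<le> ennreal (C * phi y) * ennreal \<bar>f y\<bar>"
      using C(2)[of y] by (intro mult_right_mono) auto
    then show "(\<integral>\<^sup>+u. ennreal (pk t x y u) \<partial>half_line) * ennreal \<bar>f y\<bar> \<le> ennreal C * (ennreal \<bar>f y\<bar> * ennreal (phi y))"
      using C(1) by (simp add: ennreal_mult' mult_ac)
  qed
  also have "\<dots> = ennreal C * Phi_int (\<lambda>y. ennreal \<bar>f y\<bar>)" unfolding Phi_int_def by (rule nn_integral_cmult) measurable
  also have "\<dots> < \<infinity>" using fin by (simp add: ennreal_mult_less_top)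
  finally show ?thesis .
qed

lemma heat_measurable [measurable (raw)]:
  assumes [measurable]: "f \<in> borel_measurable half_line" "g \<in> N \<rightarrow>\<^sub>M half_line" "h \<in> borel_measurable N"
  shows "(\<lambda>w. heat \<alpha> L m f (g w) (h w)) \<in> borel_measurable N"
proof -
  have g': "g w > 0" if "w \<in> space N" for w using measurable_space[OF assms(2) that] by simp
  have [measurable]: "g \<in> borel_measurable N"
    using measurable_compose[OF assms(2) measurable_half_line_id] by simp
  have "(\<lambda>w. \<integral>y. exp (- (m * g w)) * heat_ker (g w) (h w) y * f y * (y powr \<alpha> * exp (- y)) \<partial>half_line) \<in> borel_measurable N"
    by measurable
  also have "?this \<longleftrightarrow> ?thesis"
    using g' by (intro measurable_cong) (simp add: heat_def heat_integrand_eq)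
  finally show ?thesis .
qed

text \<open>Without integrability the Bochner integral is 0 by convention, so the bound holds in
  that case as well.\<close>

lemma abs_heat_le:
  assumes "f \<in> borel_measurable half_line" "u > 0" "x > 0"
  shows "ennreal \<bar>heat \<alpha> L m f u x\<bar> \<le> ennreal (exp (- (m * u))) * heat_op u (\<lambda>y. ennreal \<bar>f y\<bar>) x"
proof (cases "integrable half_line (heat_integrand \<alpha> L m f u x)")
  case True
  then have "ennreal (norm (heat \<alpha> L m f u x)) \<le> (\<integral>\<^sup>+y. ennreal (norm (heat_integrand \<alpha> L m f u x y)) \<partial>half_line)"
    unfolding heat_def by (rule integral_norm_bound_ennreal)
  then show ?thesis using nn_integral_heat_integrand[OF assms] by simp
qed (simp add: heat_def not_integrable_integral_eq)

lemma divide_powr_eq: "z / u powr (1 + \<nu>) = z * u powr (- 1 - \<nu>)"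
  using powr_minus_divide[of u "1 + \<nu>"] by simp

lemma nn_integral_poisson_integrand_le:
  assumes [measurable]: "f \<in> borel_measurable half_line" and x: "x > 0"
  shows "(\<integral>\<^sup>+u. ennreal \<bar>poisson_integrand \<alpha> L m \<nu> f t x u\<bar> \<partial>half_line) \<le> poisson_op t (\<lambda>y. ennreal \<bar>f y\<bar>) x"
proof -
  have nn_meas: "(\<lambda>y. ennreal \<bar>f y\<bar>) \<in> borel_measurable half_line" by measurable
  show ?thesis
    unfolding poisson_op_swap[OF nn_meas x] poisson_integrand_def divide_powr_eq
  proof (intro nn_integral_mono)
    fix u assume "u \<in> space half_line"
    then have u: "u > 0" by simp
    have "ennreal \<bar>exp (- (t\<^sup>2 / (4 * u))) * heat \<alpha> L m f u x * u powr (- 1 - \<nu>)\<bar> =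
       ennreal (exp (- (t\<^sup>2 / (4 * u))) * u powr (- 1 - \<nu>)) * ennreal \<bar>heat \<alpha> L m f u x\<bar>"
      by (simp add: abs_mult ennreal_mult'[symmetric] mult_ac)
    also have "\<dots> \<le> ennreal (exp (- (t\<^sup>2 / (4 * u))) * u powr (- 1 - \<nu>)) * (ennreal (exp (- (m * u))) * heat_op u (\<lambda>y. ennreal \<bar>f y\<bar>) x)"
      by (intro mult_left_mono abs_heat_le assms u x) auto
    finally show "ennreal \<bar>exp (- (t\<^sup>2 / (4 * u))) * heat \<alpha> L m f u x * u powr (- 1 - \<nu>)\<bar> \<le>
      ennreal (exp (- (t\<^sup>2 / (4 * u))) * u powr (- 1 - \<nu>)) * (ennreal (exp (- (m * u))) * heat_op u (\<lambda>y. ennreal \<bar>f y\<bar>) x)" .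
  qed
qed

lemma poisson_integrand_measurable [measurable (raw)]:
  assumes [measurable]: "f \<in> borel_measurable half_line" "g \<in> N \<rightarrow>\<^sub>M half_line" "h \<in> borel_measurable N"
  shows "(\<lambda>w. poisson_integrand \<alpha> L m \<nu> f t (h w) (g w)) \<in> borel_measurable N"
proof -
  have [measurable]: "g \<in> borel_measurable N"
    using measurable_compose[OF assms(2) measurable_half_line_id] by simp
  show ?thesis unfolding poisson_integrand_def by measurable
qed

lemma poisson_convergesI:
  assumes f[measurable]: "f \<in> borel_measurable half_line" and t: "t > 0" "x > 0" and fin: "Phi_int (\<lambda>y. ennreal \<bar>f y\<bar>) < \<infinity>"
  shows "poisson_converges \<alpha> L m \<nu> f t x"
  unfolding poisson_converges_def
proof (intro conjI allI impI)
  show "integrable half_line (heat_integrand \<alpha> L m f u x)" if "u > 0" for u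
    using heat_integrable[OF f that t(2) fin] .
  show "integrable half_line (poisson_integrand \<alpha> L m \<nu> f t x)"
  proof (rule integrableI_bounded)
    have "(\<lambda>u. poisson_integrand \<alpha> L m \<nu> f t x u) \<in> borel_measurable half_line" by measurable
    then show "poisson_integrand \<alpha> L m \<nu> f t x \<in> borel_measurable half_line" by simp
    show "(\<integral>\<^sup>+u. ennreal (norm (poisson_integrand \<alpha> L m \<nu> f t x u)) \<partial>half_line) < \<infinity>"
      using nn_integral_poisson_integrand_le[OF f t(2), of t] poisson_op_finite[OF f t fin] by (simp add: le_less_trans)
  qed
qed

lemma abs_poisson_le:
  assumes f: "f \<in> borel_measurable half_line" and x: "x > 0"
  shows "ennreal \<bar>poisson \<alpha> L m \<nu> f t x\<bar> \<le> ennreal (t powr (2 * \<nu>) / (4 powr \<nu> * Gamma \<nu>)) * poisson_op t (\<lambda>y. ennreal \<bar>f y\<bar>) x"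
proof -
  have G: "Gamma \<nu> > 0" using \<nu> by (rule Gamma_real_pos)
  have "ennreal \<bar>\<integral>u. poisson_integrand \<alpha> L m \<nu> f t x u \<partial>half_line\<bar> \<le> poisson_op t (\<lambda>y. ennreal \<bar>f y\<bar>) x"
  proof (cases "integrable half_line (poisson_integrand \<alpha> L m \<nu> f t x)")
    case True
    then show ?thesis
      using integral_norm_bound_ennreal[OF True] nn_integral_poisson_integrand_le[OF f x, of t] by simp
  qed (simp add: not_integrable_integral_eq)
  then have "ennreal (t powr (2 * \<nu>) / (4 powr \<nu> * Gamma \<nu>)) * ennreal \<bar>\<integral>u. poisson_integrand \<alpha> L m \<nu> f t x u \<partial>half_line\<bar>
     \<le> ennreal (t powr (2 * \<nu>) / (4 powr \<nu> * Gamma \<nu>)) * poisson_op t (\<lambda>y. ennreal \<bar>f y\<bar>) x"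
    by (rule mult_left_mono) simp
  then show ?thesis using G by (simp add: poisson_def abs_mult ennreal_mult'[symmetric] abs_of_pos)
qed

text \<open>Dominated convergence: \<open>exp (- (t\<^sup>2 / (4 * u)))\<close> decreases in
  \<open>t > 0\<close>, so the integrand at \<open>t / 2\<close> dominates all those at
  \<open>s n\<close>.\<close>

lemma poisson_tendsto:
  assumes f: "f \<in> borel_measurable half_line" and x: "x > 0" and fin: "Phi_int (\<lambda>y. ennreal \<bar>f y\<bar>) < \<infinity>"
    and t: "t > 0" and s: "s \<longlonglongrightarrow> t" "\<And>n. t / 2 \<le> s n"
  shows "(\<lambda>n. poisson \<alpha> L m \<nu> f (s n) x) \<longlonglongrightarrow> poisson \<alpha> L m \<nu> f t x"
proof -
  have int: "integrable half_line (poisson_integrand \<alpha> L m \<nu> f t' x)" if "t' > 0" for t'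
    using poisson_convergesI[OF f that x fin] by (simp add: poisson_converges_def)
  have "(\<lambda>n. \<integral>u. poisson_integrand \<alpha> L m \<nu> f (s n) x u \<partial>half_line) \<longlonglongrightarrow> (\<integral>u. poisson_integrand \<alpha> L m \<nu> f t x u \<partial>half_line)"
  proof (rule integral_dominated_convergence[where w = "\<lambda>u. \<bar>poisson_integrand \<alpha> L m \<nu> f (t / 2) x u\<bar>"])
    show "integrable half_line (\<lambda>u. \<bar>poisson_integrand \<alpha> L m \<nu> f (t / 2) x u\<bar>)" using t by (intro integrable_abs int) auto
    show "AE u in half_line. (\<lambda>n. poisson_integrand \<alpha> L m \<nu> f (s n) x u) \<longlonglongrightarrow> poisson_integrand \<alpha> L m \<nu> f t x u"
      unfolding poisson_integrand_def divide_inverse by (intro AE_I2 tendsto_intros s)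
    show "AE u in half_line. norm (poisson_integrand \<alpha> L m \<nu> f (s n) x u) \<le> \<bar>poisson_integrand \<alpha> L m \<nu> f (t / 2) x u\<bar>" for n
    proof (rule AE_I2)
      fix u assume "u \<in> space half_line"
      then have u: "u > 0" by simp
      have "(t / 2)\<^sup>2 \<le> (s n)\<^sup>2" using t s(2)[of n] by (intro power_mono) auto
      then have "exp (- ((s n)\<^sup>2 / (4 * u))) \<le> exp (- ((t / 2)\<^sup>2 / (4 * u)))" using u by (simp add: divide_right_mono)
      then show "norm (poisson_integrand \<alpha> L m \<nu> f (s n) x u) \<le> \<bar>poisson_integrand \<alpha> L m \<nu> f (t / 2) x u\<bar>"
        unfolding poisson_integrand_def real_norm_def abs_mult abs_divide
        by (intro divide_right_mono mult_right_mono) auto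
    qed
    show "poisson_integrand \<alpha> L m \<nu> f (s n) x \<in> borel_measurable half_line" for n
    proof -
      have "s n > 0" using s(2)[of n] t by linarith
      then show ?thesis using int by blast
    qed
    show "poisson_integrand \<alpha> L m \<nu> f t x \<in> borel_measurable half_line" using int[OF t] by blast
  qed
  moreover have "(\<lambda>n. (s n) powr (2 * \<nu>)) \<longlonglongrightarrow> t powr (2 * \<nu>)" using t by (intro tendsto_powr s tendsto_const) auto
  moreover have "Gamma \<nu> \<noteq> 0" using Gamma_real_pos[OF \<nu>] by simp
  ultimately show ?thesis
    unfolding poisson_def by (intro tendsto_mult tendsto_divide tendsto_const) auto
qed

lemma poisson_measurable:
  assumes f[measurable]: "f \<in> borel_measurable half_line"
  shows "(\<lambda>x. poisson \<alpha> L m \<nu> f t x) \<in> borel_measurable half_line"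
  unfolding poisson_def by measurable

text \<open>Continuity in \<open>t\<close> reduces the supremum to countably many times, which makes
  it measurable. As \<open>t0\<close> may be irrational, rational multiples of it are taken.\<close>

lemma poisson_maximal_rational:
  assumes f: "f \<in> borel_measurable half_line" and x: "x > 0" and fin: "Phi_int (\<lambda>y. ennreal \<bar>f y\<bar>) < \<infinity>" and t0: "t0 > 0"
  shows "poisson_maximal \<alpha> L m \<nu> t0 f x = (SUP q\<in>\<rat> \<inter> {0<..1}. ennreal \<bar>poisson \<alpha> L m \<nu> f (t0 * q) x\<bar>)" (is "_ = ?S")
  unfolding poisson_maximal_def
proof (rule antisym)
  show "?S \<le> (SUP t\<in>{0<..t0}. ennreal \<bar>poisson \<alpha> L m \<nu> f t x\<bar>)"
    using t0 by (intro SUP_least SUP_upper) (auto simp: mult_le_cancel_left1)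
  show "(SUP t\<in>{0<..t0}. ennreal \<bar>poisson \<alpha> L m \<nu> f t x\<bar>) \<le> ?S"
  proof (rule SUP_least)
    fix t assume t: "t \<in> {0<..t0}"
    define s where "s = t / t0"
    have s: "0 < s" "s \<le> 1" "t = t0 * s" using t t0 by (auto simp: s_def)
    \<comment> \<open>Starting at \<open>n + 2\<close> keeps \<open>q n\<close> above
      \<open>s / 2\<close>, as the domination in \<open>poisson_tendsto\<close> requires.\<close>
    have "\<exists>q\<in>\<rat>. s - s / real (n + 2) < q \<and> q < s" for n
      using s by (intro Rats_dense_in_real) auto
    then obtain q where q: "\<And>n. q n \<in> \<rat>" "\<And>n. s - s / real (n + 2) < q n" "\<And>n. q n < s" by metis
    have half: "s / 2 \<le> q n" for n
    proof -
      have "s / real (n + 2) \<le> s / 2" using s by (intro divide_left_mono) auto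
      then show ?thesis using q(2)[of n] by linarith
    qed
    have "(\<lambda>n. s - s / real (n + 2)) \<longlonglongrightarrow> s - 0"
      by (intro tendsto_diff tendsto_const LIMSEQ_ignore_initial_segment[OF lim_const_over_n])
    then have "q \<longlonglongrightarrow> s"
      by (intro tendsto_sandwich[of "\<lambda>n. s - s / real (n + 2)" q sequentially "\<lambda>_. s"])
         (use q in \<open>auto intro!: always_eventually less_imp_le\<close>)
    then have "(\<lambda>n. t0 * q n) \<longlonglongrightarrow> t" unfolding s(3) by (intro tendsto_intros)
    moreover have "t / 2 \<le> t0 * q n" for n using half[of n] t0 unfolding s(3) by (simp add: mult_left_mono)
    ultimately have "(\<lambda>n. poisson \<alpha> L m \<nu> f (t0 * q n) x) \<longlonglongrightarrow> poisson \<alpha> L m \<nu> f t x"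
      using t by (intro poisson_tendsto[OF f x fin]) auto
    then have lim: "(\<lambda>n. ennreal \<bar>poisson \<alpha> L m \<nu> f (t0 * q n) x\<bar>) \<longlonglongrightarrow> ennreal \<bar>poisson \<alpha> L m \<nu> f t x\<bar>"
      by (intro tendsto_intros)
    have le: "ennreal \<bar>poisson \<alpha> L m \<nu> f (t0 * q n) x\<bar> \<le> ?S" for n
      using q(1)[of n] q(3)[of n] half[of n] s by (intro SUP_upper) auto
    show "ennreal \<bar>poisson \<alpha> L m \<nu> f t x\<bar> \<le> ?S"
      by (rule LIMSEQ_le_const2[OF lim]) (use le in blast)
  qed
qed

lemma poisson_maximal_measurable:
  assumes f: "f \<in> borel_measurable half_line" and fin: "Phi_int (\<lambda>y. ennreal \<bar>f y\<bar>) < \<infinity>" and t0: "t0 > 0"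
  shows "poisson_maximal \<alpha> L m \<nu> t0 f \<in> borel_measurable half_line"
proof -
  note [measurable] = poisson_measurable[OF f]
  have [simp]: "countable (\<rat> \<inter> {0<..1::real})" by (intro countable_Int1 countable_rat)
  have "(\<lambda>x. SUP q\<in>\<rat> \<inter> {0<..1}. ennreal \<bar>poisson \<alpha> L m \<nu> f (t0 * q) x\<bar>) \<in> borel_measurable half_line"
    by (intro borel_measurable_SUP) measurable
  also have "?this \<longleftrightarrow> ?thesis"
    using poisson_maximal_rational[OF f _ fin t0] by (intro measurable_cong) auto
  finally show ?thesis .
qed

text \<open>For nonnegative \<open>f\<close> integrability makes the Bochner integrals genuine
  values rather than defaults, and Tonelli's theorem identifies them with \<open>poisson_op\<close>.
  The lower kernel bound then sits inside a finite integral.\<close>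

lemma Phi_int_finite_of_converges:
  assumes f[measurable]: "f \<in> borel_measurable half_line" and pos: "\<And>y. y > 0 \<Longrightarrow> 0 \<le> f y"
    and t: "t > 0" and conv: "poisson_converges \<alpha> L m \<nu> f t 1"
  shows "Phi_int (\<lambda>y. ennreal (f y)) < \<infinity>"
proof -
  obtain c where c: "c > 0" "\<And>y. y \<ge> 0 \<Longrightarrow> ennreal (c * phi y) \<le> (\<integral>\<^sup>+u. ennreal (pk t 1 y u) \<partial>half_line)"
    using poisson_ker_integral_lower[OF b_pos m \<nu> t] by blast
  have nn_meas: "(\<lambda>y. ennreal (f y)) \<in> borel_measurable half_line" by measurable
  have heat_op_eq: "heat_op u (\<lambda>y. ennreal (f y)) 1 = heat_op u (\<lambda>y. ennreal \<bar>f y\<bar>) 1" for u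
    unfolding heat_op_def using pos by (intro nn_integral_cong) (auto simp: abs_of_nonneg)
  have heat: "ennreal \<bar>heat \<alpha> L m f u 1\<bar> = ennreal (exp (- (m * u))) * heat_op u (\<lambda>y. ennreal (f y)) 1" if u: "u > 0" for u
  proof -
    have nn: "AE y in half_line. 0 \<le> heat_integrand \<alpha> L m f u 1 y"
    proof (rule AE_I2)
      fix y assume "y \<in> space half_line"
      then have y: "y > 0" by simp
      show "0 \<le> heat_integrand \<alpha> L m f u 1 y"
        unfolding heat_integrand_eq[OF u] using pos[OF y] heat_ker_pos[OF u, of 1 y] y by simp
    qed
    have int: "integrable half_line (heat_integrand \<alpha> L m f u 1)"
      using conv u unfolding poisson_converges_def by blast
    have "ennreal \<bar>heat \<alpha> L m f u 1\<bar> = ennreal (heat \<alpha> L m f u 1)"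
      using integral_nonneg_AE[OF nn] by (simp add: heat_def)
    also have "\<dots> = (\<integral>\<^sup>+y. ennreal (heat_integrand \<alpha> L m f u 1 y) \<partial>half_line)"
      unfolding heat_def by (rule nn_integral_eq_integral[OF int nn, symmetric])
    also have "\<dots> = (\<integral>\<^sup>+y. ennreal \<bar>heat_integrand \<alpha> L m f u 1 y\<bar> \<partial>half_line)"
      using nn by (intro nn_integral_cong_AE) auto
    finally show ?thesis using nn_integral_heat_integrand[OF f u, of 1] heat_op_eq by simp
  qed
  have "(\<integral>\<^sup>+y. ennreal (c * phi y) * ennreal (f y) \<partial>mu) \<le> poisson_op t (\<lambda>y. ennreal (f y)) 1"
    unfolding poisson_op_def by (intro nn_integral_mono mult_right_mono c(2)) auto
  also have "\<dots> = (\<integral>\<^sup>+u. ennreal \<bar>poisson_integrand \<alpha> L m \<nu> f t 1 u\<bar> \<partial>half_line)"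
    unfolding poisson_op_swap[OF nn_meas zero_less_one] poisson_integrand_def divide_powr_eq
    using heat by (intro nn_integral_cong) (simp add: abs_mult ennreal_mult' mult_ac)
  also have "\<dots> < \<infinity>" using conv by (simp add: poisson_converges_def integrable_iff_bounded)
  finally have fin: "(\<integral>\<^sup>+y. ennreal (c * phi y) * ennreal (f y) \<partial>mu) < \<infinity>" .
  have "(\<integral>\<^sup>+y. ennreal (c * phi y) * ennreal (f y) \<partial>mu) = (\<integral>\<^sup>+y. ennreal c * (ennreal (f y) * ennreal (phi y)) \<partial>mu)"
    using c(1) by (intro nn_integral_cong) (simp add: ennreal_mult' mult_ac)
  also have "\<dots> = ennreal c * Phi_int (\<lambda>y. ennreal (f y))" unfolding Phi_int_def by (rule nn_integral_cmult) measurable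
  finally show ?thesis using fin c(1) by (auto simp: ennreal_mult_less_top)
qed

text \<open>Where \<open>y < R = 72 (1 + x)\<close> one has \<open>1 \<le> phi y / phi R\<close>, so the small-time part near \<open>x\<close> is controlled
  by the maximal averages of \<open>F phi\<close>; the rest of the kernel is at most \<open>exp ((1 + \<kappa>) x) phi y\<close>.\<close>

definition majorant :: "(real \<Rightarrow> ennreal) \<Rightarrow> real \<Rightarrow> ennreal" where
  "majorant F x = max_avg (\<lambda>y. F y * ennreal (phi y)) x + ennreal (exp x) * Phi_int F"

text \<open>\<open>phi\<close> decays at most like a power, so its inverse is absorbed by an
  arbitrarily small exponential rate; this is one source of \<kappa>. The argument is the radius
  from which \<open>lag_kernel_upper_far\<close> applies.\<close>

lemma inverse_phi_le:
  assumes "\<kappa> > 0"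
  obtains C where "C > 0" "\<And>x. x \<ge> 0 \<Longrightarrow> 1 / phi (72 * (1 + x)) \<le> C * exp (\<kappa> * x)"
proof -
  define N where "N = m + 1 + \<nu>"
  obtain C where C: "C > 0" "\<And>x. x \<ge> 0 \<Longrightarrow> (1 + x) powr N * exp (- \<kappa> * x) \<le> C"
    using powr_times_exp_bounded[OF assms] by blast
  show ?thesis
  proof (rule that[of "73 powr N * C"])
    show "73 powr N * C > 0" using C by simp
    fix x :: real assume x: "x \<ge> 0"
    have "1 / phi (72 * (1 + x)) \<le> 1 / (1 + 72 * (1 + x)) powr (- N)"
      unfolding N_def using x m \<nu> laguerre_phi_pos[of "72 * (1 + x)" m \<nu>] by (intro divide_left_mono laguerre_phi_ge) auto
    also have "\<dots> = (1 + 72 * (1 + x)) powr N" by (simp add: powr_minus_divide)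
    also have "\<dots> \<le> (73 * (1 + x)) powr N" using x m \<nu> by (intro powr_mono2) (auto simp: N_def)
    also have "\<dots> = 73 powr N * (((1 + x) powr N * exp (- \<kappa> * x)) * exp (\<kappa> * x))"
    proof -
      have "(73 * (1 + x)) powr N = 73 powr N * (1 + x) powr N" by (rule powr_mult)
      moreover have "exp (- \<kappa> * x) * exp (\<kappa> * x) = 1" by (simp flip: exp_add)
      ultimately show ?thesis by (simp only: mult.assoc mult_1_right)
    qed
    also have "\<dots> \<le> 73 powr N * (C * exp (\<kappa> * x))" by (intro mult_left_mono mult_right_mono C x) auto
    finally show "1 / phi (72 * (1 + x)) \<le> 73 powr N * C * exp (\<kappa> * x)" by simp
  qed
qed

lemma poisson_op_le_majorant:
  assumes \<kappa>: "\<kappa> > 0" and t0: "t0 > 0"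
  obtains C where "C > 0" "\<And>F t x. \<lbrakk>F \<in> borel_measurable half_line; 0 < t; t \<le> t0; x > 0\<rbrakk> \<Longrightarrow>
     ennreal (t powr (2 * \<nu>)) * poisson_op t F x \<le> ennreal (C * exp (\<kappa> * x)) * majorant F x"
proof -
  obtain C1 where C1: "C1 > 0" "\<And>t x y. \<lbrakk>x \<ge> 0; y \<ge> 0\<rbrakk> \<Longrightarrow>
    (\<integral>\<^sup>+u. ennreal (pk t x y u) * indicator {ln 2..} u \<partial>half_line) \<le> ennreal (C1 * exp ((1 + \<kappa>) * x) * phi y)"
    using poisson_ker_late[OF b_pos m \<nu> \<kappa>] by blast
  obtain F0 where F0: "F0 > 0" "\<And>r x y. \<lbrakk>1 / 2 \<le> r; r < 1; 0 \<le> x; 72 * (1 + x) \<le> y\<rbrakk> \<Longrightarrow>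
    lag_kernel (\<alpha> + 1) r x y \<le> F0 * exp (- y / 4)"
    using lag_kernel_upper_far[OF b_pos] by blast
  obtain E where E: "E > 0" "\<And>y. y \<ge> 0 \<Longrightarrow> exp (- (1 / 4) * y) \<le> E * phi y"
    using exp_le_laguerre_phi[of "1 / 4" m \<nu>] m \<nu> by auto
  obtain B where B: "B > 0" "\<And>t u. \<lbrakk>t > 0; u > 0\<rbrakk> \<Longrightarrow>
    exp (- (t\<^sup>2 / (4 * u))) * u powr (- 1 - \<nu>) \<le> B * (t\<^sup>2 + u) powr (- 1 - \<nu>)"
    using time_majorant[OF \<nu>] by blast
  obtain C2 where C2: "C2 > 0" "\<And>x. x \<ge> 0 \<Longrightarrow> 1 / phi (72 * (1 + x)) \<le> C2 * exp (\<kappa> * x)"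
    using inverse_phi_le[OF \<kappa>] by blast
  \<comment> \<open>\<open>c1\<close> collects the large times, where \<open>t \<le> t0\<close>
    bounds the power of \<open>t\<close>; \<open>c2\<close> the small times with far
    \<open>y\<close>; \<open>c3\<close> the small times with near \<open>y\<close>. In the last two
    the power of \<open>t\<close> cancels against \<open>(t\<^sup>2) powr (- \<nu>)\<close>.\<close>
  define c1 where "c1 = t0 powr (2 * \<nu>) * C1"
  define c2 where "c2 = B * (F0 * E) / \<nu>"
  define c3 where "c3 = B * C2 * (2 * (1 + \<nu>) / \<nu>)"
  have c: "c1 > 0" "c2 > 0" "c3 > 0" using t0 C1 C2 B F0 E \<nu> by (auto simp: c1_def c2_def c3_def)
  show ?thesis
  proof (rule that[of "c1 + c2 + c3"])
    show "c1 + c2 + c3 > 0" using c by simp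
    fix F :: "real \<Rightarrow> ennreal" and t x :: real
    assume F[measurable]: "F \<in> borel_measurable half_line" and t: "0 < t" "t \<le> t0" and x: "x > 0"
    interpret P: pair_sigma_finite half_line mu ..
    define k where "k = (\<lambda>u. (t\<^sup>2 + u) powr (- 1 - \<nu>))"
    define K2 where "K2 = C2 * exp (\<kappa> * x)"
    have K2: "K2 > 0" using C2 by (simp add: K2_def)
    \<comment> \<open>The bounds for far and near \<open>y\<close> are added rather than kept as
      alternatives, so that the two terms can be integrated separately over all \<open>u\<close> and
      \<open>y\<close>.\<close>
    have pt: "pk t x y u \<le> B * k u * (F0 * E * phi y + K2 * (heat_ker u x y * phi y))"
      if u: "0 < u" "u < ln 2" and y: "y > 0" for u y
    proof -
      have H0: "0 < heat_ker u x y" using u x y by (intro heat_ker_pos) auto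
      have ph: "phi y > 0" using y by (intro laguerre_phi_pos) auto
      have "heat_ker u x y \<le> F0 * E * phi y + K2 * (heat_ker u x y * phi y)"
      proof (cases "72 * (1 + x) \<le> y")
        case True
        have "heat_ker u x y \<le> F0 * exp (- y / 4)" unfolding heat_ker_def
          using u exp_minus_ge_half[of u] x True by (intro F0) auto
        also have "\<dots> \<le> F0 * (E * phi y)" using E(2)[of y] y F0 by simp
        finally show ?thesis using H0 ph K2 by (simp add: add_increasing2)
      next
        case False
        have "phi (72 * (1 + x)) \<le> phi y" using False y m \<nu> by (intro laguerre_phi_antimono) auto
        moreover have pR: "phi (72 * (1 + x)) > 0" using x by (intro laguerre_phi_pos) auto
        moreover have "1 \<le> K2 * phi (72 * (1 + x))" using C2(2)[of x] x pR by (simp add: K2_def divide_le_eq)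
        ultimately have "1 \<le> K2 * phi y" using K2 by (meson less_imp_le mult_left_mono order.trans)
        then have "heat_ker u x y * 1 \<le> heat_ker u x y * (K2 * phi y)" using H0 by (intro mult_left_mono) auto
        then show ?thesis using F0 E ph by (simp add: mult_ac add_increasing)
      qed
      then have "exp (- (m * u)) * heat_ker u x y \<le> 1 * (F0 * E * phi y + K2 * (heat_ker u x y * phi y))"
        using H0 m u by (intro mult_mono) auto
      moreover have "exp (- (t\<^sup>2 / (4 * u))) * u powr (- 1 - \<nu>) \<le> B * k u"
        using B(2)[OF t(1) u(1)] by (simp add: k_def)
      ultimately have "pk t x y u \<le> (B * k u) * (1 * (F0 * E * phi y + K2 * (heat_ker u x y * phi y)))"
        unfolding pk_eq using B(1) H0 by (rule_tac mult_mono) (auto simp: k_def)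
      then show ?thesis by simp
    qed
    have inner: "(\<integral>\<^sup>+u. ennreal (pk t x y u) \<partial>half_line) * F y \<le>
        ennreal (C1 * exp ((1 + \<kappa>) * x)) * (F y * ennreal (phi y))
        + ennreal (B * (F0 * E)) * ennreal ((t\<^sup>2) powr (- \<nu>) / \<nu>) * (F y * ennreal (phi y))
        + ennreal (B * K2) * (\<integral>\<^sup>+u. ennreal (k u) * ennreal (heat_ker u x y) * (F y * ennreal (phi y)) \<partial>half_line)" if y: "y > 0" for y
    proof -
      have ph: "phi y > 0" using y by (intro laguerre_phi_pos) auto
      have "(\<integral>\<^sup>+u. ennreal (pk t x y u) \<partial>half_line) \<le>
        (\<integral>\<^sup>+u. ennreal (pk t x y u) * indicator {ln 2..} u + (ennreal (B * (F0 * E * phi y)) * (ennreal (k u) * indicator {0..} u) + ennreal (B * K2 * phi y) * (ennreal (k u) * ennreal (heat_ker u x y))) \<partial>half_line)"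
      proof (intro nn_integral_mono)
        fix u assume "u \<in> space half_line"
        then have u: "u > 0" by simp
        have H0: "0 < heat_ker u x y" using u x y by (intro heat_ker_pos) auto
        show "ennreal (pk t x y u) \<le> ennreal (pk t x y u) * indicator {ln 2..} u + (ennreal (B * (F0 * E * phi y)) * (ennreal (k u) * indicator {0..} u) + ennreal (B * K2 * phi y) * (ennreal (k u) * ennreal (heat_ker u x y)))"
        proof (cases "u < ln 2")
          case True
          have "ennreal (pk t x y u) \<le> ennreal (B * (F0 * E * phi y) * k u + B * K2 * phi y * (k u * heat_ker u x y))"
            using pt[OF u True y] by (intro ennreal_leI) (simp add: algebra_simps)
          also have "\<dots> = ennreal (B * (F0 * E * phi y)) * (ennreal (k u) * indicator {0..} u) + ennreal (B * K2 * phi y) * (ennreal (k u) * ennreal (heat_ker u x y))"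
            using B F0 E ph K2 H0 u by (subst ennreal_plus) (auto simp: ennreal_mult k_def)
          finally show ?thesis by (simp add: add_increasing)
        qed (simp add: add_increasing2)
      qed
      also have "\<dots> = (\<integral>\<^sup>+u. ennreal (pk t x y u) * indicator {ln 2..} u \<partial>half_line) + (ennreal (B * (F0 * E * phi y)) * (\<integral>\<^sup>+u. ennreal (k u) * indicator {0..} u \<partial>half_line) + ennreal (B * K2 * phi y) * (\<integral>\<^sup>+u. ennreal (k u) * ennreal (heat_ker u x y) \<partial>half_line))"
        unfolding k_def by (subst nn_integral_add, measurable, subst nn_integral_add, measurable, subst nn_integral_cmult, measurable, subst nn_integral_cmult, measurable)
      also have "\<dots> \<le> ennreal (C1 * exp ((1 + \<kappa>) * x) * phi y) + (ennreal (B * (F0 * E * phi y)) * ennreal ((t\<^sup>2 + 0) powr (- \<nu>) / \<nu>) + ennreal (B * K2 * phi y) * (\<integral>\<^sup>+u. ennreal (k u) * ennreal (heat_ker u x y) \<partial>half_line))"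
        unfolding k_def using x y t \<nu> by (intro add_mono mult_left_mono C1 nn_integral_powr_tail) auto
      finally have "(\<integral>\<^sup>+u. ennreal (pk t x y u) \<partial>half_line) * F y \<le>
          (ennreal (C1 * exp ((1 + \<kappa>) * x) * phi y) + (ennreal (B * (F0 * E * phi y)) * ennreal ((t\<^sup>2) powr (- \<nu>) / \<nu>) + ennreal (B * K2 * phi y) * (\<integral>\<^sup>+u. ennreal (k u) * ennreal (heat_ker u x y) \<partial>half_line))) * F y"
        by (simp add: mult_right_mono)
      also have "\<dots> = ennreal (C1 * exp ((1 + \<kappa>) * x)) * (F y * ennreal (phi y))
        + ennreal (B * (F0 * E)) * ennreal ((t\<^sup>2) powr (- \<nu>) / \<nu>) * (F y * ennreal (phi y))
        + ennreal (B * K2) * ((\<integral>\<^sup>+u. ennreal (k u) * ennreal (heat_ker u x y) \<partial>half_line) * (F y * ennreal (phi y)))"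
        using C1(1) B(1) F0(1) E(1) K2 ph
        by (simp add: ennreal_mult' ennreal_mult'' distrib_right distrib_left mult_ac add_ac)
      also have "(\<integral>\<^sup>+u. ennreal (k u) * ennreal (heat_ker u x y) \<partial>half_line) * (F y * ennreal (phi y)) =
          (\<integral>\<^sup>+u. ennreal (k u) * ennreal (heat_ker u x y) * (F y * ennreal (phi y)) \<partial>half_line)"
        unfolding k_def by (rule nn_integral_multc[symmetric]) measurable
      finally show ?thesis .
    qed
    have IF: "(\<integral>\<^sup>+y. c * (F y * ennreal (phi y)) \<partial>mu) = c * Phi_int F" for c
      unfolding Phi_int_def by (rule nn_integral_cmult) measurable
    have "poisson_op t F x \<le> (\<integral>\<^sup>+y. ennreal (C1 * exp ((1 + \<kappa>) * x)) * (F y * ennreal (phi y))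
        + ennreal (B * (F0 * E)) * ennreal ((t\<^sup>2) powr (- \<nu>) / \<nu>) * (F y * ennreal (phi y))
        + ennreal (B * K2) * (\<integral>\<^sup>+u. ennreal (k u) * ennreal (heat_ker u x y) * (F y * ennreal (phi y)) \<partial>half_line) \<partial>mu)"
      unfolding poisson_op_def by (intro nn_integral_mono inner) auto
    also have "\<dots> = ennreal (C1 * exp ((1 + \<kappa>) * x)) * Phi_int F + ennreal (B * (F0 * E)) * ennreal ((t\<^sup>2) powr (- \<nu>) / \<nu>) * Phi_int F
        + ennreal (B * K2) * (\<integral>\<^sup>+y. \<integral>\<^sup>+u. ennreal (k u) * ennreal (heat_ker u x y) * (F y * ennreal (phi y)) \<partial>half_line \<partial>mu)"
      unfolding k_def by (subst nn_integral_add, measurable, subst nn_integral_add, measurable, unfold IF, subst nn_integral_cmult, measurable)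
    also have "(\<integral>\<^sup>+y. \<integral>\<^sup>+u. ennreal (k u) * ennreal (heat_ker u x y) * (F y * ennreal (phi y)) \<partial>half_line \<partial>mu) =
        (\<integral>\<^sup>+u. \<integral>\<^sup>+y. ennreal (k u) * (ennreal (heat_ker u x y) * (F y * ennreal (phi y))) \<partial>mu \<partial>half_line)"
      unfolding k_def mult.assoc by (rule P.Fubini') measurable
    also have "\<dots> = (\<integral>\<^sup>+u. ennreal ((t\<^sup>2 + u) powr (- 1 - \<nu>)) * heat_op u (\<lambda>y. F y * ennreal (phi y)) x \<partial>half_line)"
      unfolding heat_op_def k_def by (intro nn_integral_cong nn_integral_cmult) measurable
    also have "\<dots> \<le> ennreal (2 * (1 + \<nu>) * ((t\<^sup>2) powr (- \<nu>) / \<nu>)) * max_avg (\<lambda>y. F y * ennreal (phi y)) x"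
      using t \<nu> by (intro subordinated_le_max_avg) auto
    finally have PPle: "poisson_op t F x \<le> ennreal (C1 * exp ((1 + \<kappa>) * x)) * Phi_int F + ennreal (B * (F0 * E)) * ennreal ((t\<^sup>2) powr (- \<nu>) / \<nu>) * Phi_int F
        + ennreal (B * K2) * (ennreal (2 * (1 + \<nu>) * ((t\<^sup>2) powr (- \<nu>) / \<nu>)) * max_avg (\<lambda>y. F y * ennreal (phi y)) x)"
      by (simp add: mult_left_mono add_left_mono)
    have tt: "t powr (2 * \<nu>) * (t\<^sup>2) powr (- \<nu>) = 1"
    proof -
      have "(t\<^sup>2) powr (- \<nu>) = t powr (- (2 * \<nu>))" using t by (simp add: powr_powr flip: powr_numeral)
      then show ?thesis using t by (simp flip: powr_add)
    qed
    have ex: "1 \<le> exp (\<kappa> * x)" "1 \<le> exp x" using x \<kappa> by auto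
    have "ennreal (t powr (2 * \<nu>)) * poisson_op t F x \<le> ennreal (t powr (2 * \<nu>)) * (ennreal (C1 * exp ((1 + \<kappa>) * x)) * Phi_int F + ennreal (B * (F0 * E)) * ennreal ((t\<^sup>2) powr (- \<nu>) / \<nu>) * Phi_int F
        + ennreal (B * K2) * (ennreal (2 * (1 + \<nu>) * ((t\<^sup>2) powr (- \<nu>) / \<nu>)) * max_avg (\<lambda>y. F y * ennreal (phi y)) x))"
      by (intro mult_left_mono PPle) auto
    also have "\<dots> = ennreal (t powr (2 * \<nu>) * (C1 * exp ((1 + \<kappa>) * x))) * Phi_int F
        + ennreal (t powr (2 * \<nu>) * (B * (F0 * E) * ((t\<^sup>2) powr (- \<nu>) / \<nu>))) * Phi_int F
        + ennreal (t powr (2 * \<nu>) * (B * K2 * (2 * (1 + \<nu>) * ((t\<^sup>2) powr (- \<nu>) / \<nu>)))) * max_avg (\<lambda>y. F y * ennreal (phi y)) x"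
      using B F0 E C1 K2 \<nu> by (simp add: distrib_left mult.assoc[symmetric] ennreal_mult'[symmetric])
    also have "\<dots> \<le> ennreal (c1 * exp (\<kappa> * x) * exp x) * Phi_int F + ennreal (c2 * exp (\<kappa> * x) * exp x) * Phi_int F
        + ennreal (c3 * exp (\<kappa> * x)) * max_avg (\<lambda>y. F y * ennreal (phi y)) x"
    proof (intro add_mono mult_right_mono ennreal_leI)
      have "t powr (2 * \<nu>) \<le> t0 powr (2 * \<nu>)" using t \<nu> by (intro powr_mono2) auto
      then have "t powr (2 * \<nu>) * (C1 * exp ((1 + \<kappa>) * x)) \<le> t0 powr (2 * \<nu>) * (C1 * exp ((1 + \<kappa>) * x))"
        using C1 by (intro mult_right_mono) auto
      moreover have "exp ((1 + \<kappa>) * x) = exp (\<kappa> * x) * exp x"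
        by (simp add: distrib_right flip: exp_add)
      ultimately show "t powr (2 * \<nu>) * (C1 * exp ((1 + \<kappa>) * x)) \<le> c1 * exp (\<kappa> * x) * exp x"
        by (simp only: c1_def mult.assoc)
      have "t powr (2 * \<nu>) * (B * (F0 * E) * ((t\<^sup>2) powr (- \<nu>) / \<nu>)) = c2 * (t powr (2 * \<nu>) * (t\<^sup>2) powr (- \<nu>))"
        by (simp add: c2_def)
      also have "\<dots> = c2 * (1 * 1)" by (simp add: tt)
      also have "\<dots> \<le> c2 * (exp (\<kappa> * x) * exp x)" using c ex by (intro mult_left_mono mult_mono) auto
      finally show "t powr (2 * \<nu>) * (B * (F0 * E) * ((t\<^sup>2) powr (- \<nu>) / \<nu>)) \<le> c2 * exp (\<kappa> * x) * exp x" by simp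
      have "t powr (2 * \<nu>) * (B * K2 * (2 * (1 + \<nu>) * ((t\<^sup>2) powr (- \<nu>) / \<nu>))) = c3 * exp (\<kappa> * x) * (t powr (2 * \<nu>) * (t\<^sup>2) powr (- \<nu>))"
        by (simp add: c3_def K2_def)
      then show "t powr (2 * \<nu>) * (B * K2 * (2 * (1 + \<nu>) * ((t\<^sup>2) powr (- \<nu>) / \<nu>))) \<le> c3 * exp (\<kappa> * x)" by (simp add: tt)
    qed auto
    also have "\<dots> = ennreal ((c1 + c2) * exp (\<kappa> * x)) * (ennreal (exp x) * Phi_int F) + ennreal (c3 * exp (\<kappa> * x)) * max_avg (\<lambda>y. F y * ennreal (phi y)) x"
      using c by (simp add: distrib_right ennreal_mult' ennreal_plus mult.assoc)
    also have "\<dots> \<le> ennreal ((c1 + c2 + c3) * exp (\<kappa> * x)) * (ennreal (exp x) * Phi_int F) + ennreal ((c1 + c2 + c3) * exp (\<kappa> * x)) * max_avg (\<lambda>y. F y * ennreal (phi y)) x"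
    proof -
      have "(c1 + c2) * exp (\<kappa> * x) \<le> (c1 + c2 + c3) * exp (\<kappa> * x)" "c3 * exp (\<kappa> * x) \<le> (c1 + c2 + c3) * exp (\<kappa> * x)"
        using c by (auto intro!: mult_right_mono)
      then show ?thesis by (intro add_mono[OF mult_right_mono mult_right_mono] ennreal_leI) auto
    qed
    also have "\<dots> = ennreal ((c1 + c2 + c3) * exp (\<kappa> * x)) * majorant F x" unfolding majorant_def by (simp add: distrib_left add.commute)
    finally show "ennreal (t powr (2 * \<nu>)) * poisson_op t F x \<le> ennreal ((c1 + c2 + c3) * exp (\<kappa> * x)) * majorant F x" .
  qed
qed

lemma poisson_maximal_le_majorant:
  assumes \<kappa>: "\<kappa> > 0" and t0: "t0 > 0"
  obtains C where "C > 0" "\<And>f x. \<lbrakk>f \<in> borel_measurable half_line; x > 0\<rbrakk> \<Longrightarrow>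
     poisson_maximal \<alpha> L m \<nu> t0 f x \<le> ennreal (C * exp (\<kappa> * x)) * majorant (\<lambda>y. ennreal \<bar>f y\<bar>) x"
proof -
  obtain C where C: "C > 0" "\<And>F t x. \<lbrakk>F \<in> borel_measurable half_line; 0 < t; t \<le> t0; x > 0\<rbrakk> \<Longrightarrow>
     ennreal (t powr (2 * \<nu>)) * poisson_op t F x \<le> ennreal (C * exp (\<kappa> * x)) * majorant F x"
    using poisson_op_le_majorant[OF \<kappa> t0] by blast
  define g where "g = 1 / (4 powr \<nu> * Gamma \<nu>)"
  have g: "g > 0" using Gamma_real_pos[OF \<nu>] by (simp add: g_def)
  show ?thesis
  proof (rule that[of "g * C"])
    show "g * C > 0" using g C by simp
    fix f :: "real \<Rightarrow> real" and x :: real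
    assume f[measurable]: "f \<in> borel_measurable half_line" and x: "x > 0"
    have "ennreal \<bar>poisson \<alpha> L m \<nu> f t x\<bar> \<le> ennreal (g * C * exp (\<kappa> * x)) * majorant (\<lambda>y. ennreal \<bar>f y\<bar>) x" if t: "t \<in> {0<..t0}" for t
    proof -
      have "ennreal \<bar>poisson \<alpha> L m \<nu> f t x\<bar> \<le> ennreal (t powr (2 * \<nu>) / (4 powr \<nu> * Gamma \<nu>)) * poisson_op t (\<lambda>y. ennreal \<bar>f y\<bar>) x"
        by (rule abs_poisson_le[OF f x])
      also have "t powr (2 * \<nu>) / (4 powr \<nu> * Gamma \<nu>) = g * t powr (2 * \<nu>)" by (simp add: g_def)
      also have "ennreal (g * t powr (2 * \<nu>)) * poisson_op t (\<lambda>y. ennreal \<bar>f y\<bar>) x = ennreal g * (ennreal (t powr (2 * \<nu>)) * poisson_op t (\<lambda>y. ennreal \<bar>f y\<bar>) x)"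
        using g by (simp add: ennreal_mult mult.assoc)
      also have "\<dots> \<le> ennreal g * (ennreal (C * exp (\<kappa> * x)) * majorant (\<lambda>y. ennreal \<bar>f y\<bar>) x)"
        using t x by (intro mult_left_mono C) auto
      also have "\<dots> = ennreal (g * C * exp (\<kappa> * x)) * majorant (\<lambda>y. ennreal \<bar>f y\<bar>) x"
        using g C by (simp add: ennreal_mult mult.assoc)
      finally show ?thesis .
    qed
    then show "poisson_maximal \<alpha> L m \<nu> t0 f x \<le> ennreal (g * C * exp (\<kappa> * x)) * majorant (\<lambda>y. ennreal \<bar>f y\<bar>) x"
      unfolding poisson_maximal_def by (intro SUP_least)
  qed
qed

end

section \<open>Weak-type estimates and weights\<close>

lemma ennreal_powr_ennreal: "0 \<le> c \<Longrightarrow> ennreal_powr (ennreal c) p = ennreal (c powr p)"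
  by (simp add: ennreal_powr_def)

lemma ennreal_powr_top [simp]: "ennreal_powr top p = top"
  by (simp add: ennreal_powr_def)

lemma ennreal_powr_mono:
  assumes "p \<ge> 0" "a \<le> c"
  shows "ennreal_powr a p \<le> ennreal_powr c p"
  using assms by (cases a; cases c) (auto simp: ennreal_powr_ennreal top_unique intro!: ennreal_leI powr_mono2)

lemma ennreal_powr_cmult:
  assumes "c > 0"
  shows "ennreal_powr (ennreal c * a) p = ennreal (c powr p) * ennreal_powr a p"
proof (cases a)
  case (real x)
  then show ?thesis using assms
    by (simp add: ennreal_powr_ennreal powr_mult ennreal_mult'[symmetric])
qed (use assms in \<open>simp add: ennreal_mult_top\<close>)

lemma ennreal_powr_less_top: "ennreal_powr a p < top \<longleftrightarrow> a < top"
  by (auto simp: ennreal_powr_def less_top[symmetric])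

lemma ennreal_powr_measurable [measurable (raw)]:
  assumes [measurable]: "f \<in> borel_measurable M"
  shows "(\<lambda>x. ennreal_powr (f x) p) \<in> borel_measurable M"
  unfolding ennreal_powr_def infinity_ennreal_def by measurable

lemma nn_integral_powr_segment:
  fixes c q :: real
  assumes c: "c \<ge> 0" and q: "q > 0"
  shows "(\<integral>\<^sup>+s. ennreal (s powr (q - 1)) * indicator {..<c} s \<partial>half_line) = ennreal (c powr q / q)"
proof -
  have "((\<lambda>s. s powr (q - 1)) has_integral c powr (q - 1 + 1) / (q - 1 + 1)) {0..c}"
    using c q by (intro has_integral_powr_from_0) auto
  then have "((\<lambda>s. s powr (q - 1)) has_integral c powr q / q) {0<..<c}"
    by (subst (asm) has_integral_spike_set_eq[where T = "{0<..<c}"]) (auto intro: negligible_subset[of "{0, c}"])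
  then have "(\<integral>\<^sup>+s. ennreal (s powr (q - 1)) * indicator {0<..<c} s \<partial>lborel) = ennreal (c powr q / q)"
    by (intro nn_integral_has_integral_lebesgue') auto
  also have "(\<integral>\<^sup>+s. ennreal (s powr (q - 1)) * indicator {0<..<c} s \<partial>lborel) =
      (\<integral>\<^sup>+s. ennreal (s powr (q - 1)) * indicator {..<c} s \<partial>half_line)"
    unfolding nn_integral_half_line by (intro nn_integral_cong) (auto split: split_indicator)
  finally show ?thesis .
qed

lemma layer_cake:
  fixes r :: ennreal and q :: real
  assumes q: "q > 0"
  shows "(\<integral>\<^sup>+s. ennreal (q * s powr (q - 1)) * indicator {s. ennreal s < r} s \<partial>half_line) = ennreal_powr r q"
proof -
  have fin: "(\<integral>\<^sup>+s. ennreal (q * s powr (q - 1)) * indicator {..<c} s \<partial>half_line) = ennreal (c powr q)" if c: "c \<ge> 0" for c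
  proof -
    have "(\<integral>\<^sup>+s. ennreal (q * s powr (q - 1)) * indicator {..<c} s \<partial>half_line) =
        (\<integral>\<^sup>+s. ennreal q * (ennreal (s powr (q - 1)) * indicator {..<c} s) \<partial>half_line)"
      using q by (simp add: ennreal_mult' mult.assoc)
    also have "\<dots> = ennreal q * (\<integral>\<^sup>+s. ennreal (s powr (q - 1)) * indicator {..<c} s \<partial>half_line)"
      by (rule nn_integral_cmult) measurable
    also have "\<dots> = ennreal (q * (c powr q / q))"
      unfolding nn_integral_powr_segment[OF c q] using q by (simp only: ennreal_mult'[OF less_imp_le])
    finally show ?thesis using q by simp
  qed
  show ?thesis
  proof (cases r)
    case (real c)
    have "(\<integral>\<^sup>+s. ennreal (q * s powr (q - 1)) * indicator {s. ennreal s < r} s \<partial>half_line) =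
        (\<integral>\<^sup>+s. ennreal (q * s powr (q - 1)) * indicator {..<c} s \<partial>half_line)"
      using real by (intro nn_integral_cong) (auto split: split_indicator simp: ennreal_less_iff)
    also have "\<dots> = ennreal_powr r q" using real fin by (simp add: ennreal_powr_ennreal)
    finally show ?thesis .
  next
    case top
    \<comment> \<open>Truncation at the height \<open>real n powr (1 / q)\<close> makes the integral
      equal to \<open>real n\<close>.\<close>
    have "ennreal (real n) \<le> (\<integral>\<^sup>+s. ennreal (q * s powr (q - 1)) * indicator {s. ennreal s < r} s \<partial>half_line)" for n
    proof -
      have "ennreal (real n) = ennreal ((real n powr (1 / q)) powr q)" using q by (simp add: powr_powr)
      also have "\<dots> = (\<integral>\<^sup>+s. ennreal (q * s powr (q - 1)) * indicator {..<real n powr (1 / q)} s \<partial>half_line)"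
        by (rule fin[symmetric]) simp
      also have "\<dots> \<le> (\<integral>\<^sup>+s. ennreal (q * s powr (q - 1)) * indicator {s. ennreal s < r} s \<partial>half_line)"
        using top by (intro nn_integral_mono) (auto split: split_indicator)
      finally show ?thesis .
    qed
    then have "(SUP n. of_nat n) \<le> (\<integral>\<^sup>+s. ennreal (q * s powr (q - 1)) * indicator {s. ennreal s < r} s \<partial>half_line)"
      unfolding ennreal_of_nat_eq_real_of_nat by (rule SUP_least)
    then have "(\<integral>\<^sup>+s. ennreal (q * s powr (q - 1)) * indicator {s. ennreal s < r} s \<partial>half_line) = top"
      by (simp add: ennreal_SUP_of_nat_eq_top top_unique)
    then show ?thesis using top by simp
  qed
qed

section \<open>From weak type to finiteness, integrability and weighted bounds\<close>

lemma weak_type_finite_AE: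
  assumes [measurable]: "G \<in> borel_measurable M" and A: "A < top"
    and weak: "\<And>s. s > 0 \<Longrightarrow> ennreal s * emeasure M {x \<in> space M. ennreal s < G x} \<le> A"
  shows "AE x in M. G x < top"
proof -
  have le: "emeasure M {x \<in> space M. G x = top} \<le> ennreal e" if e: "e > 0" for e
  proof -
    obtain a where a: "A = ennreal a" "a \<ge> 0" using A by (cases A) auto
    define s where "s = (a + 1) / e"
    have s: "s > 0" using a e by (simp add: s_def)
    have "ennreal s * emeasure M {x \<in> space M. G x = top} \<le> ennreal s * emeasure M {x \<in> space M. ennreal s < G x}"
      by (intro mult_left_mono emeasure_mono) auto
    also have "\<dots> \<le> ennreal a" using weak[OF s] a by simp
    also have "\<dots> \<le> ennreal (s * e)" using e by (intro ennreal_leI) (simp add: s_def)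
    also have "\<dots> = ennreal s * ennreal e" using s by (simp add: ennreal_mult')
    finally show ?thesis using s by (subst (asm) ennreal_mult_le_mult_iff) auto
  qed
  have "emeasure M {x \<in> space M. G x = top} \<le> 0"
    by (rule ennreal_le_epsilon) (use le in simp)
  then have "{x \<in> space M. G x = top} \<in> null_sets M" by (intro null_setsI) auto
  then have "AE x in M. x \<notin> {x \<in> space M. G x = top}" by (rule AE_not_in)
  then show ?thesis using AE_space by eventually_elim (simp add: top.not_eq_extremum)
qed

text \<open>In the layer cake formula low heights use the finite total mass and high ones the weak
  type, where \<open>\<theta> < 1\<close> makes \<open>s powr (\<theta> - 2)\<close> integrable at
  infinity.\<close>

lemma kolmogorov_inequality:
  assumes M: "finite_measure M" and [measurable]: "G \<in> borel_measurable M" and A: "A < top"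
    and weak: "\<And>s. s > 0 \<Longrightarrow> ennreal s * emeasure M {x \<in> space M. ennreal s < G x} \<le> A"
    and \<theta>: "0 < \<theta>" "\<theta> < 1"
  shows "(\<integral>\<^sup>+x. ennreal_powr (G x) \<theta> \<partial>M) < top"
proof -
  interpret finite_measure M by (rule M)
  interpret P: pair_sigma_finite half_line M ..
  obtain a where a: "A = ennreal a" "a \<ge> 0" using A by (cases A) auto
  have "(\<integral>\<^sup>+x. ennreal_powr (G x) \<theta> \<partial>M) =
      (\<integral>\<^sup>+x. \<integral>\<^sup>+s. ennreal (\<theta> * s powr (\<theta> - 1)) * indicator {s. ennreal s < G x} s \<partial>half_line \<partial>M)"
    using layer_cake[OF \<theta>(1)] by simp
  also have "\<dots> = (\<integral>\<^sup>+s. \<integral>\<^sup>+x. ennreal (\<theta> * s powr (\<theta> - 1)) * indicator {s. ennreal s < G x} s \<partial>M \<partial>half_line)"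
    unfolding indicator_def mem_Collect_eq by (rule P.Fubini') measurable
  also have "\<dots> = (\<integral>\<^sup>+s. ennreal (\<theta> * s powr (\<theta> - 1)) * emeasure M {x \<in> space M. ennreal s < G x} \<partial>half_line)"
  proof (intro nn_integral_cong)
    fix s
    have "(\<integral>\<^sup>+x. ennreal (\<theta> * s powr (\<theta> - 1)) * indicator {s. ennreal s < G x} s \<partial>M) =
       (\<integral>\<^sup>+x. ennreal (\<theta> * s powr (\<theta> - 1)) * indicator {x \<in> space M. ennreal s < G x} x \<partial>M)"
      by (intro nn_integral_cong) (auto split: split_indicator)
    also have "\<dots> = ennreal (\<theta> * s powr (\<theta> - 1)) * emeasure M {x \<in> space M. ennreal s < G x}"
      by (rule nn_integral_cmult_indicator) measurable
    finally show "(\<integral>\<^sup>+x. ennreal (\<theta> * s powr (\<theta> - 1)) * indicator {s. ennreal s < G x} s \<partial>M) =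
      ennreal (\<theta> * s powr (\<theta> - 1)) * emeasure M {x \<in> space M. ennreal s < G x}" .
  qed
  also have "\<dots> \<le> (\<integral>\<^sup>+s. ennreal (measure M (space M)) * (ennreal (s powr (\<theta> - 1)) * indicator {..<2} s)
       + ennreal a * (ennreal ((0 + s) powr (- 1 - (1 - \<theta>))) * indicator {1..} s) \<partial>half_line)"
  proof (intro nn_integral_mono)
    fix s assume "s \<in> space half_line"
    then have s: "s > 0" by simp
    show "ennreal (\<theta> * s powr (\<theta> - 1)) * emeasure M {x \<in> space M. ennreal s < G x} \<le>
       ennreal (measure M (space M)) * (ennreal (s powr (\<theta> - 1)) * indicator {..<2} s)
       + ennreal a * (ennreal ((0 + s) powr (- 1 - (1 - \<theta>))) * indicator {1..} s)"
    proof (cases "s < 1")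
      case True
      have "emeasure M {x \<in> space M. ennreal s < G x} \<le> ennreal (measure M (space M))"
        unfolding emeasure_eq_measure[symmetric] by (rule emeasure_space)
      moreover have "ennreal (\<theta> * s powr (\<theta> - 1)) \<le> ennreal (s powr (\<theta> - 1))"
        using \<theta> by (intro ennreal_leI) (simp add: mult_left_le_one_le)
      ultimately have "ennreal (\<theta> * s powr (\<theta> - 1)) * emeasure M {x \<in> space M. ennreal s < G x} \<le>
        ennreal (s powr (\<theta> - 1)) * ennreal (measure M (space M))" by (intro mult_mono) auto
      then show ?thesis using True by (simp add: mult.commute)
    next
      case False
      have "ennreal (\<theta> * s powr (\<theta> - 1)) \<le> ennreal (s powr (\<theta> - 1))"
        using \<theta> by (intro ennreal_leI) (simp add: mult_left_le_one_le)
      then have "ennreal (\<theta> * s powr (\<theta> - 1)) * emeasure M {x \<in> space M. ennreal s < G x} \<le>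
          ennreal (s powr (\<theta> - 1)) * emeasure M {x \<in> space M. ennreal s < G x}" by (intro mult_right_mono) auto
      also have "\<dots> = ennreal (s powr (\<theta> - 2) * s) * emeasure M {x \<in> space M. ennreal s < G x}"
        using s powr_add[of s "\<theta> - 2" 1] by simp
      also have "ennreal (s powr (\<theta> - 2) * s) * emeasure M {x \<in> space M. ennreal s < G x} =
          ennreal (s powr (\<theta> - 2)) * (ennreal s * emeasure M {x \<in> space M. ennreal s < G x})"
        by (simp add: ennreal_mult' mult.assoc)
      also have "\<dots> \<le> ennreal (s powr (\<theta> - 2)) * ennreal a" using weak[OF s] a by (intro mult_left_mono) auto
      finally show ?thesis using False by (simp add: mult.commute add_increasing)
    qed
  qed
  also have "\<dots> = ennreal (measure M (space M)) * (\<integral>\<^sup>+s. ennreal (s powr (\<theta> - 1)) * indicator {..<2} s \<partial>half_line)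
       + ennreal a * (\<integral>\<^sup>+s. ennreal ((0 + s) powr (- 1 - (1 - \<theta>))) * indicator {1..} s \<partial>half_line)"
    by (subst nn_integral_add, measurable, subst nn_integral_cmult, measurable, subst nn_integral_cmult, measurable)
  also have "\<dots> \<le> ennreal (measure M (space M)) * ennreal (2 powr \<theta> / \<theta>) + ennreal a * ennreal ((0 + 1) powr (- (1 - \<theta>)) / (1 - \<theta>))"
    using \<theta> by (intro add_mono mult_left_mono nn_integral_powr_tail) (auto simp: nn_integral_powr_segment)
  also have "\<dots> < top" by (simp add: ennreal_mult_less_top)
  finally show ?thesis .
qed

text \<open>On the level set \<open>2\<^sup>k \<le> G < 2\<^sup>k\<^sup>+\<^sup>1\<close> the weak-type bound at height \<open>s 2\<^sup>k\<close> gains \<open>2\<^sup>-\<^sup>k\<close>, while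
  \<open>G powr (1 - \<delta>)\<close> costs only \<open>2 powr (k (1 - \<delta>))\<close>.\<close>

lemma weak_type_weighted:
  assumes \<delta>: "0 < \<delta>" "\<delta> < 1"
  obtains D where "D > 0" "\<And>(M :: 'a measure) G N s K. \<lbrakk>G \<in> borel_measurable M; N \<in> borel_measurable M;
     \<And>x. x \<in> space M \<Longrightarrow> 1 \<le> G x;
     \<And>r. r > 0 \<Longrightarrow> ennreal r * emeasure M {x \<in> space M. ennreal r < N x} \<le> K; s > 0\<rbrakk> \<Longrightarrow>
     ennreal s * (\<integral>\<^sup>+x. ennreal (enn2real (G x) powr (1 - \<delta>)) * indicator {x \<in> space M. G x < top \<and> ennreal s * G x < N x} x \<partial>M)
       \<le> ennreal D * K"
proof -
  define c where "c = (\<lambda>k::nat. 2 powr ((real k + 1) * (1 - \<delta>)))"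
  \<comment> \<open>Ratio of the geometric series over the dyadic levels; for
    \<open>\<delta> = 0\<close> it would be 1.\<close>
  define z where "z = 2 powr (- \<delta>)"
  have z: "0 < z" "z < 1" using \<delta> powr_less_mono[of "- \<delta>" 0 2] by (auto simp: z_def)
  have cz: "c k / 2 ^ k = 2 powr (1 - \<delta>) * z ^ k" for k
  proof -
    have "c k = 2 powr (real k) * (2 powr (1 - \<delta>) * 2 powr (- \<delta> * real k))"
      unfolding c_def by (simp add: algebra_simps flip: powr_add)
    moreover have "2 powr (- \<delta> * real k) = z ^ k" by (simp add: z_def powr_realpow[symmetric] powr_powr)
    ultimately show ?thesis by (simp add: powr_realpow)
  qed
  define D where "D = 2 powr (1 - \<delta>) * (1 / (1 - z))"
  have D: "D > 0" using z by (simp add: D_def)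
  have sumc: "(\<Sum>k. ennreal (c k / 2 ^ k)) = ennreal D"
  proof -
    have s: "(\<lambda>k. c k / 2 ^ k) sums D" unfolding cz D_def using z by (intro sums_mult geometric_sums) auto
    have nn: "0 \<le> c k / 2 ^ k" for k by (simp add: c_def)
    show ?thesis by (rule suminf_ennreal_eq[OF nn s])
  qed
  show ?thesis
  proof (rule that[OF D])
    fix M :: "'a measure" and G N :: "'a \<Rightarrow> ennreal" and s :: real and K :: ennreal
    assume [measurable]: "G \<in> borel_measurable M" "N \<in> borel_measurable M"
      and G1: "\<And>x. x \<in> space M \<Longrightarrow> 1 \<le> G x"
      and weak: "\<And>r. r > 0 \<Longrightarrow> ennreal r * emeasure M {x \<in> space M. ennreal r < N x} \<le> K" and s: "s > 0"
    define E where "E = (\<lambda>k::nat. {x \<in> space M. ennreal (s * 2 ^ k) < N x})"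
    have E[measurable]: "E k \<in> sets M" for k unfolding E_def by measurable
    have "(\<integral>\<^sup>+x. ennreal (enn2real (G x) powr (1 - \<delta>)) * indicator {x \<in> space M. G x < top \<and> ennreal s * G x < N x} x \<partial>M)
        \<le> (\<integral>\<^sup>+x. (\<Sum>k. ennreal (c k) * indicator (E k) x) \<partial>M)"
    proof (intro nn_integral_mono)
      fix x assume x: "x \<in> space M"
      show "ennreal (enn2real (G x) powr (1 - \<delta>)) * indicator {x \<in> space M. G x < top \<and> ennreal s * G x < N x} x
        \<le> (\<Sum>k. ennreal (c k) * indicator (E k) x)"
      proof (cases "G x < top \<and> ennreal s * G x < N x")
        case True
        obtain g where g: "G x = ennreal g" "g \<ge> 0" using True by (cases "G x") auto
        have g1: "g \<ge> 1" using G1[OF x] g by simp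
        define k where "k = nat \<lfloor>log 2 g\<rfloor>"
        have l0: "log 2 g \<ge> 0" using g1 by simp
        have k: "real k \<le> log 2 g" "log 2 g \<le> real k + 1" using l0 by (auto simp: k_def)
        have k1: "2 ^ k \<le> g" using k(1) g1 by (simp add: le_log_iff powr_realpow)
        have k2: "g \<le> 2 powr (real k + 1)" using k(2) g1 by (simp add: log_le_iff)
        have "g powr (1 - \<delta>) \<le> (2 powr (real k + 1)) powr (1 - \<delta>)" using k2 g1 \<delta> by (intro powr_mono2) auto
        then have gc: "g powr (1 - \<delta>) \<le> c k" by (simp add: c_def powr_powr)
        have "ennreal (s * 2 ^ k) \<le> ennreal s * G x" using s k1 g by (simp add: ennreal_mult'[symmetric] ennreal_leI)
        then have xE: "x \<in> E k" using True x by (auto simp: E_def)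
        have "ennreal (g powr (1 - \<delta>)) \<le> (\<Sum>k\<in>{k}. ennreal (c k) * indicator (E k) x)"
          using gc xE by (simp add: ennreal_leI)
        also have "\<dots> \<le> (\<Sum>k. ennreal (c k) * indicator (E k) x)" by (rule sum_le_suminf) auto
        finally show ?thesis using g True x by simp
      qed auto
    qed
    also have "\<dots> = (\<Sum>k. \<integral>\<^sup>+x. ennreal (c k) * indicator (E k) x \<partial>M)" by (rule nn_integral_suminf) measurable
    also have "\<dots> = (\<Sum>k. ennreal (c k) * emeasure M (E k))" by (simp add: nn_integral_cmult_indicator)
    finally have "ennreal s * (\<integral>\<^sup>+x. ennreal (enn2real (G x) powr (1 - \<delta>)) * indicator {x \<in> space M. G x < top \<and> ennreal s * G x < N x} x \<partial>M)
        \<le> ennreal s * (\<Sum>k. ennreal (c k) * emeasure M (E k))" by (rule mult_left_mono) simp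
    also have "\<dots> = (\<Sum>k. ennreal (c k / 2 ^ k) * (ennreal (s * 2 ^ k) * emeasure M (E k)))"
    proof -
      have "ennreal s * (ennreal (c k) * emeasure M (E k)) = ennreal (c k / 2 ^ k) * (ennreal (s * 2 ^ k) * emeasure M (E k))" for k
      proof -
        have "ennreal (c k / 2 ^ k) * ennreal (s * 2 ^ k) = ennreal s * ennreal (c k)"
          using s by (simp add: ennreal_mult'[symmetric] ennreal_mult''[symmetric] c_def)
        then show ?thesis by (simp add: mult.assoc[symmetric])
      qed
      then show ?thesis by (simp add: ennreal_suminf_cmult[symmetric])
    qed
    also have "\<dots> \<le> (\<Sum>k. ennreal (c k / 2 ^ k) * K)"
      unfolding E_def using s by (intro suminf_le mult_left_mono weak) auto
    also have "\<dots> = ennreal D * K" by (simp add: ennreal_suminf_multc sumc)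
    finally show "ennreal s * (\<integral>\<^sup>+x. ennreal (enn2real (G x) powr (1 - \<delta>)) * indicator {x \<in> space M. G x < top \<and> ennreal s * G x < N x} x \<partial>M)
       \<le> ennreal D * K" .
  qed
qed

text \<open>Marcinkiewicz interpolation for \<open>g \<mapsto> N (g \<tau>) / (1 + N \<tau>)\<close>, which is bounded by \<open>sup g\<close>.\<close>

lemma weak_type_interpolation:
  fixes N :: "('a \<Rightarrow> ennreal) \<Rightarrow> 'b \<Rightarrow> ennreal"
  assumes M: "sigma_finite_measure M" and Q: "sigma_finite_measure Q"
    and Nm: "\<And>F. F \<in> borel_measurable Q \<Longrightarrow> N F \<in> borel_measurable M"
    and Nmono: "\<And>F G x. (\<And>y. y \<in> space Q \<Longrightarrow> F y \<le> G y) \<Longrightarrow> N F x \<le> N G x"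
    and Nadd: "\<And>F G x. F \<in> borel_measurable Q \<Longrightarrow> G \<in> borel_measurable Q \<Longrightarrow> N (\<lambda>y. F y + G y) x \<le> N F x + N G x"
    and Ncmult: "\<And>F c x. F \<in> borel_measurable Q \<Longrightarrow> N (\<lambda>y. c * F y) x = c * N F x"
    and C: "C > 0"
    and weak: "\<And>F s. F \<in> borel_measurable Q \<Longrightarrow> s > 0 \<Longrightarrow>
       ennreal s * emeasure M {x \<in> space M. ennreal s < N F x} \<le> ennreal C * (\<integral>\<^sup>+y. F y \<partial>Q)"
    and \<tau>[measurable]: "\<tau> \<in> borel_measurable Q" and \<tau>fin: "(\<integral>\<^sup>+y. \<tau> y \<partial>Q) < top"
    and p: "p > 1" and \<delta>: "0 < \<delta>" "\<delta> < 1"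
  obtains D where "D > 0" "\<And>g. g \<in> borel_measurable Q \<Longrightarrow> (\<And>y. 0 \<le> g y) \<Longrightarrow>
     (\<integral>\<^sup>+x. ennreal_powr (N (\<lambda>y. ennreal (g y) * \<tau> y) x) p * ennreal (enn2real (1 + N \<tau> x) powr (1 - \<delta> - p)) \<partial>M)
       \<le> ennreal D * (\<integral>\<^sup>+y. ennreal (g y powr p) * \<tau> y \<partial>Q)"
proof -
  interpret M: sigma_finite_measure M by (rule M)
  interpret Q: sigma_finite_measure Q by (rule Q)
  interpret PM: pair_sigma_finite half_line M ..
  interpret PQ: pair_sigma_finite half_line Q ..
  obtain D where D: "D > 0" "\<And>(M :: 'b measure) G N s K. \<lbrakk>G \<in> borel_measurable M; N \<in> borel_measurable M;
     \<And>x. x \<in> space M \<Longrightarrow> 1 \<le> G x;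
     \<And>r. r > 0 \<Longrightarrow> ennreal r * emeasure M {x \<in> space M. ennreal r < N x} \<le> K; s > 0\<rbrakk> \<Longrightarrow>
     ennreal s * (\<integral>\<^sup>+x. ennreal (enn2real (G x) powr (1 - \<delta>)) * indicator {x \<in> space M. G x < top \<and> ennreal s * G x < N x} x \<partial>M)
       \<le> ennreal D * K" using weak_type_weighted[OF \<delta>] by blast
  define G where "G = (\<lambda>x. 1 + N \<tau> x)"
  have Nt[measurable]: "N \<tau> \<in> borel_measurable M" by (rule Nm[OF \<tau>])
  have G[measurable]: "G \<in> borel_measurable M" unfolding G_def by measurable
  have G1: "1 \<le> G x" for x by (simp add: G_def)
  have Gfin: "AE x in M. G x < top"
  proof -
    have "AE x in M. N \<tau> x < top"
      using weak[OF \<tau>] \<tau>fin by (intro weak_type_finite_AE[where A = "ennreal C * (\<integral>\<^sup>+y. \<tau> y \<partial>Q)"]) (auto simp: ennreal_mult_less_top)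
    then show ?thesis by eventually_elim (simp add: G_def)
  qed
  define D' where "D' = 2 * (D * C) * (p * (2 powr (p - 1) / (p - 1)))"
  show ?thesis
  proof (rule that[of D'])
    show "D' > 0" using D C p by (simp add: D'_def)
    fix g :: "'a \<Rightarrow> real" assume g[measurable]: "g \<in> borel_measurable Q" and g0: "\<And>y. 0 \<le> g y"
    define n where "n = N (\<lambda>y. ennreal (g y) * \<tau> y)"
    have n[measurable]: "n \<in> borel_measurable M" unfolding n_def by (rule Nm) measurable
    \<comment> \<open>The part of \<open>g\<close> above \<open>s / 2\<close>. The rest contributes
      at most \<open>ennreal (s / 2) * N \<tau> x\<close>, which is at most half of the threshold
      \<open>ennreal s * G x\<close>, so the weak type inequality is applied to \<open>h s\<close>
      alone.\<close>
    define h where "h = (\<lambda>s y. ennreal (g y) * indicator {y. s / 2 < g y} y * \<tau> y)"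
    have h[measurable]: "h s \<in> borel_measurable Q" for s unfolding h_def indicator_def mem_Collect_eq by measurable
    define L where "L = (\<lambda>s. \<integral>\<^sup>+x. ennreal (enn2real (G x) powr (1 - \<delta>)) * indicator {x \<in> space M. G x < top \<and> ennreal s * G x < n x} x \<partial>M)"
    have Lle: "ennreal s * L s \<le> ennreal (2 * (D * C)) * (\<integral>\<^sup>+y. h s y \<partial>Q)" if s: "s > 0" for s
    proof -
      have nle: "n x \<le> N (h s) x + ennreal (s / 2) * G x" for x
      proof -
        have "n x \<le> N (\<lambda>y. h s y + ennreal (s / 2) * \<tau> y) x"
          unfolding n_def
        proof (rule Nmono)
          fix y
          show "ennreal (g y) * \<tau> y \<le> h s y + ennreal (s / 2) * \<tau> y"
          proof (cases "s / 2 < g y")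
            case False
            then have "ennreal (g y) * \<tau> y \<le> ennreal (s / 2) * \<tau> y" by (intro mult_right_mono ennreal_leI) auto
            then show ?thesis by (simp add: add_increasing)
          qed (simp add: h_def)
        qed
        also have "\<dots> \<le> N (h s) x + N (\<lambda>y. ennreal (s / 2) * \<tau> y) x" by (intro Nadd) measurable
        also have "N (\<lambda>y. ennreal (s / 2) * \<tau> y) x = ennreal (s / 2) * N \<tau> x" by (rule Ncmult[OF \<tau>])
        also have "\<dots> \<le> ennreal (s / 2) * G x" by (intro mult_left_mono) (auto simp: G_def add_increasing)
        finally show ?thesis by (simp add: add_left_mono)
      qed
      have sub: "ennreal (s / 2) * G x < N (h s) x" if "G x < top" "ennreal s * G x < n x" for x
      proof (rule ccontr)
        assume "\<not> ?thesis"
        then have "n x \<le> ennreal (s / 2) * G x + ennreal (s / 2) * G x"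
          using nle[of x] by (meson add_right_mono not_le order.trans)
        also have "\<dots> = ennreal s * G x" using s by (simp add: distrib_right[symmetric] flip: ennreal_plus)
        finally show False using that by simp
      qed
      have "L s \<le> (\<integral>\<^sup>+x. ennreal (enn2real (G x) powr (1 - \<delta>)) * indicator {x \<in> space M. G x < top \<and> ennreal (s / 2) * G x < N (h s) x} x \<partial>M)"
        unfolding L_def using sub by (intro nn_integral_mono mult_left_mono) (auto split: split_indicator)
      then have "ennreal (s / 2) * L s \<le> ennreal (s / 2) * \<dots>" by (rule mult_left_mono) simp
      also have "\<dots> \<le> ennreal D * (ennreal C * (\<integral>\<^sup>+y. h s y \<partial>Q))"
        using s by (intro D weak Nm h G G1) auto
      finally have "ennreal 2 * (ennreal (s / 2) * L s) \<le> ennreal 2 * (ennreal D * (ennreal C * (\<integral>\<^sup>+y. h s y \<partial>Q)))"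
        by (rule mult_left_mono) simp
      moreover have "ennreal 2 * (ennreal (s / 2) * L s) = ennreal s * L s"
        using ennreal_mult'[of 2 "s / 2"] by (simp add: mult.assoc[symmetric])
      moreover have "ennreal 2 * (ennreal D * (ennreal C * (\<integral>\<^sup>+y. h s y \<partial>Q))) = ennreal (2 * (D * C)) * (\<integral>\<^sup>+y. h s y \<partial>Q)"
        using D(1) C by (simp only: ennreal_mult' less_imp_le mult.assoc zero_le_numeral mult_nonneg_nonneg)
      ultimately show ?thesis by simp
    qed
    \<comment> \<open>The layer cake formula for the quotient \<open>r\<close> of \<open>n x\<close>
      by \<open>G x\<close>, whose level sets are those in \<open>L\<close>; the powers of
      \<open>G x\<close> combine to the exponent \<open>1 - \<delta>\<close>. The points with
      infinite \<open>G x\<close> form a null set.\<close>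
    have pt: "ennreal_powr (n x) p * ennreal (enn2real (G x) powr (1 - \<delta> - p)) =
       (\<integral>\<^sup>+s. ennreal (p * s powr (p - 1)) * (ennreal (enn2real (G x) powr (1 - \<delta>)) * indicator {x \<in> space M. G x < top \<and> ennreal s * G x < n x} x) \<partial>half_line)"
      if x: "x \<in> space M" and fin: "G x < top" for x
    proof -
      obtain \<gamma> where \<gamma>: "G x = ennreal \<gamma>" "\<gamma> \<ge> 0" using fin by (cases "G x") auto
      have \<gamma>1: "\<gamma> \<ge> 1" using G1[of x] \<gamma> by simp
      define r where "r = ennreal (1 / \<gamma>) * n x"
      have nr: "n x = ennreal \<gamma> * r" using \<gamma>1 by (simp add: r_def mult.assoc[symmetric] ennreal_mult'[symmetric])
      have lt: "ennreal s * G x < n x \<longleftrightarrow> ennreal s < r" for s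
        unfolding nr \<gamma>(1) mult.commute[of "ennreal s"] using \<gamma>1 ennreal_mult_le_mult_iff[of "ennreal \<gamma>" r "ennreal s"] by (simp add: not_le[symmetric])
      have "ennreal_powr (n x) p * ennreal (enn2real (G x) powr (1 - \<delta> - p)) =
          ennreal_powr r p * (ennreal (\<gamma> powr p) * ennreal (\<gamma> powr (1 - \<delta> - p)))"
        unfolding nr using ennreal_powr_cmult[of \<gamma> r p] \<gamma>1 by (simp add: \<gamma> mult_ac)
      also have "ennreal (\<gamma> powr p) * ennreal (\<gamma> powr (1 - \<delta> - p)) = ennreal (\<gamma> powr (1 - \<delta>))"
        by (simp add: ennreal_mult'[symmetric] flip: powr_add)
      also have "ennreal_powr r p = (\<integral>\<^sup>+s. ennreal (p * s powr (p - 1)) * indicator {s. ennreal s < r} s \<partial>half_line)"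
        using p by (intro layer_cake[symmetric]) auto
      also have "\<dots> * ennreal (\<gamma> powr (1 - \<delta>)) = (\<integral>\<^sup>+s. ennreal (p * s powr (p - 1)) * indicator {s. ennreal s < r} s * ennreal (\<gamma> powr (1 - \<delta>)) \<partial>half_line)"
        unfolding indicator_def mem_Collect_eq by (rule nn_integral_multc[symmetric]) measurable
      also have "\<dots> = (\<integral>\<^sup>+s. ennreal (p * s powr (p - 1)) * (ennreal (enn2real (G x) powr (1 - \<delta>)) * indicator {x \<in> space M. G x < top \<and> ennreal s * G x < n x} x) \<partial>half_line)"
        using x fin lt by (intro nn_integral_cong) (auto split: split_indicator simp: \<gamma>)
      finally show ?thesis .
    qed
    have "(\<integral>\<^sup>+x. ennreal_powr (n x) p * ennreal (enn2real (G x) powr (1 - \<delta> - p)) \<partial>M) =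
        (\<integral>\<^sup>+x. \<integral>\<^sup>+s. ennreal (p * s powr (p - 1)) * (ennreal (enn2real (G x) powr (1 - \<delta>)) * indicator {x \<in> space M. G x < top \<and> ennreal s * G x < n x} x) \<partial>half_line \<partial>M)"
      using Gfin pt by (intro nn_integral_cong_AE) auto
    also have "\<dots> = (\<integral>\<^sup>+s. \<integral>\<^sup>+x. ennreal (p * s powr (p - 1)) * (ennreal (enn2real (G x) powr (1 - \<delta>)) * indicator {x \<in> space M. G x < top \<and> ennreal s * G x < n x} x) \<partial>M \<partial>half_line)"
      unfolding indicator_def mem_Collect_eq by (rule PM.Fubini') measurable
    also have "\<dots> = (\<integral>\<^sup>+s. ennreal (p * s powr (p - 1)) * L s \<partial>half_line)"
      unfolding L_def indicator_def mem_Collect_eq by (intro nn_integral_cong nn_integral_cmult) measurable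
    also have "\<dots> \<le> (\<integral>\<^sup>+s. ennreal (p * s powr (p - 1 - 1)) * (ennreal (2 * (D * C)) * (\<integral>\<^sup>+y. h s y \<partial>Q)) \<partial>half_line)"
    proof (intro nn_integral_mono)
      fix s assume "s \<in> space half_line"
      then have s: "s > 0" by simp
      have "s powr (p - 1) = s powr (p - 1 - 1) * s" using s powr_add[of s "p - 1 - 1" 1] by simp
      then have "ennreal (p * s powr (p - 1)) * L s = ennreal (p * s powr (p - 1 - 1)) * (ennreal s * L s)"
        using p s by (simp add: ennreal_mult' ennreal_mult'' mult.assoc)
      also have "\<dots> \<le> ennreal (p * s powr (p - 1 - 1)) * (ennreal (2 * (D * C)) * (\<integral>\<^sup>+y. h s y \<partial>Q))"
        by (intro mult_left_mono Lle s) auto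
      finally show "ennreal (p * s powr (p - 1)) * L s \<le> ennreal (p * s powr (p - 1 - 1)) * (ennreal (2 * (D * C)) * (\<integral>\<^sup>+y. h s y \<partial>Q))" .
    qed
    also have "\<dots> = (\<integral>\<^sup>+s. \<integral>\<^sup>+y. ennreal (2 * (D * C)) * (ennreal (p * s powr (p - 1 - 1)) * h s y) \<partial>Q \<partial>half_line)"
      by (intro nn_integral_cong) (simp add: nn_integral_cmult mult.left_commute)
    also have "\<dots> = (\<integral>\<^sup>+y. \<integral>\<^sup>+s. ennreal (2 * (D * C)) * (ennreal (p * s powr (p - 1 - 1)) * h s y) \<partial>half_line \<partial>Q)"
      unfolding h_def indicator_def mem_Collect_eq by (rule PQ.Fubini'[symmetric]) measurable
    \<comment> \<open>For fixed \<open>y\<close> only heights \<open>s < 2 * g y\<close> count, and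
      \<open>p > 1\<close> makes \<open>s powr (p - 2)\<close> integrable at 0.\<close>
    also have "\<dots> = (\<integral>\<^sup>+y. ennreal D' * (ennreal (g y powr p) * \<tau> y) \<partial>Q)"
    proof (intro nn_integral_cong)
      fix y
      have "(\<integral>\<^sup>+s. ennreal (2 * (D * C)) * (ennreal (p * s powr (p - 1 - 1)) * h s y) \<partial>half_line) =
         (\<integral>\<^sup>+s. (ennreal (2 * (D * C)) * (ennreal p * (ennreal (g y) * \<tau> y))) * (ennreal (s powr (p - 1 - 1)) * indicator {..<2 * g y} s) \<partial>half_line)"
        using p by (intro nn_integral_cong) (auto simp: h_def ennreal_mult' mult_ac split: split_indicator)
      also have "\<dots> = (ennreal (2 * (D * C)) * (ennreal p * (ennreal (g y) * \<tau> y))) * (\<integral>\<^sup>+s. ennreal (s powr (p - 1 - 1)) * indicator {..<2 * g y} s \<partial>half_line)"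
        by (rule nn_integral_cmult) measurable
      also have "(\<integral>\<^sup>+s. ennreal (s powr (p - 1 - 1)) * indicator {..<2 * g y} s \<partial>half_line) = ennreal ((2 * g y) powr (p - 1) / (p - 1))"
        using p g0[of y] by (intro nn_integral_powr_segment) auto
      also have "(ennreal (2 * (D * C)) * (ennreal p * (ennreal (g y) * \<tau> y))) * ennreal ((2 * g y) powr (p - 1) / (p - 1)) =
          ennreal (2 * (D * C) * (p * (g y * ((2 * g y) powr (p - 1) / (p - 1))))) * \<tau> y"
      proof -
        define Z where "Z = (2 * g y) powr (p - 1) / (p - 1)"
        have "ennreal (2 * (D * C) * (p * (g y * Z))) = ennreal (2 * (D * C)) * (ennreal p * (ennreal (g y) * ennreal Z))"
        proof -
          have "0 \<le> 2 * (D * C)" "0 \<le> p" using D(1) C p by auto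
          then show ?thesis using g0[of y] by (simp only: ennreal_mult')
        qed
        then show ?thesis unfolding Z_def[symmetric] by (simp only: ac_simps)
      qed
      also have "2 * (D * C) * (p * (g y * ((2 * g y) powr (p - 1) / (p - 1)))) = D' * g y powr p"
      proof -
        have "g y * g y powr (p - 1) = g y powr p"
          using powr_add[of "g y" 1 "p - 1"] g0[of y] by simp
        moreover have "(2 * g y) powr (p - 1) = 2 powr (p - 1) * g y powr (p - 1)" by (rule powr_mult)
        ultimately show ?thesis by (simp add: D'_def)
      qed
      finally show "(\<integral>\<^sup>+s. ennreal (2 * (D * C)) * (ennreal (p * s powr (p - 1 - 1)) * h s y) \<partial>half_line) = ennreal D' * (ennreal (g y powr p) * \<tau> y)"
        using \<open>D' > 0\<close> by (simp add: ennreal_mult mult.assoc)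
    qed
    also have "\<dots> = ennreal D' * (\<integral>\<^sup>+y. ennreal (g y powr p) * \<tau> y \<partial>Q)" by (rule nn_integral_cmult) measurable
    finally show "(\<integral>\<^sup>+x. ennreal_powr (N (\<lambda>y. ennreal (g y) * \<tau> y) x) p * ennreal (enn2real (1 + N \<tau> x) powr (1 - \<delta> - p)) \<partial>M)
       \<le> ennreal D' * (\<integral>\<^sup>+y. ennreal (g y powr p) * \<tau> y \<partial>Q)" unfolding n_def G_def .
  qed
qed

text \<open>An explicit substitute for the duality of Lebesgue spaces. On disjoint pieces of measure
  \<open>a k \<ge> 1\<close> the values \<open>1 / (real (Suc k) * a k)\<close> have the harmonic
  series as integral, while the integral of their \<open>p\<close>-th powers is dominated by the
  series of \<open>real (Suc k) powr (- p)\<close>.\<close>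

lemma infinite_measure_divergent:
  assumes M: "sigma_finite_measure M" and inf: "emeasure M (space M) = top" and p: "p > 1"
  obtains g :: "'a \<Rightarrow> real" where "g \<in> borel_measurable M" "\<And>x. 0 \<le> g x"
    "(\<integral>\<^sup>+x. ennreal (g x) \<partial>M) = top" "(\<integral>\<^sup>+x. ennreal (g x powr p) \<partial>M) < top"
proof -
  interpret sigma_finite_measure M by (rule M)
  obtain A :: "nat \<Rightarrow> 'a set" where A: "range A \<subseteq> sets M" "(\<Union>i. A i) = space M" "\<And>i. emeasure M (A i) \<noteq> \<infinity>" "incseq A"
    using sigma_finite_incseq by blast
  have Am[measurable]: "A i \<in> sets M" for i using A(1) by auto
  have sup: "(SUP i. emeasure M (A i)) = top" using SUP_emeasure_incseq[OF A(1,4)] A(2) inf by simp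
  have step: "\<exists>j>i. emeasure M (A i) + 1 \<le> emeasure M (A j)" for i
  proof -
    have "emeasure M (A i) + 1 < (SUP i. emeasure M (A i))" unfolding sup using A(3)[of i] by (simp add: less_top)
    then obtain j where j: "emeasure M (A i) + 1 < emeasure M (A j)" by (auto simp: less_SUP_iff)
    have "j > i"
    proof (rule ccontr)
      assume "\<not> j > i"
      then have "A j \<subseteq> A i" using A(4) by (intro incseqD[of A]) auto
      then have "emeasure M (A j) \<le> emeasure M (A i)" by (rule emeasure_mono) simp
      also have "\<dots> \<le> emeasure M (A i) + 1" by simp
      finally show False using j by simp
    qed
    then show ?thesis using j by (intro exI[of _ j]) simp
  qed
  then obtain nx where nx: "\<And>i. nx i > i" "\<And>i. emeasure M (A i) + 1 \<le> emeasure M (A (nx i))" by metis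
  \<comment> \<open>Along this subsequence of the exhaustion the measure grows by at least 1 in each
    step, so every difference \<open>F k\<close> has measure at least 1.\<close>
  define r where "r = rec_nat 0 (\<lambda>_. nx)"
  have rS: "r (Suc k) = nx (r k)" for k by (simp add: r_def)
  have rm: "strict_mono r" using nx(1) by (intro strict_monoI_Suc) (simp add: rS)
  define F where "F = (\<lambda>k. A (r (Suc k)) - A (r k))"
  have Fm[measurable]: "F k \<in> sets M" for k unfolding F_def by measurable
  have disj: "k = l" if "x \<in> F k" "x \<in> F l" for x k l
  proof (rule ccontr)
    have *: False if kl: "k < l" and xk: "x \<in> F k" and xl: "x \<in> F l" for k l
    proof -
      have "r (Suc k) \<le> r l" using rm kl by (simp add: strict_mono_less_eq)
      then have "A (r (Suc k)) \<subseteq> A (r l)" using A(4) by (rule incseqD[rotated])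
      then show False using xk xl by (auto simp: F_def)
    qed
    assume "k \<noteq> l"
    then show False using * that by (metis linorder_neqE_nat)
  qed
  have Ff: "emeasure M (F k) \<noteq> top" for k
    using A(3)[of "r (Suc k)"] emeasure_mono[of "F k" "A (r (Suc k))" M] by (auto simp: F_def top_unique)
  have F1: "1 \<le> emeasure M (F k)" for k
  proof -
    have "emeasure M (A (r k)) + 1 \<le> emeasure M (A (r (Suc k)))" unfolding rS by (rule nx)
    also have "\<dots> \<le> emeasure M (A (r k) \<union> F k)" by (intro emeasure_mono) (auto simp: F_def)
    also have "\<dots> \<le> emeasure M (A (r k)) + emeasure M (F k)" by (intro emeasure_subadditive) auto
    finally show ?thesis using A(3)[of "r k"] by (simp add: ennreal_add_left_cancel_le)
  qed
  define a where "a = (\<lambda>k. measure M (F k))"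
  have a: "emeasure M (F k) = ennreal (a k)" for k unfolding a_def using Ff by (rule emeasure_eq_ennreal_measure)
  have a1: "a k \<ge> 1" for k using F1[of k] unfolding a by simp
  define c where "c = (\<lambda>k. 1 / (real (Suc k) * a k))"
  have c: "c k > 0" for k using a1[of k] by (auto simp: c_def)
  define g where "g = (\<lambda>x. \<Sum>k. c k * indicator (F k) x)"
  have gF: "g x = c k" if "x \<in> F k" for x k
  proof -
    have "g x = (\<Sum>k\<in>{k}. c k * indicator (F k) x)"
      unfolding g_def using disj[OF that] by (intro suminf_finite) (auto split: split_indicator)
    then show ?thesis using that by simp
  qed
  have g0: "g x = 0" if "\<And>k. x \<notin> F k" for x using that by (simp add: g_def)
  have gpow: "ennreal (g x powr q) = (\<Sum>k. ennreal (c k powr q) * indicator (F k) x)" for x q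
  proof (cases "\<exists>k. x \<in> F k")
    case True
    then obtain k where k: "x \<in> F k" by blast
    have "(\<Sum>k. ennreal (c k powr q) * indicator (F k) x) = (\<Sum>k\<in>{k}. ennreal (c k powr q) * indicator (F k) x)"
      using disj[OF k] by (intro suminf_finite) (auto split: split_indicator)
    then show ?thesis using k gF[OF k] by simp
  qed (simp add: g0)
  have int: "(\<integral>\<^sup>+x. ennreal (g x powr q) \<partial>M) = (\<Sum>k. ennreal (c k powr q * a k))" for q
    unfolding gpow by (subst nn_integral_suminf) (auto simp: nn_integral_cmult_indicator a ennreal_mult')
  have gnn: "0 \<le> g x" for x using gF[of x] g0[of x] c by (metis less_imp_le order_refl)
  show ?thesis
  proof (rule that[of g])
    show "g \<in> borel_measurable M" unfolding g_def by measurable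
    show "0 \<le> g x" for x by (rule gnn)
    have "(\<integral>\<^sup>+x. ennreal (g x) \<partial>M) = (\<Sum>k. ennreal (c k powr 1 * a k))"
      using int[of 1] gnn by simp
    also have "\<dots> = (\<Sum>k. ennreal (1 / real (Suc k)))"
    proof -
      have "c k powr 1 * a k = 1 / real (Suc k)" for k using c[of k] a1[of k] by (simp add: c_def)
      then show ?thesis by simp
    qed
    also have "\<dots> = top"
    proof (rule ccontr)
      assume "(\<Sum>k. ennreal (1 / real (Suc k))) \<noteq> top"
      then have "summable (\<lambda>k. 1 / real (Suc k))" by (intro summable_suminf_not_top) auto
      then have "summable (\<lambda>k. inverse (real k powr 1))" 
        by (subst (asm) summable_Suc_iff[of "\<lambda>k. 1 / real k"]) (simp add: inverse_eq_divide)
      then show False using summable_real_powr_iff[of "- 1"] by (simp add: powr_minus)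
    qed
    finally show "(\<integral>\<^sup>+x. ennreal (g x) \<partial>M) = top" .
    have sm: "summable (\<lambda>k. real (Suc k) powr (- p))"
      using p by (subst summable_Suc_iff[of "\<lambda>k. real k powr (- p)"]) (simp add: summable_real_powr_iff)
    have "(\<integral>\<^sup>+x. ennreal (g x powr p) \<partial>M) \<le> (\<Sum>k. ennreal (real (Suc k) powr (- p)))"
      unfolding int
    proof (intro suminf_le ennreal_leI)
      fix k
      have "c k powr p * a k = real (Suc k) powr (- p) * (a k powr (- p) * a k powr 1)"
        using a1[of k] by (simp add: c_def powr_divide powr_mult powr_minus_divide)
      also have "a k powr (- p) * a k powr 1 = a k powr (1 - p)" by (subst powr_add[symmetric]) simp
      also have "a k powr (1 - p) \<le> a k powr 0" using a1[of k] p by (intro powr_mono) auto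
      finally show "c k powr p * a k \<le> real (Suc k) powr (- p)" using a1[of k] by (simp add: mult_left_le)
    qed auto
    also have "\<dots> = ennreal (\<Sum>k. real (Suc k) powr (- p))" by (intro suminf_ennreal2 sm) auto
    finally show "(\<integral>\<^sup>+x. ennreal (g x powr p) \<partial>M) < top" using le_less_trans by fastforce
  qed
qed

section \<open>The weight classes\<close>

context laguerre_poisson
begin

abbreviation Phi :: "real \<Rightarrow> real" where "Phi \<equiv> laguerre_Phi \<alpha> m \<nu>"

lemma Phi_eq: "Phi y = phi y * (y powr \<alpha> * exp (- y))"
  by (rule laguerre_Phi_eq)

lemma Phi_pos: "y > 0 \<Longrightarrow> Phi y > 0"
  unfolding Phi_eq using laguerre_phi_pos[of y m \<nu>] by simp

lemma Phi_measurable [measurable]: "Phi \<in> borel_measurable half_line"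
  unfolding Phi_eq[abs_def] by measurable

definition Phi_measure :: "real measure" where "Phi_measure = density mu (\<lambda>y. ennreal (phi y))"

lemma space_Phi_measure [simp]: "space Phi_measure = {0<..}" and sets_Phi_measure [simp, measurable_cong]: "sets Phi_measure = sets half_line"
  by (simp_all add: Phi_measure_def)

lemma nn_integral_Phi_measure_eq_Phi_int:
  assumes [measurable]: "F \<in> borel_measurable half_line"
  shows "(\<integral>\<^sup>+y. F y \<partial>Phi_measure) = Phi_int F"
  unfolding Phi_measure_def Phi_int_def by (subst nn_integral_density) (auto simp: mult.commute)

lemma nn_integral_Phi_measure:
  assumes [measurable]: "F \<in> borel_measurable half_line"
  shows "(\<integral>\<^sup>+y. F y \<partial>Phi_measure) = (\<integral>\<^sup>+y. F y * ennreal (Phi y) \<partial>half_line)"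
proof -
  have "(\<integral>\<^sup>+y. F y \<partial>Phi_measure) = (\<integral>\<^sup>+y. F y * ennreal (phi y) * ennreal (y powr \<alpha> * exp (- y)) \<partial>half_line)"
    unfolding nn_integral_Phi_measure_eq_Phi_int[OF assms] Phi_int_def by (rule nn_integral_mu) measurable
  also have "\<dots> = (\<integral>\<^sup>+y. F y * ennreal (Phi y) \<partial>half_line)"
    using laguerre_phi_pos[of _ m \<nu>] by (intro nn_integral_cong) (simp add: Phi_eq ennreal_mult less_imp_le mult.assoc)
  finally show ?thesis .
qed

lemma Phi_int_le: "Phi_int F \<le> (\<integral>\<^sup>+y. F y \<partial>mu)"
proof -
  have "Phi_int F \<le> (\<integral>\<^sup>+y. F y * 1 \<partial>mu)"
    unfolding Phi_int_def using laguerre_phi_le_1[OF _ m \<nu>] by (intro nn_integral_mono mult_left_mono) auto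
  then show ?thesis by simp
qed

sublocale Phi_measure: finite_measure Phi_measure
proof
  have "emeasure Phi_measure (space Phi_measure) = (\<integral>\<^sup>+y. 1 \<partial>Phi_measure)" by simp
  also have "\<dots> = Phi_int (\<lambda>_. 1)" by (rule nn_integral_Phi_measure_eq_Phi_int) simp
  also have "\<dots> \<le> (\<integral>\<^sup>+y. 1 \<partial>mu)" by (rule Phi_int_le)
  also have "\<dots> < \<infinity>" by (simp add: mu.emeasure_eq_measure)
  finally show "emeasure Phi_measure (space Phi_measure) \<noteq> \<infinity>" by simp
qed

lemma exp_moment:
  assumes c: "c > 0"
  shows "(\<integral>\<^sup>+x. ennreal (x powr \<alpha> * exp (- c * x)) \<partial>half_line) < top"
proof -
  define f :: "real \<Rightarrow> ennreal" where "f = (\<lambda>y. ennreal (y powr \<alpha> * exp (- y)) * indicator {0<..} y)"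
  have fm: "f \<in> borel_measurable borel" unfolding f_def by measurable
  have "(\<integral>\<^sup>+y. f y \<partial>lborel) = (\<integral>\<^sup>+y. ennreal (y powr \<alpha> * exp (- y)) \<partial>half_line)"
    unfolding nn_integral_half_line f_def ..
  also have "\<dots> = ennreal (Gamma (\<alpha> + 1))"
    using Gamma_has_bochner_integral[OF b_pos] by (subst nn_integral_eq_integral) (auto simp: has_bochner_integral_iff)
  finally have 1: "(\<integral>\<^sup>+y. f y \<partial>lborel) = ennreal (Gamma (\<alpha> + 1))" .
  have "(\<integral>\<^sup>+y. f y \<partial>lborel) = ennreal \<bar>c\<bar> * (\<integral>\<^sup>+x. f (0 + c * x) \<partial>lborel)"
    using c by (intro nn_integral_real_affine fm) auto
  also have "(\<integral>\<^sup>+x. f (0 + c * x) \<partial>lborel) = (\<integral>\<^sup>+x. ennreal (c powr \<alpha>) * ennreal (x powr \<alpha> * exp (- c * x)) \<partial>half_line)"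
    unfolding nn_integral_half_line using c
    by (intro nn_integral_cong) (auto simp: f_def powr_mult zero_less_mult_iff ennreal_mult'[symmetric] mult.assoc split: split_indicator)
  also have "\<dots> = ennreal (c powr \<alpha>) * (\<integral>\<^sup>+x. ennreal (x powr \<alpha> * exp (- c * x)) \<partial>half_line)"
    by (rule nn_integral_cmult) measurable
  finally have eq: "(\<integral>\<^sup>+y. f y \<partial>lborel) = ennreal \<bar>c\<bar> * (ennreal (c powr \<alpha>) * (\<integral>\<^sup>+x. ennreal (x powr \<alpha> * exp (- c * x)) \<partial>half_line))" .
  have "ennreal \<bar>c\<bar> * (ennreal (c powr \<alpha>) * (\<integral>\<^sup>+x. ennreal (x powr \<alpha> * exp (- c * x)) \<partial>half_line)) < top"
    unfolding eq[symmetric] 1 by simp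
  then show ?thesis using c by (auto simp: ennreal_mult_less_top ennreal_mult_eq_top_iff less_top)
qed

lemma exp_moment_mu:
  assumes "k < 1"
  shows "(\<integral>\<^sup>+x. ennreal (exp (k * x)) \<partial>mu) < top"
proof -
  have "(\<integral>\<^sup>+x. ennreal (exp (k * x)) \<partial>mu) = (\<integral>\<^sup>+x. ennreal (exp (k * x)) * ennreal (x powr \<alpha> * exp (- x)) \<partial>half_line)"
    by (rule nn_integral_mu) measurable
  also have "\<dots> = (\<integral>\<^sup>+x. ennreal (x powr \<alpha> * exp (- (1 - k) * x)) \<partial>half_line)"
    by (intro nn_integral_cong) (simp add: ennreal_mult'[symmetric] algebra_simps flip: exp_add)
  also have "\<dots> < top" using assms by (intro exp_moment) auto
  finally show ?thesis .
qed

text \<open>Against \<open>mu\<close> itself \<open>exp x\<close> is not integrable; the extra rate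
  \<kappa> makes it so and brings the term \<open>ennreal (exp x) * Phi_int F\<close> of
  \<open>majorant\<close> within reach of Chebyshev's inequality.\<close>

definition eta :: "real \<Rightarrow> real measure" where
  "eta \<kappa> = density half_line (\<lambda>x. ennreal (x powr \<alpha> * exp (- (1 + \<kappa>) * x)))"

lemma space_eta [simp]: "space (eta \<kappa>) = {0<..}" and sets_eta [simp, measurable_cong]: "sets (eta \<kappa>) = sets half_line"
  by (simp_all add: eta_def)

lemma nn_integral_eta:
  assumes [measurable]: "F \<in> borel_measurable half_line"
  shows "(\<integral>\<^sup>+x. F x \<partial>eta \<kappa>) = (\<integral>\<^sup>+x. F x * ennreal (x powr \<alpha> * exp (- (1 + \<kappa>) * x)) \<partial>half_line)"
  unfolding eta_def by (subst nn_integral_density) (auto simp: mult.commute)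

lemma eta_finite: "\<kappa> > 0 \<Longrightarrow> finite_measure (eta \<kappa>)"
proof
  assume \<kappa>: "\<kappa> > 0"
  have "emeasure (eta \<kappa>) (space (eta \<kappa>)) = (\<integral>\<^sup>+y. 1 \<partial>eta \<kappa>)" by simp
  also have "\<dots> = (\<integral>\<^sup>+x. ennreal (x powr \<alpha> * exp (- (1 + \<kappa>) * x)) \<partial>half_line)" by (subst nn_integral_eta) auto
  also have "\<dots> < top" using \<kappa> by (intro exp_moment) auto
  finally show "emeasure (eta \<kappa>) (space (eta \<kappa>)) \<noteq> \<infinity>" by simp
qed

lemma borel_measurable_majorant [measurable]:
  assumes [measurable]: "F \<in> borel_measurable half_line"
  shows "majorant F \<in> borel_measurable half_line"
  unfolding majorant_def by measurable

lemma majorant_mono: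
  assumes "\<And>y. y > 0 \<Longrightarrow> F y \<le> G y"
  shows "majorant F x \<le> majorant G x"
  unfolding majorant_def Phi_int_def
  by (intro add_mono max_avg_mono mult_right_mono mult_left_mono nn_integral_mono assms) (auto simp: assms)

lemma majorant_add:
  assumes [measurable]: "F \<in> borel_measurable half_line" "G \<in> borel_measurable half_line"
  shows "majorant (\<lambda>y. F y + G y) x \<le> majorant F x + majorant G x"
proof -
  have "Phi_int (\<lambda>y. F y + G y) = Phi_int F + Phi_int G"
    unfolding Phi_int_def distrib_right by (rule nn_integral_add) measurable
  moreover have "max_avg (\<lambda>y. F y * ennreal (phi y) + G y * ennreal (phi y)) x \<le> max_avg (\<lambda>y. F y * ennreal (phi y)) x + max_avg (\<lambda>y. G y * ennreal (phi y)) x"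
    by (rule max_avg_add) measurable
  ultimately show ?thesis unfolding majorant_def distrib_right by (simp add: distrib_left add_mono add.assoc add.left_commute)
qed

lemma majorant_cmult:
  assumes [measurable]: "F \<in> borel_measurable half_line"
  shows "majorant (\<lambda>y. c * F y) x = c * majorant F x"
proof -
  have "Phi_int (\<lambda>y. c * F y) = c * Phi_int F"
    unfolding Phi_int_def mult.assoc by (rule nn_integral_cmult) measurable
  moreover have "max_avg (\<lambda>y. c * (F y * ennreal (phi y))) x = c * max_avg (\<lambda>y. F y * ennreal (phi y)) x"
    by (rule max_avg_cmult) measurable
  ultimately show ?thesis unfolding majorant_def mult.assoc by (simp add: distrib_left mult.left_commute)
qed

text \<open>Half of the height goes to each summand of \<open>majorant\<close>. For the averages
  \<open>eta \<kappa>\<close> is replaced by the larger measure \<open>mu\<close>, where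
  \<open>max_avg_weak_type\<close> applies; the set \<open>E2\<close> of the other summand is
  estimated by Chebyshev's inequality.\<close>

lemma majorant_weak_type:
  assumes \<kappa>: "\<kappa> > 0"
  obtains C where "C > 0" "\<And>F s. F \<in> borel_measurable half_line \<Longrightarrow> s > 0 \<Longrightarrow>
    ennreal s * emeasure (eta \<kappa>) {x \<in> space (eta \<kappa>). ennreal s < majorant F x} \<le> ennreal C * Phi_int F"
proof -
  obtain K where K: "K \<ge> 0" "(\<integral>\<^sup>+x. ennreal (x powr \<alpha> * exp (- \<kappa> * x)) \<partial>half_line) = ennreal K"
    using exp_moment[OF \<kappa>] by (cases "\<integral>\<^sup>+x. ennreal (x powr \<alpha> * exp (- \<kappa> * x)) \<partial>half_line") auto
  show ?thesis
  proof (rule that[of "2 + 2 * K"])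
    show "2 + 2 * K > 0" using K by simp
    fix F :: "real \<Rightarrow> ennreal" and s :: real
    assume F[measurable]: "F \<in> borel_measurable half_line" and s: "s > 0"
    define m where "m = max_avg (\<lambda>y. F y * ennreal (phi y))"
    have m[measurable]: "m \<in> borel_measurable half_line" unfolding m_def by measurable
    define E1 where "E1 = {x \<in> {0<..}. ennreal (s / 2) < m x}"
    define E2 where "E2 = {x \<in> {0<..}. ennreal (s / 2) \<le> ennreal (exp x) * Phi_int F}"
    have E1m: "E1 \<in> sets half_line"
    proof -
      have "{x \<in> space half_line. ennreal (s / 2) < m x} \<in> sets half_line" by measurable
      then show ?thesis by (simp add: E1_def)
    qed
    have E2m: "E2 \<in> sets half_line"
    proof -
      have "{x \<in> space half_line. ennreal (s / 2) \<le> ennreal (exp x) * Phi_int F} \<in> sets half_line" by measurable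
      then show ?thesis by (simp add: E2_def)
    qed
    have sub: "{x \<in> space (eta \<kappa>). ennreal s < majorant F x} \<subseteq> E1 \<union> E2"
    proof
      fix x assume x: "x \<in> {x \<in> space (eta \<kappa>). ennreal s < majorant F x}"
      show "x \<in> E1 \<union> E2"
      proof (rule ccontr)
        assume "x \<notin> E1 \<union> E2"
        then have "m x \<le> ennreal (s / 2)" "ennreal (exp x) * Phi_int F \<le> ennreal (s / 2)"
          using x by (auto simp: E1_def E2_def)
        then have "majorant F x \<le> ennreal (s / 2) + ennreal (s / 2)" unfolding majorant_def m_def by (rule add_mono)
        also have "\<dots> = ennreal s" using s by (simp flip: ennreal_plus)
        finally show False using x by (auto simp: not_le[symmetric])
      qed
    qed
    have 1: "ennreal s * emeasure (eta \<kappa>) E1 \<le> ennreal 2 * Phi_int F"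
    proof -
      have "emeasure (eta \<kappa>) E1 \<le> emeasure mu E1"
      proof -
        have "x powr \<alpha> * exp (- (1 + \<kappa>) * x) \<le> x powr \<alpha> * exp (- x)" if "x > 0" for x
        proof (intro mult_left_mono)
          have "0 \<le> \<kappa> * x" using \<kappa> that by simp
          then show "exp (- (1 + \<kappa>) * x) \<le> exp (- x)" by (simp add: algebra_simps)
        qed simp
        then show ?thesis
          unfolding eta_def mu_def using E1m
          by (subst (1 2) emeasure_density) (auto intro!: nn_integral_mono mult_right_mono ennreal_leI)
      qed
      then have "ennreal s * emeasure (eta \<kappa>) E1 \<le> ennreal s * emeasure mu E1" by (rule mult_left_mono) simp
      also have "\<dots> = ennreal 2 * (ennreal (s / 2) * emeasure mu E1)"
        using ennreal_mult'[of 2 "s / 2"] by (simp add: mult.assoc[symmetric])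
      also have "\<dots> \<le> ennreal 2 * Phi_int F"
        using max_avg_weak_type[of "\<lambda>y. F y * ennreal (phi y)" "s / 2"] s
        unfolding Phi_int_def E1_def m_def by (intro mult_left_mono) auto
      finally show ?thesis .
    qed
    have 2: "ennreal s * emeasure (eta \<kappa>) E2 \<le> ennreal (2 * K) * Phi_int F"
    proof -
      have "ennreal (s / 2) * emeasure (eta \<kappa>) E2 = (\<integral>\<^sup>+x. ennreal (s / 2) * indicator E2 x \<partial>eta \<kappa>)"
        using E2m by (simp add: nn_integral_cmult_indicator)
      also have "\<dots> \<le> (\<integral>\<^sup>+x. ennreal (exp x) * Phi_int F \<partial>eta \<kappa>)"
        by (intro nn_integral_mono) (auto simp: E2_def split: split_indicator)
      also have "\<dots> = (\<integral>\<^sup>+x. ennreal (exp x) * Phi_int F * ennreal (x powr \<alpha> * exp (- (1 + \<kappa>) * x)) \<partial>half_line)"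
        by (rule nn_integral_eta) measurable
      also have "\<dots> = (\<integral>\<^sup>+x. ennreal (x powr \<alpha> * exp (- \<kappa> * x)) * Phi_int F \<partial>half_line)"
      proof (intro nn_integral_cong)
        fix x
        have "ennreal (exp x) * ennreal (x powr \<alpha> * exp (- (1 + \<kappa>) * x)) = ennreal (x powr \<alpha> * exp (- \<kappa> * x))"
          by (simp add: ennreal_mult'[symmetric] algebra_simps flip: exp_add)
        then show "ennreal (exp x) * Phi_int F * ennreal (x powr \<alpha> * exp (- (1 + \<kappa>) * x)) = ennreal (x powr \<alpha> * exp (- \<kappa> * x)) * Phi_int F"
          by (metis mult.assoc mult.commute)
      qed
      also have "\<dots> = ennreal K * Phi_int F" unfolding K(2)[symmetric] by (rule nn_integral_multc) measurable
      finally have "ennreal 2 * (ennreal (s / 2) * emeasure (eta \<kappa>) E2) \<le> ennreal 2 * (ennreal K * Phi_int F)"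
        by (rule mult_left_mono) simp
      moreover have "ennreal 2 * (ennreal (s / 2) * emeasure (eta \<kappa>) E2) = ennreal s * emeasure (eta \<kappa>) E2"
        using ennreal_mult'[of 2 "s / 2"] by (simp add: mult.assoc[symmetric])
      ultimately show ?thesis by (simp add: ennreal_mult' mult.assoc)
    qed
    have "emeasure (eta \<kappa>) {x \<in> space (eta \<kappa>). ennreal s < majorant F x} \<le> emeasure (eta \<kappa>) (E1 \<union> E2)"
      using E1m E2m by (intro emeasure_mono sub) auto
    also have "\<dots> \<le> emeasure (eta \<kappa>) E1 + emeasure (eta \<kappa>) E2" using E1m E2m by (intro emeasure_subadditive) auto
    finally have "ennreal s * emeasure (eta \<kappa>) {x \<in> space (eta \<kappa>). ennreal s < majorant F x} \<le>
        ennreal s * emeasure (eta \<kappa>) E1 + ennreal s * emeasure (eta \<kappa>) E2"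
      unfolding distrib_left[symmetric] by (rule mult_left_mono) simp
    also have "\<dots> \<le> ennreal 2 * Phi_int F + ennreal (2 * K) * Phi_int F" by (rule add_mono[OF 1 2])
    also have "\<dots> = ennreal (2 + 2 * K) * Phi_int F" using K by (simp add: distrib_right[symmetric] ennreal_plus)
    finally show "ennreal s * emeasure (eta \<kappa>) {x \<in> space (eta \<kappa>). ennreal s < majorant F x} \<le> ennreal (2 + 2 * K) * Phi_int F" .
  qed
qed

section \<open>The classes D_p and the necessity of the condition\<close>

lemma weight_AE: "weight w \<Longrightarrow> AE y in half_line. y > 0 \<and> w y > 0"
  unfolding weight_def using AE_space[of half_line] by auto

text \<open>Raised to the conjugate exponent, \<open>w y powr (- 1 / p)\<close> becomes
  \<open>w y powr (- (1 / (p - 1)))\<close>, and one factor \<open>Phi y\<close> is left over as a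
  density. The outer root preserves finiteness.\<close>

lemma D_class_iff:
  assumes w: "weight w" and p: "p > 1"
  shows "w \<in> D_class p Phi \<longleftrightarrow> (\<integral>\<^sup>+y. ennreal ((Phi y / w y) powr (1 / (p - 1))) * ennreal (Phi y) \<partial>half_line) < top"
proof -
  have "(\<integral>\<^sup>+y. ennreal_powr (ennreal \<bar>w y powr (- 1 / p) * Phi y\<bar>) (p / (p - 1)) * ennreal 1 \<partial>half_line) =
     (\<integral>\<^sup>+y. ennreal ((Phi y / w y) powr (1 / (p - 1))) * ennreal (Phi y) \<partial>half_line)"
  proof (rule nn_integral_cong_AE)
    show "AE y in half_line. ennreal_powr (ennreal \<bar>w y powr (- 1 / p) * Phi y\<bar>) (p / (p - 1)) * ennreal 1 =
      ennreal ((Phi y / w y) powr (1 / (p - 1))) * ennreal (Phi y)"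
      using weight_AE[OF w]
    proof eventually_elim
      case (elim y)
      have P: "Phi y > 0" using elim by (intro Phi_pos) auto
      have "\<bar>w y powr (- 1 / p) * Phi y\<bar> powr (p / (p - 1)) = (w y powr (- 1 / p)) powr (p / (p - 1)) * Phi y powr (p / (p - 1))"
        using P by (simp add: abs_mult powr_mult)
      also have "(w y powr (- 1 / p)) powr (p / (p - 1)) = w y powr (- (1 / (p - 1)))"
        using p by (simp add: powr_powr)
      also have "\<dots> = 1 / w y powr (1 / (p - 1))" by (rule powr_minus_divide)
      also have "Phi y powr (p / (p - 1)) = Phi y powr (1 / (p - 1)) * Phi y"
      proof -
        have "p / (p - 1) = 1 / (p - 1) + 1" using p by (simp add: field_simps)
        then show ?thesis using P by (simp add: powr_add)
      qed
      finally have "\<bar>w y powr (- 1 / p) * Phi y\<bar> powr (p / (p - 1)) = (Phi y / w y) powr (1 / (p - 1)) * Phi y"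
        by (simp add: powr_divide)
      then show ?case by (simp add: ennreal_powr_ennreal ennreal_mult')
    qed
  qed
  then show ?thesis using w unfolding D_class_def Lp_norm_def by (simp add: ennreal_powr_less_top)
qed

text \<open>The substitution \<open>f = g \<tau>\<close> turns \<open>\<integral>|f|\<^sup>p w\<close> into \<open>\<integral>g\<^sup>p \<tau> \<Phi>\<close>, because \<open>w = \<tau> powr (1 - p) * \<Phi>\<close>; the
  value 1 on the null set where \<open>w \<le> 0\<close> keeps \<open>\<tau>\<close> positive everywhere.\<close>

definition tau :: "real \<Rightarrow> (real \<Rightarrow> real) \<Rightarrow> real \<Rightarrow> real" where
  "tau p w y = (if y > 0 \<and> w y > 0 then (Phi y / w y) powr (1 / (p - 1)) else 1)"

lemma tau_pos: "tau p w y > 0"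
  unfolding tau_def using Phi_pos[of y] by auto

lemma tau_measurable [measurable]:
  assumes "weight w"
  shows "tau p w \<in> borel_measurable half_line"
proof -
  have [measurable]: "w \<in> borel_measurable half_line" using assms by (simp add: weight_def)
  show ?thesis unfolding tau_def by measurable
qed

lemma D_class_iff_tau:
  assumes w: "weight w" and p: "p > 1"
  shows "w \<in> D_class p Phi \<longleftrightarrow> (\<integral>\<^sup>+y. ennreal (tau p w y) \<partial>Phi_measure) < top"
proof -
  have [measurable]: "tau p w \<in> borel_measurable half_line" by (rule tau_measurable[OF w])
  have "(\<integral>\<^sup>+y. ennreal (tau p w y) \<partial>Phi_measure) = (\<integral>\<^sup>+y. ennreal (tau p w y) * ennreal (Phi y) \<partial>half_line)"
    by (rule nn_integral_Phi_measure) measurable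
  also have "\<dots> = (\<integral>\<^sup>+y. ennreal ((Phi y / w y) powr (1 / (p - 1))) * ennreal (Phi y) \<partial>half_line)"
  proof (rule nn_integral_cong_AE)
    show "AE y in half_line. ennreal (tau p w y) * ennreal (Phi y) = ennreal ((Phi y / w y) powr (1 / (p - 1))) * ennreal (Phi y)"
      using weight_AE[OF w] by eventually_elim (simp add: tau_def)
  qed
  finally show ?thesis using D_class_iff[OF w p] by simp
qed

lemma Lp_integral_tau:
  assumes w: "weight w" and p: "p > 1" and [measurable]: "f \<in> borel_measurable half_line"
  shows "(\<integral>\<^sup>+y. ennreal ((\<bar>f y\<bar> / tau p w y) powr p) * ennreal (tau p w y) \<partial>Phi_measure) =
    (\<integral>\<^sup>+y. ennreal_powr (ennreal \<bar>f y\<bar>) p * ennreal (w y) \<partial>half_line)"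
proof -
  have [measurable]: "tau p w \<in> borel_measurable half_line" by (rule tau_measurable[OF w])
  have "(\<integral>\<^sup>+y. ennreal ((\<bar>f y\<bar> / tau p w y) powr p) * ennreal (tau p w y) \<partial>Phi_measure) =
     (\<integral>\<^sup>+y. ennreal ((\<bar>f y\<bar> / tau p w y) powr p) * ennreal (tau p w y) * ennreal (Phi y) \<partial>half_line)"
    by (rule nn_integral_Phi_measure) measurable
  also have "\<dots> = (\<integral>\<^sup>+y. ennreal_powr (ennreal \<bar>f y\<bar>) p * ennreal (w y) \<partial>half_line)"
  proof (rule nn_integral_cong_AE)
    show "AE y in half_line. ennreal ((\<bar>f y\<bar> / tau p w y) powr p) * ennreal (tau p w y) * ennreal (Phi y) =
      ennreal_powr (ennreal \<bar>f y\<bar>) p * ennreal (w y)"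
      using weight_AE[OF w]
    proof eventually_elim
      case (elim y)
      define T where "T = tau p w y"
      have P: "Phi y > 0" using elim by (intro Phi_pos) auto
      have T: "T > 0" unfolding T_def by (rule tau_pos)
      have "T powr (p - 1) = Phi y / w y"
        using elim P p by (simp add: T_def tau_def powr_powr)
      moreover have "T powr p = T powr (p - 1) * T" using powr_add[of T "p - 1" 1] T by simp
      ultimately have TT: "T powr p * w y = T * Phi y" using elim by (simp add: mult.commute)
      have "(\<bar>f y\<bar> / T) powr p * T * Phi y = \<bar>f y\<bar> powr p * w y"
      proof -
        have "(\<bar>f y\<bar> / T) powr p * T * Phi y = \<bar>f y\<bar> powr p / T powr p * (T powr p * w y)"
          unfolding TT by (simp add: powr_divide)
        also have "\<dots> = \<bar>f y\<bar> powr p * w y" using T by simp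
        finally show ?thesis .
      qed
      then show ?case using T P elim unfolding T_def[symmetric]
        by (simp add: ennreal_powr_ennreal ennreal_mult'[symmetric] ennreal_mult''[symmetric])
    qed
  qed
  finally show ?thesis .
qed

lemma Lp_iff:
  "f \<in> Lp p w \<longleftrightarrow> f \<in> borel_measurable half_line \<and> (\<integral>\<^sup>+y. ennreal_powr (ennreal \<bar>f y\<bar>) p * ennreal (w y) \<partial>half_line) < top"
  unfolding Lp_def Lp_norm_def by (simp add: ennreal_powr_less_top)

text \<open>In place of Hoelder's inequality: \<open>g \<le> 1 + g powr p\<close> for
  \<open>g = \<bar>f y\<bar> / tau p w y\<close>, integrated against the finite measure with density
  \<open>tau p w\<close> with respect to \<open>Phi_measure\<close>.\<close>

lemma Phi_int_finite_of_Lp: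
  assumes w: "weight w" "w \<in> D_class p Phi" and p: "p > 1" and f: "f \<in> Lp p w"
  shows "Phi_int (\<lambda>y. ennreal \<bar>f y\<bar>) < \<infinity>"
proof -
  have [measurable]: "tau p w \<in> borel_measurable half_line" by (rule tau_measurable[OF w(1)])
  have fm[measurable]: "f \<in> borel_measurable half_line" using f by (simp add: Lp_iff)
  have "Phi_int (\<lambda>y. ennreal \<bar>f y\<bar>) = (\<integral>\<^sup>+y. ennreal \<bar>f y\<bar> \<partial>Phi_measure)" by (rule nn_integral_Phi_measure_eq_Phi_int[symmetric]) measurable
  also have "\<dots> \<le> (\<integral>\<^sup>+y. ennreal (tau p w y) + ennreal ((\<bar>f y\<bar> / tau p w y) powr p) * ennreal (tau p w y) \<partial>Phi_measure)"
  proof (intro nn_integral_mono)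
    fix y
    define T where "T = tau p w y"
    have T: "T > 0" unfolding T_def by (rule tau_pos)
    define g where "g = \<bar>f y\<bar> / T"
    have g: "g \<ge> 0" "\<bar>f y\<bar> = g * T" using T by (auto simp: g_def)
    have "g \<le> 1 + g powr p"
    proof (cases "g \<le> 1")
      case False
      then have "g powr 1 \<le> g powr p" using p by (intro powr_mono) auto
      then show ?thesis using False by simp
    qed (simp add: add_increasing2)
    then have "g * T \<le> (1 + g powr p) * T" using T by (intro mult_right_mono) auto
    then have "ennreal \<bar>f y\<bar> \<le> ennreal (T + g powr p * T)" unfolding g(2) by (intro ennreal_leI) (simp add: distrib_right)
    also have "\<dots> = ennreal T + ennreal (g powr p) * ennreal T" using T by (simp add: ennreal_mult')
    finally show "ennreal \<bar>f y\<bar> \<le> ennreal (tau p w y) + ennreal ((\<bar>f y\<bar> / tau p w y) powr p) * ennreal (tau p w y)"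
      unfolding T_def g_def .
  qed
  also have "\<dots> = (\<integral>\<^sup>+y. ennreal (tau p w y) \<partial>Phi_measure) + (\<integral>\<^sup>+y. ennreal ((\<bar>f y\<bar> / tau p w y) powr p) * ennreal (tau p w y) \<partial>Phi_measure)"
    by (rule nn_integral_add) measurable
  also have "\<dots> < \<infinity>"
    using D_class_iff_tau[OF w(1) p] w(2) f unfolding Lp_integral_tau[OF w(1) p fm] Lp_iff by simp
  finally show ?thesis .
qed

text \<open>If the condition fails, \<open>tau p w\<close> is the density of an infinite measure
  \<open>R\<close>. A function \<open>g\<close> with integrable \<open>p\<close>-th power but
  infinite integral for \<open>R\<close> gives \<open>f = g * tau p w\<close> in
  \<open>Lp p w\<close> with infinite \<open>Phi_int\<close>, against convergence at the single
  point 1.\<close>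

theorem D_class_necessary:
  assumes w: "weight w" and p: "p > 1" and t: "t > 0"
    and conv: "\<And>f. f \<in> Lp p w \<Longrightarrow> poisson_converges \<alpha> L m \<nu> f t 1"
  shows "w \<in> D_class p Phi"
proof (rule ccontr)
  assume "\<not> ?thesis"
  then have inf: "(\<integral>\<^sup>+y. ennreal (tau p w y) \<partial>Phi_measure) = top" using D_class_iff_tau[OF w p] by (metis top.not_eq_extremum)
  have tm[measurable]: "tau p w \<in> borel_measurable half_line" by (rule tau_measurable[OF w])
  define R where "R = density Phi_measure (\<lambda>y. ennreal (tau p w y))"
  have R: "(\<integral>\<^sup>+y. F y \<partial>R) = (\<integral>\<^sup>+y. F y * ennreal (tau p w y) \<partial>Phi_measure)" if [measurable]: "F \<in> borel_measurable half_line" for F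
    unfolding R_def by (subst nn_integral_density) (auto simp: mult.commute)
  have "emeasure R (space R) = (\<integral>\<^sup>+y. 1 \<partial>R)" by simp
  also have "\<dots> = top" using R[of "\<lambda>_. 1"] inf by simp
  finally have "emeasure R (space R) = top" .
  moreover have "sigma_finite_measure R"
    unfolding R_def by (subst Phi_measure.sigma_finite_iff_density_finite) auto
  ultimately obtain g where "g \<in> borel_measurable R" and g0: "\<And>x. 0 \<le> g x"
    and g1: "(\<integral>\<^sup>+x. ennreal (g x) \<partial>R) = top" and gp: "(\<integral>\<^sup>+x. ennreal (g x powr p) \<partial>R) < top"
    using infinite_measure_divergent[of R p] p by blast
  then have gm[measurable]: "g \<in> borel_measurable half_line" by (simp add: R_def measurable_def)
  define f where "f = (\<lambda>y. g y * tau p w y)"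
  have fm[measurable]: "f \<in> borel_measurable half_line" unfolding f_def by measurable
  have f0: "0 \<le> f y" for y using g0[of y] tau_pos[of p w y] by (simp add: f_def)
  have fg: "\<bar>f y\<bar> / tau p w y = g y" for y using g0[of y] tau_pos[of p w y] by (simp add: f_def abs_mult)
  have "(\<integral>\<^sup>+y. ennreal_powr (ennreal \<bar>f y\<bar>) p * ennreal (w y) \<partial>half_line) = (\<integral>\<^sup>+x. ennreal (g x powr p) \<partial>R)"
    unfolding Lp_integral_tau[OF w p fm, symmetric] fg by (rule R[symmetric]) measurable
  then have "f \<in> Lp p w" using gp by (simp add: Lp_iff)
  then have "Phi_int (\<lambda>y. ennreal (f y)) < \<infinity>" using f0 by (intro Phi_int_finite_of_converges[OF fm _ t] conv) auto
  moreover have "Phi_int (\<lambda>y. ennreal (f y)) = (\<integral>\<^sup>+x. ennreal (g x) \<partial>R)"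
  proof -
    have "Phi_int (\<lambda>y. ennreal (f y)) = (\<integral>\<^sup>+y. ennreal (f y) \<partial>Phi_measure)" by (rule nn_integral_Phi_measure_eq_Phi_int[symmetric]) measurable
    also have "\<dots> = (\<integral>\<^sup>+y. ennreal (g y) * ennreal (tau p w y) \<partial>Phi_measure)"
      unfolding f_def using g0 by (simp add: ennreal_mult')
    also have "\<dots> = (\<integral>\<^sup>+x. ennreal (g x) \<partial>R)" by (rule R[symmetric]) measurable
    finally show ?thesis .
  qed
  ultimately show False using g1 by simp
qed

section \<open>The second weight\<close>

definition new_weight :: "real \<Rightarrow> real \<Rightarrow> real \<Rightarrow> (real \<Rightarrow> real) \<Rightarrow> real \<Rightarrow> real" where
  "new_weight \<kappa> \<delta> p w x = exp (- (\<kappa> * p * x)) * (x powr \<alpha> * exp (- (1 + \<kappa>) * x)) *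
     enn2real (1 + majorant (\<lambda>y. ennreal (tau p w y)) x) powr (1 - \<delta> - p)"

text \<open>\<open>eta 1\<close> has a positive density on the half line, so its null sets are those
  of Lebesgue measure; the rate 1 is only a convenient choice.\<close>

lemma majorant_tau_finite:
  assumes w: "weight w" "w \<in> D_class p Phi" and p: "p > 1"
  shows "AE x in half_line. x > 0 \<and> majorant (\<lambda>y. ennreal (tau p w y)) x < top"
proof -
  have tm[measurable]: "tau p w \<in> borel_measurable half_line" by (rule tau_measurable[OF w(1)])
  obtain C where C: "C > 0" "\<And>F s. F \<in> borel_measurable half_line \<Longrightarrow> s > 0 \<Longrightarrow>
    ennreal s * emeasure (eta 1) {x \<in> space (eta 1). ennreal s < majorant F x} \<le> ennreal C * Phi_int F"
    using majorant_weak_type[of 1] by auto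
  have fin: "Phi_int (\<lambda>y. ennreal (tau p w y)) < top"
    using D_class_iff_tau[OF w(1) p] w(2) by (subst nn_integral_Phi_measure_eq_Phi_int[symmetric]) auto
  have "AE x in eta 1. majorant (\<lambda>y. ennreal (tau p w y)) x < top"
  proof (rule weak_type_finite_AE[where A = "ennreal C * Phi_int (\<lambda>y. ennreal (tau p w y))"])
    show "majorant (\<lambda>y. ennreal (tau p w y)) \<in> borel_measurable (eta 1)" by measurable
    show "ennreal C * Phi_int (\<lambda>y. ennreal (tau p w y)) < top" using fin by (simp add: ennreal_mult_less_top)
  qed (intro C, measurable)
  then have "AE x in half_line. 0 < ennreal (x powr \<alpha> * exp (- (1 + 1) * x)) \<longrightarrow> majorant (\<lambda>y. ennreal (tau p w y)) x < top"
    unfolding eta_def by (subst (asm) AE_density) auto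
  then show ?thesis using AE_space[of half_line] by eventually_elim auto
qed

text \<open>Where the majorant is infinite, \<open>enn2real\<close> returns 0 and the weight
  vanishes; membership of \<open>w\<close> in the class makes this a null set.\<close>

lemma new_weight_weight:
  assumes w: "weight w" "w \<in> D_class p Phi" and p: "p > 1"
  shows "weight (new_weight \<kappa> \<delta> p w)"
  unfolding weight_def
proof
  have tm[measurable]: "tau p w \<in> borel_measurable half_line" by (rule tau_measurable[OF w(1)])
  show "new_weight \<kappa> \<delta> p w \<in> borel_measurable half_line"
    unfolding new_weight_def by measurable
  show "AE x in half_line. 0 < new_weight \<kappa> \<delta> p w x"
    using majorant_tau_finite[OF assms]
  proof eventually_elim
    case (elim x)
    have "1 \<le> 1 + majorant (\<lambda>y. ennreal (tau p w y)) x" by simp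
    then have "0 < 1 + majorant (\<lambda>y. ennreal (tau p w y)) x" by (rule less_le_trans[rotated]) simp
    then have "0 < enn2real (1 + majorant (\<lambda>y. ennreal (tau p w y)) x)"
      using elim by (simp add: enn2real_positive_iff)
    then show ?case using elim by (simp add: new_weight_def)
  qed
qed

text \<open>Each factor of \<open>new_weight\<close> has one task: the first cancels the
  \<open>p\<close>-th power of \<open>exp (\<kappa> * x)\<close> in the pointwise bound, the second
  turns Lebesgue measure into \<open>eta \<kappa>\<close>, and the third is the power in
  \<open>weak_type_interpolation\<close>, which is used with
  \<open>g = \<bar>f\<bar> / tau p w\<close>.\<close>

theorem new_weight_bounded:
  assumes w: "weight w" "w \<in> D_class p Phi" and p: "p > 1" and \<delta>: "0 < \<delta>" "\<delta> < 1" and \<kappa>: "\<kappa> > 0" and t0: "t0 > 0"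
  shows "poisson_maximal_bounded \<alpha> L m \<nu> t0 p w (new_weight \<kappa> \<delta> p w)"
proof -
  have tm[measurable]: "tau p w \<in> borel_measurable half_line" by (rule tau_measurable[OF w(1)])
  define \<tau> where "\<tau> = (\<lambda>y. ennreal (tau p w y))"
  have \<tau>[measurable]: "\<tau> \<in> borel_measurable half_line" unfolding \<tau>_def by measurable
  define G where "G = (\<lambda>x. enn2real (1 + majorant \<tau> x) powr (1 - \<delta> - p))"
  obtain C where C: "C > 0" "\<And>f x. \<lbrakk>f \<in> borel_measurable half_line; x > 0\<rbrakk> \<Longrightarrow>
     poisson_maximal \<alpha> L m \<nu> t0 f x \<le> ennreal (C * exp (\<kappa> * x)) * majorant (\<lambda>y. ennreal \<bar>f y\<bar>) x"
    using poisson_maximal_le_majorant[OF \<kappa> t0] by blast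
  obtain W where W: "W > 0" "\<And>F s. F \<in> borel_measurable half_line \<Longrightarrow> s > 0 \<Longrightarrow>
    ennreal s * emeasure (eta \<kappa>) {x \<in> space (eta \<kappa>). ennreal s < majorant F x} \<le> ennreal W * Phi_int F"
    using majorant_weak_type[OF \<kappa>] by blast
  interpret E: finite_measure "eta \<kappa>" by (rule eta_finite[OF \<kappa>])
  obtain D where D: "D > 0" "\<And>g. g \<in> borel_measurable Phi_measure \<Longrightarrow> (\<And>y. 0 \<le> g y) \<Longrightarrow>
     (\<integral>\<^sup>+x. ennreal_powr (majorant (\<lambda>y. ennreal (g y) * \<tau> y) x) p * ennreal (enn2real (1 + majorant \<tau> x) powr (1 - \<delta> - p)) \<partial>eta \<kappa>)
       \<le> ennreal D * (\<integral>\<^sup>+y. ennreal (g y powr p) * \<tau> y \<partial>Phi_measure)"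
  proof (rule weak_type_interpolation[where M = "eta \<kappa>" and Q = Phi_measure and N = majorant and C = W and \<tau> = \<tau> and p = p and \<delta> = \<delta>])
    show "sigma_finite_measure (eta \<kappa>)" "sigma_finite_measure Phi_measure" ..
    show "(\<integral>\<^sup>+y. \<tau> y \<partial>Phi_measure) < top" using D_class_iff_tau[OF w(1) p] w(2) by (simp add: \<tau>_def)
    show "ennreal s * emeasure (eta \<kappa>) {x \<in> space (eta \<kappa>). ennreal s < majorant F x} \<le> ennreal W * (\<integral>\<^sup>+y. F y \<partial>Phi_measure)"
      if "F \<in> borel_measurable Phi_measure" "s > 0" for F s
    proof -
      have F: "F \<in> borel_measurable half_line" using that(1) by (simp add: measurable_def)
      show ?thesis unfolding nn_integral_Phi_measure_eq_Phi_int[OF F] by (rule W(2)[OF F that(2)])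
    qed
    show "majorant F \<in> borel_measurable (eta \<kappa>)" if "F \<in> borel_measurable Phi_measure" for F
    proof -
      have F: "F \<in> borel_measurable half_line" using that by (simp add: measurable_def)
      show ?thesis using borel_measurable_majorant[OF F] by (simp add: measurable_def)
    qed
    show "majorant F x \<le> majorant G x" if "\<And>y. y \<in> space Phi_measure \<Longrightarrow> F y \<le> G y" for F G x
      using that by (intro majorant_mono) auto
    show "majorant (\<lambda>y. F y + G y) x \<le> majorant F x + majorant G x" if "F \<in> borel_measurable Phi_measure" "G \<in> borel_measurable Phi_measure" for F G x
      using that by (intro majorant_add) (auto simp: measurable_def)
    show "majorant (\<lambda>y. c * F y) x = c * majorant F x" if "F \<in> borel_measurable Phi_measure" for F c x
      using that by (intro majorant_cmult) (auto simp: measurable_def)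
    show "\<tau> \<in> borel_measurable Phi_measure" using \<tau> by (simp add: measurable_def)
  qed (use W p \<delta> that in auto)
  have bound: "Lp_norm p (new_weight \<kappa> \<delta> p w) (poisson_maximal \<alpha> L m \<nu> t0 f) \<le>
      ennreal ((C powr p * D) powr (1 / p)) * Lp_norm p w (\<lambda>x. ennreal \<bar>f x\<bar>)" if f: "f \<in> Lp p w" for f
  proof -
    have fm[measurable]: "f \<in> borel_measurable half_line" using f by (simp add: Lp_iff)
    define J where "J = (\<integral>\<^sup>+y. ennreal_powr (ennreal \<bar>f y\<bar>) p * ennreal (w y) \<partial>half_line)"
    define g where "g = (\<lambda>y. \<bar>f y\<bar> / tau p w y)"
    have gm[measurable]: "g \<in> borel_measurable half_line" unfolding g_def by measurable
    have g0: "0 \<le> g y" for y unfolding g_def using tau_pos[of p w y] by simp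
    have fg: "ennreal \<bar>f y\<bar> = ennreal (g y) * \<tau> y" for y
      using tau_pos[of p w y] g0[of y] by (simp add: \<tau>_def g_def ennreal_mult'[symmetric])
    define n where "n = majorant (\<lambda>y. ennreal \<bar>f y\<bar>)"
    have nm[measurable]: "n \<in> borel_measurable half_line" unfolding n_def by measurable
    have Gm[measurable]: "G \<in> borel_measurable half_line" unfolding G_def by measurable
    have "(\<integral>\<^sup>+x. ennreal_powr (poisson_maximal \<alpha> L m \<nu> t0 f x) p * ennreal (new_weight \<kappa> \<delta> p w x) \<partial>half_line) \<le>
        (\<integral>\<^sup>+x. ennreal (C powr p) * (ennreal_powr (n x) p * ennreal (G x) * ennreal (x powr \<alpha> * exp (- (1 + \<kappa>) * x))) \<partial>half_line)"
    proof (intro nn_integral_mono)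
      fix x assume "x \<in> space half_line"
      then have x: "x > 0" by simp
      have "ennreal_powr (poisson_maximal \<alpha> L m \<nu> t0 f x) p \<le> ennreal_powr (ennreal (C * exp (\<kappa> * x)) * n x) p"
        unfolding n_def using p by (intro ennreal_powr_mono C fm x) auto
      also have "\<dots> = ennreal ((C * exp (\<kappa> * x)) powr p) * ennreal_powr (n x) p"
        using C(1) by (intro ennreal_powr_cmult) auto
      also have "(C * exp (\<kappa> * x)) powr p = C powr p * exp (\<kappa> * p * x)"
        by (simp add: powr_mult exp_powr_real mult_ac)
      finally have "ennreal_powr (poisson_maximal \<alpha> L m \<nu> t0 f x) p * ennreal (new_weight \<kappa> \<delta> p w x) \<le>
          ennreal (C powr p * exp (\<kappa> * p * x)) * ennreal_powr (n x) p * ennreal (new_weight \<kappa> \<delta> p w x)"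
        by (rule mult_right_mono) simp
      also have "\<dots> = ennreal (C powr p) * (ennreal (exp (\<kappa> * p * x)) * ennreal (exp (- (\<kappa> * p * x)))) * (ennreal_powr (n x) p * ennreal (G x) * ennreal (x powr \<alpha> * exp (- (1 + \<kappa>) * x)))"
      proof -
        have "new_weight \<kappa> \<delta> p w x = exp (- (\<kappa> * p * x)) * (G x * (x powr \<alpha> * exp (- (1 + \<kappa>) * x)))"
          by (simp add: new_weight_def G_def \<tau>_def mult_ac)
        then show ?thesis by (simp add: ennreal_mult' G_def mult_ac)
      qed
      also have "ennreal (exp (\<kappa> * p * x)) * ennreal (exp (- (\<kappa> * p * x))) = 1"
        by (simp add: ennreal_mult'[symmetric] flip: exp_add)
      finally show "ennreal_powr (poisson_maximal \<alpha> L m \<nu> t0 f x) p * ennreal (new_weight \<kappa> \<delta> p w x) \<le>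
        ennreal (C powr p) * (ennreal_powr (n x) p * ennreal (G x) * ennreal (x powr \<alpha> * exp (- (1 + \<kappa>) * x)))"
        by (simp add: mult.assoc)
    qed
    also have "\<dots> = ennreal (C powr p) * (\<integral>\<^sup>+x. ennreal_powr (n x) p * ennreal (G x) * ennreal (x powr \<alpha> * exp (- (1 + \<kappa>) * x)) \<partial>half_line)"
      by (rule nn_integral_cmult) measurable
    also have "(\<integral>\<^sup>+x. ennreal_powr (n x) p * ennreal (G x) * ennreal (x powr \<alpha> * exp (- (1 + \<kappa>) * x)) \<partial>half_line) =
        (\<integral>\<^sup>+x. ennreal_powr (n x) p * ennreal (G x) \<partial>eta \<kappa>)"
      by (rule nn_integral_eta[symmetric]) measurable
    also have "\<dots> \<le> ennreal D * (\<integral>\<^sup>+y. ennreal (g y powr p) * \<tau> y \<partial>Phi_measure)"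
      unfolding n_def fg G_def using gm by (intro D g0) (simp add: measurable_def)
    also have "(\<integral>\<^sup>+y. ennreal (g y powr p) * \<tau> y \<partial>Phi_measure) = J"
      unfolding g_def \<tau>_def J_def by (rule Lp_integral_tau[OF w(1) p fm])
    finally have main: "(\<integral>\<^sup>+x. ennreal_powr (poisson_maximal \<alpha> L m \<nu> t0 f x) p * ennreal (new_weight \<kappa> \<delta> p w x) \<partial>half_line) \<le>
        ennreal (C powr p * D) * J" by (simp add: ennreal_mult' mult.assoc mult_left_mono)
    have "Lp_norm p (new_weight \<kappa> \<delta> p w) (poisson_maximal \<alpha> L m \<nu> t0 f) \<le> ennreal_powr (ennreal (C powr p * D) * J) (1 / p)"
      unfolding Lp_norm_def using p by (intro ennreal_powr_mono main) auto
    also have "\<dots> = ennreal ((C powr p * D) powr (1 / p)) * ennreal_powr J (1 / p)"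
      using C D by (intro ennreal_powr_cmult) auto
    finally show ?thesis by (simp add: Lp_norm_def J_def)
  qed
  show ?thesis
    unfolding poisson_maximal_bounded_def
  proof (intro conjI ballI exI[of _ "(C powr p * D) powr (1 / p)"] allI impI)
    fix f assume f: "f \<in> Lp p w"
    have fm: "f \<in> borel_measurable half_line" using f by (simp add: Lp_iff)
    note fin = Phi_int_finite_of_Lp[OF w p f]
    show "poisson_converges \<alpha> L m \<nu> f t x" if "t \<in> {0<..t0}" "x > 0" for t x
      using that by (intro poisson_convergesI[OF fm _ _ fin]) auto
    show "poisson_maximal \<alpha> L m \<nu> t0 f \<in> borel_measurable half_line"
      by (rule poisson_maximal_measurable[OF fm fin t0])
    show "Lp_norm p (new_weight \<kappa> \<delta> p w) (poisson_maximal \<alpha> L m \<nu> t0 f) \<le>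
      ennreal ((C powr p * D) powr (1 / p)) * Lp_norm p w (\<lambda>x. ennreal \<bar>f x\<bar>)" by (rule bound[OF f])
  qed simp
qed

text \<open>For the new weight \<open>v\<close>, \<open>tau q v\<close> is at most
  \<open>exp (k * x)\<close> times the power \<theta> of one plus the majorant. As
  \<open>\<theta> < 1\<close>, Kolmogorov's inequality integrates this power, with room to spare for
  an exponential of small rate; \<kappa> is fitted to that room.\<close>

theorem new_weight_D_class:
  assumes w: "weight w" "w \<in> D_class p Phi" and p: "p > 1" and q: "q > 1"
    and \<delta>: "0 < \<delta>" and \<theta>_def: "\<theta> = (p - 1 + \<delta>) / (q - 1)" and \<theta>1: "\<theta> < 1"
    and \<kappa>_def: "\<kappa> = (1 - \<theta>) / 4 * (q - 1) / (p + 1)"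
  shows "new_weight \<kappa> \<delta> p w \<in> D_class q Phi"
proof -
  have tm[measurable]: "tau p w \<in> borel_measurable half_line" by (rule tau_measurable[OF w(1)])
  define \<tau> where "\<tau> = (\<lambda>y. ennreal (tau p w y))"
  have \<tau>[measurable]: "\<tau> \<in> borel_measurable half_line" unfolding \<tau>_def by measurable
  define v where "v = new_weight \<kappa> \<delta> p w"
  have v: "weight v" unfolding v_def by (rule new_weight_weight[OF w p])
  have \<theta>0: "\<theta> > 0" unfolding \<theta>_def using p q \<delta> by simp
  \<comment> \<open>Midway between \<theta> and 1: the gap above \<theta> absorbs
    \<open>exp (k * x)\<close>, the gap below 1 is needed for Kolmogorov's inequality.\<close>
  define \<theta>' where "\<theta>' = (1 + \<theta>) / 2"
  have \<theta>': "0 < \<theta>'" "\<theta>' < 1" "\<theta> < \<theta>'" using \<theta>0 \<theta>1 by (auto simp: \<theta>'_def)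
  define k where "k = (1 - \<theta>) / 4"
  have k: "k > 0" "k < 1" "k + \<theta> < 1" using \<theta>0 \<theta>1 by (auto simp: k_def field_simps)
  \<comment> \<open>The rate that remains where the power of the averages does not absorb
    \<open>exp (k * x)\<close>. Since \<open>\<theta>' - \<theta> = (1 - \<theta>) / 2\<close>, the
    quotient of \<open>k\<close> by it is 1/2, and the rate is
    \<open>k + \<theta> / 2\<close>.\<close>
  define k2 where "k2 = (1 + \<theta>) / 4"
  have k2: "k2 < 1" using \<theta>1 by (simp add: k2_def)
  have kk2: "k + k * (\<theta> / (\<theta>' - \<theta>)) = k2"
    using \<theta>1 by (simp add: k_def k2_def \<theta>'_def field_simps)
  have fin: "Phi_int \<tau> < top"
    using D_class_iff_tau[OF w(1) p] w(2) by (subst nn_integral_Phi_measure_eq_Phi_int[symmetric]) (auto simp: \<tau>_def)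
  then obtain i where i: "Phi_int \<tau> = ennreal i" "i \<ge> 0" by (cases "Phi_int \<tau>") auto
  define M where "M = max_avg (\<lambda>y. \<tau> y * ennreal (phi y))"
  have Mm[measurable]: "M \<in> borel_measurable half_line" unfolding M_def by measurable
  have Mfin: "(\<integral>\<^sup>+x. ennreal_powr (M x) \<theta>' \<partial>mu) < top"
  proof (rule kolmogorov_inequality[where A = "Phi_int \<tau>"])
    show "finite_measure mu" by (rule mu.finite_measure_axioms)
    show "M \<in> borel_measurable mu" by measurable
    show "ennreal s * emeasure mu {x \<in> space mu. ennreal s < M x} \<le> Phi_int \<tau>" if "s > 0" for s
      unfolding M_def Phi_int_def by (rule max_avg_weak_type[OF _ that]) measurable
  qed (use fin \<theta>' in auto)
  define B where "B = (\<lambda>x. ennreal 3 * (ennreal (exp (k * x)) + (ennreal_powr (M x) \<theta>' + ennreal (exp (k2 * x))) + ennreal (i powr \<theta>) * ennreal (exp ((k + \<theta>) * x))))"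
  have Bm[measurable]: "B \<in> borel_measurable half_line" unfolding B_def by measurable
  have pt: "AE x in half_line. ennreal (tau q v x) \<le> B x"
    using majorant_tau_finite[OF w p]
  proof eventually_elim
    case (elim x)
    then have x: "x > 0" and Nfin: "majorant \<tau> x < top" by (auto simp: \<tau>_def)
    have majorant_eq: "majorant \<tau> x = M x + ennreal (exp x) * ennreal i" by (simp add: majorant_def M_def i)
    then have "M x < top" using Nfin by simp
    then obtain a where a: "M x = ennreal a" "a \<ge> 0" by (cases "M x") auto
    define \<Gamma> where "\<Gamma> = 1 + a + exp x * i"
    have "1 + majorant \<tau> x = ennreal \<Gamma>"
      unfolding majorant_eq a \<Gamma>_def using a i by (simp add: ennreal_mult ennreal_plus add.assoc)
    moreover have \<Gamma>1: "\<Gamma> \<ge> 1" unfolding \<Gamma>_def using a i by simp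
    ultimately have v_eq: "v x = exp (- (\<kappa> * p * x)) * (x powr \<alpha> * exp (- (1 + \<kappa>) * x)) * \<Gamma> powr (1 - \<delta> - p)"
      by (simp add: v_def new_weight_def \<tau>_def)
    have vpos: "v x > 0" unfolding v_eq using x \<Gamma>1 by simp
    have "tau q v x = (Phi x / v x) powr (1 / (q - 1))" using x vpos by (simp add: tau_def)
    \<comment> \<open>The rate \<open>\<kappa> * (p + 1)\<close> collects
      \<open>\<kappa> * p\<close> from the first factor of \<open>new_weight\<close> and \<kappa>
      from the density of \<open>eta \<kappa>\<close>; \<open>phi x\<close> is estimated by
      1.\<close>
    also have "\<dots> \<le> (exp (\<kappa> * (p + 1) * x) * \<Gamma> powr (p - 1 + \<delta>)) powr (1 / (q - 1))"
    proof (intro powr_mono2)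
      show "0 \<le> 1 / (q - 1)" using q by simp
      show "0 \<le> Phi x / v x" using Phi_pos[OF x] vpos by simp
      have "Phi x \<le> x powr \<alpha> * exp (- x)"
        unfolding Phi_eq using laguerre_phi_le_1[of x m \<nu>] x m \<nu> laguerre_phi_pos[of x m \<nu>] by (intro mult_left_le_one_le) auto
      also have "\<dots> = exp (\<kappa> * (p + 1) * x) * \<Gamma> powr (p - 1 + \<delta>) * v x"
      proof -
        have "exp (\<kappa> * (p + 1) * x) * (exp (- (\<kappa> * p * x)) * exp (- (1 + \<kappa>) * x)) = exp (- x)"
          by (simp add: algebra_simps flip: exp_add)
        moreover have "\<Gamma> powr (p - 1 + \<delta>) * \<Gamma> powr (1 - \<delta> - p) = 1" using \<Gamma>1 by (simp flip: powr_add)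
        moreover have "exp (\<kappa> * (p + 1) * x) * \<Gamma> powr (p - 1 + \<delta>) * v x =
           x powr \<alpha> * (exp (\<kappa> * (p + 1) * x) * (exp (- (\<kappa> * p * x)) * exp (- (1 + \<kappa>) * x))) * (\<Gamma> powr (p - 1 + \<delta>) * \<Gamma> powr (1 - \<delta> - p))"
          unfolding v_eq by (simp only: ac_simps)
        ultimately show ?thesis by simp
      qed
      finally show "Phi x / v x \<le> exp (\<kappa> * (p + 1) * x) * \<Gamma> powr (p - 1 + \<delta>)" using vpos by (simp add: divide_le_eq)
    qed
    also have "\<dots> = exp (k * x) * \<Gamma> powr \<theta>"
    proof -
      have "exp (\<kappa> * (p + 1) * x) powr (1 / (q - 1)) = exp (k * x)"
      proof -
        have "p + 1 \<noteq> 0" using p by simp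
        then have "c / (p + 1) * (p + 1) = c" for c by simp
        then have kp: "\<kappa> * (p + 1) = k * (q - 1)" unfolding \<kappa>_def k_def .
        show ?thesis unfolding kp using q by (simp add: exp_powr_real)
      qed
      moreover have "(\<Gamma> powr (p - 1 + \<delta>)) powr (1 / (q - 1)) = \<Gamma> powr \<theta>"
        by (simp add: powr_powr \<theta>_def)
      ultimately show ?thesis by (simp add: powr_mult)
    qed
    also have "\<dots> \<le> exp (k * x) * (3 * (1 + a powr \<theta> + i powr \<theta> * exp (\<theta> * x)))"
    proof (intro mult_left_mono)
      \<comment> \<open>\<Gamma> has three summands, hence the factor 3; \<open>b\<close> is one of
        them, so its power is at most the sum of their powers.\<close>
      define b where "b = max 1 (max a (exp x * i))"
      have b: "b \<ge> 1" "\<Gamma> \<le> 3 * b" by (auto simp: b_def \<Gamma>_def)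
      have "\<Gamma> powr \<theta> \<le> (3 * b) powr \<theta>" using b \<Gamma>1 \<theta>0 by (intro powr_mono2) auto
      also have "\<dots> = 3 powr \<theta> * b powr \<theta>" by (rule powr_mult)
      also have "3 powr \<theta> \<le> 3 powr (1::real)" using \<theta>1 by (intro powr_mono) auto
      finally have "\<Gamma> powr \<theta> \<le> 3 * b powr \<theta>" by (simp add: mult_right_mono)
      also have "b powr \<theta> \<le> 1 + a powr \<theta> + i powr \<theta> * exp (\<theta> * x)"
      proof -
        have "(exp x * i) powr \<theta> = i powr \<theta> * exp (\<theta> * x)" by (simp add: powr_mult exp_powr_real mult.commute)
        moreover have "b = 1 \<or> b = a \<or> b = exp x * i" by (auto simp: b_def max_def)
        ultimately show ?thesis by (auto simp: add_increasing add_increasing2)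
      qed
      finally show "\<Gamma> powr \<theta> \<le> 3 * (1 + a powr \<theta> + i powr \<theta> * exp (\<theta> * x))" by simp
    qed simp
    also have "\<dots> = 3 * (exp (k * x) + exp (k * x) * a powr \<theta> + i powr \<theta> * exp ((k + \<theta>) * x))"
      by (simp add: algebra_simps exp_add)
    also have "\<dots> \<le> 3 * (exp (k * x) + (a powr \<theta>' + exp (k2 * x)) + i powr \<theta> * exp ((k + \<theta>) * x))"
    proof (intro mult_left_mono add_mono order_refl)
      show "exp (k * x) * a powr \<theta> \<le> a powr \<theta>' + exp (k2 * x)"
      \<comment> \<open>Young's inequality in elementary form: either a power of \<open>a\<close>
        absorbs the exponential, or \<open>a\<close> is itself bounded by an exponential.\<close>
      proof (cases "exp (k * x) \<le> a powr (\<theta>' - \<theta>)")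
        case True
        then have "exp (k * x) * a powr \<theta> \<le> a powr (\<theta>' - \<theta>) * a powr \<theta>" by (intro mult_right_mono) auto
        also have "\<dots> = a powr \<theta>'" by (simp flip: powr_add)
        finally show ?thesis by (simp add: add_increasing2)
      next
        case False
        then have "(a powr (\<theta>' - \<theta>)) powr (\<theta> / (\<theta>' - \<theta>)) \<le> exp (k * x) powr (\<theta> / (\<theta>' - \<theta>))"
          using \<theta>0 \<theta>' by (intro powr_mono2) auto
        then have "a powr \<theta> \<le> exp (k * (\<theta> / (\<theta>' - \<theta>)) * x)"
          using \<theta>' by (simp add: powr_powr exp_powr_real mult_ac)
        then have "exp (k * x) * a powr \<theta> \<le> exp (k * x) * exp (k * (\<theta> / (\<theta>' - \<theta>)) * x)" by (intro mult_left_mono) auto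
        also have "\<dots> = exp ((k + k * (\<theta> / (\<theta>' - \<theta>))) * x)" by (simp only: distrib_right exp_add)
        finally show ?thesis unfolding kk2 by (simp add: add_increasing)
      qed
    qed auto
    finally have "ennreal (tau q v x) \<le> ennreal (3 * (exp (k * x) + (a powr \<theta>' + exp (k2 * x)) + i powr \<theta> * exp ((k + \<theta>) * x)))"
      by (rule ennreal_leI)
    also have "\<dots> = B x"
      unfolding B_def a using a(2) by (subst ennreal_mult') (auto simp: ennreal_powr_ennreal ennreal_mult' ennreal_plus simp flip: ennreal_numeral)
    finally show "ennreal (tau q v x) \<le> B x" .
  qed
  have tvm[measurable]: "tau q v \<in> borel_measurable half_line" by (rule tau_measurable[OF v])
  have "(\<integral>\<^sup>+x. ennreal (tau q v x) \<partial>Phi_measure) = (\<integral>\<^sup>+x. ennreal (tau q v x) * ennreal (Phi x) \<partial>half_line)"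
    by (rule nn_integral_Phi_measure) measurable
  also have "\<dots> \<le> (\<integral>\<^sup>+x. B x * ennreal (Phi x) \<partial>half_line)"
  proof (rule nn_integral_mono_AE)
    show "AE x in half_line. ennreal (tau q v x) * ennreal (Phi x) \<le> B x * ennreal (Phi x)"
      using pt by eventually_elim (rule mult_right_mono, auto)
  qed
  also have "\<dots> = Phi_int B" unfolding nn_integral_Phi_measure[OF Bm, symmetric] by (rule nn_integral_Phi_measure_eq_Phi_int[OF Bm])
  also have "\<dots> \<le> (\<integral>\<^sup>+x. B x \<partial>mu)" by (rule Phi_int_le)
  also have "\<dots> = ennreal 3 * ((\<integral>\<^sup>+x. ennreal (exp (k * x)) \<partial>mu) + ((\<integral>\<^sup>+x. ennreal_powr (M x) \<theta>' \<partial>mu) + (\<integral>\<^sup>+x. ennreal (exp (k2 * x)) \<partial>mu))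
      + ennreal (i powr \<theta>) * (\<integral>\<^sup>+x. ennreal (exp ((k + \<theta>) * x)) \<partial>mu))"
    unfolding B_def by (subst nn_integral_cmult, measurable, subst nn_integral_add, measurable, subst nn_integral_add, measurable,
      subst nn_integral_add, measurable, subst nn_integral_cmult, measurable)
  also have "\<dots> < top"
    using Mfin exp_moment_mu[OF k(2)] exp_moment_mu[OF k2] exp_moment_mu[OF k(3)] by (simp add: ennreal_mult_less_top)
  finally show ?thesis using D_class_iff_tau[OF v q] by (simp add: v_def)
qed

end

theorem theorem1p2:
  fixes \<alpha> m \<nu> p t0 :: real and L :: "nat \<Rightarrow> real poly" and w :: "real \<Rightarrow> real"
  assumes "\<alpha> > -1" and "m \<ge> 0" and "\<nu> > 0" and "1 < p" and "t0 > 0"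
    and "normalized_laguerre \<alpha> L"
    and "weight w"
  shows "(w \<in> D_class p (laguerre_Phi \<alpha> m \<nu>) \<longleftrightarrow>
            (\<exists>v. weight v \<and> poisson_maximal_bounded \<alpha> L m \<nu> t0 p w v)) \<and>
         (w \<in> D_class p (laguerre_Phi \<alpha> m \<nu>) \<longrightarrow>
            (\<forall>\<epsilon>>0. \<exists>v\<in>D_class (p + \<epsilon>) (laguerre_Phi \<alpha> m \<nu>).
               poisson_maximal_bounded \<alpha> L m \<nu> t0 p w v))"
proof -
  interpret laguerre_poisson \<alpha> L m \<nu> by unfold_locales (use assms in auto)
  have suff: "\<exists>v\<in>D_class (p + \<epsilon>) (laguerre_Phi \<alpha> m \<nu>). poisson_maximal_bounded \<alpha> L m \<nu> t0 p w v"
    if w: "w \<in> D_class p (laguerre_Phi \<alpha> m \<nu>)" and \<epsilon>: "\<epsilon> > 0" for \<epsilon>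
  proof -
    \<comment> \<open>The interpolation requires \<open>\<delta> < 1\<close>, and
      \<open>\<delta> < \<epsilon>\<close> is what makes \<open>\<theta> < 1\<close>.\<close>
    define \<delta> where "\<delta> = min (1 / 2) (\<epsilon> / 2)"
    have \<delta>: "0 < \<delta>" "\<delta> < 1" "\<delta> < \<epsilon>" using \<epsilon> by (auto simp: \<delta>_def)
    define \<theta> where "\<theta> = (p - 1 + \<delta>) / (p + \<epsilon> - 1)"
    have \<theta>: "\<theta> < 1" using \<delta> assms(4) by (simp add: \<theta>_def)
    define \<kappa> where "\<kappa> = (1 - \<theta>) / 4 * (p + \<epsilon> - 1) / (p + 1)"
    have "\<kappa> > 0" using \<theta> assms(4) \<epsilon> by (simp add: \<kappa>_def)
    then have "poisson_maximal_bounded \<alpha> L m \<nu> t0 p w (new_weight \<kappa> \<delta> p w)"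
      using assms w \<delta> by (intro new_weight_bounded) auto
    moreover have "new_weight \<kappa> \<delta> p w \<in> D_class (p + \<epsilon>) (laguerre_Phi \<alpha> m \<nu>)"
      using assms w \<delta> \<epsilon> \<theta> by (intro new_weight_D_class[OF _ _ _ _ _ \<theta>_def _ \<kappa>_def]) auto
    ultimately show ?thesis by blast
  qed
  moreover have "w \<in> D_class p (laguerre_Phi \<alpha> m \<nu>)" if "poisson_maximal_bounded \<alpha> L m \<nu> t0 p w v" for v
    using that assms unfolding poisson_maximal_bounded_def by (intro D_class_necessary[where t = t0]) auto
  moreover have "weight v" if "v \<in> D_class q (laguerre_Phi \<alpha> m \<nu>)" for q v
    using that by (simp add: D_class_def)
  \<comment> \<open>The equivalence takes its \<open>v\<close> from the second claim with
    \<open>\<epsilon> = 1\<close>.\<close>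
  ultimately show ?thesis using zero_less_one by meson
qed

end
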